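(* Suppose that $(S_n)$ satisfies the growth condition of order $m$ (defined in the context) for some $m$, and that $(B_n)$ is monotone increasing. Let $(Z_j)$ be a sequence of centered normal random variables so that $\mathrm{Var}(Z_j)=B_j^2-B_{j-1}^2$, where $B_0=0$. Set $X_i=S_i-S_{i-1}$, $S_0=0$. Then for every $n$ there is a coupling of $(X_1,\dots,X_n)$ with $(Z_1,\dots,Z_n)$ so that $$\left\|S_n-\sum_{j=1}^nZ_j\right\|_{L^{m-1}}\le C,$$ where $C$ is a constant which does not depend on $n$.
   Context: $(S_n)_{n\ge1}$ is a sequence of centered real random variables with $\sigma_n=\|S_n\|_{L^2}\to\infty$; $(B_n)$ is a sequence with $B_n=\sigma_n+O(1)$. Put $\Lambda_n(t)=\ln\mathbb E[e^{itS_n/\sigma_n}]+t^2/2$. Growth condition of order $m$ ($m\ge2$ an integer): for all $3\le j\le m+1$ there exist constants $C_j,\varepsilon_j>0$ such that for all $n$, $\sup_{t\in[-\varepsilon_j\sigma_n,\varepsilon_j\sigma_n]}|\Lambda_n^{(j)}(t)|\le C_j\sigma_n^{-(j-2)}$. A coupling of two random vectors is a realization of both on a common probability space, preserving their individual laws; in the coupling $S_n=\sum_{i\le n}X_i$.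
   Formalization: The normal variables Z_j are assumed independent, which the text does not say; without this the claim fails, e.g. for sums of iid ±1 signs with B_n = √n and Z_j = Z_1 for all j, where the sum of the Z_j is nZ_1. *)

theory Defs
  imports "HOL-Probability.Probability" "HOL-Library.Landau_Symbols"
begin

definition in_Lp :: "'a measure \<Rightarrow> nat \<Rightarrow> ('a \<Rightarrow> real) \<Rightarrow> bool" where
  "in_Lp M p f \<longleftrightarrow> f \<in> borel_measurable M \<and> integrable M (\<lambda>\<omega>. \<bar>f \<omega>\<bar> ^ p)"

definition Lp_norm :: "'a measure \<Rightarrow> nat \<Rightarrow> ('a \<Rightarrow> real) \<Rightarrow> real" where
  "Lp_norm M p f = root p (\<integral>\<omega>. \<bar>f \<omega>\<bar> ^ p \<partial>M)"

(* The degenerate law with v = 0, a point mass at 0, counts as normal. *)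
definition centered_normal :: "'a measure \<Rightarrow> ('a \<Rightarrow> real) \<Rightarrow> real \<Rightarrow> bool" where
  "centered_normal M Z v \<longleftrightarrow> Z \<in> borel_measurable M \<and>
     ((v = 0 \<and> (AE \<omega> in M. Z \<omega> = 0)) \<or>
      (v > 0 \<and> distributed M lborel Z (normal_density 0 (sqrt v))))"

(* The logarithm of phi at t obtained by continuation along the segment from 0 to t, starting
   with the value 0 at 0. It is uniquely determined when phi is continuous and zero-free on that
   segment and phi 0 = 1. Unlike the principal branch, it has no jumps where phi crosses the
   negative real axis. *)
definition continuous_log :: "(real \<Rightarrow> complex) \<Rightarrow> real \<Rightarrow> complex" where
  "continuous_log \<phi> t = (THE z. \<exists>L. continuous_on (closed_segment 0 t) L \<and> L 0 = 0 \<and>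
     (\<forall>s\<in>closed_segment 0 t. exp (L s) = \<phi> s) \<and> L t = z)"

definition normalized_char :: "'a measure \<Rightarrow> ('a \<Rightarrow> real) \<Rightarrow> real \<Rightarrow> complex" where
  "normalized_char M Y = char (distr M borel (\<lambda>\<omega>. Y \<omega> / Lp_norm M 2 Y))"

definition Lam :: "'a measure \<Rightarrow> ('a \<Rightarrow> real) \<Rightarrow> real \<Rightarrow> complex" where
  "Lam M Y t = continuous_log (normalized_char M Y) t + of_real (t\<^sup>2 / 2)"

(* Derivatives relative to I, hence one-sided at the end points of an interval. *)
primrec nth_deriv_within :: "real set \<Rightarrow> nat \<Rightarrow> (real \<Rightarrow> complex) \<Rightarrow> real \<Rightarrow> complex" where
  "nth_deriv_within I 0 f = f"
| "nth_deriv_within I (Suc k) f = (\<lambda>t. vector_derivative (nth_deriv_within I k f) (at t within I))"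

definition times_differentiable_on :: "nat \<Rightarrow> (real \<Rightarrow> complex) \<Rightarrow> real set \<Rightarrow> bool" where
  "times_differentiable_on j f I \<longleftrightarrow> (\<forall>k<j. nth_deriv_within I k f differentiable_on I)"

(* The bound on the supremum presupposes that Lam is defined (no zeros of the characteristic
   function) and j times differentiable on the interval; both requirements are made explicit.
   Indices with zero standard deviation, for which S n / sigma n is meaningless, are skipped. *)
definition growth_condition :: "'a measure \<Rightarrow> (nat \<Rightarrow> 'a \<Rightarrow> real) \<Rightarrow> nat \<Rightarrow> bool" where
  "growth_condition M S m \<longleftrightarrow>
     (\<forall>j\<in>{3..m+1}. \<exists>C>0. \<exists>\<epsilon>>0. \<forall>n\<ge>1.
        let \<sigma> = Lp_norm M 2 (S n); I = {- \<epsilon> * \<sigma> .. \<epsilon> * \<sigma>} in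
        \<sigma> > 0 \<longrightarrow>
          (\<forall>t\<in>I. normalized_char M (S n) t \<noteq> 0) \<and>
          times_differentiable_on j (Lam M (S n)) I \<and>
          (\<forall>t\<in>I. norm (nth_deriv_within I j (Lam M (S n)) t) \<le> C / \<sigma> ^ (j - 2)))"

definition joint_law :: "'a measure \<Rightarrow> nat \<Rightarrow> (nat \<Rightarrow> 'a \<Rightarrow> real) \<Rightarrow> (nat \<Rightarrow> real) measure" where
  "joint_law M n Y = distr M (Pi\<^sub>M {1..n} (\<lambda>_. borel)) (\<lambda>\<omega>. \<lambda>i\<in>{1..n}. Y i \<omega>)"

definition is_coupling ::
  "'c measure \<Rightarrow> ('c \<Rightarrow> 'v) \<Rightarrow> ('c \<Rightarrow> 'w) \<Rightarrow> 'v measure \<Rightarrow> 'w measure \<Rightarrow> bool" where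
  "is_coupling P U V \<mu> \<nu> \<longleftrightarrow> prob_space P \<and>
     U \<in> measurable P \<mu> \<and> distr P \<mu> U = \<mu> \<and>
     V \<in> measurable P \<nu> \<and> distr P \<nu> V = \<nu>"

end

theory Submission
  imports Defs
begin

text \<open>Write \<open>h = 1/\<sigma>\<^sub>n\<close>, \<open>p = m - 1\<close> and \<open>Y = S\<^sub>n/\<sigma>\<^sub>n\<close>. It suffices to couple \<open>Y\<close> with a standard normal variable
  at \<open>L\<^sup>p\<close> cost \<open>O(h)\<close>: rescaling gives \<open>S\<^sub>n\<close> against \<open>\<sigma>\<^sub>n G\<close>, and \<open>\<Sum>Z\<^sub>j\<close> has the law of \<open>B\<^sub>n G\<close>.

  The growth condition controls the characteristic function of \<open>Y\<close> only for \<open>|t| \<le> \<epsilon>/h\<close>. Adding to \<open>Y\<close> an independent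
  noise of size \<open>O(h)\<close> whose transform is supported there costs \<open>O(h)\<close> and produces a density. By the Edgeworth expansion
  this density agrees with that of a smoothed law \<open>\<phi>(1 + q)\<close>, where \<open>q = O(h)\<close> up to polynomial factors, with an error
  \<open>O(h\<^sup>p (1 + |x|)\<^sup>-\<^sup>m\<^sup>-\<^sup>1)\<close>. Errors of order \<open>h\<^sup>p\<close> in weighted total variation are affordable, as
  the coupling that keeps the common part of two laws in place has \<open>p\<close>-th power cost bounded by that distance.
  Errors of order \<open>h\<close> are not, so \<open>\<phi>(1 + q)\<close> (after cutting off \<open>q\<close> where it is large) is compared with \<open>\<phi>\<close> by the monotone map
  between them, which moves points by \<open>O(h)\<close> up to polynomial factors.

  Couplings are composed without disintegration: gluing along a variable that is only matched up to a small discretization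
  error has an explicit density with respect to the product measure.\<close>


section \<open>Approximate gluing and transport\<close>

text \<open>The exponents fit as follows. The growth condition bounds the derivatives of the
  logarithm up to order m + 1, so an expansion through the m-th cumulant leaves an error O(h^(m-1)),
  and m + 1 integrations by parts turn it into the weight (1 + |x|)^-(m+1). After multiplication by
  |x|^p two powers remain, just enough for integrability. The error of the expansion thus equals the
  affordable p-th power cost h^p. The obstacle is that only second moments are assumed. Moments of
  order p of \<open>S n\<close> are never estimated: the smoothed law is compared with an explicit
  density, and its tails are controlled only through that difference. Smoothing both sides by the
  same noise makes this a comparison of two genuine probability densities. The bound has to cover
  small n as well, so the constants depend only on m, \<open>C0\<close>, \<epsilon> and an upper
  bound H of h, and h ranges over the whole interval from 0 to H.\<close>

lemma glue_approx:
  fixes Y1 :: "'a \<Rightarrow> real" and Y2 :: "'b \<Rightarrow> real"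
  assumes "prob_space M1" "prob_space M2"
    and Y1[measurable]: "Y1 \<in> borel_measurable M1" and Y2[measurable]: "Y2 \<in> borel_measurable M2"
    and law: "distr M1 borel Y1 = distr M2 borel Y2" and \<delta>: "\<delta> > 0"
  obtains P where "prob_space P" "sets P = sets (M1 \<Otimes>\<^sub>M M2)"
    "distr P M1 fst = M1" "distr P M2 snd = M2"
    "AE z in P. \<bar>Y1 (fst z) - Y2 (snd z)\<bar> \<le> \<delta>"
proof -
  interpret M1: prob_space M1 by fact
  interpret M2: prob_space M2 by fact
  interpret pair_sigma_finite M1 M2 ..
  \<comment> \<open>The line is cut into cells of length \<delta>, and the two spaces are made
    conditionally independent given a common cell. Equality of the two laws enters only through the
    equality of the cell masses \<open>a k\<close>.\<close>
  define k1 where "k1 \<omega> = \<lfloor>Y1 \<omega> / \<delta>\<rfloor>" for \<omega>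
  define k2 where "k2 \<omega> = \<lfloor>Y2 \<omega> / \<delta>\<rfloor>" for \<omega>
  have [measurable]: "k1 \<in> measurable M1 (count_space UNIV)" "k2 \<in> measurable M2 (count_space UNIV)"
    unfolding k1_def k2_def by measurable
  define a where "a k = emeasure M1 {\<omega>\<in>space M1. k1 \<omega> = k}" for k
  have a2: "emeasure M2 {\<omega>\<in>space M2. k2 \<omega> = k} = a k" for k
  proof -
    define C where "C = {x::real. \<lfloor>x / \<delta>\<rfloor> = k}"
    have [measurable]: "C \<in> sets borel" unfolding C_def by measurable
    have "a k = emeasure (distr M1 borel Y1) C"
      unfolding a_def by (subst emeasure_distr) (auto simp: k1_def C_def intro!: arg_cong2[where f=emeasure])
    also have "\<dots> = emeasure M2 {\<omega>\<in>space M2. k2 \<omega> = k}"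
      unfolding law by (subst emeasure_distr) (auto simp: k2_def C_def intro!: arg_cong2[where f=emeasure])
    finally show ?thesis by simp
  qed
  have fin: "a k \<noteq> \<top>" for k unfolding a_def by simp
  have ratio: "a k * (1 / a k) = 1" if "a k \<noteq> 0" for k
    using that fin[of k] by (simp add: ennreal_times_divide ennreal_divide_self top.not_eq_extremum)
  define \<rho> where "\<rho> z = (if k1 (fst z) = k2 (snd z) then 1 / a (k1 (fst z)) else 0)" for z
  have [measurable]: "\<rho> \<in> borel_measurable (M1 \<Otimes>\<^sub>M M2)" unfolding \<rho>_def by measurable
  \<comment> \<open>Division by 0 gives \<infinity> in \<open>ennreal\<close>, so \<rho> is infinite
    over cells of mass 0; these cells have to be discarded as null sets before \<rho> can be
    integrated to 1.\<close>
  have in1: "AE \<omega> in M1. a (k1 \<omega>) \<noteq> 0"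
  proof -
    have "AE \<omega> in M1. k1 \<omega> \<noteq> k" if "a k = 0" for k
      using that by (subst AE_iff_null) (auto simp: a_def null_sets_def)
    then have "AE \<omega> in M1. a k = 0 \<longrightarrow> k1 \<omega> \<noteq> k" for k by (cases "a k = 0") auto
    then have "AE \<omega> in M1. \<forall>k. a k = 0 \<longrightarrow> k1 \<omega> \<noteq> k" by (subst AE_all_countable) auto
    then show ?thesis by eventually_elim auto
  qed
  have in2: "AE \<omega> in M2. a (k2 \<omega>) \<noteq> 0"
  proof -
    have "AE \<omega> in M2. k2 \<omega> \<noteq> k" if "a k = 0" for k
      using that by (subst AE_iff_null) (auto simp: a2 null_sets_def)
    then have "AE \<omega> in M2. a k = 0 \<longrightarrow> k2 \<omega> \<noteq> k" for k by (cases "a k = 0") auto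
    then have "AE \<omega> in M2. \<forall>k. a k = 0 \<longrightarrow> k2 \<omega> \<noteq> k" by (subst AE_all_countable) auto
    then show ?thesis by eventually_elim auto
  qed
  have i1: "AE \<omega> in M1. (\<integral>\<^sup>+\<eta>. \<rho> (\<omega>, \<eta>) \<partial>M2) = 1"
    using in1
  proof eventually_elim
    case (elim \<omega>)
    have "(\<integral>\<^sup>+\<eta>. \<rho> (\<omega>, \<eta>) \<partial>M2) = (\<integral>\<^sup>+\<eta>. 1 / a (k1 \<omega>) * indicator {\<eta>\<in>space M2. k2 \<eta> = k1 \<omega>} \<eta> \<partial>M2)"
      by (intro nn_integral_cong) (auto simp: \<rho>_def split: split_indicator)
    also have "\<dots> = 1 / a (k1 \<omega>) * a (k1 \<omega>)"
      by (subst nn_integral_cmult_indicator) (auto simp: a2)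
    finally show ?case using ratio[OF elim] by (simp add: mult.commute)
  qed
  have i2: "AE \<eta> in M2. (\<integral>\<^sup>+\<omega>. \<rho> (\<omega>, \<eta>) \<partial>M1) = 1"
    using in2
  proof eventually_elim
    case (elim \<eta>)
    have "(\<integral>\<^sup>+\<omega>. \<rho> (\<omega>, \<eta>) \<partial>M1) = (\<integral>\<^sup>+\<omega>. 1 / a (k2 \<eta>) * indicator {\<omega>\<in>space M1. k1 \<omega> = k2 \<eta>} \<omega> \<partial>M1)"
      by (intro nn_integral_cong) (auto simp: \<rho>_def split: split_indicator)
    also have "\<dots> = 1 / a (k2 \<eta>) * a (k2 \<eta>)"
      by (subst nn_integral_cmult_indicator) (auto simp: a_def)
    finally show ?case using ratio[OF elim] by (simp add: mult.commute)
  qed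
  define P where "P = density (M1 \<Otimes>\<^sub>M M2) \<rho>"
  have sP: "sets P = sets (M1 \<Otimes>\<^sub>M M2)" by (simp add: P_def)
  have d1: "distr P M1 fst = M1"
  proof (rule measure_eqI)
    fix A assume "A \<in> sets (distr P M1 fst)"
    then have [measurable]: "A \<in> sets M1" by simp
    have "emeasure (distr P M1 fst) A = emeasure P (fst -` A \<inter> space P)"
      by (rule emeasure_distr) (auto simp: P_def)
    also have "\<dots> = (\<integral>\<^sup>+z. \<rho> z * indicator (fst -` A \<inter> space P) z \<partial>(M1 \<Otimes>\<^sub>M M2))"
      unfolding P_def by (rule emeasure_density) auto
    also have "\<dots> = (\<integral>\<^sup>+z. \<rho> z * indicator A (fst z) \<partial>(M1 \<Otimes>\<^sub>M M2))"
      by (intro nn_integral_cong) (auto simp: P_def split: split_indicator)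
    also have "\<dots> = (\<integral>\<^sup>+\<omega>. (\<integral>\<^sup>+\<eta>. \<rho> (\<omega>, \<eta>) * indicator A \<omega> \<partial>M2) \<partial>M1)"
      by (subst M2.nn_integral_fst[symmetric]) auto
    also have "\<dots> = (\<integral>\<^sup>+\<omega>. (\<integral>\<^sup>+\<eta>. \<rho> (\<omega>, \<eta>) \<partial>M2) * indicator A \<omega> \<partial>M1)"
      by (intro nn_integral_cong nn_integral_multc) auto
    also have "\<dots> = (\<integral>\<^sup>+\<omega>. indicator A \<omega> \<partial>M1)"
      by (rule nn_integral_cong_AE) (use i1 in eventually_elim, simp)
    finally show "emeasure (distr P M1 fst) A = emeasure M1 A" by simp
  qed simp
  have d2: "distr P M2 snd = M2"
  proof (rule measure_eqI)
    fix A assume "A \<in> sets (distr P M2 snd)"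
    then have [measurable]: "A \<in> sets M2" by simp
    have "emeasure (distr P M2 snd) A = emeasure P (snd -` A \<inter> space P)"
      by (rule emeasure_distr) (auto simp: P_def)
    also have "\<dots> = (\<integral>\<^sup>+z. \<rho> z * indicator (snd -` A \<inter> space P) z \<partial>(M1 \<Otimes>\<^sub>M M2))"
      unfolding P_def by (rule emeasure_density) auto
    also have "\<dots> = (\<integral>\<^sup>+z. \<rho> z * indicator A (snd z) \<partial>(M1 \<Otimes>\<^sub>M M2))"
      by (intro nn_integral_cong) (auto simp: P_def split: split_indicator)
    also have "\<dots> = (\<integral>\<^sup>+\<eta>. (\<integral>\<^sup>+\<omega>. \<rho> (\<omega>, \<eta>) * indicator A \<eta> \<partial>M1) \<partial>M2)"
      by (subst nn_integral_snd[symmetric]) auto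
    also have "\<dots> = (\<integral>\<^sup>+\<eta>. (\<integral>\<^sup>+\<omega>. \<rho> (\<omega>, \<eta>) \<partial>M1) * indicator A \<eta> \<partial>M2)"
      by (intro nn_integral_cong nn_integral_multc) auto
    also have "\<dots> = (\<integral>\<^sup>+\<eta>. indicator A \<eta> \<partial>M2)"
      by (rule nn_integral_cong_AE) (use i2 in eventually_elim, simp)
    finally show "emeasure (distr P M2 snd) A = emeasure M2 A" by simp
  qed simp
  have "prob_space P"
    using M1.prob_space_axioms d1 prob_space_distrD[of fst P M1] by (simp add: P_def)
  moreover have "AE z in P. \<bar>Y1 (fst z) - Y2 (snd z)\<bar> \<le> \<delta>"
    unfolding P_def
  proof (subst AE_density, measurable, intro AE_I2 impI)
    fix z assume "0 < \<rho> z"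
    then have eq: "k1 (fst z) = k2 (snd z)" by (auto simp: \<rho>_def split: if_splits)
    have "\<bar>Y1 (fst z) / \<delta> - Y2 (snd z) / \<delta>\<bar> \<le> 1"
      using eq unfolding k1_def k2_def by linarith
    then have "\<bar>Y1 (fst z) - Y2 (snd z)\<bar> / \<delta> \<le> 1"
      using \<delta> by (simp add: diff_divide_distrib[symmetric] abs_divide)
    then show "\<bar>Y1 (fst z) - Y2 (snd z)\<bar> \<le> \<delta>" using \<delta> by simp
  qed
  ultimately show ?thesis using that sP d1 d2 by blast
qed

section \<open>Transport cost between laws on the real line\<close>

lemma fst_snd_borel_real [measurable]:
  "fst \<in> borel_measurable (borel :: (real \<times> real) measure)"
  "snd \<in> borel_measurable (borel :: (real \<times> real) measure)"
  by (simp_all add: borel_measurable_continuous_onI continuous_on_fst continuous_on_snd)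

text \<open>\<open>K\<close> bounds the \<open>p\<close>-th power of the \<open>L\<^sup>p\<close> distance, not the distance itself.\<close>

definition transport :: "nat \<Rightarrow> real measure \<Rightarrow> real measure \<Rightarrow> real \<Rightarrow> bool" where
  "transport p \<mu> \<nu> K \<longleftrightarrow> (\<exists>\<pi>::(real \<times> real) measure. prob_space \<pi> \<and> sets \<pi> = sets borel \<and>
     distr \<pi> borel fst = \<mu> \<and> distr \<pi> borel snd = \<nu> \<and>
     (\<integral>\<^sup>+z. ennreal (\<bar>fst z - snd z\<bar> ^ p) \<partial>\<pi>) \<le> ennreal K)"

lemma transportI:
  fixes f g :: "'a \<Rightarrow> real"
  assumes "prob_space P" and [measurable]: "f \<in> borel_measurable P" "g \<in> borel_measurable P"
    and "(\<integral>\<^sup>+\<omega>. ennreal (\<bar>f \<omega> - g \<omega>\<bar> ^ p) \<partial>P) \<le> ennreal K"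
  shows "transport p (distr P borel f) (distr P borel g) K"
proof -
  interpret prob_space P by fact
  let ?\<pi> = "distr P (borel::(real \<times> real) measure) (\<lambda>\<omega>. (f \<omega>, g \<omega>))"
  have "prob_space ?\<pi>" by (intro prob_space_distr) measurable
  moreover have "distr ?\<pi> borel fst = distr P borel f" "distr ?\<pi> borel snd = distr P borel g"
    by (simp_all add: distr_distr comp_def)
  moreover have "(\<integral>\<^sup>+z. ennreal (\<bar>fst z - snd z\<bar> ^ p) \<partial>?\<pi>) \<le> ennreal K"
    using assms(4) by (subst nn_integral_distr) simp_all
  ultimately show ?thesis unfolding transport_def
    by (intro exI[of _ ?\<pi>]) simp
qed

lemma transportE:
  assumes "transport p \<mu> \<nu> K"
  obtains \<pi> :: "(real \<times> real) measure" where "prob_space \<pi>" "sets \<pi> = sets borel"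
    "fst \<in> borel_measurable \<pi>" "snd \<in> borel_measurable \<pi>"
    "distr \<pi> borel fst = \<mu>" "distr \<pi> borel snd = \<nu>"
    "(\<integral>\<^sup>+z. ennreal (\<bar>fst z - snd z\<bar> ^ p) \<partial>\<pi>) \<le> ennreal K"
proof -
  obtain \<pi> :: "(real \<times> real) measure" where \<pi>: "prob_space \<pi>" "sets \<pi> = sets borel"
    "distr \<pi> borel fst = \<mu>" "distr \<pi> borel snd = \<nu>"
    "(\<integral>\<^sup>+z. ennreal (\<bar>fst z - snd z\<bar> ^ p) \<partial>\<pi>) \<le> ennreal K"
    using assms unfolding transport_def by blast
  have "fst \<in> borel_measurable \<pi>" "snd \<in> borel_measurable \<pi>"
    unfolding measurable_cong_sets[OF \<pi>(2) refl] by (rule fst_snd_borel_real)+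
  with \<pi> show ?thesis using that by blast
qed

lemma transport_mono: "transport p \<mu> \<nu> K \<Longrightarrow> K \<le> K' \<Longrightarrow> transport p \<mu> \<nu> K'"
  unfolding transport_def by (elim exE conjE) (intro exI conjI, auto intro: order_trans ennreal_leI)

lemma transport_sym: "transport p \<mu> \<nu> K \<Longrightarrow> transport p \<nu> \<mu> K"
  by (elim transportE) (metis (no_types, lifting) abs_minus_commute nn_integral_cong transportI)

lemma power_sum3_le:
  fixes a b c :: real
  assumes "0 \<le> a" "0 \<le> b" "0 \<le> c"
  shows "(a + b + c) ^ p \<le> 3 ^ p * (a ^ p + b ^ p + c ^ p)"
proof -
  define m where "m = max a (max b c)"
  have "a + b + c \<le> 3 * m" by (auto simp: m_def)
  then have "(a + b + c) ^ p \<le> (3 * m) ^ p" using assms by (intro power_mono) auto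
  moreover have "m ^ p \<le> a ^ p + b ^ p + c ^ p"
    using assms by (auto simp: m_def max_def)
  ultimately show ?thesis by (simp add: power_mult_distrib order_trans)
qed

text \<open>The middle variables of the two couplings agree only up to \<delta>, which makes the
  triangle inequality one with three terms; hence 3^p and the extra \<delta>^p. Choosing \<delta> of
  the size of the other costs makes this harmless.\<close>

lemma transport_trans:
  assumes 1: "transport p \<mu> \<nu> K1" and 2: "transport p \<nu> \<kappa> K2"
    and "\<delta> > 0" "0 \<le> K1" "0 \<le> K2"
  shows "transport p \<mu> \<kappa> (3 ^ p * (K1 + K2 + \<delta> ^ p))"
proof -
  obtain \<pi>1 :: "(real \<times> real) measure" where \<pi>1: "prob_space \<pi>1" "sets \<pi>1 = sets borel"
    "fst \<in> borel_measurable \<pi>1" "snd \<in> borel_measurable \<pi>1"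
    "distr \<pi>1 borel fst = \<mu>" "distr \<pi>1 borel snd = \<nu>"
    "(\<integral>\<^sup>+z. ennreal (\<bar>fst z - snd z\<bar> ^ p) \<partial>\<pi>1) \<le> ennreal K1" using 1 by (rule transportE)
  obtain \<pi>2 :: "(real \<times> real) measure" where \<pi>2: "prob_space \<pi>2" "sets \<pi>2 = sets borel"
    "fst \<in> borel_measurable \<pi>2" "snd \<in> borel_measurable \<pi>2"
    "distr \<pi>2 borel fst = \<nu>" "distr \<pi>2 borel snd = \<kappa>"
    "(\<integral>\<^sup>+z. ennreal (\<bar>fst z - snd z\<bar> ^ p) \<partial>\<pi>2) \<le> ennreal K2" using 2 by (rule transportE)
  note [measurable] = \<pi>1(3,4) \<pi>2(3,4)
  have law: "distr \<pi>1 borel snd = distr \<pi>2 borel fst" by (simp add: \<pi>1 \<pi>2)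
  obtain P where P: "prob_space P" "sets P = sets (\<pi>1 \<Otimes>\<^sub>M \<pi>2)"
    "distr P \<pi>1 fst = \<pi>1" "distr P \<pi>2 snd = \<pi>2"
    "AE z in P. \<bar>snd (fst z) - fst (snd z)\<bar> \<le> \<delta>"
    by (rule glue_approx[OF \<pi>1(1) \<pi>2(1) \<pi>1(4) \<pi>2(3) law \<open>\<delta> > 0\<close>])
  interpret P: prob_space P by fact
  have m: "fst \<in> measurable P \<pi>1" "snd \<in> measurable P \<pi>2"
    unfolding measurable_cong_sets[OF P(2) refl] by measurable
  note [measurable] = m
  have eq1: "(\<integral>\<^sup>+z. f (fst z) \<partial>P) = (\<integral>\<^sup>+z. f z \<partial>\<pi>1)" if [measurable]: "f \<in> borel_measurable \<pi>1" for f
    using nn_integral_distr[OF m(1), of f] by (simp add: P(3))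
  have eq2: "(\<integral>\<^sup>+z. f (snd z) \<partial>P) = (\<integral>\<^sup>+z. f z \<partial>\<pi>2)" if [measurable]: "f \<in> borel_measurable \<pi>2" for f
    using nn_integral_distr[OF m(2), of f] by (simp add: P(4))
  let ?x = "\<lambda>z::(real \<times> real) \<times> real \<times> real. \<bar>fst (fst z) - snd (fst z)\<bar>" and ?y = "\<lambda>z::(real \<times> real) \<times> real \<times> real. \<bar>fst (snd z) - snd (snd z)\<bar>"
  have "(\<integral>\<^sup>+z. ennreal (\<bar>fst (fst z) - snd (snd z)\<bar> ^ p) \<partial>P)
    \<le> (\<integral>\<^sup>+z. ennreal (3 ^ p) * (ennreal (?x z ^ p) + ennreal (?y z ^ p) + ennreal (\<delta> ^ p)) \<partial>P)"
  proof (rule nn_integral_mono_AE, use P(5) in eventually_elim)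
    case (elim z)
    have "\<bar>fst (fst z) - snd (snd z)\<bar> \<le> ?x z + ?y z + \<delta>" using elim by linarith
    then have "\<bar>fst (fst z) - snd (snd z)\<bar> ^ p \<le> (?x z + ?y z + \<delta>) ^ p"
      by (intro power_mono) auto
    also have "\<dots> \<le> 3 ^ p * (?x z ^ p + ?y z ^ p + \<delta> ^ p)"
      using \<open>\<delta> > 0\<close> by (intro power_sum3_le) auto
    finally have "ennreal (\<bar>fst (fst z) - snd (snd z)\<bar> ^ p) \<le> ennreal (3 ^ p * (?x z ^ p + ?y z ^ p + \<delta> ^ p))"
      by (rule ennreal_leI)
    also have "\<dots> = ennreal (3 ^ p) * (ennreal (?x z ^ p) + ennreal (?y z ^ p) + ennreal (\<delta> ^ p))"
      using \<open>\<delta> > 0\<close> by (subst ennreal_mult) (auto simp: ennreal_plus)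
    finally show ?case .
  qed
  also have "\<dots> = ennreal (3 ^ p) * ((\<integral>\<^sup>+z. ennreal (?x z ^ p) \<partial>P) + (\<integral>\<^sup>+z. ennreal (?y z ^ p) \<partial>P) + ennreal (\<delta> ^ p))"
    by (simp add: nn_integral_cmult nn_integral_add P.emeasure_space_1)
  also have "\<dots> \<le> ennreal (3 ^ p) * (ennreal K1 + ennreal K2 + ennreal (\<delta> ^ p))"
    using eq1[of "\<lambda>z. ennreal (\<bar>fst z - snd z\<bar> ^ p)"] eq2[of "\<lambda>z. ennreal (\<bar>fst z - snd z\<bar> ^ p)"] \<pi>1(7) \<pi>2(7)
    by (intro mult_left_mono add_mono) auto
  also have "\<dots> = ennreal (3 ^ p * (K1 + K2 + \<delta> ^ p))"
    using assms by (subst ennreal_mult) (auto simp: ennreal_plus)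
  finally have "transport p (distr P borel (\<lambda>z. fst (fst z))) (distr P borel (\<lambda>z. snd (snd z))) (3 ^ p * (K1 + K2 + \<delta> ^ p))"
    by (intro transportI P(1)) auto
  moreover have "distr P borel (\<lambda>z. fst (fst z)) = \<mu>"
    using distr_distr[OF \<pi>1(3) m(1)] by (simp add: P(3) \<pi>1(5) comp_def)
  moreover have "distr P borel (\<lambda>z. snd (snd z)) = \<kappa>"
    using distr_distr[OF \<pi>2(4) m(2)] by (simp add: P(4) \<pi>2(6) comp_def)
  ultimately show ?thesis by simp
qed

lemma transport_scale:
  assumes "transport p \<mu> \<nu> K" "0 \<le> K"
  shows "transport p (distr \<mu> borel (\<lambda>x. c * x)) (distr \<nu> borel (\<lambda>x. c * x)) (\<bar>c\<bar> ^ p * K)"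
  using assms(1)
proof (rule transportE)
  fix \<pi> :: "(real \<times> real) measure"
  assume \<pi>: "prob_space \<pi>" and [measurable]: "fst \<in> borel_measurable \<pi>" "snd \<in> borel_measurable \<pi>"
    and d: "distr \<pi> borel fst = \<mu>" "distr \<pi> borel snd = \<nu>"
    and c: "(\<integral>\<^sup>+z. ennreal (\<bar>fst z - snd z\<bar> ^ p) \<partial>\<pi>) \<le> ennreal K"
  have "(\<integral>\<^sup>+z. ennreal (\<bar>c * fst z - c * snd z\<bar> ^ p) \<partial>\<pi>) = (\<integral>\<^sup>+z. ennreal (\<bar>c\<bar> ^ p) * ennreal (\<bar>fst z - snd z\<bar> ^ p) \<partial>\<pi>)"
    by (intro nn_integral_cong)
       (auto simp: ennreal_mult[symmetric] power_mult_distrib[symmetric] abs_mult[symmetric] right_diff_distrib)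
  also have "\<dots> = ennreal (\<bar>c\<bar> ^ p) * (\<integral>\<^sup>+z. ennreal (\<bar>fst z - snd z\<bar> ^ p) \<partial>\<pi>)"
    by (rule nn_integral_cmult) auto
  also have "\<dots> \<le> ennreal (\<bar>c\<bar> ^ p) * ennreal K"
    by (intro mult_left_mono c) simp
  also have "\<dots> = ennreal (\<bar>c\<bar> ^ p * K)" using assms(2) by (simp add: ennreal_mult)
  finally have "transport p (distr \<pi> borel (\<lambda>z. c * fst z)) (distr \<pi> borel (\<lambda>z. c * snd z)) (\<bar>c\<bar> ^ p * K)"
    by (intro transportI \<pi>) auto
  then show ?thesis unfolding d[symmetric] by (simp add: distr_distr comp_def)
qed

text \<open>The coupling is (X, X + U) with U independent of X and of density u, so the cost is the
  p-th absolute moment of U whatever the tails of \<mu> are. The convolution is kept as a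
  nonnegative integral, which spares all integrability questions about \<mu>.\<close>

lemma transport_noise:
  fixes u :: "real \<Rightarrow> real"
  assumes "prob_space \<mu>" and [simp, measurable_cong]: "sets \<mu> = sets borel"
    and [measurable]: "u \<in> borel_measurable borel" and u0: "\<And>x. 0 \<le> u x"
    and u1: "(\<integral>\<^sup>+x. ennreal (u x) \<partial>lborel) = 1"
    and K: "(\<integral>\<^sup>+x. ennreal (\<bar>x\<bar> ^ p * u x) \<partial>lborel) \<le> ennreal K"
  shows "transport p \<mu> (density lborel (\<lambda>x. \<integral>\<^sup>+y. ennreal (u (x - y)) \<partial>\<mu>)) K"
proof -
  interpret \<mu>: prob_space \<mu> by fact
  define \<nu> where "\<nu> = density lborel (\<lambda>x. ennreal (u x))"
  have [simp, measurable_cong]: "sets \<nu> = sets borel" by (simp add: \<nu>_def)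
  interpret \<nu>: prob_space \<nu>
    by standard (simp add: \<nu>_def emeasure_density u1)
  interpret pair_sigma_finite \<mu> \<nu> ..
  interpret L: pair_sigma_finite \<mu> lborel ..
  interpret PS: prob_space "\<mu> \<Otimes>\<^sub>M \<nu>" by (rule prob_space_pair) unfold_locales
  have "(\<integral>\<^sup>+z. ennreal (\<bar>fst z - (fst z + snd z)\<bar> ^ p) \<partial>(\<mu> \<Otimes>\<^sub>M \<nu>)) = (\<integral>\<^sup>+y. (\<integral>\<^sup>+z. ennreal (\<bar>z\<bar> ^ p) \<partial>\<nu>) \<partial>\<mu>)"
    by (subst \<nu>.nn_integral_fst[symmetric]) (simp_all)
  also have "\<dots> = (\<integral>\<^sup>+x. ennreal (\<bar>x\<bar> ^ p * u x) \<partial>lborel)"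
    unfolding \<nu>_def using u0 
    by (simp add: nn_integral_density \<mu>.emeasure_space_1 ennreal_mult[symmetric] mult.commute)
  finally have "transport p (distr (\<mu> \<Otimes>\<^sub>M \<nu>) borel fst) (distr (\<mu> \<Otimes>\<^sub>M \<nu>) borel (\<lambda>z. fst z + snd z)) K"
    using K by (intro transportI) (auto intro: PS.prob_space_axioms)
  moreover have "distr (\<mu> \<Otimes>\<^sub>M \<nu>) borel fst = \<mu>"
    using \<nu>.distr_pair_fst[of \<mu>] by (simp cong: distr_cong)
  moreover have "distr (\<mu> \<Otimes>\<^sub>M \<nu>) borel (\<lambda>z. fst z + snd z) = density lborel (\<lambda>x. \<integral>\<^sup>+y. ennreal (u (x - y)) \<partial>\<mu>)"
  proof (rule measure_eqI)
    fix A assume "A \<in> sets (distr (\<mu> \<Otimes>\<^sub>M \<nu>) borel (\<lambda>z. fst z + snd z))"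
    then have [measurable]: "A \<in> sets borel" by simp
    have "emeasure (distr (\<mu> \<Otimes>\<^sub>M \<nu>) borel (\<lambda>z. fst z + snd z)) A
      = (\<integral>\<^sup>+z. indicator A z \<partial>(distr (\<mu> \<Otimes>\<^sub>M \<nu>) borel (\<lambda>z. fst z + snd z)))" by simp
    also have "\<dots> = (\<integral>\<^sup>+z. indicator A (fst z + snd z) \<partial>(\<mu> \<Otimes>\<^sub>M \<nu>))"
      by (subst nn_integral_distr) auto
    also have "\<dots> = (\<integral>\<^sup>+y. (\<integral>\<^sup>+z. indicator A (y + z) \<partial>\<nu>) \<partial>\<mu>)"
      by (subst \<nu>.nn_integral_fst[symmetric]) simp_all
    also have "\<dots> = (\<integral>\<^sup>+y. (\<integral>\<^sup>+z. ennreal (u z) * indicator A (y + z) \<partial>lborel) \<partial>\<mu>)"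
      unfolding \<nu>_def by (simp add: nn_integral_density)
    also have "\<dots> = (\<integral>\<^sup>+y. (\<integral>\<^sup>+x. ennreal (u (x - y)) * indicator A x \<partial>lborel) \<partial>\<mu>)"
    proof (rule nn_integral_cong)
      fix y
      show "(\<integral>\<^sup>+z. ennreal (u z) * indicator A (y + z) \<partial>lborel) = (\<integral>\<^sup>+x. ennreal (u (x - y)) * indicator A x \<partial>lborel)"
        using nn_integral_real_affine[of "\<lambda>z. ennreal (u z) * indicator A (y + z)" 1 "-y"] by simp
    qed
    also have "\<dots> = (\<integral>\<^sup>+x. (\<integral>\<^sup>+y. ennreal (u (x - y)) * indicator A x \<partial>\<mu>) \<partial>lborel)"
      by (rule L.Fubini'[symmetric]) simp
    also have "\<dots> = (\<integral>\<^sup>+x. (\<integral>\<^sup>+y. ennreal (u (x - y)) \<partial>\<mu>) * indicator A x \<partial>lborel)"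
      by (intro nn_integral_cong nn_integral_multc) simp
    finally show "emeasure (distr (\<mu> \<Otimes>\<^sub>M \<nu>) borel (\<lambda>z. fst z + snd z)) A = 
      emeasure (density lborel (\<lambda>x. \<integral>\<^sup>+y. ennreal (u (x - y)) \<partial>\<mu>)) A"
      by (subst emeasure_density) simp_all
  qed simp
  ultimately show ?thesis by simp
qed

lemma power_diff_le:
  fixes x y :: real
  shows "\<bar>x - y\<bar> ^ p \<le> 2 ^ p * (\<bar>x\<bar> ^ p + \<bar>y\<bar> ^ p)"
proof -
  have "\<bar>x - y\<bar> \<le> 2 * max \<bar>x\<bar> \<bar>y\<bar>" by linarith
  then have "\<bar>x - y\<bar> ^ p \<le> (2 * max \<bar>x\<bar> \<bar>y\<bar>) ^ p" by (intro power_mono) auto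
  moreover have "max \<bar>x\<bar> \<bar>y\<bar> ^ p \<le> \<bar>x\<bar> ^ p + \<bar>y\<bar> ^ p" by (auto simp: max_def)
  from this have "(2 * max \<bar>x\<bar> \<bar>y\<bar>) ^ p \<le> 2 ^ p * (\<bar>x\<bar> ^ p + \<bar>y\<bar> ^ p)"
    by (simp add: power_mult_distrib)
  ultimately show ?thesis by linarith
qed

text \<open>A point x drawn from f stays with probability min(1, g x / f x) and is otherwise redrawn
  from the normalized excess of g over f. Only the mass of f - g that moves is charged, and there |x
  - r|^p is at most 2^p (|x|^p + |r|^p), so departures and arrivals together pay the weighted
  distance.\<close>

lemma transport_weighted_total_variation:
  fixes f g :: "real \<Rightarrow> real"
  assumes [measurable]: "f \<in> borel_measurable borel" "g \<in> borel_measurable borel"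
    and f0: "\<And>x. 0 \<le> f x" and g0: "\<And>x. 0 \<le> g x"
    and f1: "(\<integral>\<^sup>+x. ennreal (f x) \<partial>lborel) = 1" and g1: "(\<integral>\<^sup>+x. ennreal (g x) \<partial>lborel) = 1"
    and K: "(\<integral>\<^sup>+x. ennreal (\<bar>x\<bar> ^ p * \<bar>f x - g x\<bar>) \<partial>lborel) \<le> ennreal K"
    and K0: "0 \<le> K" and p: "p > 0"
  shows "transport p (density lborel f) (density lborel g) (2 ^ p * K)"
proof -
  \<comment> \<open>\<theta> is the mass by which g exceeds f; as both total masses are 1 it is also
    the mass by which f exceeds g. It normalizes the redrawing law R, which is why \<theta> = 0 is
    treated apart.\<close>
  define \<theta> where "\<theta> = (\<integral>\<^sup>+x. ennreal (g x - f x) \<partial>lborel)"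
  have "\<theta> + 1 = (\<integral>\<^sup>+x. ennreal (g x - f x) + ennreal (f x) \<partial>lborel)"
    unfolding \<theta>_def by (subst nn_integral_add) (auto simp: f1)
  also have "\<dots> = (\<integral>\<^sup>+x. ennreal (f x - g x) + ennreal (g x) \<partial>lborel)"
  proof (rule nn_integral_cong)
    fix x
    have "ennreal (g x - f x) + ennreal (f x) = ennreal (max (f x) (g x))"
      using f0[of x] by (cases "f x \<le> g x") (auto simp: ennreal_neg ennreal_plus[symmetric] simp del: ennreal_plus)
    moreover have "ennreal (f x - g x) + ennreal (g x) = ennreal (max (f x) (g x))"
      using g0[of x] by (cases "f x \<le> g x") (auto simp: ennreal_neg ennreal_plus[symmetric] simp del: ennreal_plus)
    ultimately show "ennreal (g x - f x) + ennreal (f x) = ennreal (f x - g x) + ennreal (g x)" by simp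
  qed
  also have "\<dots> = (\<integral>\<^sup>+x. ennreal (f x - g x) \<partial>lborel) + 1"
    by (subst nn_integral_add) (auto simp: g1)
  finally have \<theta>': "(\<integral>\<^sup>+x. ennreal (f x - g x) \<partial>lborel) = \<theta>"
    by simp
  have "\<theta> \<le> (\<integral>\<^sup>+x. ennreal (g x) \<partial>lborel)"
    unfolding \<theta>_def using f0 by (intro nn_integral_mono ennreal_leI) auto
  then have \<theta>1: "\<theta> < \<top>" using g1 by (metis ennreal_one_less_top order_le_less_trans)
  have psf: "prob_space (density lborel (\<lambda>x. ennreal (f x)))" 
    by standard (simp add: emeasure_density f1)
  show ?thesis
  proof (cases "\<theta> = 0")
    case True
    have "AE x in lborel. ennreal (f x - g x) = 0"
      using \<theta>' True by (subst nn_integral_0_iff_AE[symmetric]; simp)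
    moreover have "AE x in lborel. ennreal (g x - f x) = 0"
      using True \<theta>_def by (subst nn_integral_0_iff_AE[symmetric]; simp)
    ultimately have "AE x in lborel. ennreal (f x) = ennreal (g x)"
      by eventually_elim (auto simp: ennreal_eq_0_iff)
    then have eq: "density lborel (\<lambda>x. ennreal (f x)) = density lborel (\<lambda>x. ennreal (g x))"
      by (intro density_cong) auto
    have "distr (density lborel (\<lambda>x. ennreal (f x))) borel (\<lambda>x. x) = density lborel (\<lambda>x. ennreal (f x))"
      by (rule distr_id2) simp
    moreover have "transport p (distr (density lborel (\<lambda>x. ennreal (f x))) borel (\<lambda>x. x))
       (distr (density lborel (\<lambda>x. ennreal (f x))) borel (\<lambda>x. x)) (2 ^ p * K)"
      using p by (intro transportI psf) (auto simp: zero_power)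
    ultimately show ?thesis by (simp add: eq)
  next
    case False
    have \<theta>c: "\<theta> * (c / \<theta>) = c" for c
      using False \<theta>1 by (simp add: ennreal_times_divide mult.commute[of \<theta>] ennreal_mult_divide_eq)
    define F where "F = density lborel (\<lambda>x. ennreal (f x))"
    define R where "R = density lborel (\<lambda>x. ennreal (g x - f x) / \<theta>)"
    define U where "U = uniform_measure lborel {0..1::real}"
    have [simp, measurable_cong]: "sets F = sets borel" "sets R = sets borel" "sets U = sets borel"
      by (simp_all add: F_def R_def U_def)
    interpret F: prob_space F unfolding F_def by (rule psf)
    interpret U: prob_space U unfolding U_def by (rule prob_space_uniform_measure) auto
    interpret R: prob_space R
    proof
      have "emeasure R (space R) = \<theta> / \<theta>"
        by (simp add: R_def emeasure_density nn_integral_divide \<theta>_def)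
      then show "emeasure R (space R) = 1" using False \<theta>1 by (simp add: ennreal_divide_self)
    qed
    interpret RU: prob_space "R \<Otimes>\<^sub>M U" by (rule prob_space_pair) unfold_locales
    interpret P: prob_space "F \<Otimes>\<^sub>M (R \<Otimes>\<^sub>M U)" by (rule prob_space_pair) unfold_locales
    interpret PU: pair_sigma_finite R U ..
    define P where "P = F \<Otimes>\<^sub>M (R \<Otimes>\<^sub>M U)"
    have sP[measurable_cong]: "sets P = sets (borel \<Otimes>\<^sub>M (borel \<Otimes>\<^sub>M borel))"
      unfolding P_def by (intro sets_pair_measure_cong) auto
    \<comment> \<open>The uniform third coordinate decides: x is kept if v f(x) is at most g(x),
      otherwise the independent draw from R replaces it. Writing the test as a product avoids
      dividing by f(x) = 0.\<close>
    define Y :: "real \<times> real \<times> real \<Rightarrow> real" where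
      "Y z = (if snd (snd z) * f (fst z) \<le> g (fst z) then fst z else fst (snd z))" for z
    have [measurable]: "Y \<in> borel_measurable (borel \<Otimes>\<^sub>M (borel \<Otimes>\<^sub>M borel))" unfolding Y_def by measurable
    have Y': "Y \<in> borel_measurable P" by measurable
    have \<alpha>: "ennreal (f x) * emeasure U {v. v * f x \<le> g x} = ennreal (min (f x) (g x)) \<and>
      ennreal (f x) * emeasure U {v. \<not> v * f x \<le> g x} = ennreal (f x - g x)" for x
    proof -
      have Ueq: "emeasure U A = emeasure lborel ({0..1} \<inter> A)" if "A \<in> sets borel" for A
        using that unfolding U_def by (subst emeasure_uniform_measure) (auto simp: divide_ennreal_def)
      consider "f x = 0" | "f x > 0" "f x \<le> g x" | "f x > 0" "g x < f x" using f0[of x] by linarith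
      then show ?thesis
      proof cases
        case 1
        then show ?thesis using g0[of x] by (auto simp: ennreal_neg)
      next
        case 2
        have "v * f x \<le> g x" if "v \<in> {0..1}" for v
        proof -
          have "v * f x \<le> 1 * f x" by (intro mult_right_mono) (use that 2 in auto)
          then show ?thesis using 2 by linarith
        qed
        then have e: "{0..1} \<inter> {v. v * f x \<le> g x} = {0..1}" "{0..1} \<inter> {v. \<not> v * f x \<le> g x} = {}" by auto
        have "emeasure U {v. v * f x \<le> g x} = 1"
          by (subst Ueq; (simp only: e)?; simp)
        moreover have "emeasure U {v. \<not> v * f x \<le> g x} = 0"
          by (subst Ueq; (simp only: e)?; simp)
        ultimately show ?thesis using 2 by (simp add: ennreal_neg min_def)
      next
        case 3
        have e: "{0..1} \<inter> {v. v * f x \<le> g x} = {0..g x / f x}" "{0..1} \<inter> {v. \<not> v * f x \<le> g x} = {g x / f x<..1}" 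
        proof -
          define q where "q = g x / f x"
          have q: "q < 1" "0 \<le> q" using 3 g0[of x] by (auto simp: q_def)
          have iff: "v * f x \<le> g x \<longleftrightarrow> v \<le> q" for v using 3 by (simp add: pos_le_divide_eq q_def)
          show "{0..1} \<inter> {v. v * f x \<le> g x} = {0..g x / f x}"
            unfolding iff q_def[symmetric] using q by (intro set_eqI) (simp, linarith)
          show "{0..1} \<inter> {v. \<not> v * f x \<le> g x} = {g x / f x<..1}"
            unfolding iff q_def[symmetric] using q by (intro set_eqI) (simp, linarith)
        qed
        have "emeasure U {v. v * f x \<le> g x} = ennreal (g x / f x)"
          using 3 g0[of x] by (subst Ueq; (simp only: e)?; simp)
        moreover have "emeasure U {v. \<not> v * f x \<le> g x} = ennreal (1 - g x / f x)"
          using 3 g0[of x] by (subst Ueq; (simp only: e)?; simp)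
        moreover have "ennreal (f x) * ennreal (g x / f x) = ennreal (f x * (g x / f x))"
          using 3 g0[of x] by (intro ennreal_mult[symmetric]) auto
        moreover have "ennreal (f x) * ennreal (1 - g x / f x) = ennreal (f x * (1 - g x / f x))"
          using 3 g0[of x] by (intro ennreal_mult[symmetric]) auto
        moreover have "f x * (g x / f x) = min (f x) (g x)" "f x * (1 - g x / f x) = f x - g x"
          using 3 by (auto simp: right_diff_distrib)
        ultimately show ?thesis by simp
      qed
    qed
    have mU: "{v. v * f x \<le> g x} \<in> sets U" "{v. \<not> v * f x \<le> g x} \<in> sets U" for x by simp_all
    have [measurable]: "(\<lambda>x. emeasure U {v. v * f x \<le> g x}) \<in> borel_measurable borel"
      "(\<lambda>x. emeasure U {v. \<not> v * f x \<le> g x}) \<in> borel_measurable borel"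
      unfolding nn_integral_indicator[OF mU(1), symmetric] nn_integral_indicator[OF mU(2), symmetric] indicator_def mem_Collect_eq
      by measurable
    \<comment> \<open>Joint law of the old and the new point: the diagonal carries min(f, g), and
      off it the point that leaves and the point that arrives are independent. Both the law of Y and
      the cost are instances.\<close>
    have key: "(\<integral>\<^sup>+z. H (fst z) (Y z) \<partial>P) = (\<integral>\<^sup>+x. ennreal (min (f x) (g x)) * H x x \<partial>lborel)
        + (\<integral>\<^sup>+x. ennreal (f x - g x) * (\<integral>\<^sup>+r. H x r \<partial>R) \<partial>lborel)"
      if [measurable]: "case_prod H \<in> borel_measurable (borel \<Otimes>\<^sub>M borel)" for H :: "real \<Rightarrow> real \<Rightarrow> ennreal"
    proof -
      have [measurable]: "H x \<in> borel_measurable borel" for x by measurable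
      have [measurable]: "(\<lambda>x. H x x) \<in> borel_measurable borel"
        using measurable_compose[OF _ that, of "\<lambda>x. (x, x)"] by simp
      have "(\<integral>\<^sup>+z. H (fst z) (Y z) \<partial>P) = (\<integral>\<^sup>+x. (\<integral>\<^sup>+w. H x (Y (x, w)) \<partial>(R \<Otimes>\<^sub>M U)) \<partial>F)"
        unfolding P_def by (subst RU.nn_integral_fst[symmetric]) simp_all
      also have "\<dots> = (\<integral>\<^sup>+x. (\<integral>\<^sup>+r. (\<integral>\<^sup>+v. H x (Y (x, r, v)) \<partial>U) \<partial>R) \<partial>F)"
        by (intro nn_integral_cong) (subst U.nn_integral_fst[symmetric], simp_all)
      also have "\<dots> = (\<integral>\<^sup>+x. emeasure U {v. v * f x \<le> g x} * H x x + emeasure U {v. \<not> v * f x \<le> g x} * (\<integral>\<^sup>+r. H x r \<partial>R) \<partial>F)"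
      proof (rule nn_integral_cong)
        fix x
        have "(\<integral>\<^sup>+v. H x (Y (x, r, v)) \<partial>U) = emeasure U {v. v * f x \<le> g x} * H x x + emeasure U {v. \<not> v * f x \<le> g x} * H x r" for r
        proof -
          have "(\<integral>\<^sup>+v. H x (Y (x, r, v)) \<partial>U) = (\<integral>\<^sup>+v. H x x * indicator {v. v * f x \<le> g x} v + H x r * indicator {v. \<not> v * f x \<le> g x} v \<partial>U)"
            by (intro nn_integral_cong) (auto simp: Y_def)
          also have "\<dots> = H x x * emeasure U {v. v * f x \<le> g x} + H x r * emeasure U {v. \<not> v * f x \<le> g x}"
            by (subst nn_integral_add) (simp_all add: nn_integral_cmult_indicator)
          finally show ?thesis by (simp add: mult.commute)
        qed
        then show "(\<integral>\<^sup>+r. (\<integral>\<^sup>+v. H x (Y (x, r, v)) \<partial>U) \<partial>R) = emeasure U {v. v * f x \<le> g x} * H x x + emeasure U {v. \<not> v * f x \<le> g x} * (\<integral>\<^sup>+r. H x r \<partial>R)"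
          by (simp add: nn_integral_add nn_integral_cmult R.emeasure_space_1)
      qed
      also have "\<dots> = (\<integral>\<^sup>+x. ennreal (f x) * (emeasure U {v. v * f x \<le> g x} * H x x + emeasure U {v. \<not> v * f x \<le> g x} * (\<integral>\<^sup>+r. H x r \<partial>R)) \<partial>lborel)"
        unfolding F_def by (rule nn_integral_density) measurable
      also have "\<dots> = (\<integral>\<^sup>+x. ennreal (min (f x) (g x)) * H x x + ennreal (f x - g x) * (\<integral>\<^sup>+r. H x r \<partial>R) \<partial>lborel)"
        by (intro nn_integral_cong) (simp add: distrib_left mult.assoc[symmetric] \<alpha>)
      also have "\<dots> = (\<integral>\<^sup>+x. ennreal (min (f x) (g x)) * H x x \<partial>lborel)
        + (\<integral>\<^sup>+x. ennreal (f x - g x) * (\<integral>\<^sup>+r. H x r \<partial>R) \<partial>lborel)"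
        by (rule nn_integral_add) measurable
      finally show ?thesis .
    qed
    have "distr P borel Y = density lborel g"
    proof (rule measure_eqI)
      fix A assume "A \<in> sets (distr P borel Y)"
      then have [measurable]: "A \<in> sets borel" by simp
      have "emeasure (distr P borel Y) A = (\<integral>\<^sup>+z. indicator A z \<partial>(distr P borel Y))" by simp
      also have "\<dots> = (\<integral>\<^sup>+z. indicator A (Y z) \<partial>P)" by (rule nn_integral_distr) (auto simp: Y')
      also have "\<dots> = (\<integral>\<^sup>+x. ennreal (min (f x) (g x)) * indicator A x \<partial>lborel)
        + (\<integral>\<^sup>+x. ennreal (f x - g x) * emeasure R A \<partial>lborel)"
        using key[of "\<lambda>_. indicator A"] by simp
      also have "(\<integral>\<^sup>+x. ennreal (f x - g x) * emeasure R A \<partial>lborel) = \<theta> * emeasure R A"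
        by (simp add: nn_integral_multc \<theta>')
      also have "\<dots> = \<theta> * ((\<integral>\<^sup>+x. ennreal (g x - f x) * indicator A x \<partial>lborel) / \<theta>)"
        unfolding R_def by (simp add: emeasure_density nn_integral_divide[symmetric] ennreal_times_divide mult.commute)
      also have "\<dots> = (\<integral>\<^sup>+x. ennreal (g x - f x) * indicator A x \<partial>lborel)"
        by (rule \<theta>c)
      also have "(\<integral>\<^sup>+x. ennreal (min (f x) (g x)) * indicator A x \<partial>lborel) + \<dots> = (\<integral>\<^sup>+x. ennreal (g x) * indicator A x \<partial>lborel)"
        by (subst nn_integral_add[symmetric])
           (auto intro!: nn_integral_cong split: split_indicator simp: ennreal_neg min_def ennreal_plus[symmetric] f0 g0 simp del: ennreal_plus)
      also have "\<dots> = emeasure (density lborel g) A" by (simp add: emeasure_density)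
      finally show "emeasure (distr P borel Y) A = emeasure (density lborel g) A" .
    qed simp
    moreover have "distr P borel fst = density lborel f"
      using RU.distr_pair_fst[of F] by (simp add: P_def F_def cong: distr_cong)
    moreover have "transport p (distr P borel fst) (distr P borel Y) (2 ^ p * K)"
    proof (rule transportI)
      show "prob_space P" unfolding P_def by unfold_locales
      have R: "(\<integral>\<^sup>+r. h r \<partial>R) = (\<integral>\<^sup>+r. ennreal (g r - f r) * h r \<partial>lborel) / \<theta>" if [measurable]: "h \<in> borel_measurable borel" for h
        unfolding R_def by (subst nn_integral_density) (auto simp: nn_integral_divide[symmetric] ennreal_times_divide mult.commute)
      have "(\<integral>\<^sup>+z. ennreal (\<bar>fst z - Y z\<bar> ^ p) \<partial>P) = 
        (\<integral>\<^sup>+x. ennreal (f x - g x) * (\<integral>\<^sup>+r. ennreal (\<bar>x - r\<bar> ^ p) \<partial>R) \<partial>lborel)"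
        using p by (subst key) (auto simp: zero_power)
      also have "\<dots> \<le> (\<integral>\<^sup>+x. ennreal (f x - g x) * (\<integral>\<^sup>+r. ennreal (2 ^ p) * (ennreal (\<bar>x\<bar> ^ p) + ennreal (\<bar>r\<bar> ^ p)) \<partial>R) \<partial>lborel)"
        by (intro nn_integral_mono mult_left_mono)
           (auto simp: ennreal_mult[symmetric] ennreal_plus[symmetric] power_diff_le intro!: ennreal_leI simp del: ennreal_plus)
      also have "\<dots> = (\<integral>\<^sup>+x. ennreal (2 ^ p) * (ennreal (f x - g x) * ennreal (\<bar>x\<bar> ^ p) + ennreal (f x - g x) * (\<integral>\<^sup>+r. ennreal (\<bar>r\<bar> ^ p) \<partial>R)) \<partial>lborel)"
      proof (rule nn_integral_cong)
        fix x
        have "(\<integral>\<^sup>+r. ennreal (2 ^ p) * (ennreal (\<bar>x\<bar> ^ p) + ennreal (\<bar>r\<bar> ^ p)) \<partial>R)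
          = ennreal (2 ^ p) * (ennreal (\<bar>x\<bar> ^ p) + (\<integral>\<^sup>+r. ennreal (\<bar>r\<bar> ^ p) \<partial>R))"
          by (simp add: nn_integral_cmult nn_integral_add R.emeasure_space_1)
        then show "ennreal (f x - g x) * (\<integral>\<^sup>+r. ennreal (2 ^ p) * (ennreal (\<bar>x\<bar> ^ p) + ennreal (\<bar>r\<bar> ^ p)) \<partial>R)
          = ennreal (2 ^ p) * (ennreal (f x - g x) * ennreal (\<bar>x\<bar> ^ p) + ennreal (f x - g x) * (\<integral>\<^sup>+r. ennreal (\<bar>r\<bar> ^ p) \<partial>R))"
          by (simp only: distrib_left mult.left_commute)
      qed
      also have "\<dots> = ennreal (2 ^ p) * ((\<integral>\<^sup>+x. ennreal (f x - g x) * ennreal (\<bar>x\<bar> ^ p) \<partial>lborel) + \<theta> * (\<integral>\<^sup>+r. ennreal (\<bar>r\<bar> ^ p) \<partial>R))"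
        by (simp add: nn_integral_cmult nn_integral_add nn_integral_multc \<theta>')
      \<comment> \<open>The factor \<theta> from the departures cancels the normalization of R, so
        arrivals are charged against the unnormalized excess of g.\<close>
      also have "\<theta> * (\<integral>\<^sup>+r. ennreal (\<bar>r\<bar> ^ p) \<partial>R) = (\<integral>\<^sup>+x. ennreal (g x - f x) * ennreal (\<bar>x\<bar> ^ p) \<partial>lborel)"
        by (simp add: R \<theta>c)
      also have "(\<integral>\<^sup>+x. ennreal (f x - g x) * ennreal (\<bar>x\<bar> ^ p) \<partial>lborel) + \<dots> = (\<integral>\<^sup>+x. ennreal (\<bar>x\<bar> ^ p * \<bar>f x - g x\<bar>) \<partial>lborel)"
        by (subst nn_integral_add[symmetric])
           (auto intro!: nn_integral_cong simp: ennreal_neg abs_if ennreal_mult[symmetric] mult.commute)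
      also have "ennreal (2 ^ p) * \<dots> \<le> ennreal (2 ^ p) * ennreal K"
        by (intro mult_left_mono K) simp
      also have "\<dots> = ennreal (2 ^ p * K)" using K0 by (simp add: ennreal_mult)
      finally show "(\<integral>\<^sup>+z. ennreal (\<bar>fst z - Y z\<bar> ^ p) \<partial>P) \<le> ennreal (2 ^ p * K)" .
    qed (auto simp: Y')
    ultimately show ?thesis by simp
  qed
qed

section \<open>Functions with bounded derivatives\<close>

text \<open>\<open>smooth_bd n J Z B f\<close>: on \<open>J\<close>, \<open>f\<close> and its first \<open>n\<close> derivatives are all bounded by the same function \<open>B\<close>, and they
  vanish on \<open>Z\<close>. Taking the end points of an interval for \<open>Z\<close> makes the boundary terms in integrations by parts disappear.\<close>

primrec smooth_bd :: "nat \<Rightarrow> real set \<Rightarrow> real set \<Rightarrow> (real \<Rightarrow> real) \<Rightarrow> (real \<Rightarrow> complex) \<Rightarrow> bool" where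
  "smooth_bd 0 J Z B f \<longleftrightarrow> (\<forall>t\<in>J. norm (f t) \<le> B t) \<and> (\<forall>t\<in>Z. f t = 0)"
| "smooth_bd (Suc n) J Z B f \<longleftrightarrow> (\<forall>t\<in>J. norm (f t) \<le> B t) \<and> (\<forall>t\<in>Z. f t = 0) \<and>
     (\<exists>f'. (\<forall>t\<in>J. (f has_vector_derivative f' t) (at t within J)) \<and> smooth_bd n J Z B f')"

lemma smooth_bd_SucI:
  assumes "\<And>t. t \<in> J \<Longrightarrow> norm (f t) \<le> B t" "\<And>t. t \<in> Z \<Longrightarrow> f t = 0"
    and "\<And>t. t \<in> J \<Longrightarrow> (f has_vector_derivative f' t) (at t within J)" "smooth_bd n J Z B f'"
  shows "smooth_bd (Suc n) J Z B f"
  using assms by auto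

lemma smooth_bd_bound: "smooth_bd n J Z B f \<Longrightarrow> t \<in> J \<Longrightarrow> norm (f t) \<le> B t"
  by (cases n) auto

lemma smooth_bd_zero: "smooth_bd n J Z B f \<Longrightarrow> t \<in> Z \<Longrightarrow> f t = 0"
  by (cases n) auto

lemma smooth_bd_nonneg: "smooth_bd n J Z B f \<Longrightarrow> t \<in> J \<Longrightarrow> 0 \<le> B t"
  using smooth_bd_bound norm_ge_zero order_trans by blast

lemma smooth_bd_mono:
  "smooth_bd n J Z B f \<Longrightarrow> (\<And>t. t \<in> J \<Longrightarrow> B t \<le> B' t) \<Longrightarrow> Z' \<subseteq> Z \<Longrightarrow> smooth_bd n J Z' B' f"
  by (induction n arbitrary: f) (fastforce intro: order_trans)+

lemma smooth_bd_cong: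
  "smooth_bd n J Z B f \<Longrightarrow> (\<And>t. t \<in> J \<Longrightarrow> g t = f t) \<Longrightarrow> Z \<subseteq> J \<Longrightarrow> smooth_bd n J Z B g"
proof (cases n)
  case (Suc n')
  assume a: "smooth_bd n J Z B f" "\<And>t. t \<in> J \<Longrightarrow> g t = f t" "Z \<subseteq> J"
  obtain f' where f': "\<forall>t\<in>J. (f has_vector_derivative f' t) (at t within J)" "smooth_bd n' J Z B f'"
    using a(1) Suc by auto
  have "(g has_vector_derivative f' t) (at t within J)" if "t \<in> J" for t
    by (rule has_vector_derivative_transform[OF that a(2) f'(1)[rule_format, OF that]])
  then show ?thesis using a f' by (auto simp: Suc subset_iff)
qed (auto simp: subset_iff)

lemma smooth_bd_Suc_imp: "smooth_bd (Suc n) J Z B f \<Longrightarrow> smooth_bd n J Z B f"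
  by (induction n arbitrary: f) auto

lemma smooth_bd_le: "smooth_bd n J Z B f \<Longrightarrow> m \<le> n \<Longrightarrow> smooth_bd m J Z B f"
  by (induction n arbitrary: m) (auto simp: le_Suc_eq dest: smooth_bd_Suc_imp simp del: smooth_bd.simps)

lemma smooth_bd_add:
  "smooth_bd n J Z B1 f \<Longrightarrow> smooth_bd n J Z B2 g \<Longrightarrow> smooth_bd n J Z (\<lambda>t. B1 t + B2 t) (\<lambda>t. f t + g t)"
proof (induction n arbitrary: f g)
  case 0
  then show ?case by (auto intro: norm_triangle_mono)
next
  case (Suc n)
  obtain f' where f': "\<forall>t\<in>J. (f has_vector_derivative f' t) (at t within J)" "smooth_bd n J Z B1 f'"
    using Suc.prems by auto
  obtain g' where g': "\<forall>t\<in>J. (g has_vector_derivative g' t) (at t within J)" "smooth_bd n J Z B2 g'"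
    using Suc.prems by auto
  have "\<forall>t\<in>J. ((\<lambda>t. f t + g t) has_vector_derivative f' t + g' t) (at t within J)"
    using f' g' by (auto intro: has_vector_derivative_add)
  moreover have "smooth_bd n J Z (\<lambda>t. B1 t + B2 t) (\<lambda>t. f' t + g' t)"
    using Suc.IH f' g' by blast
  ultimately show ?case using Suc.prems by (auto intro: norm_triangle_mono)
qed

text \<open>Each of the at most n differentiations doubles the number of Leibniz terms, hence 2^n.
  Only g is required to vanish on Z, because every Leibniz term contains some derivative of
  g.\<close>

lemma smooth_bd_mult:
  "smooth_bd n J {} B1 f \<Longrightarrow> smooth_bd n J Z B2 g \<Longrightarrow>
   smooth_bd n J Z (\<lambda>t. 2 ^ n * (B1 t * B2 t)) (\<lambda>t. f t * g t)"
proof (induction n arbitrary: f g)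
  case 0
  then show ?case by (auto simp: norm_mult intro!: mult_mono')
next
  case (Suc n)
  obtain f' where f': "\<forall>t\<in>J. (f has_vector_derivative f' t) (at t within J)" "smooth_bd n J {} B1 f'"
    using Suc.prems by auto
  obtain g' where g': "\<forall>t\<in>J. (g has_vector_derivative g' t) (at t within J)" "smooth_bd n J Z B2 g'"
    using Suc.prems by auto
  have "\<forall>t\<in>J. ((\<lambda>t. f t * g t) has_vector_derivative f t * g' t + f' t * g t) (at t within J)"
    using f' g' by (auto intro: has_vector_derivative_mult)
  moreover have "smooth_bd n J Z (\<lambda>t. 2 ^ n * (B1 t * B2 t)) (\<lambda>t. f t * g' t)"
    by (rule Suc.IH[OF smooth_bd_Suc_imp[OF Suc.prems(1)] g'(2)])
  moreover have "smooth_bd n J Z (\<lambda>t. 2 ^ n * (B1 t * B2 t)) (\<lambda>t. f' t * g t)"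
    by (rule Suc.IH[OF f'(2) smooth_bd_Suc_imp[OF Suc.prems(2)]])
  ultimately have "smooth_bd n J Z (\<lambda>t. 2 ^ Suc n * (B1 t * B2 t)) (\<lambda>t. f t * g' t + f' t * g t)"
    by (rule_tac smooth_bd_mono[OF smooth_bd_add[of n J Z "\<lambda>t. 2 ^ n * (B1 t * B2 t)"]]) auto
  moreover have "norm (f t * g t) \<le> 2 ^ Suc n * (B1 t * B2 t)" if "t \<in> J" for t
  proof -
    have *: "norm (f t * g t) \<le> 1 * (B1 t * B2 t)"
      using smooth_bd_bound[OF Suc.prems(1) that] smooth_bd_bound[OF Suc.prems(2) that]
      by (auto simp: norm_mult intro!: mult_mono')
    also have "\<dots> \<le> 2 ^ Suc n * (B1 t * B2 t)"
      using order_trans[OF norm_ge_zero *] by (intro mult_right_mono one_le_power) auto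
    finally show ?thesis .
  qed
  moreover have "f t * g t = 0" if "t \<in> Z" for t
    using smooth_bd_zero[OF Suc.prems(2) that] by simp
  ultimately show ?case
    using \<open>\<forall>t\<in>J. ((\<lambda>t. f t * g t) has_vector_derivative f t * g' t + f' t * g t) (at t within J)\<close>
    by auto
qed

lemma smooth_bd_const_mult:
  "smooth_bd n J Z B f \<Longrightarrow> smooth_bd n J Z (\<lambda>t. norm c * B t) (\<lambda>t. c * f t)"
proof (induction n arbitrary: f)
  case 0
  then show ?case by (auto simp: norm_mult intro: mult_left_mono)
next
  case (Suc n)
  obtain f' where f': "\<forall>t\<in>J. (f has_vector_derivative f' t) (at t within J)" "smooth_bd n J Z B f'"
    using Suc.prems by auto
  have "\<forall>t\<in>J. ((\<lambda>t. c * f t) has_vector_derivative c * f' t) (at t within J)"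
    using f' by (auto intro: has_vector_derivative_mult_right)
  then show ?case using Suc.IH[OF f'(2)] Suc.prems by (auto simp: norm_mult intro: mult_left_mono)
qed

lemma smooth_bd_jets:
  assumes "\<And>j t. j < n \<Longrightarrow> t \<in> J \<Longrightarrow> (g j has_vector_derivative g (Suc j) t) (at t within J)"
    and "\<And>j t. j \<le> n \<Longrightarrow> t \<in> J \<Longrightarrow> norm (g j t) \<le> B t"
  shows "smooth_bd n J {} B (g 0)"
  using assms
proof (induction n arbitrary: g)
  case (Suc n)
  have "smooth_bd n J {} B ((\<lambda>j. g (Suc j)) 0)"
    by (rule Suc.IH) (use Suc.prems in auto)
  then show ?case using Suc.prems by (auto intro!: exI[of _ "g (Suc 0)"])
qed auto

text \<open>The j-th derivative gains the factor |\<eta>|^j; the maximum with 1 turns this into one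
  bound for all j up to n.\<close>

lemma smooth_bd_affine:
  assumes "smooth_bd n UNIV Z (\<lambda>_. c) f"
  shows "smooth_bd n J {t. \<eta> * t + s \<in> Z} (\<lambda>_. c * max 1 \<bar>\<eta>\<bar> ^ n) (\<lambda>t. f (\<eta> * t + s))"
  using assms
proof (induction n arbitrary: f)
  case (Suc n)
  have c: "0 \<le> c" using smooth_bd_nonneg[OF Suc.prems, of 0] by simp
  obtain f' where f': "\<And>t. (f has_vector_derivative f' t) (at t)" "smooth_bd n UNIV Z (\<lambda>_. c) f'"
    using Suc.prems by auto
  have d: "((\<lambda>t. f (\<eta> * t + s)) has_vector_derivative of_real \<eta> * f' (\<eta> * t + s)) (at t within J)" for t
  proof -
    have "((\<lambda>t. \<eta> * t + s) has_vector_derivative \<eta>) (at t within J)"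
      by (auto intro!: derivative_eq_intros)
    from vector_diff_chain_within[OF this has_vector_derivative_at_within[OF f'(1)]]
    show ?thesis by (simp add: comp_def scaleR_conv_of_real)
  qed
  have S: "smooth_bd n J {t. \<eta> * t + s \<in> Z} (\<lambda>_. c * max 1 \<bar>\<eta>\<bar> ^ Suc n) (\<lambda>t. of_real \<eta> * f' (\<eta> * t + s))"
  proof (rule smooth_bd_mono[OF smooth_bd_const_mult[OF Suc.IH[OF f'(2)]]])
    have "norm (complex_of_real \<eta>) * (c * max 1 \<bar>\<eta>\<bar> ^ n) \<le> max 1 \<bar>\<eta>\<bar> * (c * max 1 \<bar>\<eta>\<bar> ^ n)"
      using c by (intro mult_right_mono) auto
    then show "norm (complex_of_real \<eta>) * (c * max 1 \<bar>\<eta>\<bar> ^ n) \<le> c * max 1 \<bar>\<eta>\<bar> ^ Suc n"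
      by (simp add: mult_ac)
  qed auto
  have Bd: "norm (f (\<eta> * t + s)) \<le> c * max 1 \<bar>\<eta>\<bar> ^ Suc n" for t
  proof -
    have "norm (f (\<eta> * t + s)) \<le> c * 1" using smooth_bd_bound[OF Suc.prems] by simp
    also have "\<dots> \<le> c * max 1 \<bar>\<eta>\<bar> ^ Suc n" by (intro mult_left_mono one_le_power c) auto
    finally show ?thesis .
  qed
  show ?case by (rule smooth_bd_SucI[OF Bd _ d S]) (use smooth_bd_zero[OF Suc.prems] in auto)
qed auto

text \<open>These tails of the exponential series are closed under differentiation: one derivative
  lowers N by one, and at N = 0 the function is \<open>exp\<close>, its own derivative, in
  accordance with truncated subtraction in \<open>N - 1\<close>.\<close>

definition exp_remainder :: "nat \<Rightarrow> complex \<Rightarrow> complex" where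
  "exp_remainder N z = exp z - (\<Sum>k<N. z ^ k / fact k)"

lemma exp_remainder_has_field_derivative:
  "(exp_remainder N has_field_derivative exp_remainder (N - 1) z) (at z)"
proof (cases N)
  case 0
  then show ?thesis unfolding exp_remainder_def by (auto intro!: derivative_eq_intros)
next
  case (Suc M)
  have "((\<lambda>z::complex. \<Sum>k<Suc M. z ^ k / fact k) has_field_derivative (\<Sum>k<Suc M. of_nat k * z ^ (k - 1) / fact k)) (at z)"
    by (auto intro!: derivative_eq_intros sum.cong)
  also have "(\<Sum>k<Suc M. of_nat k * z ^ (k - 1) / fact k) = (\<Sum>k<M. z ^ k / fact k)"
    by (subst sum.lessThan_Suc_shift) (auto intro!: sum.cong simp del: of_nat_Suc)
  finally show ?thesis unfolding exp_remainder_def[abs_def] Suc diff_Suc_1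
    by (rule DERIV_diff[OF DERIV_exp])
qed

lemma norm_exp_remainder_le: "norm (exp_remainder N z) \<le> norm z ^ N * exp (norm z)"
proof (cases N)
  case 0
  then show ?thesis using complex_Re_le_cmod[of z] by (simp add: exp_remainder_def)
next
  case (Suc M)
  have "norm (exp_remainder N z) \<le> exp \<bar>Re z\<bar> * (norm z ^ Suc M) / fact M"
    using Taylor_exp[of z M] by (simp add: exp_remainder_def Suc lessThan_Suc_atMost)
  also have "\<dots> \<le> exp \<bar>Re z\<bar> * (norm z ^ Suc M) / 1"
    by (intro divide_left_mono) (auto simp: fact_ge_1)
  also have "\<dots> \<le> exp (norm z) * (norm z ^ Suc M)"
    by (simp add: abs_Re_le_cmod mult_right_mono)
  finally show ?thesis by (simp add: Suc mult.commute)
qed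

text \<open>A derivative of the composite is l' times the tail of order N - 1. The order of
  smallness lost by the tail is restored by l', which has the same bound b as l, so all derivatives
  remain of order b^N. At N = 0 there is nothing to restore and the surplus factor b goes into (1 +
  b)^n. The function e collects the exponential growth, whose bound depends on the
  application.\<close>

lemma smooth_bd_exp_remainder:
  assumes "smooth_bd n J {} b l"
    and e: "\<And>N' t. N' \<le> N \<Longrightarrow> t \<in> J \<Longrightarrow> norm (exp_remainder N' (l t)) \<le> b t ^ N' * e t"
  shows "smooth_bd n J {} (\<lambda>t. 2 ^ (n * n) * (b t ^ N * (1 + b t) ^ n * e t)) (\<lambda>t. exp_remainder N (l t))"
  using assms
proof (induction n arbitrary: N)
  case 0
  then show ?case by auto
next
  case (Suc n)
  have b0: "0 \<le> b t" if "t \<in> J" for t using smooth_bd_nonneg[OF Suc.prems(1) that] .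
  have e0: "0 \<le> e t" if "t \<in> J" for t
    using Suc.prems(2)[of 0 t] that norm_ge_zero[of "exp_remainder 0 (l t)"] by (simp del: norm_ge_zero)
  obtain l' where l': "\<forall>t\<in>J. (l has_vector_derivative l' t) (at t within J)" "smooth_bd n J {} b l'"
    using Suc.prems by auto
  have d: "((\<lambda>t. exp_remainder N (l t)) has_vector_derivative l' t * exp_remainder (N - 1) (l t)) (at t within J)"
    if "t \<in> J" for t
    using field_vector_diff_chain_within[OF l'(1)[rule_format, OF that] has_field_derivative_at_within[OF exp_remainder_has_field_derivative]]
    by (simp add: comp_def)
  have "smooth_bd n J {} (\<lambda>t. 2 ^ (n * n) * (b t ^ (N - 1) * (1 + b t) ^ n * e t)) (\<lambda>t. exp_remainder (N - 1) (l t))"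
    by (rule Suc.IH[OF smooth_bd_Suc_imp[OF Suc.prems(1)]]) (use Suc.prems(2) in auto)
  from smooth_bd_mult[OF l'(2) this]
  have S: "smooth_bd n J {} (\<lambda>t. 2 ^ (Suc n * Suc n) * (b t ^ N * (1 + b t) ^ Suc n * e t))
    (\<lambda>t. l' t * exp_remainder (N - 1) (l t))"
  proof (rule smooth_bd_mono)
    fix t assume t: "t \<in> J"
    have 1: "b t * b t ^ (N - 1) * (1 + b t) ^ n \<le> b t ^ N * (1 + b t) ^ Suc n"
    proof (cases N)
      case 0
      have "b t * (1 + b t) ^ n \<le> (1 + b t) * (1 + b t) ^ n"
        using b0[OF t] by (intro mult_right_mono) auto
      then show ?thesis by (simp add: 0)
    next
      case (Suc M)
      have "(1 + b t) ^ n \<le> (1 + b t) ^ Suc n" using b0[OF t] by (intro power_increasing) auto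
      then have "b t ^ N * (1 + b t) ^ n \<le> b t ^ N * (1 + b t) ^ Suc n" using b0[OF t] by (intro mult_left_mono) auto
      then show ?thesis by (simp add: Suc)
    qed
    have "2 ^ n * (b t * (2 ^ (n * n) * (b t ^ (N - 1) * (1 + b t) ^ n * e t)))
      = 2 ^ (n + n * n) * ((b t * b t ^ (N - 1) * (1 + b t) ^ n) * e t)"
      by (simp add: power_add mult_ac)
    also have "\<dots> \<le> 2 ^ (Suc n * Suc n) * ((b t ^ N * (1 + b t) ^ Suc n) * e t)"
      using b0[OF t] e0[OF t] by (intro mult_mono 1 power_increasing) auto
    finally show "2 ^ n * (b t * (2 ^ (n * n) * (b t ^ (N - 1) * (1 + b t) ^ n * e t)))
      \<le> 2 ^ (Suc n * Suc n) * (b t ^ N * (1 + b t) ^ Suc n * e t)" .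
  qed auto
  have Bd: "norm (exp_remainder N (l t)) \<le> 2 ^ (Suc n * Suc n) * (b t ^ N * (1 + b t) ^ Suc n * e t)" if t: "t \<in> J" for t
  proof -
    have "norm (exp_remainder N (l t)) \<le> 1 * (b t ^ N * 1 * e t)" using Suc.prems(2)[of N t] t by simp
    also have "\<dots> \<le> 2 ^ (Suc n * Suc n) * (b t ^ N * (1 + b t) ^ Suc n * e t)"
      using b0[OF t] e0[OF t] by (intro mult_mono order_refl one_le_power) auto
    finally show ?thesis .
  qed
  show ?case by (rule smooth_bd_SucI[OF Bd _ d S]) auto
qed

text \<open>Each of n integrations by parts gains a factor |x|, and the boundary terms vanish
  because f and its derivatives are 0 at both end points.\<close>

lemma fourier_decay:
  fixes x T :: real
  assumes "smooth_bd n {-T..T} Z B f" and Z: "{-T, T} \<subseteq> Z" and T: "0 \<le> T"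
    and "(\<lambda>t. exp (- (\<i> * of_real x) * of_real t) * f t) integrable_on {-T..T}" and B: "B integrable_on {-T..T}"
  shows "\<bar>x\<bar> ^ n * norm (integral {-T..T} (\<lambda>t. exp (- (\<i> * of_real x) * of_real t) * f t)) \<le> integral {-T..T} B"
  using assms(1,4)
proof (induction n arbitrary: f)
  case 0
  have "norm (integral {-T..T} (\<lambda>t. exp (- (\<i> * of_real x) * of_real t) * f t)) \<le> integral {-T..T} B"
    using 0 by (intro integral_norm_bound_integral B) (auto simp: norm_mult)
  then show ?case by simp
next
  case (Suc n)
  let ?E = "\<lambda>t::real. exp (- (\<i> * of_real x) * of_real t)"
  obtain f' where f': "\<forall>t\<in>{-T..T}. (f has_vector_derivative f' t) (at t within {-T..T})" "smooth_bd n {-T..T} Z B f'"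
    using Suc.prems by auto
  have dE: "(?E has_vector_derivative - (\<i> * of_real x) * ?E t) (at t within {-T..T})" for t
    by (rule has_vector_derivative_eq_rhs, rule field_vector_diff_chain_within[where f = complex_of_real and g = "\<lambda>z. exp (- (\<i> * of_real x) * z)", unfolded comp_def])
       (auto intro!: derivative_eq_intros has_vector_derivative_of_real simp: mult_ac)
  have "((\<lambda>t. ?E t * f t) has_vector_derivative ?E t * f' t + (- (\<i> * of_real x) * ?E t) * f t) (at t within {-T..T})" if "t \<in> {-T..T}" for t
    using f'(1) that dE by (intro has_vector_derivative_mult) auto
  then have "((\<lambda>t. ?E t * f' t + (- (\<i> * of_real x) * ?E t) * f t) has_integral ?E T * f T - ?E (-T) * f (-T)) {-T..T}"
    using T by (intro fundamental_theorem_of_calculus) auto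
  then have 1: "((\<lambda>t. ?E t * f' t + (- (\<i> * of_real x) * ?E t) * f t) has_integral 0) {-T..T}"
    using smooth_bd_zero[OF Suc.prems(1)] Z by simp
  have 2: "((\<lambda>t. (\<i> * of_real x) * (?E t * f t)) has_integral (\<i> * of_real x) * integral {-T..T} (\<lambda>t. ?E t * f t)) {-T..T}"
    using Suc.prems(2) by (intro has_integral_mult_right integrable_integral) 
  from has_integral_add[OF 1 2]
  \<comment> \<open>This identity also delivers the integrability demanded by the induction
    hypothesis: the fundamental theorem makes the derivative of the product integrable, and the term
    without f' is integrable by assumption. So nothing has to be known about the integrability of f'
    beforehand.\<close>
  have 3: "((\<lambda>t. ?E t * f' t) has_integral (\<i> * of_real x) * integral {-T..T} (\<lambda>t. ?E t * f t)) {-T..T}"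
    by (rule has_integral_eq_rhs[OF has_integral_eq[rotated]]) (auto simp: algebra_simps)
  have "\<bar>x\<bar> ^ n * norm (integral {-T..T} (\<lambda>t. ?E t * f' t)) \<le> integral {-T..T} B"
    by (rule Suc.IH[OF f'(2)]) (use 3 in blast)
  then show ?case using integral_unique[OF 3] by (simp add: norm_mult mult_ac)
qed

section \<open>A smoothing smoothing_kernel with compactly supported transform\<close>

lemma max0_power_has_real_derivative:
  fixes s :: real
  assumes "k \<ge> 2"
  shows "((\<lambda>s. max 0 s ^ k) has_real_derivative of_nat k * max 0 s ^ (k - 1)) (at s)"
proof (cases s "0::real" rule: linorder_cases)
  case less
  have "((\<lambda>s::real. 0) has_real_derivative 0) (at s)" by simp
  then have "((\<lambda>s. max 0 s ^ k) has_real_derivative 0) (at s)"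
    by (rule has_field_derivative_transform_within_open[where S = "{..<0}"]) (use less assms in auto)
  then show ?thesis using less assms by (simp add: power_0_left)
next
  case greater
  have "((\<lambda>s. s ^ k) has_real_derivative of_nat k * s ^ (k - 1)) (at s)"
    by (auto intro!: derivative_eq_intros)
  then have "((\<lambda>s. max 0 s ^ k) has_real_derivative of_nat k * s ^ (k - 1)) (at s)"
    by (rule has_field_derivative_transform_within_open[where S = "{0<..}"]) (use greater in auto)
  then show ?thesis using greater by simp
next
  case equal
  have "((\<lambda>h::real. max 0 h ^ k / h) \<longlongrightarrow> 0) (at 0)"
  proof (rule Lim_null_comparison)
    have "norm (max 0 h ^ k / h) \<le> \<bar>h\<bar> ^ (k - 1)" for h :: real
    proof (cases "h > 0")
      case True
      moreover have "h ^ k = h * h ^ (k - 1)" using assms by (simp add: power_eq_if)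
      ultimately show ?thesis by simp
    next
      case False
      then show ?thesis using assms by (simp add: power_0_left)
    qed
    then show "\<forall>\<^sub>F h in at 0. norm (max 0 h ^ k / h) \<le> \<bar>h\<bar> ^ (k - 1)" for h :: real
      by simp
    show "((\<lambda>h::real. \<bar>h\<bar> ^ (k - 1)) \<longlongrightarrow> 0) (at 0)"
      using assms by (auto intro!: tendsto_eq_intros)
  qed
  then show ?thesis using equal assms by (simp add: has_field_derivative_iff power_0_left)
qed

text \<open>The polynomial prefactor makes the induction close: differentiating a polynomial times a
  power of the positive part of 1 - t^2 gives another polynomial times the next lower power.\<close>

lemma smooth_bd_poly_bump:
  fixes P :: "real poly"
  shows "\<exists>C. smooth_bd n UNIV {t. 1 \<le> \<bar>t\<bar>} (\<lambda>_. C) (\<lambda>t. of_real (poly P t * max 0 (1 - t\<^sup>2) ^ (n + 1)))"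
proof (induction n arbitrary: P)
  case (0 P)
  let ?n = 0
  have "compact ((\<lambda>t. poly P t * max 0 (1 - t\<^sup>2) ^ (?n + 1)) ` {-1..1})"
    by (intro compact_continuous_image continuous_intros) auto
  from compact_imp_bounded[OF this]
  obtain C where C: "\<And>t. t \<in> {-1..1} \<Longrightarrow> norm (poly P t * max 0 (1 - t\<^sup>2) ^ (?n + 1)) \<le> C"
    unfolding bounded_iff by blast
  have z: "max 0 (1 - t\<^sup>2) = 0" if "1 \<le> \<bar>t\<bar>" for t :: real
    using that power_mono[of 1 "\<bar>t\<bar>" 2] by simp
  have "norm (poly P t * max 0 (1 - t\<^sup>2) ^ (?n + 1)) \<le> max C 0" for t
  proof (cases "\<bar>t\<bar> \<le> 1")
    case True
    then have "t \<in> {-1..1}" by (auto simp: abs_le_iff)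
    from C[OF this] show ?thesis by (rule max.coboundedI1)
  next
    case False
    then show ?thesis by (subst z) simp_all
  qed
  then have "norm (complex_of_real (poly P t * max 0 (1 - t\<^sup>2) ^ (?n + 1))) \<le> max C 0" for t
    unfolding norm_of_real real_norm_def .
  moreover have "complex_of_real (poly P t * max 0 (1 - t\<^sup>2) ^ (?n + 1)) = 0" if "1 \<le> \<bar>t\<bar>" for t
    using z[OF that] by simp
  ultimately show ?case unfolding smooth_bd.simps(1) by blast
next
  case (Suc n P)
  have "compact ((\<lambda>t. poly P t * max 0 (1 - t\<^sup>2) ^ (Suc n + 1)) ` {-1..1})"
    by (intro compact_continuous_image continuous_intros) auto
  from compact_imp_bounded[OF this]
  obtain C where C: "\<And>t. t \<in> {-1..1} \<Longrightarrow> norm (poly P t * max 0 (1 - t\<^sup>2) ^ (Suc n + 1)) \<le> C"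
    unfolding bounded_iff by blast
  have z: "max 0 (1 - t\<^sup>2) = 0" if "1 \<le> \<bar>t\<bar>" for t :: real
    using that power_mono[of 1 "\<bar>t\<bar>" 2] by simp
  have b: "norm (poly P t * max 0 (1 - t\<^sup>2) ^ (Suc n + 1)) \<le> max C 0" for t
  proof (cases "\<bar>t\<bar> \<le> 1")
    case True
    then have "t \<in> {-1..1}" by (auto simp: abs_le_iff)
    from C[OF this] show ?thesis by (rule max.coboundedI1)
  next
    case False
    then show ?thesis by (subst z) simp_all
  qed
  \<comment> \<open>The derivative after one factor less of the positive part has been extracted: P'
    (1 - t^2) - 2 (n + 2) t P.\<close>
  define Q where "Q = pderiv P * [:1, 0, -1:] + smult (- 2 * real (n + 2)) (P * [:0, 1:])"
  obtain C' where C': "smooth_bd n UNIV {t. 1 \<le> \<bar>t\<bar>} (\<lambda>_. C') (\<lambda>t. of_real (poly Q t * max 0 (1 - t\<^sup>2) ^ (n + 1)))"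
    using Suc.IH by blast
  have d: "((\<lambda>t. of_real (poly P t * max 0 (1 - t\<^sup>2) ^ (Suc n + 1)) :: complex) has_vector_derivative of_real (poly Q t * max 0 (1 - t\<^sup>2) ^ (n + 1))) (at t)" for t :: real
  proof -
    have "((\<lambda>t. 1 - t\<^sup>2) has_real_derivative - 2 * t) (at t)"
      by (auto intro!: derivative_eq_intros)
    from DERIV_chain[OF max0_power_has_real_derivative this, of "n + 2"]
    have "((\<lambda>t. max 0 (1 - t\<^sup>2) ^ (n + 2)) has_real_derivative real (n + 2) * max 0 (1 - t\<^sup>2) ^ (n + 1) * (- 2 * t)) (at t)"
      by (simp add: comp_def)
    from DERIV_mult[OF poly_DERIV[of P t] this]
    have 1: "((\<lambda>t. poly P t * max 0 (1 - t\<^sup>2) ^ (n + 2)) has_real_derivative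
       poly (pderiv P) t * max 0 (1 - t\<^sup>2) ^ (n + 2) + real (n + 2) * max 0 (1 - t\<^sup>2) ^ (n + 1) * (- 2 * t) * poly P t) (at t)" .
    have "max 0 (1 - t\<^sup>2) ^ (n + 2) = (1 - t\<^sup>2) * max 0 (1 - t\<^sup>2) ^ (n + 1)"
      by (auto simp: max_def)
    then have "poly (pderiv P) t * max 0 (1 - t\<^sup>2) ^ (n + 2) + real (n + 2) * max 0 (1 - t\<^sup>2) ^ (n + 1) * (- 2 * t) * poly P t
      = poly Q t * max 0 (1 - t\<^sup>2) ^ (n + 1)"
      by (simp only: Q_def) (simp add: algebra_simps power2_eq_square)
    with 1 have "((\<lambda>t. poly P t * max 0 (1 - t\<^sup>2) ^ (n + 2)) has_real_derivative poly Q t * max 0 (1 - t\<^sup>2) ^ (n + 1)) (at t)"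
      by simp
    then show ?thesis
      by (intro has_vector_derivative_of_real) (simp add: has_real_derivative_iff_has_vector_derivative)
  qed
  have "smooth_bd (Suc n) UNIV {t. 1 \<le> \<bar>t\<bar>} (\<lambda>_. max (max C 0) C') (\<lambda>t. of_real (poly P t * max 0 (1 - t\<^sup>2) ^ (Suc n + 1)))"
  proof (rule smooth_bd_SucI[OF _ _ d])
    show "smooth_bd n UNIV {t. 1 \<le> \<bar>t\<bar>} (\<lambda>_. max (max C 0) C') (\<lambda>t. of_real (poly Q t * max 0 (1 - t\<^sup>2) ^ (n + 1)))"
      by (rule smooth_bd_mono[OF C']) auto
    show "norm (complex_of_real (poly P t * max 0 (1 - t\<^sup>2) ^ (Suc n + 1))) \<le> max (max C 0) C'" for t
      unfolding norm_of_real by (rule order_trans[OF b[unfolded real_norm_def] max.cobounded1])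
    show "complex_of_real (poly P t * max 0 (1 - t\<^sup>2) ^ (Suc n + 1)) = 0" if "t \<in> {t. 1 \<le> \<bar>t\<bar>}" for t
      using z[of t] that by simp
  qed
  then show ?case by blast
qed

text \<open>Finite smoothness suffices, so a polynomial profile replaces the usual infinitely
  differentiable bump. With exponent n + 1 even the n-th derivative retains a factor 1 - t^2 and
  vanishes at the end points -1 and 1.\<close>

definition bump :: "nat \<Rightarrow> real \<Rightarrow> real" where
  "bump n t = max 0 (1 - t\<^sup>2) ^ (n + 1)"

lemma bump_nonneg [simp]: "0 \<le> bump n t"
  by (simp add: bump_def)

lemma bump_le_1: "bump n t \<le> 1"
  unfolding bump_def by (intro power_le_one) auto

lemma bump_eq_0: "1 \<le> \<bar>t\<bar> \<Longrightarrow> bump n t = 0"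
  using power_mono[of 1 "\<bar>t\<bar>" 2] by (simp add: bump_def)

lemma bump_measurable [measurable]: "bump n \<in> borel_measurable borel"
  unfolding bump_def[abs_def] by measurable

lemma smooth_bd_bump: "\<exists>C. smooth_bd n UNIV {t. 1 \<le> \<bar>t\<bar>} (\<lambda>_. C) (\<lambda>t. of_real (bump n t))"
  using smooth_bd_poly_bump[of n 1] by (simp add: bump_def)

lemma bump_le_indicator: "bump n t \<le> indicator {-1..1} t"
  using bump_le_1[of n t] bump_eq_0[of t n] by (cases "\<bar>t\<bar> \<le> 1") (auto simp: abs_le_iff split: split_indicator)

lemma integrable_bump_affine:
  assumes "\<eta> \<noteq> 0"
  shows "integrable lborel (\<lambda>t. bump n (r + \<eta> * t))"
proof -
  have "integrable lborel (bump n)"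
    by (rule Bochner_Integration.integrable_bound[of _ "indicator {-1..1::real}"])
       (use bump_le_indicator in auto)
  then show ?thesis using lborel_integrable_real_affine_iff[OF assms, of "bump n" r] by simp
qed

lemma integrable_bump: "integrable lborel (bump n)"
  using integrable_bump_affine[of 1 n 0] by simp

lemma integral_bump_affine:
  assumes "\<eta> > 0"
  shows "(\<integral>t. bump n (r + \<eta> * t) \<partial>lborel) \<le> 2 / \<eta>"
proof -
  have "(\<integral>t. bump n t \<partial>lborel) \<le> (\<integral>t. indicator {-1..1::real} t \<partial>lborel)"
    by (intro integral_mono integrable_bump bump_le_indicator) simp
  then have "(\<integral>t. bump n t \<partial>lborel) \<le> 2" by simp
  moreover have "(\<integral>t. bump n t \<partial>lborel) = \<eta> * (\<integral>t. bump n (r + \<eta> * t) \<partial>lborel)"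
    using lborel_integral_real_affine[of \<eta> "bump n" r] assms by simp
  ultimately show ?thesis using assms by (simp add: field_simps)
qed

section \<open>The transform of the bump and the kernel made from it\<close>

lemma lborel_integral_eq_integral:
  fixes F :: "real \<Rightarrow> complex"
  assumes "integrable lborel F" "\<And>t. t \<notin> A \<Longrightarrow> F t = 0"
  shows "F integrable_on A" "integral\<^sup>L lborel F = integral A F"
proof -
  have "(F has_integral integral\<^sup>L lborel F) UNIV"
    by (rule has_integral_integral_lborel[OF assms(1)])
  moreover have "F = (\<lambda>t. if t \<in> A then F t else 0)" using assms(2) by auto
  ultimately have "(F has_integral integral\<^sup>L lborel F) A" by (metis has_integral_restrict_UNIV)
  then show "F integrable_on A" "integral\<^sup>L lborel F = integral A F"
    by (auto simp: integral_unique)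
qed

lemma integrable_bounded_mult:
  fixes f g :: "_ \<Rightarrow> complex"
  assumes "integrable M f" "g \<in> borel_measurable M" "\<And>x. norm (g x) \<le> C"
  shows "integrable M (\<lambda>x. g x * f x)"
proof (rule Bochner_Integration.integrable_bound[of _ "\<lambda>x. C * norm (f x)"])
  show "integrable M (\<lambda>x. C * norm (f x))" using assms(1) by (intro integrable_mult_right integrable_norm)
  show "AE x in M. norm (g x * f x) \<le> norm (C * norm (f x))"
  proof (rule AE_I2)
    fix x
    have "norm (g x) * norm (f x) \<le> \<bar>C\<bar> * norm (f x)" using assms(3)[of x] by (intro mult_right_mono) auto
    then show "norm (g x * f x) \<le> norm (C * norm (f x))" by (simp add: norm_mult abs_mult)
  qed
qed (use assms in simp)

definition bump_ft :: "nat \<Rightarrow> real \<Rightarrow> complex" where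
  "bump_ft n x = (\<integral>t. exp (- (\<i> * of_real x) * of_real t) * of_real (bump n t) \<partial>lborel)"

lemma norm_exp_minus_ii [simp]: "norm (exp (- (\<i> * of_real x) * of_real t)) = 1"
  by simp

lemma integrable_exp_bump:
  assumes "\<eta> \<noteq> 0"
  shows "integrable lborel (\<lambda>t. exp (- (\<i> * of_real x) * of_real t) * of_real (bump n (r + \<eta> * t)))"
  by (rule integrable_bounded_mult[where C = 1]) (auto intro!: integrable_bump_affine assms)

lemma bump_ft_measurable [measurable]: "bump_ft n \<in> borel_measurable borel"
  unfolding bump_ft_def[abs_def] by measurable

lemma bump_ft_decay: "\<exists>C. \<forall>x. (1 + \<bar>x\<bar>) ^ n * norm (bump_ft n x) \<le> C"
proof -
  obtain C where C: "smooth_bd n UNIV {t. 1 \<le> \<bar>t\<bar>} (\<lambda>_. C) (\<lambda>t. of_real (bump n t))"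
    using smooth_bd_bump by blast
  have "smooth_bd n {-1..1} {t. 1 * t + 0 \<in> {t. 1 \<le> \<bar>t\<bar>}} (\<lambda>_. C * max 1 \<bar>1\<bar> ^ n) (\<lambda>t. of_real (bump n (1 * t + 0)))"
    by (rule smooth_bd_affine[OF C])
  then have C1: "smooth_bd n {-1..1} {t. 1 \<le> \<bar>t\<bar>} (\<lambda>_. C) (\<lambda>t. of_real (bump n t))" by simp
  have eq: "bump_ft n x = integral {-1..1} (\<lambda>t. exp (- (\<i> * of_real x) * of_real t) * of_real (bump n t))"
    "(\<lambda>t. exp (- (\<i> * of_real x) * of_real t) * of_real (bump n t)) integrable_on {-1..1}" for x
    unfolding bump_ft_def using integrable_exp_bump[of 1 x n 0]
    by (auto intro!: lborel_integral_eq_integral bump_eq_0)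
  have 1: "\<bar>x\<bar> ^ n * norm (bump_ft n x) \<le> 2 * C" for x
    unfolding eq(1) using fourier_decay[OF C1 _ _ eq(2) integrable_const_ivl, of x] by simp
  have 2: "norm (bump_ft n x) \<le> 2" for x
  proof -
    have "norm (bump_ft n x) \<le> (\<integral>t. norm (exp (- (\<i> * of_real x) * of_real t) * of_real (bump n t)) \<partial>lborel)"
      unfolding bump_ft_def by (rule integral_norm_bound)
    also have "\<dots> = (\<integral>t. bump n (0 + 1 * t) \<partial>lborel)" by (simp only: norm_mult norm_exp_minus_ii norm_of_real) simp
    also have "\<dots> \<le> 2" using integral_bump_affine[of 1 n 0] by simp
    finally show ?thesis .
  qed
  have "(1 + \<bar>x\<bar>) ^ n * norm (bump_ft n x) \<le> 2 ^ n * (2 + 2 * C)" for x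
  proof -
    have "(1 + \<bar>x\<bar>) ^ n \<le> (2 * max 1 \<bar>x\<bar>) ^ n" by (intro power_mono) auto
    also have "\<dots> = 2 ^ n * max 1 \<bar>x\<bar> ^ n" by (rule power_mult_distrib)
    also have "\<dots> \<le> 2 ^ n * (1 + \<bar>x\<bar> ^ n)" by (intro mult_left_mono) (auto simp: max_def)
    finally have "(1 + \<bar>x\<bar>) ^ n * norm (bump_ft n x) \<le> 2 ^ n * (1 + \<bar>x\<bar> ^ n) * norm (bump_ft n x)"
      by (intro mult_right_mono) auto
    also have "\<dots> = 2 ^ n * (norm (bump_ft n x) + \<bar>x\<bar> ^ n * norm (bump_ft n x))" by (simp add: algebra_simps)
    also have "\<dots> \<le> 2 ^ n * (2 + 2 * C)" using 1 2 by (intro mult_left_mono add_mono) auto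
    finally show ?thesis .
  qed
  then show ?thesis by blast
qed

lemma integrable_rational_tail: "integrable lborel (\<lambda>x::real. 1 / (1 + \<bar>x\<bar>)\<^sup>2)"
proof (rule Bochner_Integration.integrable_bound[of _ "\<lambda>x::real. inverse (1 + x\<^sup>2)"])
  show "integrable lborel (\<lambda>x::real. inverse (1 + x\<^sup>2))"
    using integrable_inverse_1_plus_square by (simp add: set_integrable_def einterval_def)
  have "(1 + \<bar>x\<bar>)\<^sup>2 \<ge> 1 + x\<^sup>2" for x :: real by (simp add: power2_sum)
  moreover have "1 + x\<^sup>2 > 0" for x :: real by (simp add: add_pos_nonneg)
  ultimately have "1 / (1 + \<bar>x\<bar>)\<^sup>2 \<le> 1 / (1 + x\<^sup>2)" for x :: real
    by (intro divide_left_mono) (auto intro!: mult_pos_pos zero_less_power add_pos_nonneg)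
  then show "AE x::real in lborel. norm (1 / (1 + \<bar>x\<bar>)\<^sup>2) \<le> norm (inverse (1 + x\<^sup>2))"
    by (intro AE_I2) (simp add: inverse_eq_divide)
qed simp

text \<open>Decay with two more powers than the weight leaves the integrable tail of
  \<open>integrable_rational_tail\<close>.\<close>

lemma weighted_decay_bound:
  fixes x y C :: real
  assumes "(1 + \<bar>x\<bar>) ^ k * y \<le> C" "p + 2 \<le> k" "0 \<le> y"
  shows "(1 + \<bar>x\<bar>) ^ p * y \<le> C * (1 / (1 + \<bar>x\<bar>)\<^sup>2)"
proof -
  have "(1 + \<bar>x\<bar>) ^ (p + 2) * y \<le> (1 + \<bar>x\<bar>) ^ k * y"
    using assms by (intro mult_right_mono power_increasing) auto
  then have "((1 + \<bar>x\<bar>) ^ p * y) * (1 + \<bar>x\<bar>)\<^sup>2 \<le> C" using assms(1) by (simp add: power_add power2_eq_square mult_ac)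
  moreover have "(1 + \<bar>x\<bar>)\<^sup>2 > 0" by (intro zero_less_power) (simp add: add_pos_nonneg)
  ultimately show ?thesis by (simp add: pos_le_divide_eq)
qed

definition smoothing_kernel_mass :: "nat \<Rightarrow> real" where
  "smoothing_kernel_mass n = (\<integral>x. (norm (bump_ft n x))\<^sup>2 \<partial>lborel)"

text \<open>The squared modulus is what makes the noise density nonnegative. On the transform side
  it means the autocorrelation of the bump, which is again compactly supported, now in [-2, 2]; and
  squaring doubles the decay, so n derivatives of the bump control moments of order up to 2 n -
  2.\<close>

definition smoothing_kernel :: "nat \<Rightarrow> real \<Rightarrow> real" where
  "smoothing_kernel n x = (norm (bump_ft n x))\<^sup>2 / smoothing_kernel_mass n"

lemma smoothing_kernel_measurable [measurable]: "smoothing_kernel n \<in> borel_measurable borel"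
  unfolding smoothing_kernel_def[abs_def] by measurable

lemma integrable_bump_ft_moment:
  assumes "p + 2 \<le> 2 * n"
  shows "integrable lborel (\<lambda>x. (1 + \<bar>x\<bar>) ^ p * (norm (bump_ft n x))\<^sup>2)"
proof -
  obtain C where C: "\<And>x. (1 + \<bar>x\<bar>) ^ n * norm (bump_ft n x) \<le> C" using bump_ft_decay by blast
  have C2: "(1 + \<bar>x\<bar>) ^ (2 * n) * (norm (bump_ft n x))\<^sup>2 \<le> C\<^sup>2" for x
  proof -
    have "((1 + \<bar>x\<bar>) ^ n * norm (bump_ft n x))\<^sup>2 \<le> C\<^sup>2" using C by (intro power_mono) auto
    then show ?thesis by (simp add: power_mult_distrib power_even_eq)
  qed
  have "integrable lborel (\<lambda>x::real. C\<^sup>2 * (1 / (1 + \<bar>x\<bar>)\<^sup>2))"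
    by (intro integrable_mult_right integrable_rational_tail)
  then show ?thesis
  proof (rule Bochner_Integration.integrable_bound)
    show "AE x in lborel. norm ((1 + \<bar>x\<bar>) ^ p * (norm (bump_ft n x))\<^sup>2) \<le> norm (C\<^sup>2 * (1 / (1 + \<bar>x\<bar>)\<^sup>2))"
      using weighted_decay_bound[OF C2 assms] by (intro AE_I2) (simp add: abs_mult)
  qed simp
qed

lemma bump_integral_pos: "0 < (\<integral>t. bump n t \<partial>lborel)"
proof -
  have "(\<integral>t. (3/4) ^ (n + 1) * indicator {-1/2..1/2::real} t \<partial>lborel) \<le> (\<integral>t. bump n t \<partial>lborel)"
  proof (intro integral_mono integrable_bump integrable_mult_right)
    fix t :: real
    show "(3/4) ^ (n + 1) * indicator {-1/2..1/2} t \<le> bump n t"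
    proof (cases "t \<in> {-1/2..1/2}")
      case True
      then have "\<bar>t\<bar> \<le> 1/2" by (auto simp: abs_le_iff)
      then have "t\<^sup>2 \<le> (1/2)\<^sup>2" by (metis abs_ge_zero power2_abs power_mono)
      then have "3/4 \<le> 1 - t\<^sup>2" by (simp add: power_divide)
      then have "3/4 \<le> max 0 (1 - t\<^sup>2)" by (rule max.coboundedI2)
      then have "(3/4) ^ (n + 1) \<le> max 0 (1 - t\<^sup>2) ^ (n + 1)" by (rule power_mono) simp
      then show ?thesis using True by (simp add: bump_def)
    qed auto
  qed simp
  moreover have "(\<integral>t. (3/4) ^ (n + 1) * indicator {-1/2..1/2::real} t \<partial>lborel) = (3/4::real) ^ (n + 1)"
    by simp
  ultimately show ?thesis using zero_less_power[of "3/4::real" "n + 1"] by linarith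
qed

text \<open>For |x| and |t| at most 1 the factor cos(x t) is at least cos 1 > 0, so the transform is
  bounded below near 0 by a multiple of the integral of the bump. This gives positivity without
  Plancherel's theorem.\<close>

lemma smoothing_kernel_mass_pos:
  assumes "1 \<le> n"
  shows "0 < smoothing_kernel_mass n"
proof -
  define b where "b = (\<integral>t. bump n t \<partial>lborel)"
  have b: "b > 0" unfolding b_def by (rule bump_integral_pos)
  have low: "cos 1 * b \<le> norm (bump_ft n x)" if "\<bar>x\<bar> \<le> 1" for x
  proof -
    have i: "integrable lborel (\<lambda>t. exp (- (\<i> * of_real x) * of_real t) * of_real (bump n t))"
      using integrable_exp_bump[of 1 x n 0] by simp
    have "cos 1 * b = (\<integral>t. cos 1 * bump n t \<partial>lborel)" by (simp add: b_def)
    also have "\<dots> \<le> (\<integral>t. Re (exp (- (\<i> * of_real x) * of_real t) * of_real (bump n t)) \<partial>lborel)"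
    proof (intro integral_mono integrable_mult_right integrable_bump integrable_Re i)
      fix t
      show "cos 1 * bump n t \<le> Re (exp (- (\<i> * of_real x) * of_real t) * of_real (bump n t))"
      proof (cases "\<bar>t\<bar> \<le> 1")
        case True
        have "\<bar>x * t\<bar> \<le> 1 * 1" unfolding abs_mult using that True by (intro mult_mono) auto
        then have "cos 1 \<le> cos \<bar>x * t\<bar>" using pi_gt3 by (intro cos_monotone_0_pi_le) auto
        then have "cos 1 \<le> cos (x * t)" by simp
        then have "cos 1 * bump n t \<le> cos (x * t) * bump n t" by (intro mult_right_mono) auto
        then show ?thesis by (simp add: Re_exp)
      next
        case False
        then show ?thesis by (simp add: bump_eq_0)
      qed
    qed
    also have "\<dots> = Re (bump_ft n x)" unfolding bump_ft_def by (rule integral_Re[OF i])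
    also have "\<dots> \<le> norm (bump_ft n x)" by (rule complex_Re_le_cmod)
    finally show ?thesis .
  qed
  have c1: "cos 1 > (0::real)" using pi_gt3 by (intro cos_gt_zero) auto
  have "(\<integral>x. (cos 1 * b)\<^sup>2 * indicator {-1..1::real} x \<partial>lborel) \<le> smoothing_kernel_mass n"
    unfolding smoothing_kernel_mass_def
  proof (intro integral_mono integrable_mult_right)
    show "integrable lborel (\<lambda>x. (norm (bump_ft n x))\<^sup>2)"
      using integrable_bump_ft_moment[of 0 n] assms by simp
    fix x
    show "(cos 1 * b)\<^sup>2 * indicator {-1..1} x \<le> (norm (bump_ft n x))\<^sup>2"
      using low[of x] b c1 by (auto simp: abs_le_iff intro!: power_mono split: split_indicator)
  qed simp
  moreover have "(\<integral>x. (cos 1 * b)\<^sup>2 * indicator {-1..1::real} x \<partial>lborel) = (cos 1 * b)\<^sup>2 * 2" by simp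
  moreover have "0 < (cos 1 * b)\<^sup>2 * 2" using b c1 by simp
  ultimately show ?thesis by linarith
qed

lemma smoothing_kernel_bounded: "\<exists>C. \<forall>x. norm (smoothing_kernel n x) \<le> C"
proof -
  obtain C where C: "\<And>x. (1 + \<bar>x\<bar>) ^ n * norm (bump_ft n x) \<le> C" using bump_ft_decay by blast
  have "norm (bump_ft n x) \<le> C" for x
  proof -
    have "1 * norm (bump_ft n x) \<le> (1 + \<bar>x\<bar>) ^ n * norm (bump_ft n x)"
      by (intro mult_right_mono one_le_power) auto
    then show ?thesis using C[of x] by simp
  qed
  then have "(norm (bump_ft n x))\<^sup>2 \<le> C\<^sup>2" for x by (intro power_mono) auto
  then have "norm (smoothing_kernel n x) \<le> C\<^sup>2 / \<bar>smoothing_kernel_mass n\<bar>" for x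
    unfolding smoothing_kernel_def by (simp add: abs_divide divide_right_mono)
  then show ?thesis by blast
qed

lemma smoothing_kernel_nonneg [simp]: "0 \<le> smoothing_kernel n x"
  by (simp add: smoothing_kernel_def smoothing_kernel_mass_def integral_nonneg_AE)

lemma integrable_kernel_moment:
  "p + 2 \<le> 2 * n \<Longrightarrow> integrable lborel (\<lambda>x. (1 + \<bar>x\<bar>) ^ p * smoothing_kernel n x)"
  using integrable_divide[OF integrable_bump_ft_moment[of p n], of "smoothing_kernel_mass n"]
  by (simp add: smoothing_kernel_def)

lemma smoothing_kernel_integral:
  assumes "1 \<le> n" "\<eta> > 0"
  shows "integrable lborel (\<lambda>x. smoothing_kernel n (x / \<eta>) / \<eta>)" "(\<integral>x. smoothing_kernel n (x / \<eta>) / \<eta> \<partial>lborel) = 1"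
proof -
  have i: "integrable lborel (smoothing_kernel n)" using integrable_kernel_moment[of 0 n] assms by simp
  have 1: "(\<integral>x. smoothing_kernel n x \<partial>lborel) = 1"
    using smoothing_kernel_mass_pos[OF assms(1)] by (simp add: smoothing_kernel_def smoothing_kernel_mass_def[symmetric])
  show "integrable lborel (\<lambda>x. smoothing_kernel n (x / \<eta>) / \<eta>)"
    using lborel_integrable_real_affine[OF i, of "1 / \<eta>" 0] assms by (intro integrable_divide) simp
  show "(\<integral>x. smoothing_kernel n (x / \<eta>) / \<eta> \<partial>lborel) = 1"
    using lborel_integral_real_affine[of "1 / \<eta>" "smoothing_kernel n" 0] assms 1 by simp
qed

lemma smoothing_kernel_moment_scaled:
  assumes "p + 2 \<le> 2 * n" "\<eta> > 0" "\<eta> \<le> H"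
  shows "integrable lborel (\<lambda>x. (1 + \<bar>x\<bar>) ^ p * (smoothing_kernel n (x / \<eta>) / \<eta>))"
    "(\<integral>x. (1 + \<bar>x\<bar>) ^ p * (smoothing_kernel n (x / \<eta>) / \<eta>) \<partial>lborel) \<le> (1 + H) ^ p * (\<integral>x. (1 + \<bar>x\<bar>) ^ p * smoothing_kernel n x \<partial>lborel)"
proof -
  have i: "integrable lborel (\<lambda>x. (1 + H) ^ p * ((1 + \<bar>x\<bar>) ^ p * smoothing_kernel n x))"
    using assms(1) by (intro integrable_mult_right integrable_kernel_moment)
  have le: "(1 + \<bar>\<eta> * x\<bar>) ^ p * smoothing_kernel n x \<le> (1 + H) ^ p * ((1 + \<bar>x\<bar>) ^ p * smoothing_kernel n x)" for x
  proof -
    have "\<eta> * \<bar>x\<bar> \<le> H * \<bar>x\<bar>" using assms by (intro mult_right_mono) auto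
    then have "1 + \<bar>\<eta> * x\<bar> \<le> (1 + H) * (1 + \<bar>x\<bar>)" using assms by (simp add: abs_mult distrib_left distrib_right)
    then have "(1 + \<bar>\<eta> * x\<bar>) ^ p \<le> ((1 + H) * (1 + \<bar>x\<bar>)) ^ p" by (intro power_mono) auto
    then show ?thesis by (simp add: power_mult_distrib mult.assoc[symmetric] mult_right_mono)
  qed
  have i2: "integrable lborel (\<lambda>x. (1 + \<bar>\<eta> * x\<bar>) ^ p * smoothing_kernel n x)"
    by (rule Bochner_Integration.integrable_bound[OF i]) (use le assms in \<open>auto simp: abs_mult\<close>)
  have "integrable lborel (\<lambda>x. (1 + \<bar>x\<bar>) ^ p * smoothing_kernel n (x / \<eta>))"
    using lborel_integrable_real_affine[OF i2, of "1 / \<eta>" 0] assms by simp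
  from integrable_divide[OF this, of \<eta>]
  show "integrable lborel (\<lambda>x. (1 + \<bar>x\<bar>) ^ p * (smoothing_kernel n (x / \<eta>) / \<eta>))" by simp
  have "(\<integral>x. (1 + \<bar>x\<bar>) ^ p * (smoothing_kernel n (x / \<eta>) / \<eta>) \<partial>lborel) = (\<integral>x. (1 + \<bar>\<eta> * x\<bar>) ^ p * smoothing_kernel n x \<partial>lborel)"
    using lborel_integral_real_affine[of \<eta> "\<lambda>x. (1 + \<bar>x\<bar>) ^ p * (smoothing_kernel n (x / \<eta>) / \<eta>)" 0] assms by simp
  also have "\<dots> \<le> (\<integral>x. (1 + H) ^ p * ((1 + \<bar>x\<bar>) ^ p * smoothing_kernel n x) \<partial>lborel)"
    by (intro integral_mono i i2 le)
  finally show "(\<integral>x. (1 + \<bar>x\<bar>) ^ p * (smoothing_kernel n (x / \<eta>) / \<eta>) \<partial>lborel) \<le> (1 + H) ^ p * (\<integral>x. (1 + \<bar>x\<bar>) ^ p * smoothing_kernel n x \<partial>lborel)"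
    by simp
qed

lemma integrable_pair_mult:
  fixes f :: "'a \<Rightarrow> real" and g :: "'b \<Rightarrow> real"
  assumes "sigma_finite_measure M" "sigma_finite_measure N" and f: "integrable M f" and g: "integrable N g"
  shows "integrable (M \<Otimes>\<^sub>M N) (\<lambda>z. f (fst z) * g (snd z))"
proof -
  interpret M: sigma_finite_measure M by fact
  interpret N: sigma_finite_measure N by fact
  interpret pair_sigma_finite M N ..
  have [measurable]: "f \<in> borel_measurable M" "g \<in> borel_measurable N" using f g by auto
  show ?thesis
    by (rule Fubini_integrable) (use f g in \<open>auto simp: abs_mult intro!: integrable_mult_left integrable_abs integrable_mult_right\<close>)
qed

text \<open>The squared modulus is the transform times its conjugate. Substituting r + \<eta> t for
  the variable of one factor splits off a phase in r, and that phase is exactly the one in the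
  conjugate factor. The mass stands on both sides, as a quotient on the right, so that the identity
  reads 0 = 0 when it is 0.\<close>

lemma smoothing_kernel_eq_iterated:
  assumes "\<eta> > 0"
  shows "complex_of_real (smoothing_kernel_mass n * (smoothing_kernel n (z / \<eta>) / \<eta>)) =
    smoothing_kernel_mass n / smoothing_kernel_mass n * (\<integral>r. of_real (bump n r) * (\<integral>t. exp (- (\<i> * of_real z) * of_real t) * of_real (bump n (r + \<eta> * t)) \<partial>lborel) \<partial>lborel)"
proof -
  have inner: "(\<integral>t. exp (- (\<i> * of_real z) * of_real t) * of_real (bump n (r + \<eta> * t)) \<partial>lborel)
    = exp (\<i> * of_real (z / \<eta> * r)) * bump_ft n (z / \<eta>) / \<eta>" for r
  proof -
    have "bump_ft n (z / \<eta>) = \<eta> *\<^sub>R (\<integral>t. exp (- (\<i> * of_real (z / \<eta>)) * of_real (r + \<eta> * t)) * of_real (bump n (r + \<eta> * t)) \<partial>lborel)"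
      unfolding bump_ft_def using assms by (subst lborel_integral_real_affine[of \<eta> _ r]) auto
    also have "(\<lambda>t. exp (- (\<i> * of_real (z / \<eta>)) * of_real (r + \<eta> * t)) * of_real (bump n (r + \<eta> * t)))
      = (\<lambda>t. exp (- (\<i> * of_real (z / \<eta> * r))) * (exp (- (\<i> * of_real z) * of_real t) * of_real (bump n (r + \<eta> * t))))"
    proof
      fix t
      have "z / \<eta> * (r + \<eta> * t) = z / \<eta> * r + z * t" using assms by (simp add: field_simps)
      then have "of_real (z / \<eta>) * of_real (r + \<eta> * t) = (of_real (z / \<eta> * r) + of_real z * of_real t :: complex)"
        by (metis of_real_add of_real_mult)
      then have e: "- (\<i> * of_real (z / \<eta>)) * of_real (r + \<eta> * t) = - (\<i> * of_real (z / \<eta> * r)) + - (\<i> * of_real z) * of_real t"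
        by (simp only: mult.assoc distrib_left mult_minus_left minus_add_distrib)
      show "exp (- (\<i> * of_real (z / \<eta>)) * of_real (r + \<eta> * t)) * of_real (bump n (r + \<eta> * t))
        = exp (- (\<i> * of_real (z / \<eta> * r))) * (exp (- (\<i> * of_real z) * of_real t) * of_real (bump n (r + \<eta> * t)))"
        unfolding e exp_add by (simp only: mult.assoc)
    qed
    finally have "bump_ft n (z / \<eta>) = \<eta> *\<^sub>R (exp (- (\<i> * of_real (z / \<eta> * r))) * (\<integral>t. exp (- (\<i> * of_real z) * of_real t) * of_real (bump n (r + \<eta> * t)) \<partial>lborel))"
      by simp
    then show ?thesis using assms by (simp add: scaleR_conv_of_real exp_minus field_simps)
  qed
  have cnj: "(\<integral>r. of_real (bump n r) * exp (\<i> * of_real (z / \<eta> * r)) \<partial>lborel) = cnj (bump_ft n (z / \<eta>))"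
    unfolding bump_ft_def Bochner_Integration.integral_cnj[symmetric]
    by (intro Bochner_Integration.integral_cong) (auto simp: exp_cnj mult_ac)
  have "(\<integral>r. of_real (bump n r) * (\<integral>t. exp (- (\<i> * of_real z) * of_real t) * of_real (bump n (r + \<eta> * t)) \<partial>lborel) \<partial>lborel)
    = (\<integral>r. of_real (bump n r) * exp (\<i> * of_real (z / \<eta> * r)) * (bump_ft n (z / \<eta>) / \<eta>) \<partial>lborel)"
    unfolding inner by (simp add: mult_ac)
  also have "\<dots> = cnj (bump_ft n (z / \<eta>)) * (bump_ft n (z / \<eta>) / \<eta>)"
    unfolding cnj[symmetric] by (rule integral_mult_left_zero)
  also have "\<dots> = of_real ((norm (bump_ft n (z / \<eta>)))\<^sup>2 / \<eta>)"
    by (simp add: complex_norm_square[symmetric] mult.commute)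
  finally show ?thesis by (cases "smoothing_kernel_mass n = 0") (simp_all add: smoothing_kernel_def)
qed

text \<open>This plays the role of Fourier inversion but needs only Fubini's theorem, because the
  kernel itself is already an integral of characters over a bounded set. The general pair of a
  measure M and a complex weight c serves the law of the variable (c = 1) and the complex Edgeworth
  density (M = \<open>lborel\<close>) alike.\<close>

lemma smoothing_kernel_fourier:
  fixes c :: "real \<Rightarrow> complex"
  assumes "sigma_finite_measure M" and [measurable_cong]: "sets M = sets borel" and c: "integrable M c"
    and \<eta>: "\<eta> > 0" and n: "1 \<le> n"
  shows "(\<integral>y. of_real (smoothing_kernel n ((x - y) / \<eta>) / \<eta>) * c y \<partial>M) =
    1 / smoothing_kernel_mass n * (\<integral>r. of_real (bump n r) * (\<integral>t. exp (- (\<i> * of_real x) * of_real t) *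
      ((\<integral>y. exp (\<i> * of_real t * of_real y) * c y \<partial>M) * of_real (bump n (r + \<eta> * t))) \<partial>lborel) \<partial>lborel)"
proof -
  interpret M: sigma_finite_measure M by fact
  interpret pair_sigma_finite M lborel ..
  have [measurable]: "c \<in> borel_measurable M" using c by simp
  have km: "smoothing_kernel_mass n > 0" by (rule smoothing_kernel_mass_pos[OF n])
  define I where "I z r = (\<integral>t. exp (- (\<i> * of_real z) * of_real t) * of_real (bump n (r + \<eta> * t)) \<partial>lborel)" for z r
  have [measurable]: "(\<lambda>(z, r). I z r) \<in> borel_measurable (borel \<Otimes>\<^sub>M borel)"
    unfolding I_def by measurable
  \<comment> \<open>The bound is uniform in z and r, so |c(y)| times the bump dominates the double
    integral.\<close>
  have Ib: "norm (I z r) \<le> 2 / \<eta>" for z r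
  proof -
    have "norm (I z r) \<le> (\<integral>t. norm (exp (- (\<i> * of_real z) * of_real t) * of_real (bump n (r + \<eta> * t))) \<partial>lborel)"
      unfolding I_def by (rule integral_norm_bound)
    also have "\<dots> = (\<integral>t. bump n (r + \<eta> * t) \<partial>lborel)" by (simp only: norm_mult norm_exp_minus_ii norm_of_real) simp
    also have "\<dots> \<le> 2 / \<eta>" by (rule integral_bump_affine[OF \<eta>])
    finally show ?thesis .
  qed
  have k: "of_real (smoothing_kernel n (z / \<eta>) / \<eta>) = 1 / smoothing_kernel_mass n * (\<integral>r. of_real (bump n r) * I z r \<partial>lborel)" for z
    using smoothing_kernel_eq_iterated[OF \<eta>, of n z] km unfolding I_def by (simp add: field_simps)
  have int1: "integrable (M \<Otimes>\<^sub>M lborel) (\<lambda>(y, r). of_real (bump n r) * I (x - y) r * c y)"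
  proof (rule Bochner_Integration.integrable_bound)
    show "integrable (M \<Otimes>\<^sub>M lborel) (\<lambda>z. (2 / \<eta> * norm (c (fst z))) * bump n (snd z))"
      by (rule integrable_pair_mult) (auto intro!: integrable_mult_right integrable_norm c integrable_bump M.sigma_finite_measure_axioms lborel.sigma_finite_measure_axioms)
    show "AE z in M \<Otimes>\<^sub>M lborel. norm (case z of (y, r) \<Rightarrow> of_real (bump n r) * I (x - y) r * c y) \<le> norm ((2 / \<eta> * norm (c (fst z))) * bump n (snd z))"
    proof (rule AE_I2, clarsimp simp: norm_mult abs_mult)
      fix y r
      have "bump n r * (norm (I (x - y) r) * norm (c y)) \<le> bump n r * (2 / \<eta> * norm (c y))"
        by (intro mult_left_mono mult_right_mono Ib) auto
      then show "bump n r * norm (I (x - y) r) * norm (c y) \<le> 2 * norm (c y) * bump n r / \<bar>\<eta>\<bar>"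
        using \<eta> by (simp add: mult_ac)
    qed
  qed measurable
  have inner: "(\<integral>y. I (x - y) r * c y \<partial>M) = (\<integral>t. exp (- (\<i> * of_real x) * of_real t) *
      ((\<integral>y. exp (\<i> * of_real t * of_real y) * c y \<partial>M) * of_real (bump n (r + \<eta> * t))) \<partial>lborel)" for r
  proof -
    have e: "norm (exp (- (\<i> * of_real (x - y)) * of_real t)) = 1" for y t by (rule norm_exp_minus_ii)
    have int2: "integrable (M \<Otimes>\<^sub>M lborel) (\<lambda>(y, t). exp (- (\<i> * of_real (x - y)) * of_real t) * of_real (bump n (r + \<eta> * t)) * c y)"
    proof (rule Bochner_Integration.integrable_bound)
      show "integrable (M \<Otimes>\<^sub>M lborel) (\<lambda>z. norm (c (fst z)) * bump n (r + \<eta> * snd z))"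
        using \<eta> by (intro integrable_pair_mult) (auto intro!: integrable_norm c integrable_bump_affine M.sigma_finite_measure_axioms lborel.sigma_finite_measure_axioms)
      show "AE z in M \<Otimes>\<^sub>M lborel. norm (case z of (y, t) \<Rightarrow> exp (- (\<i> * of_real (x - y)) * of_real t) * of_real (bump n (r + \<eta> * t)) * c y) \<le> norm (norm (c (fst z)) * bump n (r + \<eta> * snd z))"
        by (rule AE_I2) (simp only: split_beta norm_mult e norm_of_real, simp)
    qed measurable
    have "(\<integral>y. I (x - y) r * c y \<partial>M) = (\<integral>y. (\<integral>t. exp (- (\<i> * of_real (x - y)) * of_real t) * of_real (bump n (r + \<eta> * t)) * c y \<partial>lborel) \<partial>M)"
      unfolding I_def by (simp only: integral_mult_left_zero)
    also have "\<dots> = (\<integral>t. (\<integral>y. exp (- (\<i> * of_real (x - y)) * of_real t) * of_real (bump n (r + \<eta> * t)) * c y \<partial>M) \<partial>lborel)"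
      by (rule Fubini_integral[symmetric, OF int2])
    also have "\<dots> = (\<integral>t. (\<integral>y. (exp (- (\<i> * of_real x) * of_real t) * of_real (bump n (r + \<eta> * t))) * (exp (\<i> * of_real t * of_real y) * c y) \<partial>M) \<partial>lborel)"
    proof (intro Bochner_Integration.integral_cong refl)
      fix t y
      have "exp (- (\<i> * of_real (x - y)) * of_real t) = exp (- (\<i> * of_real x) * of_real t) * exp (\<i> * of_real t * of_real y)"
        by (simp add: exp_add[symmetric] algebra_simps)
      then show "exp (- (\<i> * of_real (x - y)) * of_real t) * of_real (bump n (r + \<eta> * t)) * c y
        = (exp (- (\<i> * of_real x) * of_real t) * of_real (bump n (r + \<eta> * t))) * (exp (\<i> * of_real t * of_real y) * c y)"
        by (simp only: mult_ac)
    qed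
    also have "\<dots> = (\<integral>t. (exp (- (\<i> * of_real x) * of_real t) * of_real (bump n (r + \<eta> * t))) * (\<integral>y. exp (\<i> * of_real t * of_real y) * c y \<partial>M) \<partial>lborel)"
      by (simp only: integral_mult_right_zero)
    finally show ?thesis by (simp only: mult_ac)
  qed
  have "(\<integral>y. of_real (smoothing_kernel n ((x - y) / \<eta>) / \<eta>) * c y \<partial>M) = (\<integral>y. 1 / smoothing_kernel_mass n * (\<integral>r. of_real (bump n r) * I (x - y) r * c y \<partial>lborel) \<partial>M)"
    by (simp only: k integral_mult_left_zero) (simp only: mult.assoc)
  also have "\<dots> = 1 / smoothing_kernel_mass n * (\<integral>y. (\<integral>r. of_real (bump n r) * I (x - y) r * c y \<partial>lborel) \<partial>M)"
    by (rule integral_mult_right_zero)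
  also have "(\<integral>y. (\<integral>r. of_real (bump n r) * I (x - y) r * c y \<partial>lborel) \<partial>M) = (\<integral>r. (\<integral>y. of_real (bump n r) * I (x - y) r * c y \<partial>M) \<partial>lborel)"
    by (rule Fubini_integral[symmetric, OF int1])
  also have "\<dots> = (\<integral>r. of_real (bump n r) * (\<integral>y. I (x - y) r * c y \<partial>M) \<partial>lborel)"
    by (simp only: integral_mult_right_zero mult.assoc)
  finally show ?thesis unfolding inner .
qed

section \<open>Transport between a perturbed and the standard normal law\<close>

lemma integrable_std_normal_poly:
  "integrable lborel (\<lambda>s. std_normal_density s * (1 + \<bar>s\<bar>) ^ k)"
proof (rule Bochner_Integration.integrable_bound)
  show "integrable lborel (\<lambda>s. 2 ^ k * (std_normal_density s * \<bar>s\<bar> ^ 0 + std_normal_density s * \<bar>s\<bar> ^ k))"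
    by (intro integrable_mult_right Bochner_Integration.integrable_add integrable_std_normal_moment_abs)
  have *: "(1 + \<bar>s\<bar>) ^ k \<le> 2 ^ k * (1 + \<bar>s\<bar> ^ k)" for s :: real
  proof -
    have "(1 + \<bar>s\<bar>) ^ k \<le> (2 * max 1 \<bar>s\<bar>) ^ k" by (intro power_mono) auto
    also have "\<dots> = 2 ^ k * max 1 \<bar>s\<bar> ^ k" by (rule power_mult_distrib)
    also have "\<dots> \<le> 2 ^ k * (1 + \<bar>s\<bar> ^ k)" by (intro mult_left_mono) (auto simp: max_def)
    finally show ?thesis .
  qed
  have "std_normal_density s * (1 + \<bar>s\<bar>) ^ k \<le> std_normal_density s * (2 ^ k * (1 + \<bar>s\<bar> ^ k))" for s
    by (intro mult_left_mono *) auto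
  then show "AE s in lborel. norm (std_normal_density s * (1 + \<bar>s\<bar>) ^ k) \<le> norm (2 ^ k * (std_normal_density s * \<bar>s\<bar> ^ 0 + std_normal_density s * \<bar>s\<bar> ^ k))"
    by (intro AE_I2) (auto simp: abs_mult algebra_simps)
qed simp

lemma std_normal_density_shift:
  "std_normal_density (x + s) = std_normal_density x * exp (- (x * s)) * exp (- s\<^sup>2 / 2)"
  by (simp add: std_normal_density_def exp_add[symmetric] power2_eq_square field_simps)

text \<open>T is the monotone map with equal distribution functions. At x these differ by O(\<beta>
  \<phi>(x)) up to a polynomial, while the normal density is comparable with \<phi>(x) at distance
  up to 1/(1 + |x|); dividing, \<phi>(x) cancels and the displacement is O(\<beta>) up to a
  polynomial. If the displacement leaves that window, \<beta> times a polynomial is at least of the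
  size of the window, and a crude bound on T is good enough. The bound 1/2 on q keeps the two
  densities within the factors 1/2 and 3/2 of each other.\<close>

lemma density_std_normal_transport:
  fixes p D :: nat
  obtains K where "K \<ge> 0"
    "\<And>q \<beta>. q \<in> borel_measurable borel \<Longrightarrow> \<beta> \<ge> 0 \<Longrightarrow> (\<And>x. \<bar>q x\<bar> \<le> \<beta> * (1 + \<bar>x\<bar>) ^ D) \<Longrightarrow>
      (\<And>x. \<bar>q x\<bar> \<le> 1/2) \<Longrightarrow> (\<integral>x. std_normal_density x * q x \<partial>lborel) = 0 \<Longrightarrow>
      transport p (density lborel (\<lambda>x. std_normal_density x * (1 + q x))) std_normal_distribution (K * \<beta> ^ p)"
proof -
  define M0 :: real where "M0 = (\<integral>s. exp (- s\<^sup>2 / 2) * (1 + \<bar>s\<bar>) ^ D \<partial>lborel)"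
  have intM0: "integrable lborel (\<lambda>s::real. exp (- s\<^sup>2 / 2) * (1 + \<bar>s\<bar>) ^ D)"
  proof -
    have "integrable lborel (\<lambda>s. sqrt (2 * pi) * (std_normal_density s * (1 + \<bar>s\<bar>) ^ D))"
      by (intro integrable_mult_right integrable_std_normal_poly)
    then show ?thesis by (simp add: std_normal_density_def)
  qed
  have M0: "M0 \<ge> 0" unfolding M0_def by (intro integral_nonneg_AE) auto
  define C3 where "C3 = 4 * M0 * exp (3/2)"
  have C3: "C3 \<ge> 0" using M0 by (simp add: C3_def)
  define K where "K = C3 ^ p * (\<integral>x. std_normal_density x * (1 + \<bar>x\<bar>) ^ ((D + 2) * p) \<partial>lborel)"
  have K: "K \<ge> 0" unfolding K_def using C3 by (intro mult_nonneg_nonneg integral_nonneg_AE) auto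
  show ?thesis
  proof (rule that[OF K])
    fix q \<beta> assume [measurable]: "q \<in> borel_measurable borel" and \<beta>: "\<beta> \<ge> 0"
      and q\<beta>: "\<And>x. \<bar>q x\<bar> \<le> \<beta> * (1 + \<bar>x\<bar>) ^ D" and qh: "\<And>x. \<bar>q x\<bar> \<le> 1/2"
      and q0: "(\<integral>x. std_normal_density x * q x \<partial>lborel) = 0"
    let ?\<phi> = std_normal_density
    let ?\<gamma> = std_normal_distribution
    define \<mu> where "\<mu> = density lborel (\<lambda>x. ?\<phi> x * (1 + q x))"
    have q1: "0 \<le> 1 + q x" "1 / 2 \<le> 1 + q x" "1 + q x \<le> 3 / 2" for x using qh[of x] by (auto simp: abs_le_iff)
    have intq: "integrable lborel (\<lambda>x. ?\<phi> x * q x)"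
    proof (rule Bochner_Integration.integrable_bound[of _ "?\<phi>"])
      have "?\<phi> x * \<bar>q x\<bar> \<le> ?\<phi> x * 1" for x using qh[of x] by (intro mult_left_mono) auto
      then show "AE x in lborel. norm (?\<phi> x * q x) \<le> norm (?\<phi> x)" by (auto simp: abs_mult)
    qed auto
    have int1q: "integrable lborel (\<lambda>x. ?\<phi> x * (1 + q x))"
      using intq by (simp add: distrib_left)
    have w0: "0 \<le> ?\<phi> x * (1 + q x)" for x using q1 by simp
    have tot: "(\<integral>x. ?\<phi> x * (1 + q x) \<partial>lborel) = 1"
      using intq q0 by (simp add: distrib_left)
    interpret G: real_distribution ?\<gamma> by (rule real_dist_normal_dist)
    have "prob_space \<mu>"
      by standard (simp add: \<mu>_def emeasure_density nn_integral_eq_integral[OF int1q] w0 tot)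
    then interpret U: prob_space \<mu> .
    interpret U: real_distribution \<mu> by standard (simp_all add: \<mu>_def)
    have mG: "measure ?\<gamma> A = (\<integral>x. ?\<phi> x * indicator A x \<partial>lborel)" if [measurable]: "A \<in> sets borel" for A
    proof -
      have "emeasure ?\<gamma> A = ennreal (\<integral>x. ?\<phi> x * indicator A x \<partial>lborel)"
        by (subst emeasure_density; (subst nn_integral_eq_integral[symmetric])?)
           (auto intro!: nn_integral_cong integrable_mult_indicator[where 'a=real and 'b=real, unfolded real_scaleR_def, simplified mult.commute] split: split_indicator)
      then show ?thesis by (simp add: measure_def integral_nonneg_AE)
    qed
    have mU: "measure \<mu> A = (\<integral>x. ?\<phi> x * (1 + q x) * indicator A x \<partial>lborel)" if [measurable]: "A \<in> sets borel" for A
    proof -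
      have "integrable lborel (\<lambda>x. ?\<phi> x * (1 + q x) * indicator A x)"
        using integrable_mult_indicator[OF _ int1q, of A] by (simp add: mult.commute)
      then have "emeasure \<mu> A = ennreal (\<integral>x. ?\<phi> x * (1 + q x) * indicator A x \<partial>lborel)"
        unfolding \<mu>_def
        by (subst emeasure_density; (subst nn_integral_eq_integral[symmetric])?)
           (auto intro!: nn_integral_cong simp: w0 split: split_indicator)
      then show ?thesis by (simp add: measure_def integral_nonneg_AE w0)
    qed
    have intG: "integrable lborel (\<lambda>x. ?\<phi> x * indicator A x)" if [measurable]: "A \<in> sets borel" for A
      using integrable_mult_indicator[of A lborel ?\<phi>] by (simp add: mult.commute)
    have intU: "integrable lborel (\<lambda>x. ?\<phi> x * (1 + q x) * indicator A x)" if [measurable]: "A \<in> sets borel" for A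
      using integrable_mult_indicator[OF _ int1q, of A] by (simp add: mult.commute)
    have cmp: "1/2 * measure ?\<gamma> A \<le> measure \<mu> A" "measure \<mu> A \<le> 3/2 * measure ?\<gamma> A" if [measurable]: "A \<in> sets borel" for A
    proof -
      have a: "?\<phi> x * (1 + q x) \<le> 3/2 * ?\<phi> x" "1/2 * ?\<phi> x \<le> ?\<phi> x * (1 + q x)" for x
        using mult_left_mono[OF q1(3)[of x], of "?\<phi> x"] mult_left_mono[OF q1(2)[of x], of "?\<phi> x"] by (auto simp: mult.commute)
      have "(\<integral>x. 1/2 * (?\<phi> x * indicator A x) \<partial>lborel) \<le> (\<integral>x. ?\<phi> x * (1 + q x) * indicator A x \<partial>lborel)"
        using a by (intro integral_mono intU integrable_mult_right intG that) (auto split: split_indicator)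
      then show "1/2 * measure ?\<gamma> A \<le> measure \<mu> A" by (simp add: mG mU)
      have "(\<integral>x. ?\<phi> x * (1 + q x) * indicator A x \<partial>lborel) \<le> (\<integral>x. 3/2 * (?\<phi> x * indicator A x) \<partial>lborel)"
        using a by (intro integral_mono intU integrable_mult_right intG that) (auto split: split_indicator)
      then show "measure \<mu> A \<le> 3/2 * measure ?\<gamma> A" by (simp add: mG mU)
    qed
    \<comment> \<open>Since q has Gaussian mean 0, the difference of the distribution functions at x may be
      computed on whichever of the two half-lines bounded by x points away from the origin.\<close>
    have diff: "\<bar>cdf \<mu> x - cdf ?\<gamma> x\<bar> \<le> \<beta> * M0 * (1 + \<bar>x\<bar>) ^ D * ?\<phi> x" for x
    proof -
      define \<tau> :: real where "\<tau> = (if x \<ge> 0 then 1 else -1)"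
      define A where "A = {y. \<tau> * y > \<tau> * x}"
      have [measurable]: "A \<in> sets borel" unfolding A_def by measurable
      have \<tau>x: "\<tau> * x = \<bar>x\<bar>" "\<bar>\<tau>\<bar> = 1" "\<tau> \<noteq> 0" "\<tau> * \<tau> = 1" by (auto simp: \<tau>_def)
      have iq: "integrable lborel (\<lambda>y. ?\<phi> y * q y * indicator B y)" if [measurable]: "B \<in> sets borel" for B
        using integrable_mult_indicator[OF _ intq, of B] by (simp add: mult.commute)
      have "cdf \<mu> x - cdf ?\<gamma> x = (\<integral>y. ?\<phi> y * (1 + q y) * indicator {..x} y - ?\<phi> y * indicator {..x} y \<partial>lborel)"
        unfolding cdf_def by (subst Bochner_Integration.integral_diff) (auto simp: mU mG intU intG)
      also have "\<dots> = (\<integral>y. ?\<phi> y * q y * indicator {..x} y \<partial>lborel)"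
        by (intro Bochner_Integration.integral_cong) (auto simp: algebra_simps split: split_indicator)
      finally have e1: "cdf \<mu> x - cdf ?\<gamma> x = (\<integral>y. ?\<phi> y * q y * indicator {..x} y \<partial>lborel)" .
      have "(\<integral>y. ?\<phi> y * q y * indicator {..x} y \<partial>lborel) + (\<integral>y. ?\<phi> y * q y * indicator {x<..} y \<partial>lborel)
        = (\<integral>y. ?\<phi> y * q y * indicator {..x} y + ?\<phi> y * q y * indicator {x<..} y \<partial>lborel)"
        by (subst Bochner_Integration.integral_add) (auto intro: iq)
      also have "\<dots> = (\<integral>y. ?\<phi> y * q y \<partial>lborel)"
        by (intro Bochner_Integration.integral_cong) (auto split: split_indicator)
      finally have e2: "(\<integral>y. ?\<phi> y * q y * indicator {..x} y \<partial>lborel) = - (\<integral>y. ?\<phi> y * q y * indicator {x<..} y \<partial>lborel)"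
        using q0 by simp
      have e3: "\<bar>cdf \<mu> x - cdf ?\<gamma> x\<bar> = \<bar>\<integral>y. ?\<phi> y * q y * indicator A y \<partial>lborel\<bar>"
      proof (cases "x \<ge> 0")
        case True
        then have "A = {x<..}" by (auto simp: A_def \<tau>_def)
        then show ?thesis using e1 e2 by simp
      next
        case False
        then have A: "A = {..<x}" by (auto simp: A_def \<tau>_def)
        have "(\<integral>y. ?\<phi> y * q y * indicator A y \<partial>lborel) = (\<integral>y. ?\<phi> y * q y * indicator {..x} y \<partial>lborel)"
          unfolding A
          by (rule integral_cong_AE, measurable, rule AE_mp[OF AE_lborel_singleton[of x]], rule AE_I2)
             (auto split: split_indicator)
        then show ?thesis using e1 by simp
      qed
      also have "\<dots> \<le> (\<integral>y. \<bar>?\<phi> y * q y * indicator A y\<bar> \<partial>lborel)"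
        by (rule integral_abs_bound)
      also have "\<dots> = (\<integral>s. \<bar>?\<phi> (x + \<tau> * s) * q (x + \<tau> * s) * indicator A (x + \<tau> * s)\<bar> \<partial>lborel)"
        using lborel_integral_real_affine[OF \<tau>x(3), of "\<lambda>y. \<bar>?\<phi> y * q y * indicator A y\<bar>" x] \<tau>x(2) by simp
      also have "\<dots> \<le> (\<integral>s. (?\<phi> x * \<beta> * (1 + \<bar>x\<bar>) ^ D) * (exp (- s\<^sup>2 / 2) * (1 + \<bar>s\<bar>) ^ D) \<partial>lborel)"
      proof (rule integral_mono')
        show "integrable lborel (\<lambda>s. (?\<phi> x * \<beta> * (1 + \<bar>x\<bar>) ^ D) * (exp (- s\<^sup>2 / 2) * (1 + \<bar>s\<bar>) ^ D))"
          by (intro integrable_mult_right intM0)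
        fix s :: real
        show "0 \<le> (?\<phi> x * \<beta> * (1 + \<bar>x\<bar>) ^ D) * (exp (- s\<^sup>2 / 2) * (1 + \<bar>s\<bar>) ^ D)" using \<beta> by simp
        show "\<bar>?\<phi> (x + \<tau> * s) * q (x + \<tau> * s) * indicator A (x + \<tau> * s)\<bar> \<le> (?\<phi> x * \<beta> * (1 + \<bar>x\<bar>) ^ D) * (exp (- s\<^sup>2 / 2) * (1 + \<bar>s\<bar>) ^ D)"
        proof (cases "s > 0")
          case True
          \<comment> \<open>Moving outward by s multiplies \<phi>(x) by exp(-|x| s) exp(-s^2/2). The
            first factor is at most 1, and the second, with its polynomial weight, integrates to
            \<open>M0\<close>; this keeps \<phi>(x) in front of the tail integral.\<close>
          have "x * (\<tau> * s) = \<bar>x\<bar> * s" using \<tau>x(1) by (simp add: mult_ac flip: \<tau>x(1))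
          then have "?\<phi> (x + \<tau> * s) = ?\<phi> x * exp (- (\<bar>x\<bar> * s)) * exp (- s\<^sup>2 / 2)"
            by (subst std_normal_density_shift) (auto simp: \<tau>_def power_mult_distrib)
          also have "\<dots> \<le> ?\<phi> x * 1 * exp (- s\<^sup>2 / 2)"
            using True by (intro mult_right_mono mult_left_mono) auto
          finally have 1: "?\<phi> (x + \<tau> * s) \<le> ?\<phi> x * exp (- s\<^sup>2 / 2)" by simp
          have "\<bar>x + \<tau> * s\<bar> \<le> \<bar>x\<bar> + \<bar>s\<bar>" using \<tau>x(2) abs_triangle_ineq[of x "\<tau> * s"] by (simp add: abs_mult)
          moreover have "(1 + \<bar>x\<bar>) * (1 + \<bar>s\<bar>) = 1 + \<bar>x\<bar> + \<bar>s\<bar> + \<bar>x\<bar> * \<bar>s\<bar>" by (simp add: algebra_simps)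
          moreover have "0 \<le> \<bar>x\<bar> * \<bar>s\<bar>" by simp
          ultimately have "1 + \<bar>x + \<tau> * s\<bar> \<le> (1 + \<bar>x\<bar>) * (1 + \<bar>s\<bar>)" by linarith
          then have "(1 + \<bar>x + \<tau> * s\<bar>) ^ D \<le> ((1 + \<bar>x\<bar>) * (1 + \<bar>s\<bar>)) ^ D" by (intro power_mono) auto
          then have "\<beta> * (1 + \<bar>x + \<tau> * s\<bar>) ^ D \<le> \<beta> * ((1 + \<bar>x\<bar>) * (1 + \<bar>s\<bar>)) ^ D" using \<beta> by (intro mult_left_mono) auto
          with q\<beta>[of "x + \<tau> * s"] have 2: "\<bar>q (x + \<tau> * s)\<bar> \<le> \<beta> * ((1 + \<bar>x\<bar>) * (1 + \<bar>s\<bar>)) ^ D" by linarith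
          have "\<bar>?\<phi> (x + \<tau> * s) * q (x + \<tau> * s) * indicator A (x + \<tau> * s)\<bar> \<le> ?\<phi> (x + \<tau> * s) * \<bar>q (x + \<tau> * s)\<bar>"
            by (auto simp: abs_mult split: split_indicator)
          also have "\<dots> \<le> (?\<phi> x * exp (- s\<^sup>2 / 2)) * (\<beta> * ((1 + \<bar>x\<bar>) * (1 + \<bar>s\<bar>)) ^ D)"
            using \<beta> by (intro mult_mono 1 2) auto
          finally show ?thesis by (simp add: power_mult_distrib mult_ac)
        next
          case False
          have "\<tau> * (x + \<tau> * s) = \<tau> * x + s" using \<tau>x(4) by (simp add: distrib_left mult.assoc[symmetric])
          with False have "x + \<tau> * s \<notin> A" by (auto simp: A_def)
          then show ?thesis using \<beta> by simp
        qed
      qed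
      also have "\<dots> = \<beta> * M0 * (1 + \<bar>x\<bar>) ^ D * ?\<phi> x"
        unfolding integral_mult_right_zero M0_def[symmetric] by (simp add: mult_ac)
      finally show ?thesis .
    qed
    \<comment> \<open>The exponent -3/2 is -1 - 1/2: inside the window x (y - x) is at most 1 and (y
      - x)^2 / 2 is at most 1/2.\<close>
    have gap: "exp (-3/2) * ?\<phi> x * (b - a) \<le> measure ?\<gamma> {a<..b}" 
      if "a \<le> b" "\<And>y. a < y \<Longrightarrow> y \<le> b \<Longrightarrow> \<bar>y - x\<bar> * (1 + \<bar>x\<bar>) \<le> 1" for x a b
    proof -
      have "(\<integral>y. (exp (-3/2) * ?\<phi> x) * indicator {a<..b} y \<partial>lborel) \<le> (\<integral>y. ?\<phi> y * indicator {a<..b} y \<partial>lborel)"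
      proof (rule integral_mono)
        show "integrable lborel (\<lambda>y. (exp (-3/2) * ?\<phi> x) * indicator {a<..b} y)"
          using that(1) by (intro integrable_mult_right integrable_real_indicator) auto
        show "integrable lborel (\<lambda>y. ?\<phi> y * indicator {a<..b} y)" by (rule intG) simp
        fix y
        show "(exp (-3/2) * ?\<phi> x) * indicator {a<..b} y \<le> ?\<phi> y * indicator {a<..b} y"
        proof (cases "y \<in> {a<..b}")
          case True
          then have *: "\<bar>y - x\<bar> * (1 + \<bar>x\<bar>) \<le> 1" using that(2) by auto
          then have "\<bar>y - x\<bar> + \<bar>(y - x) * x\<bar> \<le> 1" by (simp add: abs_mult distrib_left)
          then have b: "\<bar>y - x\<bar> \<le> 1" "x * (y - x) \<le> 1" by (auto simp: mult.commute)
          have "(y - x)\<^sup>2 \<le> 1" using b(1) by (simp add: abs_square_le_1)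
          then have "-3/2 \<le> - (x * (y - x)) + (- (y - x)\<^sup>2 / 2)" using b(2) by simp
          then have "exp (-3/2) \<le> exp (- (x * (y - x))) * exp (- (y - x)\<^sup>2 / 2)" by (subst exp_add[symmetric]) simp
          then have "?\<phi> x * exp (-3/2) \<le> ?\<phi> x * (exp (- (x * (y - x))) * exp (- (y - x)\<^sup>2 / 2))" by (intro mult_left_mono) auto
          also have "\<dots> = ?\<phi> y" using std_normal_density_shift[of x "y - x"] by simp
          finally show ?thesis using True by (simp add: mult.commute)
        qed auto
      qed
      then show ?thesis using that(1) by (simp add: mG)
    qed
    have pos: "cdf ?\<gamma> a < cdf ?\<gamma> b" if "a < b" for a b
    proof -
      define b' where "b' = min b (a + 1 / (1 + \<bar>a\<bar>))"
      have b': "a < b'" "b' \<le> b" using that by (auto simp: b'_def)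
      have "0 < exp (-3/2) * ?\<phi> a * (b' - a)" using b' normal_density_pos[of 1 0 a] by simp
      also have "\<dots> \<le> measure ?\<gamma> {a<..b'}"
      proof (rule gap)
        fix y assume "a < y" "y \<le> b'"
        then have "\<bar>y - a\<bar> \<le> 1 / (1 + \<bar>a\<bar>)" by (auto simp: b'_def)
        then show "\<bar>y - a\<bar> * (1 + \<bar>a\<bar>) \<le> 1" by (simp add: field_simps)
      qed (use b' in auto)
      also have "\<dots> \<le> measure ?\<gamma> {a<..b}" using b' by (intro G.finite_measure_mono) auto
      also have "\<dots> = cdf ?\<gamma> b - cdf ?\<gamma> a" using that by (simp add: G.cdf_diff_eq)
      finally show ?thesis by simp
    qed
    have cd: "1/2 * (cdf ?\<gamma> b - cdf ?\<gamma> a) \<le> cdf \<mu> b - cdf \<mu> a" if "a < b" for a b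
      using cmp(1)[of "{a<..b}"] that by (simp add: G.cdf_diff_eq U.cdf_diff_eq)
    have posU: "cdf \<mu> a < cdf \<mu> b" if "a < b" for a b
      using cd[OF that] pos[OF that] by simp
    have contU: "isCont (cdf \<mu>) x" for x
      unfolding U.isCont_cdf mU[OF borel_singleton[OF sets.empty_sets]]
      by (rule integral_eq_zero_AE, rule AE_mp[OF AE_lborel_singleton[of x]], rule AE_I2) (simp split: split_indicator)
    have contG: "isCont (cdf ?\<gamma>) x" for x
      unfolding G.isCont_cdf mG[OF borel_singleton[OF sets.empty_sets]]
      by (rule integral_eq_zero_AE, rule AE_mp[OF AE_lborel_singleton[of x]], rule AE_I2) (simp split: split_indicator)
    have ivt: "\<exists>y. cdf \<nu> y = c" if c: "0 < c" "c < 1" and \<nu>: "real_distribution \<nu>" "\<And>x. isCont (cdf \<nu>) x" for c \<nu>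
    proof -
      interpret N: real_distribution \<nu> by fact
      have "eventually (\<lambda>x. cdf \<nu> x < c) at_bot" by (rule order_tendstoD(2)[OF N.cdf_lim_at_bot c(1)])
      then obtain a where a: "cdf \<nu> a < c" using eventually_happens'[OF trivial_limit_at_bot_linorder, of "\<lambda>x. cdf \<nu> x < c"] by blast
      have "eventually (\<lambda>x. c < cdf \<nu> x) at_top" by (rule order_tendstoD(1)[OF N.cdf_lim_at_top_prob c(2)])
      then obtain b where b: "c < cdf \<nu> b" using eventually_happens'[OF trivial_limit_at_top_linorder, of "\<lambda>x. c < cdf \<nu> x"] by blast
      have "a \<le> b" using a b N.cdf_nondecreasing[of b a] by (cases "a \<le> b") auto
      then show ?thesis using IVT'[of "cdf \<nu>" a c b] a b \<nu>(2) by (auto simp: continuous_at_imp_continuous_on)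
    qed
    have G01: "0 < cdf ?\<gamma> x" "cdf ?\<gamma> x < 1" for x
      using pos[of "x - 1" x] pos[of x "x + 1"] G.cdf_nonneg[of "x - 1"] G.cdf_bounded_prob[of "x + 1"] by auto
    have U01: "0 < cdf \<mu> x" "cdf \<mu> x < 1" for x
      using posU[of "x - 1" x] posU[of x "x + 1"] U.cdf_nonneg[of "x - 1"] U.cdf_bounded_prob[of "x + 1"] by auto
    have "\<exists>y. cdf \<mu> y = cdf ?\<gamma> x" for x
      by (rule ivt[OF G01]) (use contU U.real_distribution_axioms in auto)
    \<comment> \<open>Any choice of preimages will do: the distribution function of \<mu> is
      strictly increasing, which forces T to be monotone and hence measurable.\<close>
    then obtain T where T: "\<And>x. cdf \<mu> (T x) = cdf ?\<gamma> x" by metis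
    have monoT: "mono T"
    proof (rule monoI, rule ccontr)
      fix x y :: real assume "x \<le> y" "\<not> T x \<le> T y"
      then have "cdf \<mu> (T y) < cdf \<mu> (T x)" by (intro posU) auto
      then show False using G.cdf_nondecreasing[OF \<open>x \<le> y\<close>] by (simp add: T)
    qed
    then have [measurable]: "T \<in> borel_measurable borel" by (rule borel_measurable_mono)
    have lawT: "distr ?\<gamma> borel T = \<mu>"
    proof (rule cdf_unique)
      show "real_distribution (distr ?\<gamma> borel T)" by (rule G.real_distribution_distr) simp
      show "real_distribution \<mu>" by (rule U.real_distribution_axioms)
      show "cdf (distr ?\<gamma> borel T) = cdf \<mu>"
      proof
        fix y
        obtain z where z: "cdf ?\<gamma> z = cdf \<mu> y" 
          using ivt[OF U01[of y]] contG G.real_distribution_axioms by blast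
        have "T x \<le> y \<longleftrightarrow> x \<le> z" for x
        proof -
          have "T x \<le> y \<longleftrightarrow> cdf \<mu> (T x) \<le> cdf \<mu> y" using posU[of y "T x"] U.cdf_nondecreasing[of "T x" y] by (cases "T x \<le> y") auto
          also have "\<dots> \<longleftrightarrow> cdf ?\<gamma> x \<le> cdf ?\<gamma> z" by (simp add: T z)
          also have "\<dots> \<longleftrightarrow> x \<le> z" using pos[of z x] G.cdf_nondecreasing[of x z] by (cases "x \<le> z") auto
          finally show ?thesis .
        qed
        then have "T -` {..y} \<inter> space ?\<gamma> = {..z}" by auto
        then show "cdf (distr ?\<gamma> borel T) y = cdf \<mu> y"
          using z by (simp add: cdf_def measure_distr)
      qed
    qed
    \<comment> \<open>Moving outward by 2 gains the factor exp(-2). The distance 2 is chosen so that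
      exp(-2) beats the factor 3/2 between the two laws, which yields the contradiction in the bound
      on T below.\<close>
    have tail: "measure ?\<gamma> {y. \<tau> * y > r + 2} \<le> exp (-2) * measure ?\<gamma> {y. \<tau> * y > r}" if r: "r \<ge> 0" and \<tau>: "\<tau> = 1 \<or> \<tau> = -1" for r \<tau> :: real
    proof -
      have [measurable]: "{y. \<tau> * y > s} \<in> sets borel" for s by measurable
      have "measure ?\<gamma> {y. \<tau> * y > r + 2} = (\<integral>y. ?\<phi> (2 * \<tau> + y) * indicator {y. \<tau> * y > r + 2} (2 * \<tau> + y) \<partial>lborel)"
        by (simp add: mG) (subst lborel_integral_real_affine[of 1 _ "2 * \<tau>"], auto)
      also have "\<dots> \<le> (\<integral>y. exp (-2) * (?\<phi> y * indicator {y. \<tau> * y > r} y) \<partial>lborel)"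
      proof (rule integral_mono')
        show "integrable lborel (\<lambda>y. exp (-2) * (?\<phi> y * indicator {y. \<tau> * y > r} y))"
          by (intro integrable_mult_right intG) simp
        fix y
        show "?\<phi> (2 * \<tau> + y) * indicator {y. \<tau> * y > r + 2} (2 * \<tau> + y) \<le> exp (-2) * (?\<phi> y * indicator {y. \<tau> * y > r} y)"
        proof (cases "\<tau> * y > r")
          case True
          have "?\<phi> (y + 2 * \<tau>) = ?\<phi> y * exp (- (2 * (\<tau> * y))) * exp (-2)"
            using \<tau> by (subst std_normal_density_shift) (auto simp: power2_eq_square mult_ac)
          also have "\<dots> \<le> ?\<phi> y * 1 * exp (-2)"
            using True r by (intro mult_right_mono mult_left_mono) auto
          finally show ?thesis using True by (auto simp: add.commute mult.commute split: split_indicator)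
        next
          case False
          then have "\<not> \<tau> * (2 * \<tau> + y) > r + 2" using \<tau> by auto
          then show ?thesis by simp
        qed
      qed simp
      also have "\<dots> = exp (-2) * measure ?\<gamma> {y. \<tau> * y > r}" by (simp add: mG)
      finally show ?thesis .
    qed
    have e2: "3/2 * exp (-2 :: real) < 1"
    proof -
      have "3/2 < exp (2::real)" using exp_ge_add_one_self[of 2] by simp
      then show ?thesis by (simp add: exp_minus field_simps)
    qed
    \<comment> \<open>If T x lay further out than |x| + 2, the \<mu>-mass beyond T x, which equals
      the normal mass beyond x, would be strictly smaller than that mass. The sign \<tau> treats
      both directions at once.\<close>
    have far: "\<tau> * T x \<le> \<bar>x\<bar> + 2" if \<tau>: "\<tau> = 1 \<or> \<tau> = -1" for \<tau> x
    proof (rule ccontr)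
      assume c: "\<not> \<tau> * T x \<le> \<bar>x\<bar> + 2"
      have [measurable]: "{y. \<tau> * y > s} \<in> sets borel" for s by measurable
      have strict: "measure \<nu> {y. \<tau> * y > \<tau> * s} = (if \<tau> = 1 then 1 - cdf \<nu> s else cdf \<nu> s)" if "real_distribution \<nu>" "\<And>x. isCont (cdf \<nu>) x" for \<nu> s
      proof -
        interpret N: real_distribution \<nu> by fact
        have at: "measure \<nu> {s} = 0" using N.isCont_cdf that(2) by blast
        show ?thesis
        proof (cases "\<tau> = 1")
          case True
          have "{y. \<tau> * y > \<tau> * s} = space \<nu> - {..s}" using True by auto
          then have "measure \<nu> {y. \<tau> * y > \<tau> * s} = 1 - measure \<nu> {..s}" using N.prob_compl[of "{..s}"] by (simp del: N.space_eq_univ)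
          then show ?thesis using True by (simp add: cdf_def)
        next
          case False
          then have "{y. \<tau> * y > \<tau> * s} = {..s} - {s}" using \<tau> by auto
          then have "measure \<nu> {y. \<tau> * y > \<tau> * s} = measure \<nu> {..s} - measure \<nu> {s}"
            using N.finite_measure_Diff[of "{..s}" "{s}"] by auto
          then show ?thesis using False at by (simp add: cdf_def)
        qed
      qed
      have "measure ?\<gamma> {y. \<tau> * y > \<tau> * x} = measure \<mu> {y. \<tau> * y > \<tau> * T x}"
        using contU contG by (simp add: strict G.real_distribution_axioms U.real_distribution_axioms T)
      also have "\<dots> \<le> 3/2 * measure ?\<gamma> {y. \<tau> * y > \<tau> * T x}" by (rule cmp) simp
      also have "\<dots> \<le> 3/2 * measure ?\<gamma> {y. \<tau> * y > \<bar>x\<bar> + 2}"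
        using c by (intro mult_left_mono G.finite_measure_mono) auto
      also have "\<dots> \<le> 3/2 * (exp (-2) * measure ?\<gamma> {y. \<tau> * y > \<bar>x\<bar>})"
        by (intro mult_left_mono tail \<tau>) auto
      also have "\<dots> \<le> 3/2 * (exp (-2) * measure ?\<gamma> {y. \<tau> * y > \<tau> * x})"
        using \<tau> by (intro mult_left_mono G.finite_measure_mono) auto
      finally have "measure ?\<gamma> {y. \<tau> * y > \<tau> * x} \<le> (3/2 * exp (-2)) * measure ?\<gamma> {y. \<tau> * y > \<tau> * x}" by simp
      moreover have "0 < measure ?\<gamma> {y. \<tau> * y > \<tau> * x}"
        using G01[of x] contG by (simp add: strict G.real_distribution_axioms)
      ultimately show False using e2 by (simp add: mult_le_cancel_right1)
    qed
    have Tx: "\<bar>x - T x\<bar> \<le> C3 * \<beta> * (1 + \<bar>x\<bar>) ^ (D + 2)" for x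
    proof -
      define \<kappa> where "\<kappa> = 2 * (M0 * exp (3/2)) * \<beta> * (1 + \<bar>x\<bar>) ^ D"
      \<comment> \<open>The displacement cut off at the length of the comparison window; the lower
        bound on normal mass is available for d, not for the full displacement.\<close>
      define d where "d = min \<bar>x - T x\<bar> (1 / (1 + \<bar>x\<bar>))"
      have d0: "0 \<le> d" "d * (1 + \<bar>x\<bar>) \<le> 1" by (auto simp: d_def min_def field_simps)
      \<comment> \<open>The increment is taken with respect to \<mu>, where the value at T x is
        known to be \<open>cdf ?\<gamma> x\<close>, and is then transferred to the normal law at the
        cost of a factor 2.\<close>
      have "1/2 * \<bar>cdf ?\<gamma> (T x) - cdf ?\<gamma> x\<bar> \<le> \<bar>cdf \<mu> (T x) - cdf \<mu> x\<bar>"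
        using cd[of x "T x"] cd[of "T x" x] pos[of x "T x"] pos[of "T x" x]
        by (cases x "T x" rule: linorder_cases) (auto simp: abs_if)
      also have "\<dots> = \<bar>cdf \<mu> x - cdf ?\<gamma> x\<bar>" by (simp add: T)
      also have "\<dots> \<le> \<beta> * M0 * (1 + \<bar>x\<bar>) ^ D * ?\<phi> x" by (rule diff)
      finally have 1: "\<bar>cdf ?\<gamma> (T x) - cdf ?\<gamma> x\<bar> \<le> 2 * (\<beta> * M0 * (1 + \<bar>x\<bar>) ^ D * ?\<phi> x)" by simp
      have "exp (-3/2) * ?\<phi> x * d \<le> \<bar>cdf ?\<gamma> (T x) - cdf ?\<gamma> x\<bar>"
      proof (cases "x \<le> T x")
        case True
        have "exp (-3/2) * ?\<phi> x * (x + d - x) \<le> measure ?\<gamma> {x<..x + d}"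
        proof (rule gap)
          fix y assume "x < y" "y \<le> x + d"
          then have "\<bar>y - x\<bar> * (1 + \<bar>x\<bar>) \<le> d * (1 + \<bar>x\<bar>)" by (intro mult_right_mono) auto
          then show "\<bar>y - x\<bar> * (1 + \<bar>x\<bar>) \<le> 1" using d0 by simp
        qed (use d0 in auto)
        also have "\<dots> \<le> measure ?\<gamma> {x<..T x}" using True by (intro G.finite_measure_mono) (auto simp: d_def)
        also have "\<dots> = cdf ?\<gamma> (T x) - cdf ?\<gamma> x" using True by (cases "x = T x") (auto simp: G.cdf_diff_eq)
        finally show ?thesis by simp
      next
        case False
        have "exp (-3/2) * ?\<phi> x * (x - (x - d)) \<le> measure ?\<gamma> {x - d<..x}"
        proof (rule gap)
          fix y assume "x - d < y" "y \<le> x"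
          then have "\<bar>y - x\<bar> * (1 + \<bar>x\<bar>) \<le> d * (1 + \<bar>x\<bar>)" by (intro mult_right_mono) auto
          then show "\<bar>y - x\<bar> * (1 + \<bar>x\<bar>) \<le> 1" using d0 by simp
        qed (use d0 in auto)
        also have "\<dots> \<le> measure ?\<gamma> {T x<..x}" using False by (intro G.finite_measure_mono) (auto simp: d_def)
        also have "\<dots> = cdf ?\<gamma> x - cdf ?\<gamma> (T x)" using False by (auto simp: G.cdf_diff_eq)
        finally show ?thesis by simp
      qed
      with 1 have "?\<phi> x * (exp (-3/2) * d) \<le> ?\<phi> x * (2 * (\<beta> * M0 * (1 + \<bar>x\<bar>) ^ D))" by (simp add: mult_ac)
      then have "exp (-3/2) * d \<le> 2 * (\<beta> * M0 * (1 + \<bar>x\<bar>) ^ D)"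
        using normal_density_pos[of 1 0 x] by (simp only: mult_le_cancel_left_pos)
      then have "exp (3/2) * (exp (-3/2) * d) \<le> exp (3/2) * (2 * (\<beta> * M0 * (1 + \<bar>x\<bar>) ^ D))" by (intro mult_left_mono) auto
      moreover have "exp (3/2) * (exp (-3/2) * d) = d"
        using exp_add[of "3/2::real" "-3/2"] by (simp only: mult.assoc[symmetric]) simp
      moreover have "exp (3/2) * (2 * (\<beta> * M0 * (1 + \<bar>x\<bar>) ^ D)) = \<kappa>" by (simp add: \<kappa>_def mult_ac)
      ultimately have d\<kappa>: "d \<le> \<kappa>" by linarith
      have one: "1 \<le> (1 + \<bar>x\<bar>)\<^sup>2" by (rule one_le_power) simp
      have "\<bar>x - T x\<bar> \<le> 2 * \<kappa> * (1 + \<bar>x\<bar>)\<^sup>2"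
      proof (cases "\<bar>x - T x\<bar> \<le> 1 / (1 + \<bar>x\<bar>)")
        case True
        then have "\<bar>x - T x\<bar> = d" unfolding d_def by linarith
        also have "d \<le> \<kappa> * 1" using d\<kappa> by simp
        also have "\<dots> \<le> 2 * \<kappa> * (1 + \<bar>x\<bar>)\<^sup>2" using d\<kappa> d0 one by (intro mult_mono) auto
        finally show ?thesis .
      next
        \<comment> \<open>Here d is the full window length, so 1 is at most \<kappa> (1 + |x|).
          Multiplying the crude bound 2 (1 + |x|) by this quantity restores the factor \<beta>; this
          is the origin of the two extra powers in D + 2.\<close>
        case False
        then have "d = 1 / (1 + \<bar>x\<bar>)" unfolding d_def by linarith
        then have "1 / (1 + \<bar>x\<bar>) \<le> \<kappa>" using d\<kappa> by simp
        then have "1 \<le> \<kappa> * (1 + \<bar>x\<bar>)" by (simp add: field_simps)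
        have "\<bar>x - T x\<bar> \<le> 2 * (1 + \<bar>x\<bar>) * 1" using far[of 1 x] far[of "-1" x] by (auto simp: abs_le_iff)
        also have "\<dots> \<le> 2 * (1 + \<bar>x\<bar>) * (\<kappa> * (1 + \<bar>x\<bar>))" by (intro mult_left_mono) (use \<open>1 \<le> \<kappa> * (1 + \<bar>x\<bar>)\<close> in auto)
        finally show ?thesis by (simp add: power2_eq_square mult_ac)
      qed
      also have "\<dots> = C3 * \<beta> * (1 + \<bar>x\<bar>) ^ (D + 2)" by (simp add: \<kappa>_def C3_def power_add power2_eq_square mult_ac)
      finally show ?thesis .
    qed
    have "(\<integral>\<^sup>+x. ennreal (\<bar>x - T x\<bar> ^ p) \<partial>?\<gamma>) = (\<integral>\<^sup>+x. ennreal (?\<phi> x) * ennreal (\<bar>x - T x\<bar> ^ p) \<partial>lborel)"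
      by (rule nn_integral_density) auto
    also have "\<dots> \<le> (\<integral>\<^sup>+x. ennreal ((C3 * \<beta>) ^ p * (?\<phi> x * (1 + \<bar>x\<bar>) ^ ((D + 2) * p))) \<partial>lborel)"
    proof (rule nn_integral_mono)
      fix x
      have "\<bar>x - T x\<bar> ^ p \<le> (C3 * \<beta> * (1 + \<bar>x\<bar>) ^ (D + 2)) ^ p" using Tx by (intro power_mono) auto
      then have "?\<phi> x * \<bar>x - T x\<bar> ^ p \<le> ?\<phi> x * (C3 * \<beta> * (1 + \<bar>x\<bar>) ^ (D + 2)) ^ p" by (intro mult_left_mono) auto
      also have "(C3 * \<beta> * (1 + \<bar>x\<bar>) ^ (D + 2)) ^ p = (C3 * \<beta>) ^ p * (1 + \<bar>x\<bar>) ^ ((D + 2) * p)"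
        by (simp only: power_mult_distrib power_mult)
      also have "?\<phi> x * \<dots> = (C3 * \<beta>) ^ p * (?\<phi> x * (1 + \<bar>x\<bar>) ^ ((D + 2) * p))" 
        by (rule mult.left_commute)
      finally show "ennreal (?\<phi> x) * ennreal (\<bar>x - T x\<bar> ^ p) \<le> ennreal ((C3 * \<beta>) ^ p * (?\<phi> x * (1 + \<bar>x\<bar>) ^ ((D + 2) * p)))"
        by (subst ennreal_mult[symmetric]) (auto intro: ennreal_leI)
    qed
    also have "\<dots> = ennreal (\<integral>x. (C3 * \<beta>) ^ p * (?\<phi> x * (1 + \<bar>x\<bar>) ^ ((D + 2) * p)) \<partial>lborel)"
      using C3 \<beta> by (intro nn_integral_eq_integral integrable_mult_right integrable_std_normal_poly) auto
    also have "\<dots> = ennreal (K * \<beta> ^ p)" by (simp add: K_def power_mult_distrib mult_ac)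
    finally have "transport p (distr ?\<gamma> borel (\<lambda>x. x)) (distr ?\<gamma> borel T) (K * \<beta> ^ p)"
      by (intro transportI G.prob_space_axioms) auto
    moreover have "distr ?\<gamma> borel (\<lambda>x. x) = ?\<gamma>" by (rule distr_id2) simp
    ultimately have "transport p ?\<gamma> \<mu> (K * \<beta> ^ p)" by (simp add: lawT)
    then show "transport p (density lborel (\<lambda>x. ?\<phi> x * (1 + q x))) ?\<gamma> (K * \<beta> ^ p)"
      unfolding \<mu>_def by (rule transport_sym)
  qed
qed

section \<open>The Edgeworth expansion of the characteristic function\<close>

text \<open>One step of Taylor's estimate by the mean value inequality. The factor 1/(k+1) that
  integration would give is sacrificed, which affects constants only.\<close>

lemma norm_le_of_vector_derivative_power:
  fixes g g' :: "real \<Rightarrow> complex"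
  assumes d: "\<And>t. t \<in> {-T..T} \<Longrightarrow> (g has_vector_derivative g' t) (at t within {-T..T})"
    and "g 0 = 0" and b: "\<And>t. t \<in> {-T..T} \<Longrightarrow> norm (g' t) \<le> C * \<bar>t\<bar> ^ k" and t: "t \<in> {-T..T}" and C: "0 \<le> C"
  shows "norm (g t) \<le> C * \<bar>t\<bar> ^ Suc k"
proof -
  have sub: "closed_segment 0 t \<subseteq> {-T..T}"
    using t by (auto simp: closed_segment_eq_real_ivl)
  have "norm (g t - g 0) \<le> (C * \<bar>t\<bar> ^ k) * norm (t - 0)"
  proof (rule differentiable_bound[where S = "closed_segment 0 t" and f' = "\<lambda>s x. x *\<^sub>R g' s"])
    fix s assume s: "s \<in> closed_segment 0 t"
    have sT: "s \<in> {-T..T}" by (rule subsetD[OF sub s])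
    show "(g has_derivative (\<lambda>x. x *\<^sub>R g' s)) (at s within closed_segment 0 t)"
      using has_vector_derivative_within_subset[OF d[OF sT] sub] unfolding has_vector_derivative_def .
    have "\<bar>s\<bar> \<le> \<bar>t\<bar>" using segment_bound1[OF s] by simp
    then have "C * \<bar>s\<bar> ^ k \<le> C * \<bar>t\<bar> ^ k" using C by (intro mult_left_mono power_mono) auto
    then have "norm (g' s) \<le> C * \<bar>t\<bar> ^ k" using b[OF sT] by linarith
    then show "onorm (\<lambda>x. x *\<^sub>R g' s) \<le> C * \<bar>t\<bar> ^ k"
      by (intro onorm_le) (auto simp: mult.commute intro: mult_left_mono)
  qed auto
  then show ?thesis using \<open>g 0 = 0\<close> by (simp add: mult_ac)
qed

text \<open>The argument lists derivatives at 0. A formal polynomial is used because its derivatives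
  serve the remainder estimate and its coefficients later become coefficients of Hermite
  polynomials.\<close>

definition taylor_poly :: "nat \<Rightarrow> (nat \<Rightarrow> complex) \<Rightarrow> complex poly" where
  "taylor_poly m a = (\<Sum>j\<le>m. monom (a j / fact j) j)"

lemma coeff_taylor_poly: "coeff (taylor_poly m a) j = (if j \<le> m then a j / fact j else 0)"
  by (simp add: taylor_poly_def coeff_sum)

lemma higher_pderiv_taylor_poly_0:
  assumes "k \<le> m"
  shows "poly ((pderiv ^^ k) (taylor_poly m a)) 0 = a k"
proof -
  have "pochhammer 1 k = (fact k :: nat)" "pochhammer (Suc 0) k = (fact k :: nat)"
    using pochhammer_fact[of k, where 'a = nat] by simp_all
  moreover have "pochhammer 1 k = (fact k :: complex)" using pochhammer_fact[of k, where 'a = complex] by simp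
  ultimately show ?thesis using assms
    by (simp only: poly_0_coeff_0 coeff_higher_pderiv coeff_taylor_poly) simp
qed

lemma higher_pderiv_taylor_poly_Suc: "(pderiv ^^ Suc m) (taylor_poly m a) = 0"
  by (intro poly_eqI) (simp only: coeff_higher_pderiv coeff_taylor_poly, simp)

lemma poly_of_real_has_vector_derivative:
  fixes P :: "complex poly"
  shows "((\<lambda>t. poly P (of_real t)) has_vector_derivative poly (pderiv P) (of_real t)) (at t within A)"
proof -
  have "(complex_of_real has_vector_derivative of_real 1) (at t within A)"
    by (rule has_vector_derivative_of_real[OF DERIV_ident])
  from field_vector_diff_chain_within[OF this has_field_derivative_at_within[OF poly_DERIV[of P "of_real t"]]]
  show ?thesis by (simp add: comp_def)
qed

text \<open>Split l into its Taylor polynomial A and the remainder \<rho>. With R_N the tail of the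
  exponential series, exp(A + \<rho>) minus the partial sum in A equals R_(m-1)(A) + exp(A)
  R_1(\<rho>). Since A is O(h) and \<rho> is O(h^(m-1)) with polynomial weights and all derivatives
  included, both terms are O(h^(m-1)). The condition \<open>C0 * \<epsilon> \<le> 1 / 16\<close>
  keeps the exponentials below exp(3 t^2/16), so that exp(-t^2/2) still leaves exp(-t^2/4).\<close>

lemma edgeworth_error:
  fixes m :: nat and C0 \<epsilon> H :: real
  assumes m: "2 \<le> m" and C0: "0 \<le> C0" and \<epsilon>: "0 < \<epsilon>" "\<epsilon> \<le> 1" "C0 * \<epsilon> \<le> 1 / 16" and H: "0 < H"
  obtains K k where "0 \<le> K" "\<And>h l. 0 < h \<Longrightarrow> h \<le> H \<Longrightarrow>
    (\<And>j t. j \<le> m \<Longrightarrow> t \<in> {-(\<epsilon>/h)..\<epsilon>/h} \<Longrightarrow> (l j has_vector_derivative l (Suc j) t) (at t within {-(\<epsilon>/h)..\<epsilon>/h})) \<Longrightarrow>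
    (\<And>j t. 3 \<le> j \<Longrightarrow> j \<le> m + 1 \<Longrightarrow> t \<in> {-(\<epsilon>/h)..\<epsilon>/h} \<Longrightarrow> norm (l j t) \<le> C0 * h ^ (j - 2)) \<Longrightarrow>
    (\<And>j. j < 3 \<Longrightarrow> l j 0 = 0) \<Longrightarrow>
    smooth_bd (m + 1) {-(\<epsilon>/h)..\<epsilon>/h} {} (\<lambda>t. K * h ^ (m - 1) * ((1 + \<bar>t\<bar>) ^ k * exp (- t\<^sup>2 / 4)))
      (\<lambda>t. exp (l 0 t - of_real (t\<^sup>2 / 2)) - exp (- of_real (t\<^sup>2 / 2)) * (\<Sum>i<m - 1. poly (taylor_poly m (\<lambda>j. l j 0)) (of_real t) ^ i / fact i))"
proof -
  define n where "n = m + 1"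
  define CA where "CA = 2 * C0 * (1 + H) ^ m"
  define c1 where "c1 = 1 + CA * H + C0 * H ^ (m - 1)"
  have CA: "0 \<le> CA" using C0 H by (simp add: CA_def)
  have c1: "1 \<le> c1" using CA C0 H by (simp add: c1_def)
  define K2 where "K2 = 2 ^ (n * n) * CA ^ (m - 1) * c1 ^ n + 2 ^ n * 2 ^ (n * n) * 2 ^ (n * n) * C0 * c1 ^ n * c1 ^ n"
  have K2: "0 \<le> K2" using CA C0 c1 by (simp add: K2_def)
  define k0 where "k0 = m + 2 * n"
  define K where "K = 2 ^ n * (2 ^ (n * n) * 2 ^ n) * K2"
  have K: "0 \<le> K" using K2 by (simp add: K_def)
  show ?thesis
  proof (rule that[OF K, of "(m + 1) * (n + k0)"])
    fix h :: real and l :: "nat \<Rightarrow> real \<Rightarrow> complex"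
    assume h: "0 < h" "h \<le> H"
      and D: "\<And>j t. j \<le> m \<Longrightarrow> t \<in> {-(\<epsilon>/h)..\<epsilon>/h} \<Longrightarrow> (l j has_vector_derivative l (Suc j) t) (at t within {-(\<epsilon>/h)..\<epsilon>/h})"
      and Bl: "\<And>j t. 3 \<le> j \<Longrightarrow> j \<le> m + 1 \<Longrightarrow> t \<in> {-(\<epsilon>/h)..\<epsilon>/h} \<Longrightarrow> norm (l j t) \<le> C0 * h ^ (j - 2)"
      and Z: "\<And>j. j < 3 \<Longrightarrow> l j 0 = 0"
    define J where "J = {-(\<epsilon>/h)..\<epsilon>/h}"
    define A where "A j t = poly ((pderiv ^^ j) (taylor_poly m (\<lambda>j. l j 0))) (of_real t)" for j t
    define \<rho> where "\<rho> j t = l j t - A j t" for j t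
    define q where "q t = (1 + \<bar>t\<bar>) ^ (m + 1)" for t :: real
    have q1: "1 \<le> q t" for t unfolding q_def by (intro one_le_power) simp
    have dA: "(A j has_vector_derivative A (Suc j) t) (at t within J)" for j t
      unfolding A_def using poly_of_real_has_vector_derivative by simp
    have d\<rho>: "(\<rho> j has_vector_derivative \<rho> (Suc j) t) (at t within J)" if "j \<le> m" "t \<in> J" for j t
      unfolding \<rho>_def using D[OF that(1)] that(2) dA by (intro has_vector_derivative_diff) (auto simp: J_def)
    have J0: "0 \<in> J" using \<epsilon> h by (simp add: J_def)
    \<comment> \<open>Downward induction from the derivative of order m + 1, to which the Taylor
      polynomial contributes nothing. Each lower derivative vanishes at 0 and is obtained by
      integrating from there.\<close>
    have \<rho>b: "norm (\<rho> (m + 1 - k) t) \<le> C0 * h ^ (m - 1) * \<bar>t\<bar> ^ k" if "k \<le> m + 1" "t \<in> J" for k t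
      using that
    proof (induction k arbitrary: t)
      case 0
      have "\<rho> (m + 1) t = l (m + 1) t"
        using higher_pderiv_taylor_poly_Suc[of m "\<lambda>j. l j 0"] by (simp add: \<rho>_def A_def del: funpow.simps)
      then show ?case using Bl[of "m + 1" t] m 0 by (simp add: J_def)
    next
      case (Suc k)
      define j where "j = m - k"
      have j: "j \<le> m" "m + 1 - Suc k = j" "m + 1 - k = Suc j" using Suc.prems by (auto simp: j_def)
      have "\<rho> j 0 = 0" using higher_pderiv_taylor_poly_0[OF j(1), of "\<lambda>j. l j 0"] by (simp add: \<rho>_def A_def)
      then have "norm (\<rho> j t) \<le> C0 * h ^ (m - 1) * \<bar>t\<bar> ^ Suc k"
        using Suc.IH[unfolded j(3)] Suc.prems d\<rho>[OF j(1)] C0 h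
        by (intro norm_le_of_vector_derivative_power[where T = "\<epsilon>/h" and g' = "\<rho> (Suc j)"]) (auto simp: J_def)
      then show ?case by (simp only: j(2))
    qed
    \<comment> \<open>The same descent for l, starting from the third derivative, which is O(h);
      here l and its first two derivatives vanish at 0.\<close>
    have lsmall: "norm (l (3 - k) t) \<le> C0 * h * \<bar>t\<bar> ^ k" if "k \<le> 3" "t \<in> J" for k t
      using that
    proof (induction k arbitrary: t)
      case 0
      then show ?case using Bl[of 3 t] m by (simp add: J_def)
    next
      case (Suc k)
      define j where "j = 2 - k"
      have j: "j \<le> m" "3 - Suc k = j" "3 - k = Suc j" "j < 3" using Suc.prems m by (auto simp: j_def)
      have "norm (l j t) \<le> C0 * h * \<bar>t\<bar> ^ Suc k"
        using Suc.IH[unfolded j(3)] Suc.prems D[OF j(1)] C0 h Z[OF j(4)]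
        by (intro norm_le_of_vector_derivative_power[where T = "\<epsilon>/h" and g' = "l (Suc j)"]) (auto simp: J_def)
      then show ?case by (simp only: j(2))
    qed
    have wp: "\<bar>t\<bar> ^ i \<le> q t" if "i \<le> m + 1" for i and t :: real
    proof -
      have "\<bar>t\<bar> ^ i \<le> (1 + \<bar>t\<bar>) ^ i" by (intro power_mono) auto
      also have "\<dots> \<le> q t" unfolding q_def using that by (intro power_increasing) auto
      finally show ?thesis .
    qed
    have hp: "h ^ i \<le> (1 + H) ^ m" if "i \<le> m" for i
    proof -
      have "h ^ i \<le> (1 + H) ^ i" using h by (intro power_mono) auto
      also have "\<dots> \<le> (1 + H) ^ m" using H that by (intro power_increasing) auto
      finally show ?thesis .
    qed
    have b\<rho>: "norm (\<rho> j t) \<le> C0 * h ^ (m - 1) * q t" if "j \<le> m + 1" "t \<in> J" for j t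
    proof -
      have "norm (\<rho> j t) \<le> C0 * h ^ (m - 1) * \<bar>t\<bar> ^ (m + 1 - j)" using \<rho>b[of "m + 1 - j" t] that by simp
      also have "\<dots> \<le> C0 * h ^ (m - 1) * q t" using C0 h by (intro mult_left_mono wp) auto
      finally show ?thesis .
    qed
    have bl: "norm (l j t) \<le> C0 * (h * (1 + H) ^ m) * q t" if "j \<le> m + 1" "t \<in> J" for j t
    proof (cases "3 \<le> j")
      case True
      have "h ^ (j - 2) = h * h ^ (j - 3)"
      proof -
        have "j - 2 = Suc (j - 3)" using True by simp
        then show ?thesis by (metis power_Suc)
      qed
      then have "norm (l j t) \<le> C0 * (h * h ^ (j - 3)) * 1" using Bl[OF True] that by (simp add: J_def)
      also have "\<dots> \<le> C0 * (h * (1 + H) ^ m) * q t"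
        using C0 h H q1 that hp[of "j - 3"] by (intro mult_mono) auto
      finally show ?thesis .
    next
      case False
      have "norm (l j t) \<le> C0 * (h * 1) * \<bar>t\<bar> ^ (3 - j)" using lsmall[of "3 - j" t] that False by simp
      also have "\<dots> \<le> C0 * (h * (1 + H) ^ m) * q t"
        using C0 h H m wp[of "3 - j" t] hp[of 0] by (intro mult_mono) auto
      finally show ?thesis .
    qed
    have bA: "norm (A j t) \<le> CA * h * q t" if "j \<le> m + 1" "t \<in> J" for j t
    proof -
      have "h ^ (m - 1) = h * h ^ (m - 2)"
      proof -
        have "m - 1 = Suc (m - 2)" using m by simp
        then show ?thesis by (metis power_Suc)
      qed
      also have "\<dots> \<le> h * (1 + H) ^ m" using h hp[of "m - 2"] by (intro mult_left_mono) auto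
      finally have hm: "C0 * h ^ (m - 1) * q t \<le> C0 * (h * (1 + H) ^ m) * q t"
        using C0 q1[of t] by (intro mult_right_mono mult_left_mono) auto
      have "norm (A j t) \<le> norm (l j t) + norm (\<rho> j t)"
        unfolding \<rho>_def by (metis diff_diff_eq2 add_diff_cancel_left' norm_triangle_ineq4 add.commute diff_add_cancel)
      also have "\<dots> \<le> C0 * (h * (1 + H) ^ m) * q t + C0 * (h * (1 + H) ^ m) * q t"
        using bl[OF that] b\<rho>[OF that] hm by linarith
      also have "\<dots> = CA * h * q t" by (simp add: CA_def mult_ac)
      finally show ?thesis .
    qed
    have sA: "smooth_bd n J {} (\<lambda>t. CA * h * q t) (A 0)"
      by (rule smooth_bd_jets) (use dA bA in \<open>auto simp: n_def\<close>)
    have s\<rho>: "smooth_bd n J {} (\<lambda>t. C0 * h ^ (m - 1) * q t) (\<rho> 0)"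
      by (rule smooth_bd_jets) (use d\<rho> b\<rho> in \<open>auto simp: n_def\<close>)
    have tJ: "h * \<bar>t\<bar> \<le> \<epsilon>" if "t \<in> J" for t
      using that h by (auto simp: J_def abs_le_iff field_simps)
    \<comment> \<open>On J the product h |t| is at most \<epsilon>, so m - 1 of the factors |t| are
      traded for \<epsilon>^(m-1), leaving t^2 with a small constant.\<close>
    have e\<rho>: "norm (\<rho> 0 t) \<le> t\<^sup>2 / 16" if "t \<in> J" for t
    proof -
      have "\<bar>t\<bar> ^ (m + 1) = \<bar>t\<bar> ^ (m - 1) * t\<^sup>2"
      proof -
        have "m + 1 = (m - 1) + 2" using m by simp
        then show ?thesis by (metis power_add power2_abs)
      qed
      then have "norm (\<rho> 0 t) \<le> C0 * ((h * \<bar>t\<bar>) ^ (m - 1) * t\<^sup>2)"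
        using \<rho>b[of "m + 1" t] that by (simp add: power_mult_distrib mult_ac)
      also have "(h * \<bar>t\<bar>) ^ (m - 1) \<le> \<epsilon> ^ (m - 1)" using tJ[OF that] h by (intro power_mono) auto
      also have "\<epsilon> ^ (m - 1) \<le> \<epsilon> ^ 1" using \<epsilon> m by (intro power_decreasing) auto
      finally have "norm (\<rho> 0 t) \<le> (C0 * \<epsilon>) * t\<^sup>2" using C0 by (simp add: mult_left_mono mult_right_mono mult.assoc)
      also have "\<dots> \<le> 1/16 * t\<^sup>2" using \<epsilon> by (intro mult_right_mono) auto
      finally show ?thesis by simp
    qed
    have eA: "norm (A 0 t) \<le> t\<^sup>2 / 8" if "t \<in> J" for t
    proof -
      have "norm (l 0 t) \<le> C0 * ((h * \<bar>t\<bar>) * t\<^sup>2)"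
        using lsmall[of 3 t] that by (simp add: power3_eq_cube power2_eq_square mult_ac)
      also have "\<dots> \<le> C0 * (\<epsilon> * t\<^sup>2)" using tJ[OF that] C0 by (intro mult_left_mono mult_right_mono) auto
      also have "\<dots> \<le> 1/16 * t\<^sup>2" unfolding mult.assoc[symmetric] using \<epsilon> by (intro mult_right_mono) auto
      finally have "norm (l 0 t) \<le> t\<^sup>2 / 16" by simp
      moreover have "A 0 t = l 0 t - \<rho> 0 t" by (simp add: \<rho>_def)
      ultimately show ?thesis using e\<rho>[OF that] norm_triangle_ineq4[of "l 0 t" "\<rho> 0 t"] by simp
    qed
    have rem: "norm (exp_remainder N z) \<le> b ^ N * exp e" if "norm z \<le> b" "norm z \<le> e" for N z b e
    proof -
      have "norm (exp_remainder N z) \<le> norm z ^ N * exp (norm z)" by (rule norm_exp_remainder_le)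
      also have "\<dots> \<le> b ^ N * exp e"
        using that order_trans[OF norm_ge_zero that(1)] by (intro mult_mono power_mono) auto
      finally show ?thesis .
    qed
    have q2: "1 + CA * h * q t \<le> c1 * q t" "1 + C0 * h ^ (m - 1) * q t \<le> c1 * q t" for t
    proof -
      have "CA * h * q t \<le> CA * H * q t" "C0 * h ^ (m - 1) * q t \<le> C0 * H ^ (m - 1) * q t"
        using CA C0 h q1[of t] by (intro mult_right_mono mult_left_mono power_mono; simp)+
      moreover have "c1 * q t = q t + CA * H * q t + C0 * H ^ (m - 1) * q t" by (simp add: c1_def distrib_right)
      moreover have "0 \<le> CA * H * q t" "0 \<le> C0 * H ^ (m - 1) * q t" using CA C0 H q1[of t] by auto
      ultimately show "1 + CA * h * q t \<le> c1 * q t" "1 + C0 * h ^ (m - 1) * q t \<le> c1 * q t" using q1[of t] by linarith+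
    qed
    have sRA: "smooth_bd n J {} (\<lambda>t. 2 ^ (n * n) * ((CA * h * q t) ^ N * (c1 * q t) ^ n * exp (t\<^sup>2 / 8))) (\<lambda>t. exp_remainder N (A 0 t))" for N
    proof (rule smooth_bd_mono[OF smooth_bd_exp_remainder[OF sA, where e = "\<lambda>t. exp (t\<^sup>2 / 8)"]])
      show "norm (exp_remainder N' (A 0 t)) \<le> (CA * h * q t) ^ N' * exp (t\<^sup>2 / 8)" if "t \<in> J" for N' t
        using bA[of 0 t] eA that by (intro rem) auto
      show "2 ^ (n * n) * ((CA * h * q t) ^ N * (1 + CA * h * q t) ^ n * exp (t\<^sup>2 / 8)) \<le> 2 ^ (n * n) * ((CA * h * q t) ^ N * (c1 * q t) ^ n * exp (t\<^sup>2 / 8))" for t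
        using CA h q1[of t] q2(1)[of t] by (intro mult_left_mono mult_right_mono power_mono) auto
    qed auto
    have sR\<rho>: "smooth_bd n J {} (\<lambda>t. 2 ^ (n * n) * ((C0 * h ^ (m - 1) * q t) ^ 1 * (c1 * q t) ^ n * exp (t\<^sup>2 / 16))) (\<lambda>t. exp_remainder 1 (\<rho> 0 t))"
    proof (rule smooth_bd_mono[OF smooth_bd_exp_remainder[OF s\<rho>, where e = "\<lambda>t. exp (t\<^sup>2 / 16)"]])
      show "norm (exp_remainder N' (\<rho> 0 t)) \<le> (C0 * h ^ (m - 1) * q t) ^ N' * exp (t\<^sup>2 / 16)" if "t \<in> J" for N' t
        using b\<rho>[of 0 t] e\<rho> that by (intro rem) auto
      show "2 ^ (n * n) * ((C0 * h ^ (m - 1) * q t) ^ 1 * (1 + C0 * h ^ (m - 1) * q t) ^ n * exp (t\<^sup>2 / 16)) \<le> 2 ^ (n * n) * ((C0 * h ^ (m - 1) * q t) ^ 1 * (c1 * q t) ^ n * exp (t\<^sup>2 / 16))" for t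
        using C0 h q1[of t] q2(2)[of t] by (intro mult_left_mono mult_right_mono power_mono) auto
    qed auto
    \<comment> \<open>The derivatives of -t^2/2, listed so that the Gaussian factor is
      \<open>exp_remainder 0\<close> of it and the same lemma bounds its derivatives.\<close>
    define G where "G j t = (if j = 0 then - of_real (t\<^sup>2 / 2) else if j = 1 then - of_real t else if j = 2 then -1 else (0::complex))" for j :: nat and t :: real
    have sG: "smooth_bd n J {} q (G 0)"
    proof (rule smooth_bd_jets)
      fix j t assume "t \<in> J"
      have "((\<lambda>t. - complex_of_real (t\<^sup>2 / 2)) has_vector_derivative - of_real t) (at t within J)"
        unfolding of_real_minus[symmetric] by (rule has_vector_derivative_of_real) (auto intro!: derivative_eq_intros)
      moreover have "((\<lambda>t. - complex_of_real t) has_vector_derivative - 1) (at t within J)"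
        using has_vector_derivative_minus[OF has_vector_derivative_of_real[OF DERIV_ident]] by simp
      ultimately show "(G j has_vector_derivative G (Suc j) t) (at t within J)"
        unfolding G_def[abs_def] by (auto simp: numeral_eq_Suc)
      have "t\<^sup>2 / 2 \<le> q t" using wp[of 2 t] m q1[of t] by simp
      then show "norm (G j t) \<le> q t" using wp[of 1 t] q1[of t] by (auto simp: G_def norm_power norm_divide)
    qed
    have sE: "smooth_bd n J {} (\<lambda>t. 2 ^ (n * n) * (q t ^ 0 * (1 + q t) ^ n * exp (- t\<^sup>2 / 2))) (\<lambda>t. exp_remainder 0 (G 0 t))"
      by (rule smooth_bd_exp_remainder[OF sG]) (auto simp: exp_remainder_def G_def)
    let ?B1 = "\<lambda>t. 2 ^ (n * n) * ((CA * h * q t) ^ (m - 1) * (c1 * q t) ^ n * exp (t\<^sup>2 / 8))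
      + 2 ^ n * (2 ^ (n * n) * ((CA * h * q t) ^ 0 * (c1 * q t) ^ n * exp (t\<^sup>2 / 8)) * (2 ^ (n * n) * ((C0 * h ^ (m - 1) * q t) ^ 1 * (c1 * q t) ^ n * exp (t\<^sup>2 / 16))))"
    have S: "smooth_bd n J {} (\<lambda>t. 2 ^ n * (2 ^ (n * n) * (q t ^ 0 * (1 + q t) ^ n * exp (- t\<^sup>2 / 2)) * ?B1 t))
      (\<lambda>t. exp_remainder 0 (G 0 t) * (exp_remainder (m - 1) (A 0 t) + exp_remainder 0 (A 0 t) * exp_remainder 1 (\<rho> 0 t)))"
      by (rule smooth_bd_mult[OF sE smooth_bd_add[OF sRA smooth_bd_mult[OF sRA sR\<rho>]]])
    have feq: "(\<lambda>t. exp_remainder 0 (G 0 t) * (exp_remainder (m - 1) (A 0 t) + exp_remainder 0 (A 0 t) * exp_remainder 1 (\<rho> 0 t)))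
      = (\<lambda>t. exp (l 0 t - of_real (t\<^sup>2 / 2)) - exp (- of_real (t\<^sup>2 / 2)) * (\<Sum>i<m - 1. poly (taylor_poly m (\<lambda>j. l j 0)) (of_real t) ^ i / fact i))"
    proof
      fix t
      have "exp (l 0 t - of_real (t\<^sup>2 / 2)) = exp (- of_real (t\<^sup>2 / 2)) * (exp (A 0 t) * exp (\<rho> 0 t))"
        by (simp add: \<rho>_def exp_add[symmetric])
      then show "exp_remainder 0 (G 0 t) * (exp_remainder (m - 1) (A 0 t) + exp_remainder 0 (A 0 t) * exp_remainder 1 (\<rho> 0 t))
        = exp (l 0 t - of_real (t\<^sup>2 / 2)) - exp (- of_real (t\<^sup>2 / 2)) * (\<Sum>i<m - 1. poly (taylor_poly m (\<lambda>j. l j 0)) (of_real t) ^ i / fact i)"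
        by (simp add: exp_remainder_def G_def A_def algebra_simps)
    qed
    have bound: "2 ^ n * (2 ^ (n * n) * (q t ^ 0 * (1 + q t) ^ n * exp (- t\<^sup>2 / 2)) * ?B1 t) \<le> K * h ^ (m - 1) * ((1 + \<bar>t\<bar>) ^ ((m + 1) * (n + k0)) * exp (- t\<^sup>2 / 4))" for t
    proof -
      have qp: "q t ^ i \<le> q t ^ k0" if "i \<le> k0" for i using q1[of t] that by (intro power_increasing) auto
      have "2 ^ (n * n) * ((CA * h * q t) ^ (m - 1) * (c1 * q t) ^ n * exp (t\<^sup>2 / 8))
        = (2 ^ (n * n) * CA ^ (m - 1) * c1 ^ n) * h ^ (m - 1) * (q t ^ (m - 1 + n) * exp (t\<^sup>2 / 8))"
        by (simp add: power_mult_distrib power_add mult_ac)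
      also have "\<dots> \<le> (2 ^ (n * n) * CA ^ (m - 1) * c1 ^ n) * h ^ (m - 1) * (q t ^ k0 * exp (3 * t\<^sup>2 / 16))"
        using CA c1 h q1[of t] qp[of "m - 1 + n"] by (intro mult_left_mono mult_mono) (auto simp: k0_def)
      finally have a1: "2 ^ (n * n) * ((CA * h * q t) ^ (m - 1) * (c1 * q t) ^ n * exp (t\<^sup>2 / 8)) \<le> \<dots>" .
      have "exp (t\<^sup>2 / 8) * exp (t\<^sup>2 / 16) = exp (3 * t\<^sup>2 / 16)" by (simp add: exp_add[symmetric])
      then have "2 ^ n * (2 ^ (n * n) * ((CA * h * q t) ^ 0 * (c1 * q t) ^ n * exp (t\<^sup>2 / 8)) * (2 ^ (n * n) * ((C0 * h ^ (m - 1) * q t) ^ 1 * (c1 * q t) ^ n * exp (t\<^sup>2 / 16))))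
        = (2 ^ n * 2 ^ (n * n) * 2 ^ (n * n) * C0 * c1 ^ n * c1 ^ n) * h ^ (m - 1) * (q t ^ (n + n + 1) * exp (3 * t\<^sup>2 / 16))"
        by (simp add: power_mult_distrib power_add mult_ac) 
      also have "\<dots> \<le> (2 ^ n * 2 ^ (n * n) * 2 ^ (n * n) * C0 * c1 ^ n * c1 ^ n) * h ^ (m - 1) * (q t ^ k0 * exp (3 * t\<^sup>2 / 16))"
        using C0 c1 h q1[of t] qp[of "n + n + 1"] m by (intro mult_left_mono mult_right_mono) (auto simp: k0_def)
      finally have a2: "2 ^ n * (2 ^ (n * n) * ((CA * h * q t) ^ 0 * (c1 * q t) ^ n * exp (t\<^sup>2 / 8)) * (2 ^ (n * n) * ((C0 * h ^ (m - 1) * q t) ^ 1 * (c1 * q t) ^ n * exp (t\<^sup>2 / 16)))) \<le> \<dots>" .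
      have B1: "?B1 t \<le> K2 * h ^ (m - 1) * (q t ^ k0 * exp (3 * t\<^sup>2 / 16))"
        using add_mono[OF a1 a2] by (simp add: K2_def distrib_right)
      have "(1 + q t) ^ n \<le> (2 * q t) ^ n" using q1[of t] by (intro power_mono) auto
      then have E: "2 ^ (n * n) * (q t ^ 0 * (1 + q t) ^ n * exp (- t\<^sup>2 / 2)) \<le> 2 ^ (n * n) * 2 ^ n * (q t ^ n * exp (- t\<^sup>2 / 2))"
        by (simp add: power_mult_distrib)
      \<comment> \<open>The exponents add up to -5 t^2/16, which is below -t^2/4.\<close>
      have ex: "exp (- t\<^sup>2 / 2) * exp (3 * t\<^sup>2 / 16) \<le> exp (- t\<^sup>2 / 4)" by (simp add: exp_add[symmetric])
      have B10: "0 \<le> ?B1 t" using CA C0 c1 h q1[of t] by simp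
      have "2 ^ n * (2 ^ (n * n) * (q t ^ 0 * (1 + q t) ^ n * exp (- t\<^sup>2 / 2)) * ?B1 t)
        \<le> 2 ^ n * ((2 ^ (n * n) * 2 ^ n * (q t ^ n * exp (- t\<^sup>2 / 2))) * (K2 * h ^ (m - 1) * (q t ^ k0 * exp (3 * t\<^sup>2 / 16))))"
        using q1[of t] by (intro mult_left_mono mult_mono E B1 B10) auto
      also have "\<dots> = K * h ^ (m - 1) * (q t ^ (n + k0) * (exp (- t\<^sup>2 / 2) * exp (3 * t\<^sup>2 / 16)))"
        by (simp add: K_def power_add mult_ac)
      also have "\<dots> \<le> K * h ^ (m - 1) * (q t ^ (n + k0) * exp (- t\<^sup>2 / 4))"
        using K h q1[of t] ex by (intro mult_left_mono) auto
      also have "q t ^ (n + k0) = (1 + \<bar>t\<bar>) ^ ((m + 1) * (n + k0))" by (simp only: q_def power_mult)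
      finally show ?thesis .
    qed
    show "smooth_bd (m + 1) {-(\<epsilon>/h)..\<epsilon>/h} {} (\<lambda>t. K * h ^ (m - 1) * ((1 + \<bar>t\<bar>) ^ ((m + 1) * (n + k0)) * exp (- t\<^sup>2 / 4)))
      (\<lambda>t. exp (l 0 t - of_real (t\<^sup>2 / 2)) - exp (- of_real (t\<^sup>2 / 2)) * (\<Sum>i<m - 1. poly (taylor_poly m (\<lambda>j. l j 0)) (of_real t) ^ i / fact i))"
      using smooth_bd_mono[OF S bound, of "{}"] unfolding feq by (simp add: n_def J_def)
  qed
qed

section \<open>Hermite polynomials and transforms of polynomials times a Gaussian\<close>

lemma norm_poly_le:
  fixes P :: "real poly"
  assumes "degree P \<le> d"
  shows "\<exists>C\<ge>0. \<forall>x. \<bar>poly P x\<bar> \<le> C * (1 + \<bar>x\<bar>) ^ d"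
proof (intro exI[of _ "\<Sum>i\<le>d. \<bar>coeff P i\<bar>"] conjI allI)
  fix x
  have "poly P x = (\<Sum>i\<le>d. coeff P i * x ^ i)"
    unfolding poly_altdef using assms
    by (intro sum.mono_neutral_left) (auto simp: coeff_eq_0)
  also have "\<bar>\<dots>\<bar> \<le> (\<Sum>i\<le>d. \<bar>coeff P i * x ^ i\<bar>)" by (rule sum_abs)
  also have "\<dots> \<le> (\<Sum>i\<le>d. \<bar>coeff P i\<bar> * (1 + \<bar>x\<bar>) ^ d)"
  proof (rule sum_mono)
    fix i assume "i \<in> {..d}"
    have "\<bar>x\<bar> ^ i \<le> (1 + \<bar>x\<bar>) ^ i" by (intro power_mono) auto
    also have "\<dots> \<le> (1 + \<bar>x\<bar>) ^ d" using \<open>i \<in> {..d}\<close> by (intro power_increasing) auto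
    finally show "\<bar>coeff P i * x ^ i\<bar> \<le> \<bar>coeff P i\<bar> * (1 + \<bar>x\<bar>) ^ d"
      by (simp add: abs_mult power_abs mult_left_mono)
  qed
  finally show "\<bar>poly P x\<bar> \<le> (\<Sum>i\<le>d. \<bar>coeff P i\<bar>) * (1 + \<bar>x\<bar>) ^ d" by (simp add: sum_distrib_right)
qed (auto intro: sum_nonneg)

lemma std_normal_density_decay:
  "std_normal_density y * (1 + \<bar>y\<bar>) ^ k \<le> exp (3/2) * ((1 + \<bar>y\<bar>) ^ k / exp (1 + \<bar>y\<bar>))"
proof -
  have "0 \<le> (\<bar>y\<bar> - 1)\<^sup>2" by simp
  then have "\<bar>y\<bar> - 1/2 \<le> y\<^sup>2 / 2" by (simp add: power2_diff)
  then have 1: "exp (- y\<^sup>2 / 2) \<le> exp (3/2 - (1 + \<bar>y\<bar>))" by simp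
  have "1 \<le> sqrt (2 * pi)" using pi_gt3 by simp
  then have "std_normal_density y \<le> 1 * exp (- y\<^sup>2 / 2)"
    unfolding std_normal_density_def by (intro mult_right_mono) auto
  with 1 have "std_normal_density y \<le> exp (3/2) / exp (1 + \<bar>y\<bar>)" unfolding exp_diff by linarith
  from mult_right_mono[OF this, of "(1 + \<bar>y\<bar>) ^ k"] show ?thesis by simp
qed

lemma std_normal_poly_tendsto_0:
  fixes P :: "real poly"
  shows "((\<lambda>y. poly P y * std_normal_density y) \<longlongrightarrow> 0) at_top" "((\<lambda>y. poly P y * std_normal_density y) \<longlongrightarrow> 0) at_bot"
proof -
  define k where "k = degree P"
  obtain C where C: "0 \<le> C" "\<And>x. \<bar>poly P x\<bar> \<le> C * (1 + \<bar>x\<bar>) ^ k"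
    using norm_poly_le[of P k] by (auto simp: k_def)
  have b: "norm (poly P y * std_normal_density y) \<le> C * exp (3/2) * ((1 + \<bar>y\<bar>) ^ k / exp (1 + \<bar>y\<bar>))" for y
  proof -
    have "norm (poly P y * std_normal_density y) = \<bar>poly P y\<bar> * std_normal_density y" by (simp add: abs_mult)
    also have "\<dots> \<le> (C * (1 + \<bar>y\<bar>) ^ k) * std_normal_density y" by (intro mult_right_mono C) simp
    also have "\<dots> = C * (std_normal_density y * (1 + \<bar>y\<bar>) ^ k)" by simp
    also have "\<dots> \<le> C * (exp (3/2) * ((1 + \<bar>y\<bar>) ^ k / exp (1 + \<bar>y\<bar>)))"
      by (intro mult_left_mono std_normal_density_decay C)
    finally show ?thesis by (simp only: mult.assoc)
  qed
  have l: "((\<lambda>y::real. C * exp (3/2) * ((1 + \<bar>y\<bar>) ^ k / exp (1 + \<bar>y\<bar>))) \<longlongrightarrow> 0) F" if "filterlim (\<lambda>y. 1 + \<bar>y\<bar>) at_top F" for F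
    by (intro tendsto_mult_right_zero filterlim_compose[OF tendsto_power_div_exp_0 that])
  have "filterlim (\<lambda>y::real. 1 + \<bar>y\<bar>) at_top at_top"
    by (intro filterlim_tendsto_add_at_top[OF tendsto_const] filterlim_abs_real)
  moreover have *: "filterlim (\<lambda>y::real. 1 + \<bar>y\<bar>) at_top at_bot"
    by (intro filterlim_tendsto_add_at_top[OF tendsto_const] filterlim_at_top_mono[OF filterlim_uminus_at_top_at_bot] always_eventually) auto
  ultimately show "((\<lambda>y. poly P y * std_normal_density y) \<longlongrightarrow> 0) at_top"
    by (intro Lim_null_comparison[OF always_eventually[OF allI[OF b]]] l)
  show "((\<lambda>y. poly P y * std_normal_density y) \<longlongrightarrow> 0) at_bot"
    by (intro Lim_null_comparison[OF always_eventually[OF allI[OF b]]] l *)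
qed

text \<open>The probabilists' Hermite polynomials: the recursion expresses that the derivative of
  He_k \<phi> is -He_(k+1) \<phi>.\<close>

fun hermite :: "nat \<Rightarrow> real poly" where
  "hermite 0 = 1"
| "hermite (Suc k) = [:0, 1:] * hermite k - pderiv (hermite k)"

lemma degree_hermite: "degree (hermite k) \<le> k"
proof (induction k)
  case (Suc k)
  have "degree ([:0, 1:] * hermite k) \<le> Suc k"
    using degree_mult_le[of "[:0, 1:]" "hermite k"] Suc by simp
  moreover have "degree (pderiv (hermite k)) \<le> Suc k" using Suc by (simp add: degree_pderiv)
  ultimately show ?case by (simp add: degree_diff_le)
qed simp

lemma integrable_std_normal_polynomial:
  fixes P :: "real poly"
  shows "integrable lborel (\<lambda>y. poly P y * std_normal_density y)"
proof -
  obtain C where C: "0 \<le> C" "\<And>x. \<bar>poly P x\<bar> \<le> C * (1 + \<bar>x\<bar>) ^ degree P"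
    using norm_poly_le[of P "degree P"] by auto
  have [measurable]: "poly P \<in> borel_measurable borel"
    by (intro borel_measurable_continuous_onI continuous_intros)
  show ?thesis
  proof (rule Bochner_Integration.integrable_bound[OF integrable_mult_right[OF integrable_std_normal_poly, of C "degree P"]])
    have "\<bar>poly P y\<bar> * std_normal_density y \<le> (C * (1 + \<bar>y\<bar>) ^ degree P) * std_normal_density y" for y
      by (intro mult_right_mono C) simp
    then show "AE y in lborel. norm (poly P y * std_normal_density y) \<le> norm (C * (std_normal_density y * (1 + \<bar>y\<bar>) ^ degree P))"
      using C(1) by (auto simp: abs_mult mult_ac)
  qed simp
qed

lemma integrable_exp_hermite:
  "integrable lborel (\<lambda>y. exp (\<i> * of_real t * of_real y) * of_real (poly P y * std_normal_density y))"
proof (rule integrable_bounded_mult[where C = 1])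
  show "integrable lborel (\<lambda>y. complex_of_real (poly P y * std_normal_density y))"
    by (rule integrable_of_real[OF integrable_std_normal_polynomial])
qed auto

text \<open>One integration by parts raises the degree by one: the derivative of the integrand for k
  is i t times itself minus the integrand for k + 1, and its integral over the line is 0 since the
  integrand vanishes at both ends.\<close>

lemma fourier_hermite:
  "(\<integral>y. exp (\<i> * of_real t * of_real y) * of_real (poly (hermite k) y * std_normal_density y) \<partial>lborel)
    = (\<i> * of_real t) ^ k * exp (- of_real (t\<^sup>2 / 2))"
proof (induction k)
  case 0
  have "(\<integral>y. exp (\<i> * of_real t * of_real y) * of_real (std_normal_density y) \<partial>lborel) = char std_normal_distribution t"
    unfolding char_def by (subst integral_density) (auto simp: scaleR_conv_of_real mult_ac)
  then show ?case by (simp add: char_std_normal_distribution exp_of_real[symmetric])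
next
  case (Suc k)
  define F where "F y = exp (\<i> * of_real t * of_real y) * of_real (poly (hermite k) y * std_normal_density y)" for y
  define f where "f y = (\<i> * of_real t) * F y - exp (\<i> * of_real t * of_real y) * of_real (poly (hermite (Suc k)) y * std_normal_density y)" for y
  have Fd: "(F has_vector_derivative f y) (at y)" for y
  proof -
    have 1: "((\<lambda>y. exp (\<i> * of_real t * complex_of_real y)) has_vector_derivative exp (\<i> * of_real t * of_real y) * (\<i> * of_real t)) (at y)"
    proof -
      have "(complex_of_real has_vector_derivative of_real 1) (at y)"
        by (rule has_vector_derivative_of_real[OF DERIV_ident])
      moreover have "((\<lambda>z. exp (\<i> * of_real t * z)) has_field_derivative exp (\<i> * of_real t * of_real y) * (\<i> * of_real t)) (at (of_real y))"
        by (auto intro!: derivative_eq_intros)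
      ultimately show ?thesis using field_vector_diff_chain_at by (fastforce simp: comp_def)
    qed
    have "((\<lambda>y. std_normal_density y) has_real_derivative - y * std_normal_density y) (at y)"
      unfolding std_normal_density_def[abs_def] by (auto intro!: derivative_eq_intros simp: field_simps)
    from DERIV_mult[OF poly_DERIV this, of "hermite k"]
    have "((\<lambda>y. poly (hermite k) y * std_normal_density y) has_real_derivative - (poly (hermite (Suc k)) y * std_normal_density y)) (at y)"
      by (rule DERIV_cong) (simp add: algebra_simps)
    then have 2: "((\<lambda>y. complex_of_real (poly (hermite k) y * std_normal_density y)) has_vector_derivative of_real (- (poly (hermite (Suc k)) y * std_normal_density y))) (at y)"
      by (rule has_vector_derivative_of_real)
    from has_vector_derivative_mult[OF 1 2]
    show ?thesis unfolding F_def[abs_def] f_def by (rule has_vector_derivative_eq_rhs) (simp add: F_def algebra_simps)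
  qed
  have iF: "integrable lborel F" unfolding F_def by (rule integrable_exp_hermite)
  have iS: "integrable lborel (\<lambda>y. exp (\<i> * of_real t * of_real y) * of_real (poly (hermite (Suc k)) y * std_normal_density y))"
    by (rule integrable_exp_hermite)
  have intf: "integrable lborel f"
    unfolding f_def by (intro Bochner_Integration.integrable_diff integrable_mult_right iF iS)
  have cont: "isCont f y" for y
    unfolding f_def[abs_def] F_def[abs_def] std_normal_density_def[abs_def] by (intro continuous_intros) auto
  have lim: "(F \<longlongrightarrow> 0) Fi" if "((\<lambda>y. poly (hermite k) y * std_normal_density y) \<longlongrightarrow> 0) Fi" for Fi
    using tendsto_norm_zero[OF that] by (intro tendsto_norm_zero_cancel[of F]) (simp add: F_def norm_mult abs_mult)
  have "(LBINT y=-\<infinity>..\<infinity>. f y) = 0 - 0"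
  proof (rule interval_integral_FTC_integrable)
    show "((F \<circ> real_of_ereal) \<longlongrightarrow> 0) (at_right (-\<infinity>))"
      using lim[OF std_normal_poly_tendsto_0(2)] by (simp add: ereal_tendsto_simps1)
    show "((F \<circ> real_of_ereal) \<longlongrightarrow> 0) (at_left \<infinity>)"
      using lim[OF std_normal_poly_tendsto_0(1)] by (simp add: ereal_tendsto_simps1)
  qed (use Fd cont intf in \<open>auto simp: set_integrable_def einterval_def\<close>)
  then have "integral\<^sup>L lborel f = 0"
    by (simp add: interval_lebesgue_integral_def set_lebesgue_integral_def einterval_def)
  then have "(\<i> * of_real t) * integral\<^sup>L lborel F - (\<integral>y. exp (\<i> * of_real t * of_real y) * of_real (poly (hermite (Suc k)) y * std_normal_density y) \<partial>lborel) = 0"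
    unfolding f_def[abs_def] Bochner_Integration.integral_diff[OF integrable_mult_right[OF iF] iS]
      integral_mult_right_zero .
  then have "(\<integral>y. exp (\<i> * of_real t * of_real y) * of_real (poly (hermite (Suc k)) y * std_normal_density y) \<partial>lborel)
      = (\<i> * of_real t) * integral\<^sup>L lborel F"
    by (simp only: right_minus_eq)
  moreover have "integral\<^sup>L lborel F = (\<i> * of_real t) ^ k * exp (- of_real (t\<^sup>2 / 2))"
    unfolding F_def[abs_def] by (rule Suc.IH)
  ultimately show ?case by (simp only: power_Suc mult.assoc)
qed

lemma norm_coeff_mult_le:
  fixes P Q :: "complex poly"
  assumes "\<And>j. norm (coeff P j) \<le> a" "\<And>j. norm (coeff Q j) \<le> b" "degree P \<le> d" "0 \<le> b"
  shows "norm (coeff (P * Q) j) \<le> real (d + 1) * a * b"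
proof -
  have a: "0 \<le> a" using assms(1)[of 0] norm_ge_zero order_trans by blast
  have "norm (coeff (P * Q) j) \<le> (\<Sum>i\<le>j. norm (coeff P i * coeff Q (j - i)))"
    unfolding coeff_mult by (rule norm_sum)
  also have "\<dots> \<le> (\<Sum>i\<le>j. if i \<le> d then a * b else 0)"
  proof (rule sum_mono)
    fix i
    show "norm (coeff P i * coeff Q (j - i)) \<le> (if i \<le> d then a * b else 0)"
    proof (cases "i \<le> d")
      case True
      then show ?thesis using assms(1,2) by (auto simp: norm_mult intro!: mult_mono')
    next
      case False
      then have "coeff P i = 0" using assms(3) by (intro coeff_eq_0) simp
      then show ?thesis using False by simp
    qed
  qed
  also have "\<dots> = (\<Sum>i\<in>{i\<in>{..j}. i \<le> d}. a * b)"
    by (subst sum.inter_filter) auto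
  also have "\<dots> \<le> (\<Sum>i\<le>d. a * b)"
    using a assms(4) by (intro sum_mono2) auto
  finally show ?thesis by (simp add: mult.assoc)
qed

text \<open>All powers from the first on remain of the first order in a, which later makes every
  nonconstant coefficient of the Edgeworth polynomial O(h).\<close>

lemma norm_coeff_power_le:
  fixes P :: "complex poly"
  assumes "\<And>j. norm (coeff P j) \<le> a" "degree P \<le> d"
  shows "norm (coeff (P ^ Suc k) j) \<le> a * (real (d + 1) * a) ^ k"
proof (induction k arbitrary: j)
  case 0
  then show ?case using assms by simp
next
  case (Suc k)
  have a: "0 \<le> a" using assms(1)[of 0] norm_ge_zero order_trans by blast
  have "norm (coeff (P * P ^ Suc k) j) \<le> real (d + 1) * a * (a * (real (d + 1) * a) ^ k)"
    using a by (intro norm_coeff_mult_le assms Suc) auto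
  then show ?case by (simp add: mult_ac)
qed

text \<open>A Gaussian times a polynomial with constant term 1 is the Fourier transform of an explicit
  perturbation of the normal density. Only the real part of the perturbation matters later, so the
  coefficients need not satisfy the symmetry that would make the perturbation real.\<close>

lemma fourier_of_polynomial:
  fixes d :: nat
  obtains C where "0 \<le> C" "\<And>P b. degree P \<le> d \<Longrightarrow> coeff P 0 = 1 \<Longrightarrow> (\<And>j. 1 \<le> j \<Longrightarrow> norm (coeff P j) \<le> b) \<Longrightarrow> 0 \<le> b \<Longrightarrow>
    \<exists>Q. Q \<in> borel_measurable borel \<and> (\<forall>x. norm (Q x) \<le> C * b * (1 + \<bar>x\<bar>) ^ d) \<and>
      (\<forall>t. (\<integral>y. exp (\<i> * of_real t * of_real y) * (of_real (std_normal_density y) * (1 + Q y)) \<partial>lborel)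
         = exp (- of_real (t\<^sup>2 / 2)) * poly P (of_real t))"
proof -
  have "\<exists>C\<ge>0. \<forall>x. \<bar>poly (hermite j) x\<bar> \<le> C * (1 + \<bar>x\<bar>) ^ j" for j
    by (rule norm_poly_le[OF degree_hermite])
  then obtain Ch where Ch: "\<And>j. 0 \<le> Ch j" "\<And>j x. \<bar>poly (hermite j) x\<bar> \<le> Ch j * (1 + \<bar>x\<bar>) ^ j"
    by metis
  show ?thesis
  proof (rule that[of "\<Sum>j\<le>d. Ch j"])
    show "0 \<le> (\<Sum>j\<le>d. Ch j)" by (intro sum_nonneg Ch)
    fix P :: "complex poly" and b :: real
    assume dP: "degree P \<le> d" and P0: "coeff P 0 = 1" and Pb: "\<And>j. 1 \<le> j \<Longrightarrow> norm (coeff P j) \<le> b" and b: "0 \<le> b"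
    \<comment> \<open>The transform of He_j \<phi> carries (i t)^j, so the powers of i are divided
      out.\<close>
    define c where "c j = coeff P j / \<i> ^ j" for j
    have nc: "norm (c j) \<le> b" if "1 \<le> j" for j using Pb[OF that] by (simp add: c_def norm_divide norm_power)
    define Q where "Q x = (\<Sum>j=1..d. c j * of_real (poly (hermite j) x))" for x
    have [measurable]: "poly (hermite j) \<in> borel_measurable borel" for j
      by (intro borel_measurable_continuous_onI continuous_intros)
    have m: "Q \<in> borel_measurable borel" unfolding Q_def[abs_def] by measurable
    have bd: "norm (Q x) \<le> (\<Sum>j\<le>d. Ch j) * b * (1 + \<bar>x\<bar>) ^ d" for x
    proof -
      have "norm (Q x) \<le> (\<Sum>j=1..d. norm (c j * of_real (poly (hermite j) x)))"
        unfolding Q_def by (rule norm_sum)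
      also have "\<dots> \<le> (\<Sum>j=1..d. b * (Ch j * (1 + \<bar>x\<bar>) ^ d))"
      proof (rule sum_mono)
        fix j assume j: "j \<in> {1..d}"
        have "Ch j * (1 + \<bar>x\<bar>) ^ j \<le> Ch j * (1 + \<bar>x\<bar>) ^ d"
          using j by (intro mult_left_mono power_increasing Ch) auto
        then have "\<bar>poly (hermite j) x\<bar> \<le> Ch j * (1 + \<bar>x\<bar>) ^ d" using Ch(2)[of j x] by linarith
        then show "norm (c j * of_real (poly (hermite j) x)) \<le> b * (Ch j * (1 + \<bar>x\<bar>) ^ d)"
          using nc[of j] j by (auto simp: norm_mult intro!: mult_mono')
      qed
      also have "\<dots> \<le> (\<Sum>j\<le>d. b * (Ch j * (1 + \<bar>x\<bar>) ^ d))"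
        using b Ch(1) by (intro sum_mono2) auto
      also have "\<dots> = (\<Sum>j\<le>d. Ch j) * b * (1 + \<bar>x\<bar>) ^ d"
        unfolding sum_distrib_right by (intro sum.cong) simp_all
      finally show ?thesis .
    qed
    have ft: "(\<integral>y. exp (\<i> * of_real t * of_real y) * (of_real (std_normal_density y) * (1 + Q y)) \<partial>lborel)
         = exp (- of_real (t\<^sup>2 / 2)) * poly P (of_real t)" for t
    proof -
      have c0: "c 0 = 1" using P0 by (simp add: c_def)
      have "exp (\<i> * of_real t * of_real y) * (of_real (std_normal_density y) * (1 + Q y))
        = (\<Sum>j\<le>d. c j * (exp (\<i> * of_real t * of_real y) * of_real (poly (hermite j) y * std_normal_density y)))" for y
      proof -
        have "1 + Q y = (\<Sum>j\<le>d. c j * of_real (poly (hermite j) y))"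
          unfolding Q_def atMost_atLeast0 by (subst sum.atLeast_Suc_atMost) (auto simp: c0)
        then show ?thesis by (simp add: sum_distrib_left mult_ac)
      qed
      then have "(\<integral>y. exp (\<i> * of_real t * of_real y) * (of_real (std_normal_density y) * (1 + Q y)) \<partial>lborel)
        = (\<Sum>j\<le>d. c j * ((\<i> * of_real t) ^ j * exp (- of_real (t\<^sup>2 / 2))))"
        by (simp only: Bochner_Integration.integral_sum integrable_mult_right integrable_exp_hermite integral_mult_right_zero fourier_hermite)
      also have "\<dots> = exp (- of_real (t\<^sup>2 / 2)) * (\<Sum>j\<le>d. coeff P j * of_real t ^ j)"
        unfolding c_def sum_distrib_left by (intro sum.cong) (simp_all add: power_mult_distrib)
      also have "(\<Sum>j\<le>d. coeff P j * of_real t ^ j) = poly P (of_real t)"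
        unfolding poly_altdef using dP by (intro sum.mono_neutral_right) (auto simp: coeff_eq_0)
      finally show ?thesis .
    qed
    show "\<exists>Q. Q \<in> borel_measurable borel \<and> (\<forall>x. norm (Q x) \<le> (\<Sum>j\<le>d. Ch j) * b * (1 + \<bar>x\<bar>) ^ d) \<and>
      (\<forall>t. (\<integral>y. exp (\<i> * of_real t * of_real y) * (of_real (std_normal_density y) * (1 + Q y)) \<partial>lborel)
         = exp (- of_real (t\<^sup>2 / 2)) * poly P (of_real t))"
      using m bd ft by blast
  qed
qed

section \<open>From transforms to smoothed densities\<close>

lemma integrable_gauss_poly: "integrable lborel (\<lambda>t::real. (1 + \<bar>t\<bar>) ^ k * exp (- t\<^sup>2 / 4))"
proof -
  have "integrable lborel (\<lambda>t. std_normal_density (0 + (1 / sqrt 2) * t) * (1 + \<bar>0 + (1 / sqrt 2) * t\<bar>) ^ k)"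
    by (rule lborel_integrable_real_affine[OF integrable_std_normal_poly]) simp
  then have i: "integrable lborel (\<lambda>t. (sqrt (2 * pi) * 2 ^ k) * (std_normal_density (t / sqrt 2) * (1 + \<bar>t / sqrt 2\<bar>) ^ k))"
    by (intro integrable_mult_right) simp
  show ?thesis
  proof (rule Bochner_Integration.integrable_bound[OF i])
    have "norm ((1 + \<bar>t\<bar>) ^ k * exp (- t\<^sup>2 / 4)) \<le> norm ((sqrt (2 * pi) * 2 ^ k) * (std_normal_density (t / sqrt 2) * (1 + \<bar>t / sqrt 2\<bar>) ^ k))" for t
    proof -
      have "sqrt 2 \<le> (2::real)" using real_sqrt_le_mono[of 2 4] by simp
      then have "\<bar>t\<bar> * sqrt 2 \<le> \<bar>t\<bar> * 2" by (rule mult_left_mono) simp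
      then have "\<bar>t\<bar> \<le> 2 * \<bar>t / sqrt 2\<bar>" by (simp add: abs_divide field_simps)
      then have "1 + \<bar>t\<bar> \<le> 2 * (1 + \<bar>t / sqrt 2\<bar>)" by simp
      then have "(1 + \<bar>t\<bar>) ^ k \<le> (2 * (1 + \<bar>t / sqrt 2\<bar>)) ^ k" by (intro power_mono) auto
      then have "(1 + \<bar>t\<bar>) ^ k * exp (- t\<^sup>2 / 4) \<le> (2 ^ k * (1 + \<bar>t / sqrt 2\<bar>) ^ k) * exp (- t\<^sup>2 / 4)"
        unfolding power_mult_distrib by (intro mult_right_mono) auto
      also have "\<dots> = (sqrt (2 * pi) * 2 ^ k) * (std_normal_density (t / sqrt 2) * (1 + \<bar>t / sqrt 2\<bar>) ^ k)"
        by (simp add: std_normal_density_def power_divide)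
      finally show ?thesis by (simp add: abs_mult)
    qed
    then show "AE t in lborel. norm ((1 + \<bar>t\<bar>) ^ k * exp (- t\<^sup>2 / 4)) \<le> norm ((sqrt (2 * pi) * 2 ^ k) * (std_normal_density (t / sqrt 2) * (1 + \<bar>t / sqrt 2\<bar>) ^ k))"
      by simp
  qed simp
qed

lemma one_plus_power_le:
  fixes x :: real
  assumes "0 \<le> x"
  shows "(1 + x) ^ n \<le> 2 ^ n * (1 + x ^ n)"
proof -
  have "(1 + x) ^ n \<le> (2 * max 1 x) ^ n" using assms by (intro power_mono) auto
  also have "\<dots> = 2 ^ n * max 1 x ^ n" by (rule power_mult_distrib)
  also have "\<dots> \<le> 2 ^ n * (1 + x ^ n)" using assms by (intro mult_left_mono) (auto simp: max_def)
  finally show ?thesis .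
qed

text \<open>The Fourier inversion step: closeness of two transforms on the support of the (scaled) bump,
  together with their derivatives, becomes weighted pointwise closeness after smoothing.\<close>

lemma smoothed_difference_bound:
  fixes n k :: nat and \<epsilon> H :: real
  assumes n: "1 \<le> n" and \<epsilon>: "0 < \<epsilon>" and H: "0 < H"
  obtains C where "0 \<le> C" "\<And>h K M1 M2 c1 c2 x. 0 < h \<Longrightarrow> h \<le> H \<Longrightarrow> 0 \<le> K \<Longrightarrow>
    sigma_finite_measure M1 \<Longrightarrow> sets M1 = sets borel \<Longrightarrow> integrable M1 c1 \<Longrightarrow>
    sigma_finite_measure M2 \<Longrightarrow> sets M2 = sets borel \<Longrightarrow> integrable M2 c2 \<Longrightarrow>
    smooth_bd n {-(\<epsilon>/h)..\<epsilon>/h} {} (\<lambda>t. K * ((1 + \<bar>t\<bar>) ^ k * exp (- t\<^sup>2 / 4)))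
      (\<lambda>t. (\<integral>y. exp (\<i> * of_real t * of_real y) * c1 y \<partial>M1) - (\<integral>y. exp (\<i> * of_real t * of_real y) * c2 y \<partial>M2)) \<Longrightarrow>
    (1 + \<bar>x\<bar>) ^ n * norm ((\<integral>y. of_real (smoothing_kernel n ((x - y) / (2 * h / \<epsilon>)) / (2 * h / \<epsilon>)) * c1 y \<partial>M1)
      - (\<integral>y. of_real (smoothing_kernel n ((x - y) / (2 * h / \<epsilon>)) / (2 * h / \<epsilon>)) * c2 y \<partial>M2)) \<le> C * K"
proof -
  obtain Cb where Cb: "smooth_bd n UNIV {t. 1 \<le> \<bar>t\<bar>} (\<lambda>_. Cb) (\<lambda>t. of_real (bump n t))"
    using smooth_bd_bump by blast
  have Cb0: "0 \<le> Cb" using smooth_bd_nonneg[OF Cb, of 0] by simp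
  define \<Gamma> :: real where "\<Gamma> = (\<integral>t. (1 + \<bar>t\<bar>) ^ k * exp (- t\<^sup>2 / 4) \<partial>lborel)"
  have \<Gamma>: "0 \<le> \<Gamma>" unfolding \<Gamma>_def by (intro integral_nonneg_AE) auto
  \<comment> \<open>Bounds the first n derivatives of the rescaled bump for every admissible h, as
    the scale \<eta> is at most 2 H/\<epsilon>.\<close>
  define Cm where "Cm = Cb * max 1 (2 * H / \<epsilon>) ^ n"
  have Cm: "0 \<le> Cm" using Cb0 by (simp add: Cm_def)
  define C1 where "C1 = 2 ^ n * Cm * \<Gamma>"
  define C where "C = 1 / smoothing_kernel_mass n * (2 * (2 ^ n * (C1 + C1)))"
  have C1: "0 \<le> C1" using Cm \<Gamma> by (simp add: C1_def)
  have km: "0 < smoothing_kernel_mass n" by (rule smoothing_kernel_mass_pos[OF n])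
  have C: "0 \<le> C" using C1 km by (simp add: C_def)
  show ?thesis
  proof (rule that[OF C])
    fix h K :: real and M1 M2 :: "real measure" and c1 c2 :: "real \<Rightarrow> complex" and x :: real
    assume h: "0 < h" "h \<le> H" and K: "0 \<le> K"
      and M1: "sigma_finite_measure M1" "sets M1 = sets borel" and c1: "integrable M1 c1"
      and M2: "sigma_finite_measure M2" "sets M2 = sets borel" and c2: "integrable M2 c2"
      and sm: "smooth_bd n {-(\<epsilon>/h)..\<epsilon>/h} {} (\<lambda>t. K * ((1 + \<bar>t\<bar>) ^ k * exp (- t\<^sup>2 / 4)))
        (\<lambda>t. (\<integral>y. exp (\<i> * of_real t * of_real y) * c1 y \<partial>M1) - (\<integral>y. exp (\<i> * of_real t * of_real y) * c2 y \<partial>M2))"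
    define \<eta> where "\<eta> = 2 * h / \<epsilon>"
    have \<eta>: "0 < \<eta>" using h \<epsilon> by (simp add: \<eta>_def)
    \<comment> \<open>The scale \<eta> is chosen so that \<eta> T = 2. For |r| at most 1 and |t| at
      least T the argument r + \<eta> t then has modulus at least 1, so the bump cuts the integral
      off exactly where control of the transforms ends.\<close>
    define T where "T = \<epsilon> / h"
    have T: "0 < T" "\<eta> * T = 2" using h \<epsilon> by (auto simp: T_def \<eta>_def)
    define D1 where "D1 t = (\<integral>y. exp (\<i> * of_real t * of_real y) * c1 y \<partial>M1)" for t
    define D2 where "D2 t = (\<integral>y. exp (\<i> * of_real t * of_real y) * c2 y \<partial>M2)" for t
    have Db: "norm (\<integral>y. exp (\<i> * of_real t * of_real y) * c y \<partial>M) \<le> (\<integral>y. norm (c y) \<partial>M)" for c :: "real \<Rightarrow> complex" and M and t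
      using integral_norm_bound[of M "\<lambda>y. exp (\<i> * of_real t * of_real y) * c y"] by (simp add: norm_mult)
    have Db1: "norm (D1 t) \<le> (\<integral>y. norm (c1 y) \<partial>M1)" for t unfolding D1_def by (rule Db)
    have Db2: "norm (D2 t) \<le> (\<integral>y. norm (c2 y) \<partial>M2)" for t unfolding D2_def by (rule Db)
    note [measurable_cong] = M1(2) M2(2)
    have [measurable]: "c1 \<in> borel_measurable borel" "c2 \<in> borel_measurable borel"
      using borel_measurable_integrable[OF c1] borel_measurable_integrable[OF c2] by measurable
    interpret M1: sigma_finite_measure M1 by fact
    interpret M2: sigma_finite_measure M2 by fact
    have [measurable]: "D1 \<in> borel_measurable borel" "D2 \<in> borel_measurable borel"
      unfolding D1_def[abs_def] D2_def[abs_def] by measurable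
    define E where "E t = exp (- (\<i> * of_real x) * of_real t)" for t :: real
    have [measurable]: "E \<in> borel_measurable borel" unfolding E_def by measurable
    have nE: "norm (E t) = 1" for t unfolding E_def by simp
    have int: "integrable lborel (\<lambda>t. E t * (D t * of_real (bump n (r + \<eta> * t))))"
      if [measurable]: "D \<in> borel_measurable borel" and "\<And>t. norm (D t) \<le> B" for D :: "real \<Rightarrow> complex" and B r
    proof -
      have "integrable lborel (\<lambda>t. (E t * D t) * of_real (bump n (r + \<eta> * t)))"
      proof (rule integrable_bounded_mult[where C = B])
        show "integrable lborel (\<lambda>t. complex_of_real (bump n (r + \<eta> * t)))"
          using \<eta> by (intro integrable_of_real integrable_bump_affine) auto
        show "norm (E t * D t) \<le> B" for t using that(2) by (simp add: norm_mult nE)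
      qed measurable
      then show ?thesis by (simp only: mult.assoc)
    qed
    have int1: "integrable lborel (\<lambda>t. E t * (D1 t * of_real (bump n (r + \<eta> * t))))" for r
      by (rule int) (measurable, rule Db1)
    have int2: "integrable lborel (\<lambda>t. E t * (D2 t * of_real (bump n (r + \<eta> * t))))" for r
      by (rule int) (measurable, rule Db2)
    define I1 where "I1 r = (\<integral>t. E t * (D1 t * of_real (bump n (r + \<eta> * t))) \<partial>lborel)" for r
    define I2 where "I2 r = (\<integral>t. E t * (D2 t * of_real (bump n (r + \<eta> * t))) \<partial>lborel)" for r
    have [measurable]: "I1 \<in> borel_measurable borel" "I2 \<in> borel_measurable borel"
      unfolding I1_def[abs_def] I2_def[abs_def] by measurable
    have Ib: "norm (\<integral>t. E t * (D t * of_real (bump n (r + \<eta> * t))) \<partial>lborel) \<le> B * (2 / \<eta>)"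
      if [measurable]: "D \<in> borel_measurable borel" and B: "\<And>t. norm (D t) \<le> B" for D :: "real \<Rightarrow> complex" and B r
    proof -
      have B0: "0 \<le> B" using B[of 0] norm_ge_zero order_trans by blast
      have "norm (\<integral>t. E t * (D t * of_real (bump n (r + \<eta> * t))) \<partial>lborel) \<le> (\<integral>t. norm (E t * (D t * of_real (bump n (r + \<eta> * t)))) \<partial>lborel)"
        by (rule integral_norm_bound)
      also have "\<dots> \<le> (\<integral>t. B * bump n (r + \<eta> * t) \<partial>lborel)"
      proof (rule integral_mono)
        show "integrable lborel (\<lambda>t. norm (E t * (D t * of_real (bump n (r + \<eta> * t)))))"
          by (rule integrable_norm[OF int[OF that]])
        show "integrable lborel (\<lambda>t. B * bump n (r + \<eta> * t))"
          using \<eta> by (intro integrable_mult_right integrable_bump_affine) auto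
        show "norm (E t * (D t * of_real (bump n (r + \<eta> * t)))) \<le> B * bump n (r + \<eta> * t)" for t
          using B[of t] by (simp add: norm_mult nE mult_right_mono)
      qed
      also have "\<dots> \<le> B * (2 / \<eta>)" unfolding integral_mult_right_zero by (rule mult_left_mono[OF integral_bump_affine[OF \<eta>] B0])
      finally show ?thesis .
    qed
    have iI1: "integrable lborel (\<lambda>r. of_real (bump n r) * I1 r)"
    proof -
      have "integrable lborel (\<lambda>r. I1 r * of_real (bump n r))"
        unfolding I1_def by (rule integrable_bounded_mult[OF integrable_of_real[OF integrable_bump] _ Ib])
          (measurable, rule Db1)
      then show ?thesis by (simp only: mult.commute)
    qed
    have iI2: "integrable lborel (\<lambda>r. of_real (bump n r) * I2 r)"
    proof -
      have "integrable lborel (\<lambda>r. I2 r * of_real (bump n r))"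
        unfolding I2_def by (rule integrable_bounded_mult[OF integrable_of_real[OF integrable_bump] _ Ib])
          (measurable, rule Db2)
      then show ?thesis by (simp only: mult.commute)
    qed
    have dI: "(1 + \<bar>x\<bar>) ^ n * norm (I1 r - I2 r) \<le> 2 ^ n * (C1 + C1) * K" if r: "\<bar>r\<bar> \<le> 1" for r
    proof -
      define F where "F t = (D1 t - D2 t) * of_real (bump n (\<eta> * t + r))" for t
      have "I1 r - I2 r = (\<integral>t. E t * (D1 t * of_real (bump n (r + \<eta> * t))) - E t * (D2 t * of_real (bump n (r + \<eta> * t))) \<partial>lborel)"
        unfolding I1_def I2_def by (rule Bochner_Integration.integral_diff[symmetric, OF int1 int2])
      also have "(\<lambda>t. E t * (D1 t * of_real (bump n (r + \<eta> * t))) - E t * (D2 t * of_real (bump n (r + \<eta> * t)))) = (\<lambda>t. E t * F t)"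
        by (simp add: fun_eq_iff F_def algebra_simps)
      finally have dd: "I1 r - I2 r = (\<integral>t. E t * F t \<partial>lborel)" .
      have intF: "integrable lborel (\<lambda>t. E t * F t)"
        using Bochner_Integration.integrable_diff[OF int1[of r] int2[of r]] by (simp add: F_def algebra_simps)
      have zero: "E t * F t = 0" if "t \<notin> {-T..T}" for t
      proof -
        have "T < \<bar>t\<bar>" using that by auto
        then have "\<eta> * T < \<eta> * \<bar>t\<bar>" using \<eta> by simp
        then have "2 < \<bar>\<eta> * t\<bar>" using T(2) \<eta> by (simp add: abs_mult)
        then have "1 \<le> \<bar>\<eta> * t + r\<bar>" using r by linarith
        then show ?thesis by (simp add: F_def bump_eq_0)
      qed
      note hk = lborel_integral_eq_integral[where A = "{-T..T}", OF intF zero]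
      have "smooth_bd n {-T..T} {t. \<eta> * t + r \<in> {t. 1 \<le> \<bar>t\<bar>}} (\<lambda>_. Cb * max 1 \<bar>\<eta>\<bar> ^ n) (\<lambda>t. of_real (bump n (\<eta> * t + r)))"
        by (rule smooth_bd_affine[OF Cb])
      then have "smooth_bd n {-T..T} {-T, T} (\<lambda>_. Cm) (\<lambda>t. of_real (bump n (\<eta> * t + r)))"
      proof (rule smooth_bd_mono)
        have "\<eta> \<le> 2 * H / \<epsilon>" using h \<epsilon> by (simp add: \<eta>_def divide_right_mono)
        then have "max 1 \<bar>\<eta>\<bar> \<le> max 1 (2 * H / \<epsilon>)" using \<eta> by auto
        then show "Cb * max 1 \<bar>\<eta>\<bar> ^ n \<le> Cm" unfolding Cm_def using Cb0 by (intro mult_left_mono power_mono) auto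
        show "{-T, T} \<subseteq> {t. \<eta> * t + r \<in> {t. 1 \<le> \<bar>t\<bar>}}" using T r by (auto simp: abs_le_iff)
      qed
      from smooth_bd_mult[OF sm[folded D1_def D2_def T_def] this]
      have sF: "smooth_bd n {-T..T} {-T, T} (\<lambda>t. 2 ^ n * (K * ((1 + \<bar>t\<bar>) ^ k * exp (- t\<^sup>2 / 4)) * Cm)) F"
        unfolding F_def .
      define B where "B t = 2 ^ n * (K * ((1 + \<bar>t\<bar>) ^ k * exp (- t\<^sup>2 / 4)) * Cm)" for t
      have iB: "integrable lborel B" 
        unfolding B_def by (intro integrable_mult_right integrable_mult_left integrable_gauss_poly)
      have B0: "0 \<le> B t" for t using K Cm by (simp add: B_def)
      have Bcont: "B integrable_on {-T..T}"
        unfolding B_def by (intro integrable_continuous_interval continuous_intros) auto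
      have "integral {-T..T} B \<le> integral UNIV B"
        using has_integral_integral_lborel[OF iB] Bcont B0 by (intro integral_subset_le) (auto simp: integrable_on_def)
      also have "\<dots> = integral\<^sup>L lborel B" using has_integral_integral_lborel[OF iB] by (rule integral_unique)
      also have "\<dots> = C1 * K" unfolding B_def C1_def \<Gamma>_def by simp
      finally have Bint: "integral {-T..T} B \<le> C1 * K" .
      \<comment> \<open>The decay estimate is used with n and with 0 integrations by parts; the two
        together control the weight (1 + |x|)^n.\<close>
      have "\<bar>x\<bar> ^ n * norm (integral {-T..T} (\<lambda>t. E t * F t)) \<le> integral {-T..T} B"
        unfolding E_def by (rule fourier_decay[OF sF[folded B_def]]) (use T hk Bcont in \<open>auto simp: E_def\<close>)
      moreover have "\<bar>x\<bar> ^ 0 * norm (integral {-T..T} (\<lambda>t. E t * F t)) \<le> integral {-T..T} B"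
        unfolding E_def by (rule fourier_decay[OF smooth_bd_le[OF sF[folded B_def]]]) (use T hk Bcont in \<open>auto simp: E_def\<close>)
      ultimately have b2: "norm (I1 r - I2 r) \<le> C1 * K" "\<bar>x\<bar> ^ n * norm (I1 r - I2 r) \<le> C1 * K"
        using Bint hk(2) dd by auto
      have "(1 + \<bar>x\<bar>) ^ n * norm (I1 r - I2 r) \<le> (2 ^ n * (1 + \<bar>x\<bar> ^ n)) * norm (I1 r - I2 r)"
        by (intro mult_right_mono one_plus_power_le) auto
      also have "\<dots> = 2 ^ n * (norm (I1 r - I2 r) + \<bar>x\<bar> ^ n * norm (I1 r - I2 r))" by (simp add: algebra_simps)
      also have "\<dots> \<le> 2 ^ n * (C1 * K + C1 * K)" using b2 by (intro mult_left_mono add_mono) auto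
      finally show ?thesis by (simp add: algebra_simps)
    qed
    define W where "W = (1 + \<bar>x\<bar>) ^ n"
    have W: "0 < W" by (simp add: W_def add_pos_nonneg)
    have r1: "(\<integral>y. of_real (smoothing_kernel n ((x - y) / \<eta>) / \<eta>) * c1 y \<partial>M1) = 1 / smoothing_kernel_mass n * (\<integral>r. of_real (bump n r) * I1 r \<partial>lborel)"
      unfolding I1_def E_def D1_def by (rule smoothing_kernel_fourier[OF M1 c1 \<eta> n])
    have r2: "(\<integral>y. of_real (smoothing_kernel n ((x - y) / \<eta>) / \<eta>) * c2 y \<partial>M2) = 1 / smoothing_kernel_mass n * (\<integral>r. of_real (bump n r) * I2 r \<partial>lborel)"
      unfolding I2_def E_def D2_def by (rule smoothing_kernel_fourier[OF M2 c2 \<eta> n])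
    have "W * norm ((\<integral>y. of_real (smoothing_kernel n ((x - y) / \<eta>) / \<eta>) * c1 y \<partial>M1) - (\<integral>y. of_real (smoothing_kernel n ((x - y) / \<eta>) / \<eta>) * c2 y \<partial>M2))
      = 1 / smoothing_kernel_mass n * (W * norm (\<integral>r. of_real (bump n r) * I1 r - of_real (bump n r) * I2 r \<partial>lborel))"
    proof -
      have sc: "W * norm (of_real (1 / smoothing_kernel_mass n) * a - of_real (1 / smoothing_kernel_mass n) * b) = 1 / smoothing_kernel_mass n * (W * norm (a - b))" for a b :: complex
        unfolding right_diff_distrib[symmetric] norm_mult norm_of_real using km by simp
      show ?thesis unfolding r1 r2 Bochner_Integration.integral_diff[OF iI1 iI2] by (rule sc)
    qed
    also have "\<dots> \<le> 1 / smoothing_kernel_mass n * (2 * (2 ^ n * (C1 + C1) * K))"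
    proof (intro mult_left_mono)
      have "W * norm (\<integral>r. of_real (bump n r) * I1 r - of_real (bump n r) * I2 r \<partial>lborel)
        \<le> W * (\<integral>r. norm (of_real (bump n r) * I1 r - of_real (bump n r) * I2 r) \<partial>lborel)"
        using W by (intro mult_left_mono integral_norm_bound) auto
      also have "\<dots> = (\<integral>r. W * norm (of_real (bump n r) * I1 r - of_real (bump n r) * I2 r) \<partial>lborel)" by simp
      also have "\<dots> \<le> (\<integral>r. (2 ^ n * (C1 + C1) * K) * indicator {-1..1::real} r \<partial>lborel)"
      proof (rule integral_mono)
        show "integrable lborel (\<lambda>r. W * norm (of_real (bump n r) * I1 r - of_real (bump n r) * I2 r))"
          by (intro integrable_mult_right integrable_norm Bochner_Integration.integrable_diff iI1 iI2)
        show "integrable lborel (\<lambda>r. (2 ^ n * (C1 + C1) * K) * indicator {-1..1::real} r)"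
          by (intro integrable_mult_right) simp
        fix r :: real
        \<comment> \<open>Outside [-1, 1] the outer bump is 0, so the estimate for the inner
          integral is needed only for |r| at most 1.\<close>
        show "W * norm (of_real (bump n r) * I1 r - of_real (bump n r) * I2 r) \<le> (2 ^ n * (C1 + C1) * K) * indicator {-1..1} r"
        proof (cases "\<bar>r\<bar> \<le> 1")
          case True
          have "W * norm (of_real (bump n r) * I1 r - of_real (bump n r) * I2 r) = bump n r * (W * norm (I1 r - I2 r))"
            unfolding right_diff_distrib[symmetric] norm_mult norm_of_real by simp
          also have "\<dots> \<le> 1 * (2 ^ n * (C1 + C1) * K)"
            by (rule mult_mono[OF bump_le_1]) (use dI[OF True] W in \<open>auto simp: W_def\<close>)
          finally show ?thesis using True by (auto simp: abs_le_iff)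
        next
          case False
          then show ?thesis using K C1 by (simp add: bump_eq_0)
        qed
      qed
      also have "\<dots> = 2 * (2 ^ n * (C1 + C1) * K)" by simp
      finally show "W * norm (\<integral>r. of_real (bump n r) * I1 r - of_real (bump n r) * I2 r \<partial>lborel) \<le> 2 * (2 ^ n * (C1 + C1) * K)" .
    qed (use km in simp)
    also have "\<dots> = C * K" by (simp add: C_def)
    finally show "(1 + \<bar>x\<bar>) ^ n * norm ((\<integral>y. of_real (smoothing_kernel n ((x - y) / (2 * h / \<epsilon>)) / (2 * h / \<epsilon>)) * c1 y \<partial>M1)
      - (\<integral>y. of_real (smoothing_kernel n ((x - y) / (2 * h / \<epsilon>)) / (2 * h / \<epsilon>)) * c2 y \<partial>M2)) \<le> C * K"
      unfolding W_def \<eta>_def .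
  qed
qed

text \<open>The Edgeworth polynomial P is the truncated exponential series of the Taylor polynomial
  A. As A has no constant term and O(h) coefficients, P has constant term 1 and all its other
  coefficients are O(h); this is the size of q. Its value 1 at t = 0 is also what gives q Gaussian
  mean 0.\<close>

lemma smoothed_density_expansion:
  fixes m :: nat and C0 \<epsilon> H :: real
  assumes m: "2 \<le> m" and C0: "0 \<le> C0" and \<epsilon>: "0 < \<epsilon>" "\<epsilon> \<le> 1" "C0 * \<epsilon> \<le> 1 / 16" and H: "0 < H"
  obtains K D where "0 \<le> K" "\<And>h l \<mu>. 0 < h \<Longrightarrow> h \<le> H \<Longrightarrow> real_distribution \<mu> \<Longrightarrow>
    (\<And>j t. j \<le> m \<Longrightarrow> t \<in> {-(\<epsilon>/h)..\<epsilon>/h} \<Longrightarrow> (l j has_vector_derivative l (Suc j) t) (at t within {-(\<epsilon>/h)..\<epsilon>/h})) \<Longrightarrow>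
    (\<And>j t. 3 \<le> j \<Longrightarrow> j \<le> m + 1 \<Longrightarrow> t \<in> {-(\<epsilon>/h)..\<epsilon>/h} \<Longrightarrow> norm (l j t) \<le> C0 * h ^ (j - 2)) \<Longrightarrow>
    (\<And>j. j < 3 \<Longrightarrow> l j 0 = 0) \<Longrightarrow>
    (\<And>t. t \<in> {-(\<epsilon>/h)..\<epsilon>/h} \<Longrightarrow> char \<mu> t = exp (l 0 t - of_real (t\<^sup>2 / 2))) \<Longrightarrow>
    \<exists>q. q \<in> borel_measurable borel \<and> (\<forall>x. \<bar>q x\<bar> \<le> K * h * (1 + \<bar>x\<bar>) ^ D) \<and>
      (\<integral>x. std_normal_density x * q x \<partial>lborel) = 0 \<and>
      (\<forall>x. (1 + \<bar>x\<bar>) ^ (m + 1) * \<bar>(\<integral>y. smoothing_kernel (m + 1) ((x - y) / (2 * h / \<epsilon>)) / (2 * h / \<epsilon>) \<partial>\<mu>)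
        - (\<integral>y. smoothing_kernel (m + 1) ((x - y) / (2 * h / \<epsilon>)) / (2 * h / \<epsilon>) * (std_normal_density y * (1 + q y)) \<partial>lborel)\<bar> \<le> K * h ^ (m - 1))"
proof -
  show ?thesis
  proof (rule edgeworth_error[OF m C0 \<epsilon> H])
  fix KE k
  assume KE: "0 \<le> KE" "\<And>h l. 0 < h \<Longrightarrow> h \<le> H \<Longrightarrow>
    (\<And>j t. j \<le> m \<Longrightarrow> t \<in> {-(\<epsilon>/h)..\<epsilon>/h} \<Longrightarrow> (l j has_vector_derivative l (Suc j) t) (at t within {-(\<epsilon>/h)..\<epsilon>/h})) \<Longrightarrow>
    (\<And>j t. 3 \<le> j \<Longrightarrow> j \<le> m + 1 \<Longrightarrow> t \<in> {-(\<epsilon>/h)..\<epsilon>/h} \<Longrightarrow> norm (l j t) \<le> C0 * h ^ (j - 2)) \<Longrightarrow>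
    (\<And>j. j < 3 \<Longrightarrow> l j 0 = 0) \<Longrightarrow>
    smooth_bd (m + 1) {-(\<epsilon>/h)..\<epsilon>/h} {} (\<lambda>t. KE * h ^ (m - 1) * ((1 + \<bar>t\<bar>) ^ k * exp (- t\<^sup>2 / 4)))
      (\<lambda>t. exp (l 0 t - of_real (t\<^sup>2 / 2)) - exp (- of_real (t\<^sup>2 / 2)) * (\<Sum>i<m - 1. poly (taylor_poly m (\<lambda>j. l j 0)) (of_real t) ^ i / fact i))"
  \<comment> \<open>A has degree at most m and the highest power in the truncated series is m -
    2.\<close>
  define D where "D = m * (m - 2)"
  show ?thesis
  proof (rule smoothed_difference_bound[where n = "m + 1" and k = k, OF le_add2 \<epsilon>(1) H])
  fix CD
  assume CD: "0 \<le> CD" "\<And>h K M1 M2 c1 c2 x. 0 < h \<Longrightarrow> h \<le> H \<Longrightarrow> 0 \<le> K \<Longrightarrow>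
    sigma_finite_measure M1 \<Longrightarrow> sets M1 = sets borel \<Longrightarrow> integrable M1 c1 \<Longrightarrow>
    sigma_finite_measure M2 \<Longrightarrow> sets M2 = sets borel \<Longrightarrow> integrable M2 c2 \<Longrightarrow>
    smooth_bd (m + 1) {-(\<epsilon>/h)..\<epsilon>/h} {} (\<lambda>t. K * ((1 + \<bar>t\<bar>) ^ k * exp (- t\<^sup>2 / 4)))
      (\<lambda>t. (\<integral>y. exp (\<i> * of_real t * of_real y) * c1 y \<partial>M1) - (\<integral>y. exp (\<i> * of_real t * of_real y) * c2 y \<partial>M2)) \<Longrightarrow>
    (1 + \<bar>x\<bar>) ^ (m + 1) * norm ((\<integral>y. of_real (smoothing_kernel (m + 1) ((x - y) / (2 * h / \<epsilon>)) / (2 * h / \<epsilon>)) * c1 y \<partial>M1)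
      - (\<integral>y. of_real (smoothing_kernel (m + 1) ((x - y) / (2 * h / \<epsilon>)) / (2 * h / \<epsilon>)) * c2 y \<partial>M2)) \<le> CD * K"
  show ?thesis
  proof (rule fourier_of_polynomial[where d = D])
  fix CP
  assume CP: "0 \<le> CP" "\<And>P b. degree P \<le> D \<Longrightarrow> coeff P 0 = 1 \<Longrightarrow> (\<And>j. 1 \<le> j \<Longrightarrow> norm (coeff P j) \<le> b) \<Longrightarrow> 0 \<le> b \<Longrightarrow>
    \<exists>Q. Q \<in> borel_measurable borel \<and> (\<forall>x. norm (Q x) \<le> CP * b * (1 + \<bar>x\<bar>) ^ D) \<and>
      (\<forall>t. (\<integral>y. exp (\<i> * of_real t * of_real y) * (of_real (std_normal_density y) * (1 + Q y)) \<partial>lborel)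
         = exp (- of_real (t\<^sup>2 / 2)) * poly P (of_real t))"
  define ca where "ca = C0 * (1 + H) ^ m"
  have ca: "0 \<le> ca" using C0 H by (simp add: ca_def)
  define cb where "cb = real m * (ca * (1 + real (m + 1) * (ca * H)) ^ m)"
  have cb: "0 \<le> cb" using ca H by (simp add: cb_def)
  define K where "K = CP * cb + CD * KE"
  have K: "0 \<le> K" using CP CD KE cb by (simp add: K_def)
  show ?thesis
  proof (rule that[OF K, of D])
    fix h :: real and l :: "nat \<Rightarrow> real \<Rightarrow> complex" and \<mu> :: "real measure"
    assume h: "0 < h" "h \<le> H" and \<mu>: "real_distribution \<mu>"
      and Dl: "\<And>j t. j \<le> m \<Longrightarrow> t \<in> {-(\<epsilon>/h)..\<epsilon>/h} \<Longrightarrow> (l j has_vector_derivative l (Suc j) t) (at t within {-(\<epsilon>/h)..\<epsilon>/h})"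
      and Bl: "\<And>j t. 3 \<le> j \<Longrightarrow> j \<le> m + 1 \<Longrightarrow> t \<in> {-(\<epsilon>/h)..\<epsilon>/h} \<Longrightarrow> norm (l j t) \<le> C0 * h ^ (j - 2)"
      and Z: "\<And>j. j < 3 \<Longrightarrow> l j 0 = 0"
      and ch: "\<And>t. t \<in> {-(\<epsilon>/h)..\<epsilon>/h} \<Longrightarrow> char \<mu> t = exp (l 0 t - of_real (t\<^sup>2 / 2))"
    interpret \<mu>: real_distribution \<mu> by fact
    define A where "A = taylor_poly m (\<lambda>j. l j 0)"
    define P where "P = (\<Sum>i<m - 1. smult (1 / fact i) (A ^ i))"
    have A0: "coeff A 0 = 0" using Z[of 0] by (simp add: A_def coeff_taylor_poly)
    have dA: "degree A \<le> m" by (rule degree_le) (simp add: A_def coeff_taylor_poly)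
    have Ab: "norm (coeff A j) \<le> ca * h" for j
    proof (cases "3 \<le> j \<and> j \<le> m")
      case True
      have "j - 2 = Suc (j - 3)" using True by arith
      then have hj: "h ^ (j - 2) = h * h ^ (j - 3)" by (metis power_Suc)
      have "h ^ (j - 3) \<le> (1 + H) ^ (j - 3)" using h by (intro power_mono) auto
      also have "\<dots> \<le> (1 + H) ^ m" using H True by (intro power_increasing) auto
      finally have hp: "h ^ (j - 3) \<le> (1 + H) ^ m" .
      have "norm (coeff A j) = norm (l j 0) / fact j" using True by (simp add: A_def coeff_taylor_poly norm_divide)
      also have "\<dots> \<le> norm (l j 0) / 1" by (intro divide_left_mono) (auto simp: fact_ge_1)
      also have "\<dots> \<le> C0 * (h * h ^ (j - 3))" using Bl[of j 0] True h \<epsilon> by (simp add: hj)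
      also have "\<dots> \<le> C0 * (h * (1 + H) ^ m)" using C0 h hp by (intro mult_left_mono) auto
      finally show ?thesis by (simp add: ca_def mult_ac)
    next
      case False
      then have "coeff A j = 0" using Z[of j] by (auto simp: A_def coeff_taylor_poly)
      then show ?thesis using ca h by simp
    qed
    have P0: "coeff P 0 = 1"
    proof -
      have "coeff P 0 = (\<Sum>i<m - 1. if i = 0 then 1 else 0)"
        unfolding P_def coeff_sum using A0 by (intro sum.cong) (auto simp: coeff_0_power)
      then show ?thesis using m by simp
    qed
    have dP: "degree P \<le> D"
      unfolding P_def
    proof (intro degree_sum_le)
      fix i assume i: "i \<in> {..<m - 1}"
      have "degree (smult (1 / fact i) (A ^ i)) \<le> degree A * i"
        using degree_power_le[of A i] degree_smult_le[of "1 / fact i" "A ^ i"] by linarith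
      also have "\<dots> \<le> m * (m - 2)" using dA i by (intro mult_le_mono) auto
      finally show "degree (smult (1 / fact i) (A ^ i)) \<le> D" by (simp add: D_def)
    qed simp
    have Pb: "norm (coeff P j) \<le> cb * h" if j: "1 \<le> j" for j
    proof -
      have t: "norm (coeff (smult (1 / fact i) (A ^ i)) j) \<le> ca * h * (1 + real (m + 1) * (ca * H)) ^ m" if i: "i < m - 1" for i
      proof (cases i)
        case 0
        then have "coeff (smult (1 / fact i) (A ^ i)) j = 0" using j by (cases j) simp_all
        then show ?thesis using ca h H by simp
      next
        case (Suc i')
        have "norm (coeff (smult (1 / fact i) (A ^ i)) j) = norm (coeff (A ^ Suc i') j) / fact i"
          by (simp only: Suc coeff_smult norm_mult norm_divide norm_fact norm_one) simp
        also have "\<dots> \<le> norm (coeff (A ^ Suc i') j) / 1" by (intro divide_left_mono) (auto simp: fact_ge_1)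
        also have "\<dots> \<le> ca * h * (real (m + 1) * (ca * h)) ^ i'"
          using norm_coeff_power_le[OF Ab dA] by simp
        also have "\<dots> \<le> ca * h * (1 + real (m + 1) * (ca * H)) ^ m"
        proof -
          have "real (m + 1) * (ca * h) \<le> 1 + real (m + 1) * (ca * H)"
            using ca h mult_left_mono[of "ca * h" "ca * H" "real (m + 1)"] mult_left_mono[OF h(2) ca] by linarith
          then have "(real (m + 1) * (ca * h)) ^ i' \<le> (1 + real (m + 1) * (ca * H)) ^ i'" using ca h by (intro power_mono) auto
          also have "\<dots> \<le> (1 + real (m + 1) * (ca * H)) ^ m" using ca H i Suc by (intro power_increasing) auto
          finally show ?thesis using ca h by (intro mult_left_mono) auto
        qed
        finally show ?thesis .
      qed
      have "norm (coeff P j) \<le> (\<Sum>i<m - 1. norm (coeff (smult (1 / fact i) (A ^ i)) j))"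
        unfolding P_def coeff_sum by (rule norm_sum)
      also have "\<dots> \<le> real (card {..<m - 1}) * (ca * h * (1 + real (m + 1) * (ca * H)) ^ m)"
        using t by (intro sum_bounded_above) auto
      also have "\<dots> \<le> real m * (ca * h * (1 + real (m + 1) * (ca * H)) ^ m)"
        using ca h H by (intro mult_right_mono) auto
      finally show ?thesis by (simp add: cb_def mult_ac)
    qed
    have "\<exists>Q. Q \<in> borel_measurable borel \<and> (\<forall>x. norm (Q x) \<le> CP * (cb * h) * (1 + \<bar>x\<bar>) ^ D) \<and>
      (\<forall>t. (\<integral>y. exp (\<i> * of_real t * of_real y) * (of_real (std_normal_density y) * (1 + Q y)) \<partial>lborel)
         = exp (- of_real (t\<^sup>2 / 2)) * poly P (of_real t))"
      by (rule CP(2)[OF dP P0 Pb]) (use cb h in auto)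
    then obtain Q where [measurable]: "Q \<in> borel_measurable borel"
      and Qb: "\<And>x. norm (Q x) \<le> CP * (cb * h) * (1 + \<bar>x\<bar>) ^ D"
      and Qf: "\<And>t. (\<integral>y. exp (\<i> * of_real t * of_real y) * (of_real (std_normal_density y) * (1 + Q y)) \<partial>lborel)
         = exp (- of_real (t\<^sup>2 / 2)) * poly P (of_real t)" by blast
    \<comment> \<open>Kernel and law are real, so replacing Q by its real part cannot increase the
      difference to be bounded.\<close>
    define q where "q x = Re (Q x)" for x
    have [measurable]: "q \<in> borel_measurable borel" unfolding q_def[abs_def] by measurable
    have iQ: "integrable lborel (\<lambda>y. of_real (std_normal_density y) * Q y)"
    proof (rule Bochner_Integration.integrable_bound[OF integrable_mult_right[OF integrable_std_normal_poly, of "CP * (cb * h)" D]])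
      have "std_normal_density y * norm (Q y) \<le> std_normal_density y * (CP * (cb * h) * (1 + \<bar>y\<bar>) ^ D)" for y
        by (intro mult_left_mono Qb) simp
      then show "AE y in lborel. norm (of_real (std_normal_density y) * Q y) \<le> norm (CP * (cb * h) * (std_normal_density y * (1 + \<bar>y\<bar>) ^ D))"
        using CP cb h by (auto simp: norm_mult abs_mult mult_ac)
    qed measurable
    have i1: "integrable lborel (\<lambda>y. complex_of_real (std_normal_density y))" by (intro integrable_of_real) simp
    have iQ1: "integrable lborel (\<lambda>y. of_real (std_normal_density y) * (1 + Q y))"
      using Bochner_Integration.integrable_add[OF i1 iQ] by (simp add: distrib_left)
    have q0: "(\<integral>x. std_normal_density x * q x \<partial>lborel) = 0"
    proof -
      have "1 + (\<integral>y. of_real (std_normal_density y) * Q y \<partial>lborel) = (\<integral>y. of_real (std_normal_density y) + of_real (std_normal_density y) * Q y \<partial>lborel)"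
        by (subst Bochner_Integration.integral_add[OF i1 iQ]) simp
      also have "\<dots> = 1" using Qf[of 0] P0 by (simp add: distrib_left poly_0_coeff_0)
      finally have "(\<integral>y. of_real (std_normal_density y) * Q y \<partial>lborel) = 0" by simp
      then have "Re (\<integral>y. of_real (std_normal_density y) * Q y \<partial>lborel) = 0" by simp
      then show ?thesis by (subst (asm) integral_Re[OF iQ, symmetric]) (simp add: q_def)
    qed
    have qb: "\<bar>q x\<bar> \<le> K * h * (1 + \<bar>x\<bar>) ^ D" for x
    proof -
      have "\<bar>q x\<bar> \<le> CP * (cb * h) * (1 + \<bar>x\<bar>) ^ D" using Qb[of x] abs_Re_le_cmod[of "Q x"] by (simp add: q_def)
      also have "\<dots> \<le> K * h * (1 + \<bar>x\<bar>) ^ D"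
        using CD KE h unfolding K_def by (intro mult_right_mono) (auto simp: distrib_right)
      finally show ?thesis .
    qed
    define \<eta> where "\<eta> = 2 * h / \<epsilon>"
    have \<eta>: "0 < \<eta>" using h \<epsilon> by (simp add: \<eta>_def)
    have char_eq: "(\<integral>y. exp (\<i> * of_real t * of_real y) * 1 \<partial>\<mu>) = char \<mu> t" for t
      unfolding char_def by (simp add: mult.assoc)
    have sm: "smooth_bd (m + 1) {-(\<epsilon>/h)..\<epsilon>/h} {} (\<lambda>t. KE * h ^ (m - 1) * ((1 + \<bar>t\<bar>) ^ k * exp (- t\<^sup>2 / 4)))
      (\<lambda>t. (\<integral>y. exp (\<i> * of_real t * of_real y) * 1 \<partial>\<mu>) - (\<integral>y. exp (\<i> * of_real t * of_real y) * (of_real (std_normal_density y) * (1 + Q y)) \<partial>lborel))"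
    proof -
      have polyP: "poly P z = (\<Sum>i<m - 1. poly A z ^ i / fact i)" for z
        by (simp add: P_def poly_sum poly_power)
      show ?thesis
        unfolding Qf char_eq polyP
        by (rule smooth_bd_cong[OF KE(2)[OF h Dl Bl Z, folded A_def]]) (auto simp: ch)
    qed
    have main: "(1 + \<bar>x\<bar>) ^ (m + 1) * norm ((\<integral>y. of_real (smoothing_kernel (m + 1) ((x - y) / \<eta>) / \<eta>) * 1 \<partial>\<mu>)
      - (\<integral>y. of_real (smoothing_kernel (m + 1) ((x - y) / \<eta>) / \<eta>) * (of_real (std_normal_density y) * (1 + Q y)) \<partial>lborel)) \<le> CD * (KE * h ^ (m - 1))" for x
      unfolding \<eta>_def
      by (rule CD(2)[OF h _ _ _ _ _ _ _ sm])
         (use KE h iQ1 in \<open>auto intro: \<mu>.sigma_finite_measure lborel.sigma_finite_measure_axioms \<mu>.sigma_finite_measure_axioms\<close>)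
    have fin: "(1 + \<bar>x\<bar>) ^ (m + 1) * \<bar>(\<integral>y. smoothing_kernel (m + 1) ((x - y) / \<eta>) / \<eta> \<partial>\<mu>)
        - (\<integral>y. smoothing_kernel (m + 1) ((x - y) / \<eta>) / \<eta> * (std_normal_density y * (1 + q y)) \<partial>lborel)\<bar> \<le> K * h ^ (m - 1)" for x
    proof -
      let ?X = "(\<integral>y. of_real (smoothing_kernel (m + 1) ((x - y) / \<eta>) / \<eta>) * 1 \<partial>\<mu>) :: complex"
      let ?Y = "(\<integral>y. of_real (smoothing_kernel (m + 1) ((x - y) / \<eta>) / \<eta>) * (of_real (std_normal_density y) * (1 + Q y)) \<partial>lborel)"
      obtain Ck where Ck: "\<And>x. norm (smoothing_kernel (m + 1) x) \<le> Ck" using smoothing_kernel_bounded[of "m + 1"] by auto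
      have iY: "integrable lborel (\<lambda>y. of_real (smoothing_kernel (m + 1) ((x - y) / \<eta>) / \<eta>) * (of_real (std_normal_density y) * (1 + Q y)))"
      proof (rule integrable_bounded_mult[OF iQ1, where C = "Ck / \<eta>"])
        show "norm (complex_of_real (smoothing_kernel (m + 1) ((x - y) / \<eta>) / \<eta>)) \<le> Ck / \<eta>" for y
          unfolding norm_of_real using Ck[of "(x - y) / \<eta>"] \<eta> by (simp add: abs_divide divide_right_mono)
      qed measurable
      have reX: "Re ?X = (\<integral>y. smoothing_kernel (m + 1) ((x - y) / \<eta>) / \<eta> \<partial>\<mu>)"
        unfolding mult_1_right integral_complex_of_real by simp
      have "Re ?Y = (\<integral>y. Re (of_real (smoothing_kernel (m + 1) ((x - y) / \<eta>) / \<eta>) * (of_real (std_normal_density y) * (1 + Q y))) \<partial>lborel)"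
        by (rule integral_Re[OF iY, symmetric])
      also have "\<dots> = (\<integral>y. smoothing_kernel (m + 1) ((x - y) / \<eta>) / \<eta> * (std_normal_density y * (1 + q y)) \<partial>lborel)"
        by (intro Bochner_Integration.integral_cong refl) (simp add: q_def)
      finally have reY: "Re ?Y = (\<integral>y. smoothing_kernel (m + 1) ((x - y) / \<eta>) / \<eta> * (std_normal_density y * (1 + q y)) \<partial>lborel)" .
      have "(1 + \<bar>x\<bar>) ^ (m + 1) * \<bar>Re ?X - Re ?Y\<bar> \<le> (1 + \<bar>x\<bar>) ^ (m + 1) * norm (?X - ?Y)"
        using abs_Re_le_cmod[of "?X - ?Y"] by (intro mult_left_mono) auto
      also have "\<dots> \<le> CD * (KE * h ^ (m - 1))" by (rule main)
      also have "\<dots> \<le> K * h ^ (m - 1)" unfolding K_def using CP cb h by (simp add: distrib_right)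
      finally show ?thesis unfolding reX reY .
    qed
    show "\<exists>q. q \<in> borel_measurable borel \<and> (\<forall>x. \<bar>q x\<bar> \<le> K * h * (1 + \<bar>x\<bar>) ^ D) \<and>
      (\<integral>x. std_normal_density x * q x \<partial>lborel) = 0 \<and>
      (\<forall>x. (1 + \<bar>x\<bar>) ^ (m + 1) * \<bar>(\<integral>y. smoothing_kernel (m + 1) ((x - y) / (2 * h / \<epsilon>)) / (2 * h / \<epsilon>) \<partial>\<mu>)
        - (\<integral>y. smoothing_kernel (m + 1) ((x - y) / (2 * h / \<epsilon>)) / (2 * h / \<epsilon>) * (std_normal_density y * (1 + q y)) \<partial>lborel)\<bar> \<le> K * h ^ (m - 1))"
      using qb q0 fin[unfolded \<eta>_def] by (intro exI[of _ q]) auto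
  qed
  qed
  qed
  qed
qed

section \<open>Normal approximation for one random variable\<close>

lemma transport_prob_space:
  assumes "transport p \<mu> \<nu> K"
  shows "prob_space \<mu>" "prob_space \<nu>" "sets \<mu> = sets borel" "sets \<nu> = sets borel"
proof -
  obtain \<pi> :: "(real \<times> real) measure" where \<pi>: "prob_space \<pi>" "fst \<in> borel_measurable \<pi>" "snd \<in> borel_measurable \<pi>"
    "distr \<pi> borel fst = \<mu>" "distr \<pi> borel snd = \<nu>"
    using assms by (rule transportE)
  show "prob_space \<mu>" "prob_space \<nu>"
    using prob_space.prob_space_distr[OF \<pi>(1,2)] prob_space.prob_space_distr[OF \<pi>(1,3)] unfolding \<pi>(4,5) by -
  show "sets \<mu> = sets borel" "sets \<nu> = sets borel"
    unfolding \<pi>(4,5)[symmetric] by simp_all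
qed

lemma smoothing_kernel_moment_eq:
  assumes "p + 2 \<le> 2 * n" "0 < \<eta>"
  shows "(\<integral>\<^sup>+x. ennreal (\<bar>x\<bar> ^ p * (smoothing_kernel n (x / \<eta>) / \<eta>)) \<partial>lborel) = ennreal (\<eta> ^ p * (\<integral>x. \<bar>x\<bar> ^ p * smoothing_kernel n x \<partial>lborel))"
proof -
  have i0: "integrable lborel (\<lambda>x. \<bar>x\<bar> ^ p * smoothing_kernel n x)"
  proof (rule Bochner_Integration.integrable_bound[OF integrable_kernel_moment[OF assms(1)]])
    have "\<bar>x\<bar> ^ p * smoothing_kernel n x \<le> (1 + \<bar>x\<bar>) ^ p * smoothing_kernel n x" for x
      by (intro mult_right_mono power_mono) auto
    then show "AE x in lborel. norm (\<bar>x\<bar> ^ p * smoothing_kernel n x) \<le> norm ((1 + \<bar>x\<bar>) ^ p * smoothing_kernel n x)"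
      by (auto simp: abs_mult power_abs)
  qed simp
  have i1: "integrable lborel (\<lambda>x. \<eta> ^ p * (\<bar>x\<bar> ^ p * smoothing_kernel n x))" using i0 by (rule integrable_mult_right)
  have eq: "(\<lambda>x. \<bar>x\<bar> ^ p * smoothing_kernel n (x / \<eta>)) = (\<lambda>x. \<eta> ^ p * (\<bar>0 + 1 / \<eta> * x\<bar> ^ p * smoothing_kernel n (0 + 1 / \<eta> * x)))"
    using assms(2) by (auto simp: fun_eq_iff abs_mult power_mult_distrib power_divide)
  have "integrable lborel (\<lambda>x. \<bar>x\<bar> ^ p * smoothing_kernel n (x / \<eta>))"
    unfolding eq using assms(2) by (intro lborel_integrable_real_affine[OF i1]) auto
  then have i2: "integrable lborel (\<lambda>x. \<bar>x\<bar> ^ p * (smoothing_kernel n (x / \<eta>) / \<eta>))"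
    using integrable_divide[of lborel "\<lambda>x. \<bar>x\<bar> ^ p * smoothing_kernel n (x / \<eta>)" \<eta>] by simp
  have "(\<integral>x. \<bar>x\<bar> ^ p * (smoothing_kernel n (x / \<eta>) / \<eta>) \<partial>lborel) = (\<integral>x. \<eta> ^ p * (\<bar>x\<bar> ^ p * smoothing_kernel n x) \<partial>lborel)"
    using lborel_integral_real_affine[of \<eta> "\<lambda>x. \<bar>x\<bar> ^ p * (smoothing_kernel n (x / \<eta>) / \<eta>)" 0] assms(2)
    by (simp add: abs_mult power_mult_distrib mult_ac)
  then show ?thesis
    using assms(2) by (subst nn_integral_eq_integral[OF i2]) auto
qed

text \<open>The perturbation \<open>q\<close> delivered by the expansion need not leave \<open>1 + q\<close> positive. It is cut off where
  its bound exceeds 1/4 and recentred; the polynomial bound makes the discarded part of order \<open>\<beta> ^ p\<close>.\<close>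

lemma density_truncation:
  fixes p D :: nat and q :: "real \<Rightarrow> real"
  assumes [measurable]: "q \<in> borel_measurable borel" and p: "1 \<le> p" and \<beta>: "0 \<le> \<beta>"
    and q: "\<And>x. \<bar>q x\<bar> \<le> \<beta> * (1 + \<bar>x\<bar>) ^ D" and q0: "(\<integral>x. std_normal_density x * q x \<partial>lborel) = 0"
  defines "M \<equiv> (\<integral>x. std_normal_density x * (1 + \<bar>x\<bar>) ^ (D * p) \<partial>lborel)"
  obtains q' where "q' \<in> borel_measurable borel" "\<And>x. \<bar>q' x\<bar> \<le> 1/2"
    "\<And>x. \<bar>q' x\<bar> \<le> \<beta> * (1 + 4 ^ (p - 1) * \<beta> ^ (p - 1) * M) * (1 + \<bar>x\<bar>) ^ D"
    "(\<integral>x. std_normal_density x * q' x \<partial>lborel) = 0"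
    "\<And>x. \<bar>q x - q' x\<bar> \<le> \<beta> ^ p * (4 ^ (p - 1) * (1 + M)) * (1 + \<bar>x\<bar>) ^ (D * p)"
proof -
  let ?\<phi> = std_normal_density
  define A where "A = {x::real. \<beta> * (1 + \<bar>x\<bar>) ^ D \<le> 1/4}"
  have [measurable]: "A \<in> sets borel" unfolding A_def by measurable
  have M: "0 \<le> M" unfolding M_def by (intro integral_nonneg_AE) auto
  define q1 where "q1 x = q x * indicator A x" for x
  define r where "r x = q x * indicator (- A) x" for x
  have [measurable]: "q1 \<in> borel_measurable borel" "r \<in> borel_measurable borel"
    unfolding q1_def[abs_def] r_def[abs_def] by measurable
  have q1b: "\<bar>q1 x\<bar> \<le> 1/4" "\<bar>q1 x\<bar> \<le> \<beta> * (1 + \<bar>x\<bar>) ^ D" for x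
    using q[of x] \<beta> by (auto simp: q1_def A_def split: split_indicator)
  have \<beta>p: "\<beta> * \<beta> ^ (p - 1) = \<beta> ^ p" using p by (metis power_minus_mult mult.commute less_le_trans zero_less_one)
  have rb: "\<bar>r x\<bar> \<le> \<beta> ^ p * 4 ^ (p - 1) * (1 + \<bar>x\<bar>) ^ (D * p)" for x
  proof (cases "x \<in> A")
    case True
    then show ?thesis using \<beta> by (simp add: r_def)
  next
    case False
    define b where "b = \<beta> * (1 + \<bar>x\<bar>) ^ D"
    have b: "0 \<le> b" "1/4 < b" using \<beta> False by (auto simp: b_def A_def)
    \<comment> \<open>Off A the factor 4 b exceeds 1, so p - 1 further copies of it may be inserted;
      this converts a bound of order \<beta> into one of order \<beta>^p with a higher polynomial
      weight.\<close>
    have "b * 1 \<le> b * (4 * b) ^ (p - 1)" using b by (intro mult_left_mono one_le_power) auto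
    also have "\<dots> = 4 ^ (p - 1) * (b * b ^ (p - 1))" by (simp add: power_mult_distrib)
    also have "b * b ^ (p - 1) = b ^ p" using p by (metis power_minus_mult mult.commute less_le_trans zero_less_one)
    also have "b ^ p = \<beta> ^ p * (1 + \<bar>x\<bar>) ^ (D * p)" by (simp add: b_def power_mult_distrib power_mult)
    finally have "b \<le> \<beta> ^ p * 4 ^ (p - 1) * (1 + \<bar>x\<bar>) ^ (D * p)" by (simp add: mult_ac)
    then show ?thesis using q[of x] False by (simp add: r_def b_def)
  qed
  have intb: "integrable lborel (\<lambda>x. ?\<phi> x * f x)" if [measurable]: "f \<in> borel_measurable borel" and "\<And>x. \<bar>f x\<bar> \<le> C * (1 + \<bar>x\<bar>) ^ k" for f C k
  proof (rule Bochner_Integration.integrable_bound[OF integrable_mult_right[OF integrable_std_normal_poly, of C k]])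
    have "?\<phi> x * \<bar>f x\<bar> \<le> \<bar>C * (?\<phi> x * (1 + \<bar>x\<bar>) ^ k)\<bar>" for x
    proof -
      have "?\<phi> x * \<bar>f x\<bar> \<le> ?\<phi> x * (C * (1 + \<bar>x\<bar>) ^ k)" by (intro mult_left_mono that) simp
      then show ?thesis by (simp add: mult.left_commute)
    qed
    then show "AE x in lborel. norm (?\<phi> x * f x) \<le> norm (C * (?\<phi> x * (1 + \<bar>x\<bar>) ^ k))"
      by (simp add: abs_mult)
  qed measurable
  have iq1: "integrable lborel (\<lambda>x. ?\<phi> x * q1 x)" by (rule intb[OF _ q1b(2)]) measurable
  have ir: "integrable lborel (\<lambda>x. ?\<phi> x * r x)" by (rule intb[OF _ rb]) measurable
  define c where "c = (\<integral>x. ?\<phi> x * q1 x \<partial>lborel)"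
  have "c + (\<integral>x. ?\<phi> x * r x \<partial>lborel) = (\<integral>x. ?\<phi> x * q1 x + ?\<phi> x * r x \<partial>lborel)"
    unfolding c_def by (rule Bochner_Integration.integral_add[symmetric, OF iq1 ir])
  also have "\<dots> = (\<integral>x. ?\<phi> x * q x \<partial>lborel)"
    by (intro Bochner_Integration.integral_cong) (auto simp: q1_def r_def split: split_indicator)
  finally have cr: "c = - (\<integral>x. ?\<phi> x * r x \<partial>lborel)" using q0 by simp
  \<comment> \<open>Since q has mean 0, the mean of the retained part is minus that of the discarded
    part, hence of order \<beta>^p.\<close>
  have cb: "\<bar>c\<bar> \<le> \<beta> ^ p * 4 ^ (p - 1) * M"
  proof -
    have "\<bar>c\<bar> \<le> (\<integral>x. \<bar>?\<phi> x * r x\<bar> \<partial>lborel)" unfolding cr by (simp add: integral_abs_bound)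
    also have "\<dots> \<le> (\<integral>x. \<beta> ^ p * 4 ^ (p - 1) * (?\<phi> x * (1 + \<bar>x\<bar>) ^ (D * p)) \<partial>lborel)"
    proof (rule integral_mono)
      show "integrable lborel (\<lambda>x. \<bar>?\<phi> x * r x\<bar>)" by (rule integrable_abs[OF ir])
      show "integrable lborel (\<lambda>x. \<beta> ^ p * 4 ^ (p - 1) * (?\<phi> x * (1 + \<bar>x\<bar>) ^ (D * p)))"
        by (intro integrable_mult_right integrable_std_normal_poly)
      fix x
      have "?\<phi> x * \<bar>r x\<bar> \<le> ?\<phi> x * (\<beta> ^ p * 4 ^ (p - 1) * (1 + \<bar>x\<bar>) ^ (D * p))" by (intro mult_left_mono rb) simp
      then show "\<bar>?\<phi> x * r x\<bar> \<le> \<beta> ^ p * 4 ^ (p - 1) * (?\<phi> x * (1 + \<bar>x\<bar>) ^ (D * p))"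
        by (simp add: abs_mult mult_ac)
    qed
    finally show ?thesis by (simp add: M_def)
  qed
  \<comment> \<open>The cutoff at 1/4 leaves room for the recentring constant: 1/4 + 1/4 =
    1/2.\<close>
  have c4: "\<bar>c\<bar> \<le> 1/4"
  proof -
    have "\<bar>c\<bar> \<le> (\<integral>x. \<bar>?\<phi> x * q1 x\<bar> \<partial>lborel)" unfolding c_def by (rule integral_abs_bound)
    also have "\<dots> \<le> (\<integral>x. 1/4 * ?\<phi> x \<partial>lborel)"
    proof (rule integral_mono)
      show "integrable lborel (\<lambda>x. \<bar>?\<phi> x * q1 x\<bar>)" by (rule integrable_abs[OF iq1])
      fix x
      have "?\<phi> x * \<bar>q1 x\<bar> \<le> ?\<phi> x * (1/4)" by (intro mult_left_mono q1b) simp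
      then show "\<bar>?\<phi> x * q1 x\<bar> \<le> 1/4 * ?\<phi> x" by (simp add: abs_mult)
    qed simp
    finally show ?thesis by simp
  qed
  have one: "1 \<le> (1 + \<bar>x\<bar>) ^ k" for x :: real and k by (rule one_le_power) simp
  show ?thesis
  proof (rule that[of "\<lambda>x. q1 x - c"])
    show "(\<lambda>x. q1 x - c) \<in> borel_measurable borel" by measurable
    fix x
    show "\<bar>q1 x - c\<bar> \<le> 1/2" using q1b(1)[of x] c4 by linarith
    have "\<beta> ^ p * 4 ^ (p - 1) * M = \<beta> * (4 ^ (p - 1) * \<beta> ^ (p - 1) * M)" unfolding \<beta>p[symmetric] by (simp add: mult_ac)
    then have "\<bar>c\<bar> \<le> \<beta> * (4 ^ (p - 1) * \<beta> ^ (p - 1) * M) * 1" using cb by linarith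
    also have "\<dots> \<le> \<beta> * (4 ^ (p - 1) * \<beta> ^ (p - 1) * M) * (1 + \<bar>x\<bar>) ^ D"
      using \<beta> M by (intro mult_left_mono one) auto
    finally have "\<bar>c\<bar> \<le> \<beta> * (4 ^ (p - 1) * \<beta> ^ (p - 1) * M) * (1 + \<bar>x\<bar>) ^ D" .
    then have "\<bar>q1 x - c\<bar> \<le> \<beta> * (1 + \<bar>x\<bar>) ^ D + \<beta> * (4 ^ (p - 1) * \<beta> ^ (p - 1) * M) * (1 + \<bar>x\<bar>) ^ D"
      using q1b(2)[of x] by linarith
    then show "\<bar>q1 x - c\<bar> \<le> \<beta> * (1 + 4 ^ (p - 1) * \<beta> ^ (p - 1) * M) * (1 + \<bar>x\<bar>) ^ D"
      by (simp only: distrib_left distrib_right mult_1_right)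
    have "(\<integral>x. ?\<phi> x * (q1 x - c) \<partial>lborel) = (\<integral>x. ?\<phi> x * q1 x - ?\<phi> x * c \<partial>lborel)" by (simp add: right_diff_distrib)
    also have "\<dots> = c - (\<integral>x. ?\<phi> x * c \<partial>lborel)"
      unfolding c_def by (rule Bochner_Integration.integral_diff[OF iq1]) simp
    finally show "(\<integral>x. ?\<phi> x * (q1 x - c) \<partial>lborel) = 0" by simp
    have "\<bar>c\<bar> \<le> \<beta> ^ p * 4 ^ (p - 1) * M * 1" using cb by simp
    also have "\<dots> \<le> \<beta> ^ p * 4 ^ (p - 1) * M * (1 + \<bar>x\<bar>) ^ (D * p)" using \<beta> M by (intro mult_left_mono one) auto
    finally have "\<bar>c\<bar> \<le> \<beta> ^ p * 4 ^ (p - 1) * M * (1 + \<bar>x\<bar>) ^ (D * p)" .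
    moreover have "q x - (q1 x - c) = r x + c" by (auto simp: q1_def r_def split: split_indicator)
    moreover have "\<beta> ^ p * (4 ^ (p - 1) * (1 + M)) * (1 + \<bar>x\<bar>) ^ (D * p)
      = \<beta> ^ p * 4 ^ (p - 1) * (1 + \<bar>x\<bar>) ^ (D * p) + \<beta> ^ p * 4 ^ (p - 1) * M * (1 + \<bar>x\<bar>) ^ (D * p)"
      by (simp only: distrib_left distrib_right mult_1_right mult.assoc)
    ultimately show "\<bar>q x - (q1 x - c)\<bar> \<le> \<beta> ^ p * (4 ^ (p - 1) * (1 + M)) * (1 + \<bar>x\<bar>) ^ (D * p)"
      using rb[of x] by linarith
  qed
qed

text \<open>The weight is submultiplicative, 1 + |y + z| being at most (1 + |y|)(1 + |z|), so the
  weighted mass of a convolution is at most the product of the weighted masses.\<close>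

lemma smoothing_moment_bound:
  fixes \<psi> :: "real \<Rightarrow> real"
  assumes [measurable]: "\<psi> \<in> borel_measurable borel" and \<psi>: "\<And>y. 0 \<le> \<psi> y"
    and i: "integrable lborel (\<lambda>y. (1 + \<bar>y\<bar>) ^ p * \<psi> y)"
    and [measurable]: "u \<in> borel_measurable borel" and u: "\<And>y. 0 \<le> u y"
    and iu: "integrable lborel (\<lambda>y. (1 + \<bar>y\<bar>) ^ p * u y)"
  shows "(\<integral>\<^sup>+x. ennreal ((1 + \<bar>x\<bar>) ^ p) * (\<integral>\<^sup>+y. ennreal (u (x - y) * \<psi> y) \<partial>lborel) \<partial>lborel)
    \<le> ennreal ((\<integral>y. (1 + \<bar>y\<bar>) ^ p * \<psi> y \<partial>lborel) * (\<integral>y. (1 + \<bar>y\<bar>) ^ p * u y \<partial>lborel))"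
proof -
  have "(\<integral>\<^sup>+x. ennreal ((1 + \<bar>x\<bar>) ^ p) * (\<integral>\<^sup>+y. ennreal (u (x - y) * \<psi> y) \<partial>lborel) \<partial>lborel)
    = (\<integral>\<^sup>+x. (\<integral>\<^sup>+y. ennreal ((1 + \<bar>x\<bar>) ^ p) * ennreal (u (x - y) * \<psi> y) \<partial>lborel) \<partial>lborel)"
    by (intro nn_integral_cong nn_integral_cmult[symmetric]) measurable
  also have "\<dots> = (\<integral>\<^sup>+y. (\<integral>\<^sup>+x. ennreal ((1 + \<bar>x\<bar>) ^ p) * ennreal (u (x - y) * \<psi> y) \<partial>lborel) \<partial>lborel)"
    by (rule lborel_pair.Fubini'[symmetric]) measurable
  also have "\<dots> \<le> (\<integral>\<^sup>+y. ennreal ((1 + \<bar>y\<bar>) ^ p * \<psi> y) * ennreal (\<integral>y. (1 + \<bar>y\<bar>) ^ p * u y \<partial>lborel) \<partial>lborel)"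
  proof (rule nn_integral_mono)
    fix y
    have "(\<integral>\<^sup>+x. ennreal ((1 + \<bar>x\<bar>) ^ p) * ennreal (u (x - y) * \<psi> y) \<partial>lborel)
      = (\<integral>\<^sup>+z. ennreal ((1 + \<bar>y + z\<bar>) ^ p) * ennreal (u z * \<psi> y) \<partial>lborel)"
      using nn_integral_real_affine[of "\<lambda>x. ennreal ((1 + \<bar>x\<bar>) ^ p) * ennreal (u (x - y) * \<psi> y)" 1 y] by simp
    also have "\<dots> \<le> (\<integral>\<^sup>+z. ennreal ((1 + \<bar>y\<bar>) ^ p * \<psi> y) * ennreal ((1 + \<bar>z\<bar>) ^ p * u z) \<partial>lborel)"
    proof (rule nn_integral_mono)
      fix z
      have "(1 + \<bar>y\<bar>) * (1 + \<bar>z\<bar>) = 1 + \<bar>y\<bar> + \<bar>z\<bar> + \<bar>y\<bar> * \<bar>z\<bar>" by (simp add: algebra_simps)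
      moreover have "0 \<le> \<bar>y\<bar> * \<bar>z\<bar>" by simp
      ultimately have "1 + \<bar>y + z\<bar> \<le> (1 + \<bar>y\<bar>) * (1 + \<bar>z\<bar>)" using abs_triangle_ineq[of y z] by linarith
      then have "(1 + \<bar>y + z\<bar>) ^ p \<le> ((1 + \<bar>y\<bar>) * (1 + \<bar>z\<bar>)) ^ p" by (intro power_mono) auto
      then have "(1 + \<bar>y + z\<bar>) ^ p * (u z * \<psi> y) \<le> ((1 + \<bar>y\<bar>) * (1 + \<bar>z\<bar>)) ^ p * (u z * \<psi> y)"
        using u \<psi> by (intro mult_right_mono) auto
      also have "\<dots> = ((1 + \<bar>y\<bar>) ^ p * \<psi> y) * ((1 + \<bar>z\<bar>) ^ p * u z)" by (simp add: power_mult_distrib mult_ac)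
      finally show "ennreal ((1 + \<bar>y + z\<bar>) ^ p) * ennreal (u z * \<psi> y) \<le> ennreal ((1 + \<bar>y\<bar>) ^ p * \<psi> y) * ennreal ((1 + \<bar>z\<bar>) ^ p * u z)"
        using u \<psi> by (subst (1 2) ennreal_mult[symmetric]) (auto intro: ennreal_leI)
    qed
    also have "\<dots> = ennreal ((1 + \<bar>y\<bar>) ^ p * \<psi> y) * (\<integral>\<^sup>+z. ennreal ((1 + \<bar>z\<bar>) ^ p * u z) \<partial>lborel)"
      by (rule nn_integral_cmult) measurable
    also have "(\<integral>\<^sup>+z. ennreal ((1 + \<bar>z\<bar>) ^ p * u z) \<partial>lborel) = ennreal (\<integral>y. (1 + \<bar>y\<bar>) ^ p * u y \<partial>lborel)"
      using u by (intro nn_integral_eq_integral iu) auto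
    finally show "(\<integral>\<^sup>+x. ennreal ((1 + \<bar>x\<bar>) ^ p) * ennreal (u (x - y) * \<psi> y) \<partial>lborel)
      \<le> ennreal ((1 + \<bar>y\<bar>) ^ p * \<psi> y) * ennreal (\<integral>y. (1 + \<bar>y\<bar>) ^ p * u y \<partial>lborel)" .
  qed
  also have "\<dots> = (\<integral>\<^sup>+y. ennreal ((1 + \<bar>y\<bar>) ^ p * \<psi> y) \<partial>lborel) * ennreal (\<integral>y. (1 + \<bar>y\<bar>) ^ p * u y \<partial>lborel)"
    by (rule nn_integral_multc) measurable
  also have "(\<integral>\<^sup>+y. ennreal ((1 + \<bar>y\<bar>) ^ p * \<psi> y) \<partial>lborel) = ennreal (\<integral>y. (1 + \<bar>y\<bar>) ^ p * \<psi> y \<partial>lborel)"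
    using \<psi> by (intro nn_integral_eq_integral i) auto
  also have "\<dots> * ennreal (\<integral>y. (1 + \<bar>y\<bar>) ^ p * u y \<partial>lborel) = ennreal ((\<integral>y. (1 + \<bar>y\<bar>) ^ p * \<psi> y \<partial>lborel) * (\<integral>y. (1 + \<bar>y\<bar>) ^ p * u y \<partial>lborel))"
    using \<psi> by (intro ennreal_mult[symmetric] integral_nonneg_AE) (auto simp: u)
  finally show ?thesis .
qed

text \<open>The chain runs from \<mu> to its smoothing f, to the smoothing g of the truncated
  Edgeworth law \<nu>, back to \<nu>, and on to the normal law. The four links are noise, weighted
  total variation, noise reversed, and the monotone map, each of p-th power cost O(h^p).\<close>

lemma normal_approximation:
  fixes m :: nat and C0 \<epsilon> H :: real
  assumes m: "2 \<le> m" and C0: "0 \<le> C0" and \<epsilon>: "0 < \<epsilon>" "\<epsilon> \<le> 1" "C0 * \<epsilon> \<le> 1 / 16" and H: "0 < H"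
  obtains K where "0 \<le> K" "\<And>h l \<mu>. 0 < h \<Longrightarrow> h \<le> H \<Longrightarrow> real_distribution \<mu> \<Longrightarrow>
    (\<And>j t. j \<le> m \<Longrightarrow> t \<in> {-(\<epsilon>/h)..\<epsilon>/h} \<Longrightarrow> (l j has_vector_derivative l (Suc j) t) (at t within {-(\<epsilon>/h)..\<epsilon>/h})) \<Longrightarrow>
    (\<And>j t. 3 \<le> j \<Longrightarrow> j \<le> m + 1 \<Longrightarrow> t \<in> {-(\<epsilon>/h)..\<epsilon>/h} \<Longrightarrow> norm (l j t) \<le> C0 * h ^ (j - 2)) \<Longrightarrow>
    (\<And>j. j < 3 \<Longrightarrow> l j 0 = 0) \<Longrightarrow>
    (\<And>t. t \<in> {-(\<epsilon>/h)..\<epsilon>/h} \<Longrightarrow> char \<mu> t = exp (l 0 t - of_real (t\<^sup>2 / 2))) \<Longrightarrow>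
    transport (m - 1) \<mu> std_normal_distribution (K * h ^ (m - 1))"
proof -
  show ?thesis
  proof (rule smoothed_density_expansion[OF m C0 \<epsilon> H])
  fix K1 D
  assume K1: "0 \<le> K1" and expand: "\<And>h l \<mu>. 0 < h \<Longrightarrow> h \<le> H \<Longrightarrow> real_distribution \<mu> \<Longrightarrow>
    (\<And>j t. j \<le> m \<Longrightarrow> t \<in> {-(\<epsilon>/h)..\<epsilon>/h} \<Longrightarrow> (l j has_vector_derivative l (Suc j) t) (at t within {-(\<epsilon>/h)..\<epsilon>/h})) \<Longrightarrow>
    (\<And>j t. 3 \<le> j \<Longrightarrow> j \<le> m + 1 \<Longrightarrow> t \<in> {-(\<epsilon>/h)..\<epsilon>/h} \<Longrightarrow> norm (l j t) \<le> C0 * h ^ (j - 2)) \<Longrightarrow>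
    (\<And>j. j < 3 \<Longrightarrow> l j 0 = 0) \<Longrightarrow>
    (\<And>t. t \<in> {-(\<epsilon>/h)..\<epsilon>/h} \<Longrightarrow> char \<mu> t = exp (l 0 t - of_real (t\<^sup>2 / 2))) \<Longrightarrow>
    \<exists>q. q \<in> borel_measurable borel \<and> (\<forall>x. \<bar>q x\<bar> \<le> K1 * h * (1 + \<bar>x\<bar>) ^ D) \<and>
      (\<integral>x. std_normal_density x * q x \<partial>lborel) = 0 \<and>
      (\<forall>x. (1 + \<bar>x\<bar>) ^ (m + 1) * \<bar>(\<integral>y. smoothing_kernel (m + 1) ((x - y) / (2 * h / \<epsilon>)) / (2 * h / \<epsilon>) \<partial>\<mu>)
        - (\<integral>y. smoothing_kernel (m + 1) ((x - y) / (2 * h / \<epsilon>)) / (2 * h / \<epsilon>) * (std_normal_density y * (1 + q y)) \<partial>lborel)\<bar> \<le> K1 * h ^ (m - 1))"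
  define p where "p = m - 1"
  have p: "1 \<le> p" using m by (simp add: p_def)
  let ?\<phi> = std_normal_density
  show ?thesis
  proof (rule density_std_normal_transport[where p = p and D = D])
  fix K2
  assume K2: "0 \<le> K2" and quantile: "\<And>q \<beta>. q \<in> borel_measurable borel \<Longrightarrow> \<beta> \<ge> 0 \<Longrightarrow> (\<And>x. \<bar>q x\<bar> \<le> \<beta> * (1 + \<bar>x\<bar>) ^ D) \<Longrightarrow>
      (\<And>x. \<bar>q x\<bar> \<le> 1/2) \<Longrightarrow> (\<integral>x. std_normal_density x * q x \<partial>lborel) = 0 \<Longrightarrow>
      transport p (density lborel (\<lambda>x. std_normal_density x * (1 + q x))) std_normal_distribution (K2 * \<beta> ^ p)"
  define M where "M = (\<integral>x. ?\<phi> x * (1 + \<bar>x\<bar>) ^ (D * p) \<partial>lborel)"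
  have M: "0 \<le> M" unfolding M_def by (intro integral_nonneg_AE) auto
  define M' where "M' = (\<integral>x. ?\<phi> x * (1 + \<bar>x\<bar>) ^ (p + D * p) \<partial>lborel)"
  have M': "0 \<le> M'" unfolding M'_def by (intro integral_nonneg_AE) auto
  define Mk where "Mk = (\<integral>x. \<bar>x\<bar> ^ p * smoothing_kernel (m + 1) x \<partial>lborel)"
  have Mk: "0 \<le> Mk" unfolding Mk_def by (intro integral_nonneg_AE) auto
  define Mu where "Mu = (1 + 2 * H / \<epsilon>) ^ p * (\<integral>x. (1 + \<bar>x\<bar>) ^ p * smoothing_kernel (m + 1) x \<partial>lborel)"
  have Mu: "0 \<le> Mu" unfolding Mu_def using H \<epsilon> by (intro mult_nonneg_nonneg integral_nonneg_AE) auto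
  define I2 where "I2 = integral\<^sup>L lborel (\<lambda>x::real. 1 / (1 + \<bar>x\<bar>)\<^sup>2)"
  have I2: "0 \<le> I2" unfolding I2_def by (intro integral_nonneg_AE) auto
  define Kn where "Kn = (2 / \<epsilon>) ^ p * Mk"
  have Kn: "0 \<le> Kn" using Mk \<epsilon> by (simp add: Kn_def)
  define c5 where "c5 = 4 ^ (p - 1) * (1 + M)"
  have c5: "0 \<le> c5" using M by (simp add: c5_def)
  define Ktv where "Ktv = K1 * I2 + K1 ^ p * c5 * M' * Mu"
  have Ktv: "0 \<le> Ktv" using K1 I2 c5 M' Mu by (simp add: Ktv_def)
  define c4 where "c4 = 1 + 4 ^ (p - 1) * (K1 * H) ^ (p - 1) * M"
  have c4: "1 \<le> c4" using K1 H M by (simp add: c4_def)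
  define Kq where "Kq = K2 * (K1 * c4) ^ p"
  have Kq: "0 \<le> Kq" using K1 K2 c4 by (simp add: Kq_def)
  define Ka where "Ka = 3 ^ p * (Kn + 2 ^ p * Ktv + 1)"
  define Kb where "Kb = 3 ^ p * (Kn + Kq + 1)"
  have Kab: "0 \<le> Ka" "0 \<le> Kb" using Kn Ktv Kq by (simp_all add: Ka_def Kb_def)
  define K where "K = 3 ^ p * (Ka + Kb + 1)"
  have K: "0 \<le> K" using Kab by (simp add: K_def)
  show ?thesis
  proof (rule that[OF K])
    fix h :: real and l :: "nat \<Rightarrow> real \<Rightarrow> complex" and \<mu> :: "real measure"
    assume h: "0 < h" "h \<le> H" and \<mu>: "real_distribution \<mu>"
      and Dl: "\<And>j t. j \<le> m \<Longrightarrow> t \<in> {-(\<epsilon>/h)..\<epsilon>/h} \<Longrightarrow> (l j has_vector_derivative l (Suc j) t) (at t within {-(\<epsilon>/h)..\<epsilon>/h})"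
      and Bl: "\<And>j t. 3 \<le> j \<Longrightarrow> j \<le> m + 1 \<Longrightarrow> t \<in> {-(\<epsilon>/h)..\<epsilon>/h} \<Longrightarrow> norm (l j t) \<le> C0 * h ^ (j - 2)"
      and Z: "\<And>j. j < 3 \<Longrightarrow> l j 0 = 0"
      and ch: "\<And>t. t \<in> {-(\<epsilon>/h)..\<epsilon>/h} \<Longrightarrow> char \<mu> t = exp (l 0 t - of_real (t\<^sup>2 / 2))"
    interpret \<mu>: real_distribution \<mu> by fact
    define \<eta> where "\<eta> = 2 * h / \<epsilon>"
    have \<eta>: "0 < \<eta>" "\<eta> \<le> 2 * H / \<epsilon>" using h \<epsilon> by (auto simp: \<eta>_def divide_right_mono)
    define u where "u z = smoothing_kernel (m + 1) (z / \<eta>) / \<eta>" for z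
    have [measurable]: "u \<in> borel_measurable borel" unfolding u_def[abs_def] by measurable
    have u0: "0 \<le> u z" for z using \<eta> by (simp add: u_def)
    have pm: "p + 2 \<le> 2 * (m + 1)" by (simp add: p_def)
    have u1: "(\<integral>\<^sup>+z. ennreal (u z) \<partial>lborel) = 1"
      using smoothing_kernel_integral[of "m + 1" \<eta>] \<eta> u0 unfolding u_def by (subst nn_integral_eq_integral) auto
    have um: "(\<integral>\<^sup>+z. ennreal (\<bar>z\<bar> ^ p * u z) \<partial>lborel) \<le> ennreal (Kn * h ^ p)"
    proof -
      have "(\<integral>\<^sup>+z. ennreal (\<bar>z\<bar> ^ p * u z) \<partial>lborel) = ennreal (\<eta> ^ p * Mk)"
        unfolding u_def smoothing_kernel_moment_eq[OF pm \<eta>(1)] Mk_def ..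
      also have "\<eta> ^ p * Mk = Kn * h ^ p" by (simp add: Kn_def \<eta>_def power_divide power_mult_distrib mult_ac)
      finally show ?thesis by simp
    qed
    obtain Cu where Cu: "\<And>z. norm (u z) \<le> Cu"
    proof -
      obtain C where "\<And>x. norm (smoothing_kernel (m + 1) x) \<le> C" using smoothing_kernel_bounded[of "m + 1"] by auto
      then have "norm (u z) \<le> C / \<eta>" for z unfolding u_def using \<eta> by (simp add: abs_divide divide_right_mono)
      then show ?thesis using that by blast
    qed
    obtain q where q[measurable]: "q \<in> borel_measurable borel" and qb: "\<And>x. \<bar>q x\<bar> \<le> K1 * h * (1 + \<bar>x\<bar>) ^ D"
      and q0: "(\<integral>x. ?\<phi> x * q x \<partial>lborel) = 0"
      and fe: "\<And>x. (1 + \<bar>x\<bar>) ^ (m + 1) * \<bar>(\<integral>y. u (x - y) \<partial>\<mu>) - (\<integral>y. u (x - y) * (?\<phi> y * (1 + q y)) \<partial>lborel)\<bar> \<le> K1 * h ^ p"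
      using expand[OF h \<mu> Dl Bl Z ch] unfolding u_def \<eta>_def p_def by blast
    have \<beta>0: "0 \<le> K1 * h" using K1 h by simp
    show "transport (m - 1) \<mu> std_normal_distribution (K * h ^ (m - 1))"
    proof (rule density_truncation[OF q p \<beta>0 qb q0])
      fix q' assume q'[measurable]: "q' \<in> borel_measurable borel" and q'h: "\<And>x. \<bar>q' x\<bar> \<le> 1/2"
        and q'b: "\<And>x. \<bar>q' x\<bar> \<le> K1 * h * (1 + 4 ^ (p - 1) * (K1 * h) ^ (p - 1) * (\<integral>x. ?\<phi> x * (1 + \<bar>x\<bar>) ^ (D * p) \<partial>lborel)) * (1 + \<bar>x\<bar>) ^ D"
        and q'0: "(\<integral>x. ?\<phi> x * q' x \<partial>lborel) = 0"
        and qq: "\<And>x. \<bar>q x - q' x\<bar> \<le> (K1 * h) ^ p * (4 ^ (p - 1) * (1 + (\<integral>x. ?\<phi> x * (1 + \<bar>x\<bar>) ^ (D * p) \<partial>lborel))) * (1 + \<bar>x\<bar>) ^ (D * p)"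
      note q'b = q'b[folded M_def] and qq = qq[folded M_def, folded c5_def]
      define \<nu> where "\<nu> = density lborel (\<lambda>x. ?\<phi> x * (1 + q' x))"
      have q'1: "0 \<le> 1 + q' x" for x using q'h[of x] by (auto simp: abs_le_iff)
      have q'b': "\<bar>q' x\<bar> \<le> K1 * c4 * h * (1 + \<bar>x\<bar>) ^ D" for x
      proof -
        have "(K1 * h) ^ (p - 1) \<le> (K1 * H) ^ (p - 1)" using K1 h by (intro power_mono mult_left_mono) auto
        then have "1 + 4 ^ (p - 1) * (K1 * h) ^ (p - 1) * M \<le> c4" unfolding c4_def using M
          by (intro add_left_mono mult_right_mono mult_left_mono) auto
        then have "K1 * h * (1 + 4 ^ (p - 1) * (K1 * h) ^ (p - 1) * M) * (1 + \<bar>x\<bar>) ^ D \<le> K1 * h * c4 * (1 + \<bar>x\<bar>) ^ D"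
          using \<beta>0 by (intro mult_right_mono mult_left_mono) auto
        then show ?thesis using q'b[of x] by (simp add: mult_ac)
      qed
      have t4: "transport p \<nu> std_normal_distribution (Kq * h ^ p)"
      proof -
        have "transport p \<nu> std_normal_distribution (K2 * (K1 * c4 * h) ^ p)"
          unfolding \<nu>_def using K1 c4 h by (intro quantile q' q'b' q'h q'0) auto
        then show ?thesis by (simp add: Kq_def power_mult_distrib mult_ac)
      qed
      note \<nu>p = transport_prob_space(1,3)[OF t4]
      interpret \<nu>: prob_space \<nu> by (rule \<nu>p)
      define f where "f x = (\<integral>y. u (x - y) \<partial>\<mu>)" for x
      define g where "g x = (\<integral>y. u (x - y) * (?\<phi> y * (1 + q' y)) \<partial>lborel)" for x
      \<comment> \<open>The smoothing of the untruncated expansion. It may take negative values, so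
        it serves only as an intermediate function in the comparison of the densities f and
        g.\<close>
      define e where "e x = (\<integral>y. u (x - y) * (?\<phi> y * (1 + q y)) \<partial>lborel)" for x
      have [measurable]: "f \<in> borel_measurable borel" "g \<in> borel_measurable borel" "e \<in> borel_measurable borel"
        unfolding f_def[abs_def] g_def[abs_def] e_def[abs_def] by measurable
      have f0: "0 \<le> f x" "0 \<le> g x" for x
        unfolding f_def g_def using u0 q'1 by (auto intro!: integral_nonneg_AE)
      have intb: "integrable lborel (\<lambda>x. ?\<phi> x * f x)" if [measurable]: "f \<in> borel_measurable borel" and "\<And>x. \<bar>f x\<bar> \<le> C * (1 + \<bar>x\<bar>) ^ k" for f C k
      proof (rule Bochner_Integration.integrable_bound[OF integrable_mult_right[OF integrable_std_normal_poly, of C k]])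
        have "?\<phi> x * \<bar>f x\<bar> \<le> \<bar>C * (?\<phi> x * (1 + \<bar>x\<bar>) ^ k)\<bar>" for x
        proof -
          have "?\<phi> x * \<bar>f x\<bar> \<le> ?\<phi> x * (C * (1 + \<bar>x\<bar>) ^ k)" by (intro mult_left_mono that) simp
          then show ?thesis by (simp add: mult.left_commute)
        qed
        then show "AE x in lborel. norm (?\<phi> x * f x) \<le> norm (C * (?\<phi> x * (1 + \<bar>x\<bar>) ^ k))"
          by (simp add: abs_mult)
      qed measurable
      have i0: "integrable lborel ?\<phi>" by simp
      have ig: "integrable lborel (\<lambda>y. ?\<phi> y * (1 + q' y))"
        using Bochner_Integration.integrable_add[OF i0 intb[OF q' q'b']] by (simp add: distrib_left)
      have ie: "integrable lborel (\<lambda>y. ?\<phi> y * (1 + q y))"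
        using Bochner_Integration.integrable_add[OF i0 intb[OF q qb]] by (simp add: distrib_left)
      have iub: "integrable N (\<lambda>y. u (x - y) * w y)" if "integrable N w" and [measurable_cong]: "sets N = sets borel" for N w x
      proof (rule Bochner_Integration.integrable_bound[OF integrable_mult_right[OF that(1), of Cu]])
        have [measurable]: "w \<in> borel_measurable N" using that(1) by simp
        show "(\<lambda>y. u (x - y) * w y) \<in> borel_measurable N" by measurable
        have "\<bar>u z\<bar> * \<bar>w y\<bar> \<le> \<bar>Cu\<bar> * \<bar>w y\<bar>" for z y using Cu[of z] by (intro mult_right_mono) auto
        then show "AE y in N. norm (u (x - y) * w y) \<le> norm (Cu * w y)" by (simp add: abs_mult)
      qed
      have fe': "ennreal (f x) = (\<integral>\<^sup>+y. ennreal (u (x - y)) \<partial>\<mu>)" for x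
      proof -
        have "integrable \<mu> (\<lambda>y. u (x - y) * 1)" by (rule iub) auto
        then show ?thesis unfolding f_def using u0 by (subst nn_integral_eq_integral) auto
      qed
      have ge': "ennreal (g x) = (\<integral>\<^sup>+y. ennreal (u (x - y)) \<partial>\<nu>)" for x
      proof -
        have "(\<integral>\<^sup>+y. ennreal (u (x - y)) \<partial>\<nu>) = (\<integral>\<^sup>+y. ennreal (?\<phi> y * (1 + q' y)) * ennreal (u (x - y)) \<partial>lborel)"
          unfolding \<nu>_def by (rule nn_integral_density) measurable
        also have "\<dots> = (\<integral>\<^sup>+y. ennreal (u (x - y) * (?\<phi> y * (1 + q' y))) \<partial>lborel)"
          using u0 q'1 by (intro nn_integral_cong) (simp add: ennreal_mult mult.commute)
        also have "\<dots> = ennreal (g x)"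
          unfolding g_def using u0 q'1 by (intro nn_integral_eq_integral iub[OF ig]) auto
        finally show ?thesis by simp
      qed
      have t1: "transport p \<mu> (density lborel f) (Kn * h ^ p)"
        using transport_noise[OF \<mu>.prob_space_axioms _ _ u0 u1 um] by (simp add: fe')
      have t3: "transport p \<nu> (density lborel g) (Kn * h ^ p)"
        using transport_noise[OF \<nu>p _ u0 u1 um] by (simp add: ge')
      \<comment> \<open>Unit mass is read off from the noise couplings, whose second marginals are
        probability measures.\<close>
      have mass: "(\<integral>\<^sup>+x. ennreal (f x) \<partial>lborel) = 1" "(\<integral>\<^sup>+x. ennreal (g x) \<partial>lborel) = 1"
        using prob_space.emeasure_space_1[OF transport_prob_space(2)[OF t1]] prob_space.emeasure_space_1[OF transport_prob_space(2)[OF t3]]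
        by (simp_all add: emeasure_density)
      \<comment> \<open>Dominates the change of the Edgeworth density caused by the truncation; it
        is of order h^p.\<close>
      define \<psi> where "\<psi> y = ?\<phi> y * ((K1 * h) ^ p * c5 * (1 + \<bar>y\<bar>) ^ (D * p))" for y
      have [measurable]: "\<psi> \<in> borel_measurable borel" unfolding \<psi>_def[abs_def] by measurable
      have \<psi>0: "0 \<le> \<psi> y" for y using \<beta>0 c5 by (simp add: \<psi>_def)
      have \<psi>eq: "(1 + \<bar>y\<bar>) ^ p * \<psi> y = (K1 * h) ^ p * c5 * (?\<phi> y * (1 + \<bar>y\<bar>) ^ (p + D * p))" for y
        by (simp add: \<psi>_def power_add mult_ac)
      have i\<psi>: "integrable lborel (\<lambda>y. (1 + \<bar>y\<bar>) ^ p * \<psi> y)"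
        unfolding \<psi>eq by (intro integrable_mult_right integrable_std_normal_poly)
      have \<psi>M: "(\<integral>y. (1 + \<bar>y\<bar>) ^ p * \<psi> y \<partial>lborel) = (K1 * h) ^ p * c5 * M'"
        unfolding \<psi>eq M'_def by simp
      have iu: "integrable lborel (\<lambda>y. (1 + \<bar>y\<bar>) ^ p * u y)" "(\<integral>y. (1 + \<bar>y\<bar>) ^ p * u y \<partial>lborel) \<le> Mu"
        unfolding u_def Mu_def using smoothing_kernel_moment_scaled[OF pm \<eta>] by auto
      have eg: "ennreal \<bar>e x - g x\<bar> \<le> (\<integral>\<^sup>+y. ennreal (u (x - y) * \<psi> y) \<partial>lborel)" for x
      proof -
        have "e x - g x = (\<integral>y. u (x - y) * (?\<phi> y * (1 + q y)) - u (x - y) * (?\<phi> y * (1 + q' y)) \<partial>lborel)"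
          unfolding e_def g_def using iub[OF ie] iub[OF ig] by (subst Bochner_Integration.integral_diff) auto
        also have "\<dots> = (\<integral>y. u (x - y) * (?\<phi> y * (q y - q' y)) \<partial>lborel)"
          by (intro Bochner_Integration.integral_cong) (auto simp: algebra_simps)
        finally have eq: "e x - g x = (\<integral>y. u (x - y) * (?\<phi> y * (q y - q' y)) \<partial>lborel)" .
        have "integrable lborel (\<lambda>y. u (x - y) * (?\<phi> y * (1 + q y)) - u (x - y) * (?\<phi> y * (1 + q' y)))"
          using iub[OF ie] iub[OF ig] by (intro Bochner_Integration.integrable_diff) auto
        then have "integrable lborel (\<lambda>y. u (x - y) * (?\<phi> y * (q y - q' y)))" by (simp add: algebra_simps)
        then have "ennreal \<bar>e x - g x\<bar> \<le> (\<integral>\<^sup>+y. ennreal (norm (u (x - y) * (?\<phi> y * (q y - q' y)))) \<partial>lborel)"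
          unfolding eq real_norm_def[symmetric] by (rule integral_norm_bound_ennreal)
        also have "\<dots> \<le> (\<integral>\<^sup>+y. ennreal (u (x - y) * \<psi> y) \<partial>lborel)"
        proof (intro nn_integral_mono ennreal_leI)
          fix y
          have "u (x - y) * (?\<phi> y * \<bar>q y - q' y\<bar>) \<le> u (x - y) * \<psi> y"
            unfolding \<psi>_def using qq u0 by (intro mult_left_mono) auto
          then show "norm (u (x - y) * (?\<phi> y * (q y - q' y))) \<le> u (x - y) * \<psi> y" using u0 by (simp add: abs_mult)
        qed
        finally show ?thesis .
      qed
      have tv: "(\<integral>\<^sup>+x. ennreal (\<bar>x\<bar> ^ p * \<bar>f x - g x\<bar>) \<partial>lborel) \<le> ennreal (Ktv * h ^ p)"
      proof -
        have "(\<integral>\<^sup>+x. ennreal (\<bar>x\<bar> ^ p * \<bar>f x - g x\<bar>) \<partial>lborel)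
          \<le> (\<integral>\<^sup>+x. ennreal (K1 * h ^ p * (1 / (1 + \<bar>x\<bar>)\<^sup>2)) + ennreal ((1 + \<bar>x\<bar>) ^ p) * (\<integral>\<^sup>+y. ennreal (u (x - y) * \<psi> y) \<partial>lborel) \<partial>lborel)"
        proof (rule nn_integral_mono)
          fix x
          have "(1 + \<bar>x\<bar>) ^ p * \<bar>f x - e x\<bar> \<le> K1 * h ^ p * (1 / (1 + \<bar>x\<bar>)\<^sup>2)"
            by (rule weighted_decay_bound[OF fe[folded f_def e_def]]) (use m in \<open>auto simp: p_def\<close>)
          then have a: "ennreal ((1 + \<bar>x\<bar>) ^ p * \<bar>f x - e x\<bar>) \<le> ennreal (K1 * h ^ p * (1 / (1 + \<bar>x\<bar>)\<^sup>2))" by (rule ennreal_leI)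
          have b: "ennreal ((1 + \<bar>x\<bar>) ^ p * \<bar>e x - g x\<bar>) \<le> ennreal ((1 + \<bar>x\<bar>) ^ p) * (\<integral>\<^sup>+y. ennreal (u (x - y) * \<psi> y) \<partial>lborel)"
            by (subst ennreal_mult) (auto intro: mult_left_mono eg)
          have "\<bar>x\<bar> ^ p * \<bar>f x - g x\<bar> \<le> (1 + \<bar>x\<bar>) ^ p * (\<bar>f x - e x\<bar> + \<bar>e x - g x\<bar>)"
            by (intro mult_mono power_mono) auto
          then have "ennreal (\<bar>x\<bar> ^ p * \<bar>f x - g x\<bar>) \<le> ennreal ((1 + \<bar>x\<bar>) ^ p * \<bar>f x - e x\<bar> + (1 + \<bar>x\<bar>) ^ p * \<bar>e x - g x\<bar>)"
            by (intro ennreal_leI) (simp add: distrib_left)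
          also have "\<dots> = ennreal ((1 + \<bar>x\<bar>) ^ p * \<bar>f x - e x\<bar>) + ennreal ((1 + \<bar>x\<bar>) ^ p * \<bar>e x - g x\<bar>)"
            by (rule ennreal_plus) auto
          finally show "ennreal (\<bar>x\<bar> ^ p * \<bar>f x - g x\<bar>) \<le> ennreal (K1 * h ^ p * (1 / (1 + \<bar>x\<bar>)\<^sup>2)) + ennreal ((1 + \<bar>x\<bar>) ^ p) * (\<integral>\<^sup>+y. ennreal (u (x - y) * \<psi> y) \<partial>lborel)"
            using add_mono[OF a b] by (rule order_trans)
        qed
        also have "\<dots> = (\<integral>\<^sup>+x. ennreal (K1 * h ^ p * (1 / (1 + \<bar>x\<bar>)\<^sup>2)) \<partial>lborel) + (\<integral>\<^sup>+x. ennreal ((1 + \<bar>x\<bar>) ^ p) * (\<integral>\<^sup>+y. ennreal (u (x - y) * \<psi> y) \<partial>lborel) \<partial>lborel)"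
          by (rule nn_integral_add) measurable
        also have "(\<integral>\<^sup>+x. ennreal (K1 * h ^ p * (1 / (1 + \<bar>x\<bar>)\<^sup>2)) \<partial>lborel) = ennreal (\<integral>x. K1 * h ^ p * (1 / (1 + \<bar>x\<bar>)\<^sup>2) \<partial>lborel)"
          using K1 h by (intro nn_integral_eq_integral integrable_mult_right integrable_rational_tail) auto
        also have "(\<integral>x. K1 * h ^ p * (1 / (1 + \<bar>x\<bar>)\<^sup>2) \<partial>lborel) = K1 * h ^ p * I2"
          unfolding I2_def by (rule integral_mult_right_zero)
        also have "(\<integral>\<^sup>+x. ennreal ((1 + \<bar>x\<bar>) ^ p) * (\<integral>\<^sup>+y. ennreal (u (x - y) * \<psi> y) \<partial>lborel) \<partial>lborel)
          \<le> ennreal (((K1 * h) ^ p * c5 * M') * (\<integral>y. (1 + \<bar>y\<bar>) ^ p * u y \<partial>lborel))"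
          unfolding \<psi>M[symmetric] by (rule smoothing_moment_bound[OF _ \<psi>0 i\<psi> _ u0 iu(1)]) measurable
        also have "\<dots> \<le> ennreal (((K1 * h) ^ p * c5 * M') * Mu)"
          using \<beta>0 c5 M' iu(2) by (intro ennreal_leI mult_left_mono) auto
        also have "ennreal (K1 * h ^ p * I2) + ennreal (((K1 * h) ^ p * c5 * M') * Mu) = ennreal (Ktv * h ^ p)"
          using K1 h I2 \<beta>0 c5 M' Mu by (subst ennreal_plus[symmetric]) (auto simp: Ktv_def power_mult_distrib algebra_simps)
        finally show ?thesis by (simp add: add_left_mono)
      qed
      have t2: "transport p (density lborel f) (density lborel g) (2 ^ p * (Ktv * h ^ p))"
        using Ktv h p by (intro transport_weighted_total_variation f0 mass tv) auto
      have hp: "0 \<le> h ^ p" using h by simp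
      have ta: "transport p \<mu> (density lborel g) (Ka * h ^ p)"
      proof -
        \<comment> \<open>The gluing tolerance is \<delta> = h here and in the next two
          compositions, so that each contributes one more h^p.\<close>
        have "transport p \<mu> (density lborel g) (3 ^ p * (Kn * h ^ p + 2 ^ p * (Ktv * h ^ p) + h ^ p))"
          using Kn Ktv h hp by (intro transport_trans[OF t1 t2]) auto
        then show ?thesis by (simp add: Ka_def algebra_simps)
      qed
      have tb: "transport p (density lborel g) std_normal_distribution (Kb * h ^ p)"
      proof -
        have "transport p (density lborel g) std_normal_distribution (3 ^ p * (Kn * h ^ p + Kq * h ^ p + h ^ p))"
          using Kn Kq h hp by (intro transport_trans[OF transport_sym[OF t3] t4]) auto
        then show ?thesis by (simp add: Kb_def algebra_simps)
      qed
      have "transport p \<mu> std_normal_distribution (3 ^ p * (Ka * h ^ p + Kb * h ^ p + h ^ p))"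
        using Kab h hp by (intro transport_trans[OF ta tb]) auto
      then show ?thesis by (simp add: K_def p_def algebra_simps)
    qed
  qed
  qed
  qed
qed

section \<open>From the growth condition to the coupling\<close>

text \<open>Lifts a coupling of two real laws to the spaces that carry the variables, by gluing M to
  \<pi> and the result to N. The tolerance 1 in both gluings accounts for the summand 2 and is
  affordable because in the end only boundedness is claimed.\<close>

lemma couple_measure_spaces:
  fixes f :: "'a \<Rightarrow> real" and g :: "'b \<Rightarrow> real"
  assumes M: "prob_space M" and N: "prob_space N"
    and [measurable]: "f \<in> borel_measurable M" "g \<in> borel_measurable N"
    and t: "transport p (distr M borel f) (distr N borel g) K" and K: "0 \<le> K"
  obtains Q where "prob_space Q" "sets Q = sets (M \<Otimes>\<^sub>M N)" "distr Q M fst = M" "distr Q N snd = N"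
    "(\<integral>\<^sup>+z. ennreal (\<bar>f (fst z) - g (snd z)\<bar> ^ p) \<partial>Q) \<le> ennreal (3 ^ p * (K + 2))"
proof -
  obtain \<pi> :: "(real \<times> real) measure" where \<pi>: "prob_space \<pi>" "sets \<pi> = sets borel"
    "fst \<in> borel_measurable \<pi>" "snd \<in> borel_measurable \<pi>"
    "distr \<pi> borel fst = distr M borel f" "distr \<pi> borel snd = distr N borel g"
    "(\<integral>\<^sup>+z. ennreal (\<bar>fst z - snd z\<bar> ^ p) \<partial>\<pi>) \<le> ennreal K" using t by (rule transportE)
  note [measurable] = \<pi>(3,4)
  obtain P1 where P1: "prob_space P1" "sets P1 = sets (M \<Otimes>\<^sub>M \<pi>)"
    "distr P1 M fst = M" "distr P1 \<pi> snd = \<pi>" "AE z in P1. \<bar>f (fst z) - fst (snd z)\<bar> \<le> 1"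
    by (rule glue_approx[OF M \<pi>(1) assms(3) \<pi>(3) \<pi>(5)[symmetric] zero_less_one])
  have m1: "fst \<in> measurable P1 M" "snd \<in> measurable P1 \<pi>"
    unfolding measurable_cong_sets[OF P1(2) refl] by measurable
  note [measurable] = m1
  have m1': "(\<lambda>z. snd (snd z)) \<in> borel_measurable P1" by measurable
  have l2: "distr P1 borel (\<lambda>z. snd (snd z)) = distr N borel g"
    using distr_distr[OF \<pi>(4) m1(2)] by (simp add: P1(4) \<pi>(6) comp_def)
  obtain P2 where P2: "prob_space P2" "sets P2 = sets (P1 \<Otimes>\<^sub>M N)"
    "distr P2 P1 fst = P1" "distr P2 N snd = N" "AE z in P2. \<bar>snd (snd (fst z)) - g (snd z)\<bar> \<le> 1"
    by (rule glue_approx[OF P1(1) N m1' assms(4) l2 zero_less_one])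
  interpret P2: prob_space P2 by (rule P2(1))
  have m2: "fst \<in> measurable P2 P1" "snd \<in> measurable P2 N"
    unfolding measurable_cong_sets[OF P2(2) refl] by measurable
  note [measurable] = m2
  define F where "F z = (fst (fst z), snd z)" for z :: "('a \<times> real \<times> real) \<times> 'b"
  have F: "F \<in> measurable P2 (M \<Otimes>\<^sub>M N)" unfolding F_def[abs_def] by measurable
  define Q where "Q = distr P2 (M \<Otimes>\<^sub>M N) F"
  have ae: "AE z in P2. \<bar>f (fst (fst z)) - fst (snd (fst z))\<bar> \<le> 1"
  proof -
    have "AE z in distr P2 P1 fst. \<bar>f (fst z) - fst (snd z)\<bar> \<le> 1" unfolding P2(3) by (rule P1(5))
    then show ?thesis by (rule AE_distrD[OF m2(1)])
  qed
  have "(\<integral>\<^sup>+z. ennreal (\<bar>f (fst z) - g (snd z)\<bar> ^ p) \<partial>Q) = (\<integral>\<^sup>+z. ennreal (\<bar>f (fst (fst z)) - g (snd z)\<bar> ^ p) \<partial>P2)"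
    unfolding Q_def by (subst nn_integral_distr[OF F]) (simp_all add: F_def)
  also have "\<dots> \<le> (\<integral>\<^sup>+z. ennreal (3 ^ p) * (ennreal (\<bar>fst (snd (fst z)) - snd (snd (fst z))\<bar> ^ p) + 2) \<partial>P2)"
  proof (rule nn_integral_mono_AE, use ae P2(5) in eventually_elim)
    case (elim z)
    let ?y = "\<bar>fst (snd (fst z)) - snd (snd (fst z))\<bar>"
    have "\<bar>f (fst (fst z)) - g (snd z)\<bar> \<le> 1 + ?y + 1" using elim by linarith
    then have "\<bar>f (fst (fst z)) - g (snd z)\<bar> ^ p \<le> (1 + ?y + 1) ^ p" by (intro power_mono) auto
    also have "\<dots> \<le> 3 ^ p * (1 ^ p + ?y ^ p + 1 ^ p)" by (intro power_sum3_le) auto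
    finally have "ennreal (\<bar>f (fst (fst z)) - g (snd z)\<bar> ^ p) \<le> ennreal (3 ^ p * (?y ^ p + 2))"
      by (intro ennreal_leI) (simp add: add.commute)
    also have "\<dots> = ennreal (3 ^ p) * (ennreal (?y ^ p) + 2)"
      by (subst ennreal_mult) (auto simp: ennreal_plus)
    finally show ?case .
  qed
  also have "\<dots> = ennreal (3 ^ p) * ((\<integral>\<^sup>+z. ennreal (\<bar>fst (snd (fst z)) - snd (snd (fst z))\<bar> ^ p) \<partial>P2) + 2)"
    by (simp add: nn_integral_cmult nn_integral_add P2.emeasure_space_1)
  also have "(\<integral>\<^sup>+z. ennreal (\<bar>fst (snd (fst z)) - snd (snd (fst z))\<bar> ^ p) \<partial>P2) = (\<integral>\<^sup>+z. ennreal (\<bar>fst (snd z) - snd (snd z)\<bar> ^ p) \<partial>P1)"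
    using nn_integral_distr[OF m2(1), of "\<lambda>z. ennreal (\<bar>fst (snd z) - snd (snd z)\<bar> ^ p)"] by (simp add: P2(3))
  also have "\<dots> = (\<integral>\<^sup>+z. ennreal (\<bar>fst z - snd z\<bar> ^ p) \<partial>\<pi>)"
    using nn_integral_distr[OF m1(2), of "\<lambda>z. ennreal (\<bar>fst z - snd z\<bar> ^ p)"] by (simp add: P1(4))
  also have "ennreal (3 ^ p) * ((\<integral>\<^sup>+z. ennreal (\<bar>fst z - snd z\<bar> ^ p) \<partial>\<pi>) + 2) \<le> ennreal (3 ^ p) * (ennreal K + 2)"
    by (intro mult_left_mono add_mono \<pi>(7)) auto
  also have "\<dots> = ennreal (3 ^ p * (K + 2))"
    using K by (subst ennreal_mult) (auto simp: ennreal_plus)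
  finally have cost: "(\<integral>\<^sup>+z. ennreal (\<bar>f (fst z) - g (snd z)\<bar> ^ p) \<partial>Q) \<le> ennreal (3 ^ p * (K + 2))" .
  have d1: "distr Q M fst = M"
  proof -
    have "distr Q M fst = distr P2 M (fst \<circ> F)" unfolding Q_def by (rule distr_distr[OF measurable_fst F])
    also have "fst \<circ> F = fst \<circ> fst" by (auto simp: F_def)
    also have "distr P2 M (fst \<circ> fst) = distr (distr P2 P1 fst) M fst" by (rule distr_distr[OF m1(1) m2(1), symmetric])
    finally show ?thesis by (simp add: P2(3) P1(3))
  qed
  have d2: "distr Q N snd = N"
  proof -
    have "distr Q N snd = distr P2 N (snd \<circ> F)" unfolding Q_def by (rule distr_distr[OF measurable_snd F])
    also have "snd \<circ> F = snd" by (auto simp: F_def)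
    finally show ?thesis by (simp add: P2(4))
  qed
  show ?thesis
    by (rule that[OF _ _ d1 d2 cost]) (auto simp: Q_def intro: P2.prob_space_distr F)
qed

section \<open>The continuous logarithm of a characteristic function and its derivatives\<close>

lemma continuous_log_unique:
  assumes "continuous_on S L1" "continuous_on S L2" "connected S" "a \<in> S" "L1 a = L2 a" "t \<in> S"
    and "\<And>s. s \<in> S \<Longrightarrow> exp (L1 s) = exp (L2 s :: complex)"
  shows "L1 t = L2 t"
proof -
  \<comment> \<open>Two logarithms of the same function differ by a multiple of 2 \<pi> i. These
    values are isolated, so a continuous difference on a connected set is constant.\<close>
  have sep: "1 \<le> norm (w - z)" if w: "exp w = 1" "exp z = 1" "w \<noteq> z" for w z :: complex
  proof -
    have "exp (w - z) = 1" using w by (simp add: exp_diff)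
    then obtain n :: int where n: "Re (w - z) = 0" "Im (w - z) = of_int (2 * n) * pi" using exp_eq_1 by blast
    have "n \<noteq> 0" using n w(3) by (auto simp: complex_eq_iff)
    then have "1 \<le> \<bar>real_of_int n\<bar>" by linarith
    then have "1 * 1 \<le> (2 * \<bar>real_of_int n\<bar>) * pi" using pi_gt3 by (intro mult_mono) auto
    then have "1 \<le> \<bar>Im (w - z)\<bar>" unfolding n(2) by (simp add: abs_mult)
    then show ?thesis using abs_Im_le_cmod[of "w - z"] by linarith
  qed
  have e1: "exp (L1 s - L2 s) = 1" if "s \<in> S" for s using assms(7)[OF that] by (simp add: exp_diff)
  have "(\<lambda>s. L1 s - L2 s) constant_on S"
  proof (rule continuous_discrete_range_constant[OF assms(3)])
    show "continuous_on S (\<lambda>s. L1 s - L2 s)" by (intro continuous_intros assms)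
    show "\<exists>e>0. \<forall>y. y \<in> S \<and> L1 y - L2 y \<noteq> L1 x - L2 x \<longrightarrow> e \<le> norm (L1 y - L2 y - (L1 x - L2 x))" if "x \<in> S" for x
      using sep[OF e1 e1[OF that]] by (intro exI[of _ 1]) auto
  qed
  then obtain c where "\<And>s. s \<in> S \<Longrightarrow> L1 s - L2 s = c" unfolding constant_on_def by blast
  from this[OF assms(4)] this[OF assms(6)] assms(5) show ?thesis by simp
qed

lemma exp_continuous_log:
  assumes "continuous_on (closed_segment 0 t) \<phi>" "\<phi> 0 = 1" "\<And>s. s \<in> closed_segment 0 t \<Longrightarrow> \<phi> s \<noteq> 0"
  shows "exp (continuous_log \<phi> t) = \<phi> t"
proof -
  let ?S = "closed_segment 0 t"
  obtain g where g: "continuous_on ?S g" "\<And>s. s \<in> ?S \<Longrightarrow> \<phi> s = exp (g s)"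
    using continuous_logarithm_on_contractible[OF assms(1) convex_imp_contractible[OF convex_closed_segment] assms(3)] by auto
  define L where "L s = g s - g 0" for s
  have g0: "exp (g 0) = 1" using g(2)[of 0] assms(2) by simp
  have L: "continuous_on ?S L" "L 0 = 0" "\<And>s. s \<in> ?S \<Longrightarrow> exp (L s) = \<phi> s"
    unfolding L_def using g g0 by (auto intro!: continuous_intros simp: exp_diff)
  have "continuous_log \<phi> t = L t"
    unfolding continuous_log_def
  proof (rule the_equality)
    show "\<exists>La. continuous_on ?S La \<and> La 0 = 0 \<and> (\<forall>s\<in>?S. exp (La s) = \<phi> s) \<and> La t = L t"
      using L by blast
    fix z assume "\<exists>La. continuous_on ?S La \<and> La 0 = 0 \<and> (\<forall>s\<in>?S. exp (La s) = \<phi> s) \<and> La t = z"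
    then obtain La where La: "continuous_on ?S La" "La 0 = 0" "\<forall>s\<in>?S. exp (La s) = \<phi> s" "La t = z" by blast
    have "La t = L t"
      by (rule continuous_log_unique[OF La(1) L(1) connected_segment, of 0]) (use La L in auto)
    then show "z = L t" using La by simp
  qed
  then show ?thesis using L(3)[of t] by simp
qed

lemma continuous_log_0:
  assumes "\<phi> 0 = 1"
  shows "continuous_log \<phi> 0 = 0"
  unfolding continuous_log_def
  by (rule the_equality) (use assms in \<open>auto intro!: exI[of _ "\<lambda>_. 0"]\<close>)

text \<open>The growth condition uses derivatives within intervals that may differ from one j to the
  next. In the interior all of them agree with the two-sided derivatives iterated here, which gives
  one chain of derivatives for all j.\<close>

definition nth_vector_deriv :: "nat \<Rightarrow> (real \<Rightarrow> complex) \<Rightarrow> real \<Rightarrow> complex" where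
  "nth_vector_deriv k f = ((\<lambda>g t. vector_derivative g (at t)) ^^ k) f"

lemma nth_vector_deriv_Suc: "nth_vector_deriv (Suc k) f t = vector_derivative (nth_vector_deriv k f) (at t)"
  by (simp add: nth_vector_deriv_def)

lemma nth_deriv_within_interior:
  "t \<in> interior I \<Longrightarrow> nth_deriv_within I k f t = nth_vector_deriv k f t"
proof (induction k arbitrary: t)
  case 0
  then show ?case by (simp add: nth_vector_deriv_def)
next
  case (Suc k)
  have "(nth_deriv_within I k f has_vector_derivative D) (at t) \<longleftrightarrow> (nth_vector_deriv k f has_vector_derivative D) (at t)" for D
    using has_vector_derivative_transform_within_open[OF _ open_interior Suc.prems, of "nth_deriv_within I k f" D "nth_vector_deriv k f"]
      has_vector_derivative_transform_within_open[OF _ open_interior Suc.prems, of "nth_vector_deriv k f" D "nth_deriv_within I k f"] Suc.IH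
    by auto
  then show ?case
    by (simp add: nth_vector_deriv_Suc at_within_interior[OF Suc.prems] vector_derivative_def)
qed

lemma nth_vector_deriv_has_vector_derivative:
  assumes "times_differentiable_on j f I" "k < j" "t \<in> interior I"
  shows "(nth_vector_deriv k f has_vector_derivative nth_vector_deriv (Suc k) f t) (at t)"
proof -
  have "t \<in> I" using assms(3) interior_subset by auto
  then have "nth_deriv_within I k f differentiable (at t within I)"
    using assms(1,2) by (auto simp: times_differentiable_on_def differentiable_on_def)
  then have "nth_deriv_within I k f differentiable (at t)" by (simp add: at_within_interior[OF assms(3)])
  then have "(nth_deriv_within I k f has_vector_derivative vector_derivative (nth_deriv_within I k f) (at t)) (at t)"
    by (simp add: vector_derivative_works)
  then have d: "(nth_vector_deriv k f has_vector_derivative vector_derivative (nth_deriv_within I k f) (at t)) (at t)"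
    by (rule has_vector_derivative_transform_within_open[OF _ open_interior assms(3)]) (rule nth_deriv_within_interior)
  then show ?thesis using vector_derivative_at[OF d] by (simp add: nth_vector_deriv_Suc)
qed

text \<open>Only two moments are assumed, so the vanishing of the first two cumulants is read off from
  \<open>\<phi>(t) = 1 - t\<^sup>2/2 + o(t\<^sup>2)\<close> and the assumed smoothness of \<open>ln \<phi>\<close>.\<close>

lemma log_char_derivatives_0:
  fixes l :: "nat \<Rightarrow> real \<Rightarrow> complex" and Y :: "'a \<Rightarrow> real"
  assumes "prob_space M" and [measurable]: "Y \<in> borel_measurable M"
    and i1: "integrable M Y" and i2: "integrable M (\<lambda>\<omega>. (Y \<omega>)\<^sup>2)"
    and mean: "(\<integral>\<omega>. Y \<omega> \<partial>M) = 0" and var: "(\<integral>\<omega>. (Y \<omega>)\<^sup>2 \<partial>M) = 1"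
    and T: "0 < T"
    and d: "\<And>j t. j \<le> 2 \<Longrightarrow> t \<in> {-T..T} \<Longrightarrow> (l j has_vector_derivative l (Suc j) t) (at t within {-T..T})"
    and b3: "\<And>t. t \<in> {-T..T} \<Longrightarrow> norm (l 3 t) \<le> C"
    and l0: "l 0 0 = 0"
    and ch: "\<And>t. t \<in> {-T..T} \<Longrightarrow> char (distr M borel Y) t = exp (l 0 t - of_real (t\<^sup>2 / 2))"
  shows "l 1 0 = 0" "l 2 0 = 0"
proof -
  interpret prob_space M by fact
  define a where "a = l 1 0"
  define b where "b = l 2 0"
  have C: "0 \<le> C" using order_trans[OF norm_ge_zero b3[of 0]] T by simp
  \<comment> \<open>The remainder of l after its second-order Taylor polynomial at 0, with the
    derivatives of that remainder; the coefficients a and b are the unknowns to be shown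
    zero.\<close>
  define r where "r j t = l j t - (if j = 0 then a * of_real t + b * of_real (t\<^sup>2 / 2) else if j = 1 then a + b * of_real t else if j = 2 then b else 0)" for j :: nat and t :: real
  have rd: "(r j has_vector_derivative r (Suc j) t) (at t within {-T..T})" if "j \<le> 2" "t \<in> {-T..T}" for j t
  proof -
    have i: "((\<lambda>t. complex_of_real t) has_vector_derivative 1) (at t within {-T..T})"
      using has_vector_derivative_of_real[OF DERIV_ident] by simp
    have s: "((\<lambda>t. complex_of_real (t\<^sup>2 / 2)) has_vector_derivative of_real t) (at t within {-T..T})"
      by (rule has_vector_derivative_of_real) (auto intro!: derivative_eq_intros)
    consider "j = 0" | "j = 1" | "j = 2" using \<open>j \<le> 2\<close> by linarith
    then show ?thesis
    proof cases
      case 1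
      have "((\<lambda>t. l 0 t - (a * of_real t + b * of_real (t\<^sup>2 / 2))) has_vector_derivative l 1 t - (a * 1 + b * of_real t)) (at t within {-T..T})"
        using d[of 0 t] that by (intro has_vector_derivative_diff has_vector_derivative_add has_vector_derivative_mult_right i s) auto
      then show ?thesis using 1 by (simp add: r_def[abs_def])
    next
      case 2
      have "((\<lambda>t. l 1 t - (a + b * of_real t)) has_vector_derivative l 2 t - (0 + b * 1)) (at t within {-T..T})"
        using d[of 1 t] that by (intro has_vector_derivative_diff has_vector_derivative_add has_vector_derivative_mult_right has_vector_derivative_const i) (auto simp: numeral_2_eq_2)
      then show ?thesis using 2 by (simp add: r_def[abs_def] numeral_2_eq_2)
    next
      case 3
      have "((\<lambda>t. l 2 t - b) has_vector_derivative l 3 t - 0) (at t within {-T..T})"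
        using d[of 2 t] that by (intro has_vector_derivative_diff has_vector_derivative_const) (auto simp: numeral_eq_Suc)
      then show ?thesis using 3 by (simp add: r_def[abs_def] numeral_eq_Suc)
    qed
  qed
  have rb: "norm (r (3 - k) t) \<le> C * \<bar>t\<bar> ^ k" if "k \<le> 3" "t \<in> {-T..T}" for k t
    using that
  proof (induction k arbitrary: t)
    case 0
    then show ?case using b3[of t] by (simp add: r_def)
  next
    case (Suc k)
    define j where "j = 2 - k"
    have j: "j \<le> 2" "3 - Suc k = j" "3 - k = Suc j" using Suc.prems by (auto simp: j_def)
    have "r j 0 = 0" using j(1) l0 by (auto simp: r_def a_def b_def le_Suc_eq numeral_2_eq_2)
    then have "norm (r j t) \<le> C * \<bar>t\<bar> ^ Suc k"
      using Suc.IH[unfolded j(3)] Suc.prems rd[OF j(1)] C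
      by (intro norm_le_of_vector_derivative_power[where T = T and g' = "r (Suc j)"]) auto
    then show ?case by (simp only: j(2))
  qed
  have r3: "norm (r 0 t) \<le> C * \<bar>t\<bar> ^ 3" if "t \<in> {-T..T}" for t using rb[of 3 t] that by simp
  define G where "G t = expectation (\<lambda>\<omega>. min (6 * (Y \<omega>)\<^sup>2) (\<bar>t\<bar> * \<bar>Y \<omega>\<bar> ^ 3)) / 6" for t
  have G: "norm (char (distr M borel Y) t - (1 - of_real (t\<^sup>2 / 2))) \<le> t\<^sup>2 * G t" for t
    using char_approx3'[OF assms(2) i1 i2 mean, of 1 "distr M borel Y" t] var mean by (simp add: G_def)
  have G1: "G t \<le> 1" for t
  proof -
    have "expectation (\<lambda>\<omega>. min (6 * (Y \<omega>)\<^sup>2) (\<bar>t\<bar> * \<bar>Y \<omega>\<bar> ^ 3)) \<le> expectation (\<lambda>\<omega>. 6 * (Y \<omega>)\<^sup>2)"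
      by (rule integral_mono') (auto intro!: integrable_mult_right i2)
    then show ?thesis using var by (simp add: G_def)
  qed
  define s where "s n = T / real (Suc n)" for n
  have s: "0 < s n" "s n \<le> T" "s n \<in> {-T..T}" for n using T by (auto simp: s_def field_simps)
  have slim: "s \<longlonglongrightarrow> 0" unfolding s_def[abs_def] by (rule LIMSEQ_Suc[OF lim_const_over_n])
  have slim2: "(\<lambda>n. (s n)\<^sup>2) \<longlonglongrightarrow> 0" using tendsto_power[OF slim, of 2] by simp
  \<comment> \<open>Without a third moment the remainder is only o(t^2). The minimum with the
    integrable 6 Y^2 is what permits dominated convergence.\<close>
  have Glim: "(\<lambda>n. G (s n)) \<longlonglongrightarrow> 0"
  proof -
    have "(\<lambda>n. expectation (\<lambda>\<omega>. min (6 * (Y \<omega>)\<^sup>2) (\<bar>s n\<bar> * \<bar>Y \<omega>\<bar> ^ 3))) \<longlonglongrightarrow> expectation (\<lambda>\<omega>. 0)"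
    proof (rule integral_dominated_convergence[where w = "\<lambda>\<omega>. 6 * (Y \<omega>)\<^sup>2"])
      show "AE \<omega> in M. (\<lambda>n. min (6 * (Y \<omega>)\<^sup>2) (\<bar>s n\<bar> * \<bar>Y \<omega>\<bar> ^ 3)) \<longlonglongrightarrow> 0"
      proof (rule AE_I2)
        fix \<omega>
        have "(\<lambda>n. min (6 * (Y \<omega>)\<^sup>2) (\<bar>s n\<bar> * \<bar>Y \<omega>\<bar> ^ 3)) \<longlonglongrightarrow> min (6 * (Y \<omega>)\<^sup>2) (\<bar>0\<bar> * \<bar>Y \<omega>\<bar> ^ 3)"
          by (intro tendsto_intros slim)
        then show "(\<lambda>n. min (6 * (Y \<omega>)\<^sup>2) (\<bar>s n\<bar> * \<bar>Y \<omega>\<bar> ^ 3)) \<longlonglongrightarrow> 0" by simp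
      qed
      fix n
      show "AE \<omega> in M. norm (min (6 * (Y \<omega>)\<^sup>2) (\<bar>s n\<bar> * \<bar>Y \<omega>\<bar> ^ 3)) \<le> 6 * (Y \<omega>)\<^sup>2"
        by (rule AE_I2) (simp add: abs_le_iff min_def)
    qed (auto intro!: integrable_mult_right i2)
    then show ?thesis unfolding G_def using tendsto_divide[of _ 0 sequentially "\<lambda>_. 6" 6] by simp
  qed
  define z where "z t = l 0 t - of_real (t\<^sup>2 / 2)" for t
  have zr: "z t = a * of_real t + b * of_real (t\<^sup>2 / 2) + r 0 t - of_real (t\<^sup>2 / 2)" for t
    by (simp add: z_def r_def)
  have "(\<lambda>n. z (s n)) \<longlonglongrightarrow> 0"
  proof -
    have "continuous (at 0 within {-T..T}) (l 0)"
      using has_vector_derivative_continuous[OF d[of 0 0]] T by simp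
    then have "(\<lambda>n. l 0 (s n)) \<longlonglongrightarrow> l 0 0"
      by (rule continuous_within_tendsto_compose'[OF _ s(3) slim])
    then have "(\<lambda>n. l 0 (s n) - of_real ((s n)\<^sup>2 / 2)) \<longlonglongrightarrow> l 0 0 - of_real (0\<^sup>2 / 2)"
      by (intro tendsto_intros slim) simp_all
    then show ?thesis by (simp add: z_def l0)
  qed
  then have "eventually (\<lambda>n. norm (z (s n)) < 1/6) sequentially"
    using tendstoD[of "\<lambda>n. z (s n)" 0 sequentially "1/6"] by simp
  \<comment> \<open>Bootstrap: for |z| below 1/6 the quadratic error is at most |z|/2, so |z| is at
    most 2 |exp z - 1|, and the expansion of the characteristic function bounds the latter by 3
    t^2.\<close>
  then have zsmall: "eventually (\<lambda>n. norm (exp (z (s n)) - 1 - z (s n)) \<le> 3 * norm (z (s n)) ^ 2 \<and> norm (z (s n)) \<le> 3 * (s n)\<^sup>2) sequentially"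
  proof eventually_elim
    case (elim n)
    let ?z = "z (s n)"
    have "norm (exp ?z - 1 - ?z) = norm (exp_remainder 2 ?z)" by (simp add: exp_remainder_def numeral_2_eq_2 algebra_simps)
    also have "\<dots> \<le> norm ?z ^ 2 * exp (norm ?z)" by (rule norm_exp_remainder_le)
    also have "\<dots> \<le> norm ?z ^ 2 * 3"
    proof (intro mult_left_mono)
      have "exp (norm ?z) \<le> exp 1" using elim by simp
      then show "exp (norm ?z) \<le> 3" using exp_le by linarith
    qed simp
    finally have 1: "norm (exp ?z - 1 - ?z) \<le> 3 * norm ?z ^ 2" by simp
    have "norm ?z * norm ?z \<le> 1/6 * norm ?z" using elim by (intro mult_right_mono) auto
    then have 2: "norm ?z \<le> norm (exp ?z - 1) + 1/2 * norm ?z"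
      using 1 norm_triangle_ineq4[of "exp ?z - 1" "exp ?z - 1 - ?z"] by (simp add: power2_eq_square)
    have "exp ?z - 1 = (char (distr M borel Y) (s n) - (1 - of_real ((s n)\<^sup>2 / 2))) - of_real ((s n)\<^sup>2 / 2)"
      using ch[OF s(3)] by (simp add: z_def)
    then have "norm (exp ?z - 1) \<le> (s n)\<^sup>2 * G (s n) + norm (complex_of_real ((s n)\<^sup>2 / 2))"
      using norm_triangle_ineq4[of "char (distr M borel Y) (s n) - (1 - of_real ((s n)\<^sup>2 / 2))" "of_real ((s n)\<^sup>2 / 2)"] G[of "s n"] by simp
    also have "\<dots> \<le> (s n)\<^sup>2 * 1 + (s n)\<^sup>2 / 2"
      unfolding norm_of_real by (intro add_mono mult_left_mono G1) auto
    finally show ?case using 1 2 by simp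
  qed
  have tri3: "norm (x - y - u) \<le> norm x + norm y + norm u" for x y u :: complex
    using norm_triangle_ineq4[of "x - y" u] norm_triangle_ineq4[of x y] by linarith
  have tri4: "norm (x - y - u + w) \<le> norm x + norm y + norm u + norm w" for x y u w :: complex
    using norm_triangle_ineq[of "x - y - u" w] tri3[of x y u] by linarith
  \<comment> \<open>z is O(t^2), whereas its linear term is a t: dividing by t and letting t tend to
    0 gives a = 0.\<close>
  have a0: "norm a \<le> 0"
  proof (rule tendsto_le[OF sequentially_bot])
    show "(\<lambda>n. (4 + norm b) * s n + C * (s n)\<^sup>2) \<longlonglongrightarrow> 0"
      using tendsto_add[OF tendsto_mult_right_zero[OF slim, of "4 + norm b"] tendsto_mult_right_zero[OF slim2, of C]] by simp
    show "(\<lambda>n. norm a) \<longlonglongrightarrow> norm a" by simp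
    show "eventually (\<lambda>n. norm a \<le> (4 + norm b) * s n + C * (s n)\<^sup>2) sequentially"
      using zsmall
    proof eventually_elim
      case (elim n)
      let ?t = "s n"
      have "a * of_real ?t = z ?t - b * of_real (?t\<^sup>2 / 2) - r 0 ?t + of_real (?t\<^sup>2 / 2)" by (simp add: zr)
      then have "norm (a * of_real ?t) \<le> norm (z ?t) + norm (b * of_real (?t\<^sup>2 / 2)) + norm (r 0 ?t) + norm (complex_of_real (?t\<^sup>2 / 2))"
        by (simp only: tri4)
      also have "\<dots> \<le> 3 * ?t\<^sup>2 + norm b * (?t\<^sup>2 / 2) + C * \<bar>?t\<bar> ^ 3 + ?t\<^sup>2 / 2"
        using elim r3[OF s(3)] unfolding norm_mult norm_of_real by (intro add_mono) auto
      also have "\<dots> \<le> 4 * ?t\<^sup>2 + norm b * ?t\<^sup>2 + C * ?t ^ 3"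
      proof -
        have t: "\<bar>?t\<bar> = ?t" using s(1)[of n] by simp
        have "0 \<le> norm b * ?t\<^sup>2" "0 \<le> ?t\<^sup>2" by simp_all
        then show ?thesis unfolding t by linarith
      qed
      also have "\<dots> = ((4 + norm b) * ?t + C * ?t\<^sup>2) * ?t"
        by (simp add: power2_eq_square power3_eq_cube algebra_simps)
      finally have "norm a * ?t \<le> ((4 + norm b) * ?t + C * ?t\<^sup>2) * ?t" using s(1)[of n] by (simp add: norm_mult)
      then show ?case using s(1)[of n] by (simp only: mult_le_cancel_right_pos)
    qed
  qed
  then show "l 1 0 = 0" by (simp add: a_def)
  have a0': "a = 0" using a0 by simp
  \<comment> \<open>With a = 0 the quadratic terms are compared. The summand 27 t^2 is 3 (3 t^2)^2
    divided by t^2.\<close>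
  have "norm b / 2 \<le> 0"
  proof (rule tendsto_le[OF sequentially_bot])
    show "(\<lambda>n. G (s n) + 27 * (s n)\<^sup>2 + C * s n) \<longlonglongrightarrow> 0"
      using tendsto_add[OF tendsto_add[OF Glim tendsto_mult_right_zero[OF slim2, of 27]] tendsto_mult_right_zero[OF slim, of C]] by simp
    show "(\<lambda>n. norm b / 2) \<longlonglongrightarrow> norm b / 2" by simp
    show "eventually (\<lambda>n. norm b / 2 \<le> G (s n) + 27 * (s n)\<^sup>2 + C * s n) sequentially"
      using zsmall
    proof eventually_elim
      case (elim n)
      let ?t = "s n"
      have chz: "char (distr M borel Y) ?t = exp (z ?t)" unfolding z_def by (rule ch[OF s(3)])
      have "b * of_real (?t\<^sup>2 / 2) = (char (distr M borel Y) ?t - (1 - of_real (?t\<^sup>2 / 2))) - (exp (z ?t) - 1 - z ?t) - r 0 ?t"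
        unfolding chz using zr[of ?t] by (simp add: a0')
      then have "norm (b * of_real (?t\<^sup>2 / 2)) \<le> norm (char (distr M borel Y) ?t - (1 - of_real (?t\<^sup>2 / 2))) + norm (exp (z ?t) - 1 - z ?t) + norm (r 0 ?t)"
        by (simp only: tri3)
      also have "\<dots> \<le> ?t\<^sup>2 * G ?t + 3 * (3 * ?t\<^sup>2)\<^sup>2 + C * \<bar>?t\<bar> ^ 3"
      proof (intro add_mono G r3 s)
        have "3 * (norm (z ?t))\<^sup>2 \<le> 3 * (3 * ?t\<^sup>2)\<^sup>2" using elim by (intro mult_left_mono power_mono) auto
        then show "norm (exp (z ?t) - 1 - z ?t) \<le> 3 * (3 * ?t\<^sup>2)\<^sup>2" using elim by linarith
      qed
      also have "\<dots> = (G ?t + 27 * ?t\<^sup>2 + C * ?t) * ?t\<^sup>2"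
        using s(1)[of n] by (simp add: power2_eq_square power3_eq_cube algebra_simps)
      finally have "norm b / 2 * ?t\<^sup>2 \<le> (G ?t + 27 * ?t\<^sup>2 + C * ?t) * ?t\<^sup>2" by (simp add: norm_mult norm_power)
      then show ?case using s(1)[of n] by (simp only: mult_le_cancel_right_pos zero_less_power)
    qed
  qed
  then show "l 2 0 = 0" by (simp add: b_def)
qed

section \<open>Normal laws as scaled standard normal laws\<close>

lemma distr_std_normal_scale:
  assumes "c > 0"
  shows "distr std_normal_distribution borel (\<lambda>x. c * x) = density lborel (normal_density 0 c)"
proof -
  interpret G: real_distribution std_normal_distribution by (rule real_dist_normal_dist)
  have "distributed std_normal_distribution lborel (\<lambda>x. x) std_normal_density"
    unfolding distributed_def by (auto simp: distr_id2)
  from G.normal_density_affine[OF this _ , of c 0] assms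
  have "distributed std_normal_distribution lborel (\<lambda>x. c * x) (normal_density 0 c)" by simp
  then have "distr std_normal_distribution lborel (\<lambda>x. c * x) = density lborel (normal_density 0 c)"
    by (rule distributed_distr_eq_density)
  then show ?thesis by (simp cong: distr_cong)
qed

lemma char_std_normal_scale:
  "char (distr std_normal_distribution borel (\<lambda>x. c * x)) t = exp (- of_real ((c * t)\<^sup>2 / 2))"
proof -
  have "char (distr std_normal_distribution borel (\<lambda>x. c * x)) t = char std_normal_distribution (c * t)"
    unfolding char_def by (subst integral_distr) (auto simp: mult_ac)
  then show ?thesis by (simp add: char_std_normal_distribution exp_of_real[symmetric])
qed

text \<open>The point mass is written as 0 times a standard normal variable, so degenerate and
  nondegenerate normal laws have the same form from here on.\<close>

lemma distr_AE_zero: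
  fixes f :: "'a \<Rightarrow> real"
  assumes "prob_space M" "f \<in> borel_measurable M" "AE \<omega> in M. f \<omega> = 0"
  shows "distr M borel f = distr std_normal_distribution borel (\<lambda>x. 0 * x)"
proof -
  interpret prob_space M by fact
  interpret G: real_distribution std_normal_distribution by (rule real_dist_normal_dist)
  have "distr M borel f = distr M borel (\<lambda>_. 0)"
    using assms by (intro distr_cong_AE) auto
  also have "\<dots> = distr std_normal_distribution borel (\<lambda>x. 0 * x)"
    by (simp add: distr_const G.distr_const)
  finally show ?thesis .
qed

lemma distr_centered_normal:
  assumes "prob_space M" "centered_normal M Z v"
  shows "distr M borel Z = distr std_normal_distribution borel (\<lambda>x. sqrt v * x)" "0 \<le> v"
proof -
  have Z: "Z \<in> borel_measurable M" using assms(2) by (simp add: centered_normal_def)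
  consider "v = 0" "AE \<omega> in M. Z \<omega> = 0" | "v > 0" "distributed M lborel Z (normal_density 0 (sqrt v))"
    using assms(2) by (auto simp: centered_normal_def)
  then show "distr M borel Z = distr std_normal_distribution borel (\<lambda>x. sqrt v * x)"
  proof cases
    case 1
    then show ?thesis using distr_AE_zero[OF assms(1) Z] by simp
  next
    case 2
    have "distr M borel Z = distr M lborel Z" by (simp cong: distr_cong)
    also have "\<dots> = density lborel (normal_density 0 (sqrt v))" by (rule distributed_distr_eq_density[OF 2(2)])
    finally show ?thesis using distr_std_normal_scale[of "sqrt v"] 2(1) by simp
  qed
  show "0 \<le> v" using assms(2) by (auto simp: centered_normal_def)
qed

text \<open>By independence the characteristic functions multiply, and the variances telescope to (B
  n)^2.\<close>

lemma distr_sum_centered_normal: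
  fixes Z :: "nat \<Rightarrow> 'b \<Rightarrow> real" and B :: "nat \<Rightarrow> real"
  assumes "prob_space N" "B 0 = 0"
    and Z: "\<And>j. j \<ge> 1 \<Longrightarrow> centered_normal N (Z j) ((B j)\<^sup>2 - (B (j - 1))\<^sup>2)"
    and indep: "prob_space.indep_vars N (\<lambda>_. borel) Z {1..}"
  shows "distr N borel (\<lambda>\<omega>. \<Sum>j=1..n. Z j \<omega>) = distr std_normal_distribution borel (\<lambda>x. B n * x)"
proof -
  interpret prob_space N by fact
  interpret G: real_distribution std_normal_distribution by (rule real_dist_normal_dist)
  have Zm: "Z j \<in> borel_measurable N" if "j \<ge> 1" for j using Z[OF that] by (simp add: centered_normal_def)
  show ?thesis
  proof (rule Levy_uniqueness)
    show "real_distribution (distr N borel (\<lambda>\<omega>. \<Sum>j=1..n. Z j \<omega>))"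
      using Zm by (intro real_distribution_distr borel_measurable_sum) auto
    show "real_distribution (distr std_normal_distribution borel (\<lambda>x. B n * x))"
      by (intro G.real_distribution_distr) simp
    show "char (distr N borel (\<lambda>\<omega>. \<Sum>j=1..n. Z j \<omega>)) = char (distr std_normal_distribution borel (\<lambda>x. B n * x))"
    proof
      fix t
      have "indep_vars (\<lambda>_. borel) Z {1..n}" by (rule indep_vars_subset[OF indep]) auto
      then have "char (distr N borel (\<lambda>\<omega>. \<Sum>j=1..n. Z j \<omega>)) t = (\<Prod>j=1..n. char (distr N borel (Z j)) t)"
        by (rule char_distr_sum)
      also have "\<dots> = (\<Prod>j=1..n. exp (of_real (- ((B j)\<^sup>2 - (B (j - 1))\<^sup>2) * t\<^sup>2 / 2)))"
      proof (intro prod.cong refl)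
        fix j assume "j \<in> {1..n}"
        then have j: "1 \<le> j" by simp
        note D = distr_centered_normal[OF assms(1) Z[OF j]]
        have eq: "- ((B j)\<^sup>2 - (B (j - 1))\<^sup>2) * t\<^sup>2 / 2 = - ((sqrt ((B j)\<^sup>2 - (B (j - 1))\<^sup>2) * t)\<^sup>2 / 2)"
        proof -
          have "(sqrt ((B j)\<^sup>2 - (B (j - 1))\<^sup>2) * t)\<^sup>2 = ((B j)\<^sup>2 - (B (j - 1))\<^sup>2) * t\<^sup>2"
            using D(2) by (simp add: power_mult_distrib)
          then show ?thesis by (simp only: mult_minus_left minus_divide_left)
        qed
        show "char (distr N borel (Z j)) t = exp (of_real (- ((B j)\<^sup>2 - (B (j - 1))\<^sup>2) * t\<^sup>2 / 2))"
          unfolding D(1) char_std_normal_scale eq of_real_minus ..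
      qed
      also have "\<dots> = exp (\<Sum>j=1..n. of_real (- ((B j)\<^sup>2 - (B (j - 1))\<^sup>2) * t\<^sup>2 / 2))"
        by (simp only: exp_sum finite_atLeastAtMost)
      also have "(\<Sum>j=1..n. complex_of_real (- ((B j)\<^sup>2 - (B (j - 1))\<^sup>2) * t\<^sup>2 / 2)) = - of_real ((B n * t)\<^sup>2 / 2)"
      proof -
        have "(\<Sum>j=1..n. - ((B j)\<^sup>2 - (B (j - 1))\<^sup>2) * t\<^sup>2 / 2) = - ((B n * t)\<^sup>2 / 2)"
          by (induction n) (auto simp: assms(2) power_mult_distrib algebra_simps add_divide_distrib diff_divide_distrib)
        then show ?thesis by (simp only: of_real_sum[symmetric] of_real_minus[symmetric])
      qed
      finally show "char (distr N borel (\<lambda>\<omega>. \<Sum>j=1..n. Z j \<omega>)) t = char (distr std_normal_distribution borel (\<lambda>x. B n * x)) t"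
        unfolding char_std_normal_scale .
    qed
  qed
qed

lemma Lp_norm_2: "(Lp_norm M 2 f)\<^sup>2 = (\<integral>\<omega>. (f \<omega>)\<^sup>2 \<partial>M)" "0 \<le> Lp_norm M 2 f"
  by (auto simp: Lp_norm_def integral_nonneg_AE intro!: real_root_ge_zero)

text \<open>The finitely many constants are summed and the radii replaced by a common \<epsilon>. It
  is taken strictly below every radius, which puts its interval in the interior of all the others,
  where one-sided end point derivatives do not occur. The clause for j = m + 1 supplies
  differentiability for all orders.\<close>

lemma growth_condition_uniform:
  assumes "growth_condition M S m" "2 \<le> m"
  obtains C0 \<epsilon> where "0 \<le> C0" "0 < \<epsilon>" "\<epsilon> \<le> 1" "C0 * \<epsilon> \<le> 1 / 16"
    "\<And>n t. 1 \<le> n \<Longrightarrow> 0 < Lp_norm M 2 (S n) \<Longrightarrow> t \<in> {-(\<epsilon> * Lp_norm M 2 (S n))..\<epsilon> * Lp_norm M 2 (S n)} \<Longrightarrow> normalized_char M (S n) t \<noteq> 0"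
    "\<And>n j t. 1 \<le> n \<Longrightarrow> 0 < Lp_norm M 2 (S n) \<Longrightarrow> j \<le> m \<Longrightarrow> t \<in> {-(\<epsilon> * Lp_norm M 2 (S n))..\<epsilon> * Lp_norm M 2 (S n)} \<Longrightarrow>
      (nth_vector_deriv j (Lam M (S n)) has_vector_derivative nth_vector_deriv (Suc j) (Lam M (S n)) t) (at t)"
    "\<And>n j t. 1 \<le> n \<Longrightarrow> 0 < Lp_norm M 2 (S n) \<Longrightarrow> 3 \<le> j \<Longrightarrow> j \<le> m + 1 \<Longrightarrow> t \<in> {-(\<epsilon> * Lp_norm M 2 (S n))..\<epsilon> * Lp_norm M 2 (S n)} \<Longrightarrow>
      norm (nth_vector_deriv j (Lam M (S n)) t) \<le> C0 / Lp_norm M 2 (S n) ^ (j - 2)"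
proof -
  have "\<forall>j\<in>{3..m+1}. \<exists>C \<epsilon>. 0 < C \<and> 0 < \<epsilon> \<and> (\<forall>n\<ge>1. 0 < Lp_norm M 2 (S n) \<longrightarrow>
      (\<forall>t\<in>{- \<epsilon> * Lp_norm M 2 (S n)..\<epsilon> * Lp_norm M 2 (S n)}. normalized_char M (S n) t \<noteq> 0) \<and>
      times_differentiable_on j (Lam M (S n)) {- \<epsilon> * Lp_norm M 2 (S n)..\<epsilon> * Lp_norm M 2 (S n)} \<and>
      (\<forall>t\<in>{- \<epsilon> * Lp_norm M 2 (S n)..\<epsilon> * Lp_norm M 2 (S n)}.
        norm (nth_deriv_within {- \<epsilon> * Lp_norm M 2 (S n)..\<epsilon> * Lp_norm M 2 (S n)} j (Lam M (S n)) t) \<le> C / Lp_norm M 2 (S n) ^ (j - 2)))"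
    using assms(1) unfolding growth_condition_def Let_def by blast
  then obtain Cf ef where ce: "\<And>j. j \<in> {3..m+1} \<Longrightarrow> 0 < Cf j \<and> 0 < ef j \<and> (\<forall>n\<ge>1. 0 < Lp_norm M 2 (S n) \<longrightarrow>
      (\<forall>t\<in>{- ef j * Lp_norm M 2 (S n)..ef j * Lp_norm M 2 (S n)}. normalized_char M (S n) t \<noteq> 0) \<and>
      times_differentiable_on j (Lam M (S n)) {- ef j * Lp_norm M 2 (S n)..ef j * Lp_norm M 2 (S n)} \<and>
      (\<forall>t\<in>{- ef j * Lp_norm M 2 (S n)..ef j * Lp_norm M 2 (S n)}.
        norm (nth_deriv_within {- ef j * Lp_norm M 2 (S n)..ef j * Lp_norm M 2 (S n)} j (Lam M (S n)) t) \<le> Cf j / Lp_norm M 2 (S n) ^ (j - 2)))"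
    by metis
  define C0 where "C0 = (\<Sum>j=3..m+1. Cf j)"
  have C0: "Cf j \<le> C0" if "j \<in> {3..m+1}" for j
    unfolding C0_def using ce that by (intro member_le_sum) (auto intro: less_imp_le)
  have C00: "0 \<le> C0" unfolding C0_def using ce by (intro sum_nonneg) (auto intro: less_imp_le)
  define e1 where "e1 = Min (ef ` {3..m+1})"
  have ne: "{3..m+1} \<noteq> {}" using assms(2) by simp
  have e1: "0 < e1" "\<And>j. j \<in> {3..m+1} \<Longrightarrow> e1 \<le> ef j"
    unfolding e1_def using ce ne by (auto simp: Min_gr_iff)
  \<comment> \<open>Half the smallest radius gives the strict inclusion; the last bound gives the
    smallness of \<open>C0 * \<epsilon>\<close>, with C0 + 1 guarding against C0 = 0.\<close>
  define \<epsilon> where "\<epsilon> = min (e1 / 2) (min 1 (1 / (16 * (C0 + 1))))"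
  have \<epsilon>: "0 < \<epsilon>" "\<epsilon> \<le> 1" "\<epsilon> < e1"
  proof -
    show "0 < \<epsilon>" using e1(1) C00 by (simp add: \<epsilon>_def)
    show "\<epsilon> \<le> 1" unfolding \<epsilon>_def by (rule min.coboundedI2[OF min.cobounded1])
    have "\<epsilon> \<le> e1 / 2" unfolding \<epsilon>_def by (rule min.cobounded1)
    then show "\<epsilon> < e1" using e1(1) by simp
  qed
  have C\<epsilon>: "C0 * \<epsilon> \<le> 1 / 16"
  proof -
    have "C0 * \<epsilon> \<le> C0 * (1 / (16 * (C0 + 1)))" using C00 by (intro mult_left_mono) (auto simp: \<epsilon>_def)
    also have "\<dots> \<le> 1 / 16" using C00 by (simp add: field_simps)
    finally show ?thesis .
  qed
  have int: "t \<in> interior {- ef j * s..ef j * s}" "t \<in> {- ef j * s..ef j * s}"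
    if "j \<in> {3..m+1}" "0 < s" "t \<in> {-(\<epsilon> * s)..\<epsilon> * s}" for j s t
  proof -
    have "\<epsilon> * s < ef j * s" using \<epsilon>(3) e1(2)[OF that(1)] that(2) by simp
    then show "t \<in> interior {- ef j * s..ef j * s}" "t \<in> {- ef j * s..ef j * s}"
      using that(3) by (auto simp: interior_atLeastAtMost_real)
  qed
  have m1: "m + 1 \<in> {3..m+1}" using assms(2) by simp
  show ?thesis
  proof (rule that[OF C00 \<epsilon>(1,2) C\<epsilon>])
    fix n t assume n: "1 \<le> n" "0 < Lp_norm M 2 (S n)" and t: "t \<in> {-(\<epsilon> * Lp_norm M 2 (S n))..\<epsilon> * Lp_norm M 2 (S n)}"
    show "normalized_char M (S n) t \<noteq> 0" using ce[OF m1] n int(2)[OF m1 n(2) t] by blast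
  next
    fix n j t assume n: "1 \<le> n" "0 < Lp_norm M 2 (S n)" and j: "j \<le> m" and t: "t \<in> {-(\<epsilon> * Lp_norm M 2 (S n))..\<epsilon> * Lp_norm M 2 (S n)}"
    show "(nth_vector_deriv j (Lam M (S n)) has_vector_derivative nth_vector_deriv (Suc j) (Lam M (S n)) t) (at t)"
      by (rule nth_vector_deriv_has_vector_derivative[OF _ _ int(1)[OF m1 n(2) t]]) (use ce[OF m1] n j in auto)
  next
    fix n j t assume n: "1 \<le> n" "0 < Lp_norm M 2 (S n)" and j: "3 \<le> j" "j \<le> m + 1" and t: "t \<in> {-(\<epsilon> * Lp_norm M 2 (S n))..\<epsilon> * Lp_norm M 2 (S n)}"
    have j': "j \<in> {3..m+1}" using j by simp
    have "norm (nth_deriv_within {- ef j * Lp_norm M 2 (S n)..ef j * Lp_norm M 2 (S n)} j (Lam M (S n)) t) \<le> Cf j / Lp_norm M 2 (S n) ^ (j - 2)"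
      using ce[OF j'] n int(2)[OF j' n(2) t] by blast
    also have "\<dots> \<le> C0 / Lp_norm M 2 (S n) ^ (j - 2)" using C0[OF j'] n by (intro divide_right_mono) auto
    finally show "norm (nth_vector_deriv j (Lam M (S n)) t) \<le> C0 / Lp_norm M 2 (S n) ^ (j - 2)"
      unfolding nth_deriv_within_interior[OF int(1)[OF j' n(2) t]] .
  qed
qed

text \<open>Both laws are driven by the same normal variable. This absorbs the bounded difference
  between \<sigma> n and B n.\<close>

lemma transport_std_normal_scales:
  "transport p (distr std_normal_distribution borel (\<lambda>x. a * x)) (distr std_normal_distribution borel (\<lambda>x. b * x))
    (\<bar>a - b\<bar> ^ p * (\<integral>x. std_normal_density x * \<bar>x\<bar> ^ p \<partial>lborel))"
proof -
  interpret G: real_distribution std_normal_distribution by (rule real_dist_normal_dist)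
  have "(\<integral>\<^sup>+x. ennreal (\<bar>a * x - b * x\<bar> ^ p) \<partial>std_normal_distribution) = (\<integral>\<^sup>+x. ennreal (std_normal_density x) * ennreal (\<bar>a * x - b * x\<bar> ^ p) \<partial>lborel)"
    by (rule nn_integral_density) measurable
  also have "\<dots> = (\<integral>\<^sup>+x. ennreal (\<bar>a - b\<bar> ^ p * (std_normal_density x * \<bar>x\<bar> ^ p)) \<partial>lborel)"
  proof (rule nn_integral_cong)
    fix x
    have "\<bar>a * x - b * x\<bar> ^ p = \<bar>a - b\<bar> ^ p * \<bar>x\<bar> ^ p"
      by (simp add: left_diff_distrib[symmetric] abs_mult power_mult_distrib)
    then show "ennreal (std_normal_density x) * ennreal (\<bar>a * x - b * x\<bar> ^ p) = ennreal (\<bar>a - b\<bar> ^ p * (std_normal_density x * \<bar>x\<bar> ^ p))"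
      by (simp add: ennreal_mult[symmetric] mult.left_commute)
  qed
  also have "\<dots> = ennreal (\<integral>x. \<bar>a - b\<bar> ^ p * (std_normal_density x * \<bar>x\<bar> ^ p) \<partial>lborel)"
    by (intro nn_integral_eq_integral integrable_mult_right integrable_std_normal_moment_abs) auto
  finally show ?thesis by (intro transportI G.prob_space_axioms) auto
qed

text \<open>With h = 1/\<sigma> n the normalized variable is coupled at p-th power cost K h^p, and
  rescaling by \<sigma> n multiplies this by (\<sigma> n)^p: the powers cancel, which is why K does
  not depend on n.\<close>

lemma partial_sums_transport:
  fixes M :: "'a measure" and S :: "nat \<Rightarrow> 'a \<Rightarrow> real" and \<sigma> :: "nat \<Rightarrow> real" and m :: nat
  assumes "prob_space M"
    and L2: "\<And>n. n \<ge> 1 \<Longrightarrow> in_Lp M 2 (S n)"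
    and mean: "\<And>n. n \<ge> 1 \<Longrightarrow> (\<integral>\<omega>. S n \<omega> \<partial>M) = 0"
    and \<sigma>: "\<And>n. \<sigma> n = Lp_norm M 2 (S n)"
    and lim: "filterlim \<sigma> at_top sequentially"
    and m: "m \<ge> 2" and gc: "growth_condition M S m"
  obtains K where "0 \<le> K"
    "\<And>n. n \<ge> 1 \<Longrightarrow> transport (m - 1) (distr M borel (S n)) (distr std_normal_distribution borel (\<lambda>x. \<sigma> n * x)) K"
proof -
  interpret prob_space M by fact
  interpret G: real_distribution std_normal_distribution by (rule real_dist_normal_dist)
  have "(\<lambda>n. inverse (\<sigma> n)) \<longlonglongrightarrow> 0"
    using filterlim_compose[OF tendsto_inverse_0_at_top[OF filterlim_ident] lim] by (simp add: comp_def)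
  then have "Bseq (\<lambda>n. inverse (\<sigma> n))" by (intro convergent_imp_Bseq convergentI)
  \<comment> \<open>Boundedness of the whole sequence includes small n; at an index with \<sigma> n
    = 0 the inverse is 0 by convention, and there S n vanishes almost surely.\<close>
  then obtain H where H: "0 < H" "\<And>n. norm (inverse (\<sigma> n)) \<le> H" by (auto elim: BseqE)
  show ?thesis
  proof (rule growth_condition_uniform[OF gc m])
    fix C0 \<epsilon>
    assume C0: "0 \<le> C0" and \<epsilon>: "0 < \<epsilon>" "\<epsilon> \<le> 1" "C0 * \<epsilon> \<le> 1 / 16"
      and nz: "\<And>n t. 1 \<le> n \<Longrightarrow> 0 < Lp_norm M 2 (S n) \<Longrightarrow> t \<in> {-(\<epsilon> * Lp_norm M 2 (S n))..\<epsilon> * Lp_norm M 2 (S n)} \<Longrightarrow> normalized_char M (S n) t \<noteq> 0"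
      and df: "\<And>n j t. 1 \<le> n \<Longrightarrow> 0 < Lp_norm M 2 (S n) \<Longrightarrow> j \<le> m \<Longrightarrow> t \<in> {-(\<epsilon> * Lp_norm M 2 (S n))..\<epsilon> * Lp_norm M 2 (S n)} \<Longrightarrow>
        (nth_vector_deriv j (Lam M (S n)) has_vector_derivative nth_vector_deriv (Suc j) (Lam M (S n)) t) (at t)"
      and bd: "\<And>n j t. 1 \<le> n \<Longrightarrow> 0 < Lp_norm M 2 (S n) \<Longrightarrow> 3 \<le> j \<Longrightarrow> j \<le> m + 1 \<Longrightarrow> t \<in> {-(\<epsilon> * Lp_norm M 2 (S n))..\<epsilon> * Lp_norm M 2 (S n)} \<Longrightarrow>
        norm (nth_vector_deriv j (Lam M (S n)) t) \<le> C0 / Lp_norm M 2 (S n) ^ (j - 2)"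
    show ?thesis
    proof (rule normal_approximation[OF m C0 \<epsilon> H(1)])
      fix K assume K: "0 \<le> K" and approx: "\<And>h l \<mu>. 0 < h \<Longrightarrow> h \<le> H \<Longrightarrow> real_distribution \<mu> \<Longrightarrow>
        (\<And>j t. j \<le> m \<Longrightarrow> t \<in> {-(\<epsilon>/h)..\<epsilon>/h} \<Longrightarrow> (l j has_vector_derivative l (Suc j) t) (at t within {-(\<epsilon>/h)..\<epsilon>/h})) \<Longrightarrow>
        (\<And>j t. 3 \<le> j \<Longrightarrow> j \<le> m + 1 \<Longrightarrow> t \<in> {-(\<epsilon>/h)..\<epsilon>/h} \<Longrightarrow> norm (l j t) \<le> C0 * h ^ (j - 2)) \<Longrightarrow>
        (\<And>j. j < 3 \<Longrightarrow> l j 0 = 0) \<Longrightarrow>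
        (\<And>t. t \<in> {-(\<epsilon>/h)..\<epsilon>/h} \<Longrightarrow> char \<mu> t = exp (l 0 t - of_real (t\<^sup>2 / 2))) \<Longrightarrow>
        transport (m - 1) \<mu> std_normal_distribution (K * h ^ (m - 1))"
      show ?thesis
      proof (rule that[OF K])
        fix n :: nat assume n: "n \<ge> 1"
        have Sm[measurable]: "S n \<in> borel_measurable M" and Si: "integrable M (\<lambda>\<omega>. (S n \<omega>)\<^sup>2)"
          using L2[OF n] by (auto simp: in_Lp_def)
        have \<sigma>2: "(\<sigma> n)\<^sup>2 = (\<integral>\<omega>. (S n \<omega>)\<^sup>2 \<partial>M)" "0 \<le> \<sigma> n" using Lp_norm_2 by (auto simp: \<sigma>)
        show "transport (m - 1) (distr M borel (S n)) (distr std_normal_distribution borel (\<lambda>x. \<sigma> n * x)) K"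
        proof (cases "\<sigma> n = 0")
          case True
          have "AE \<omega> in M. (S n \<omega>)\<^sup>2 = 0"
            using integral_nonneg_eq_0_iff_AE[OF Si] \<sigma>2 True by simp
          then have "AE \<omega> in M. S n \<omega> = 0" by simp
          from distr_AE_zero[OF assms(1) Sm this]
          have e: "distr M borel (S n) = distr std_normal_distribution borel (\<lambda>x. \<sigma> n * x)" by (simp add: True)
          have "transport (m - 1) (distr std_normal_distribution borel (\<lambda>x. \<sigma> n * x)) (distr std_normal_distribution borel (\<lambda>x. \<sigma> n * x)) 0"
            using transport_std_normal_scales[of "m - 1" "\<sigma> n" "\<sigma> n"] m by (simp add: zero_power)
          then show ?thesis unfolding e using K by (rule transport_mono)
        next
          case False
          then have s: "0 < \<sigma> n" "0 < Lp_norm M 2 (S n)" using \<sigma>2(2) by (auto simp: \<sigma>)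
          define h where "h = 1 / \<sigma> n"
          have h: "0 < h" "h \<le> H" using H(2)[of n] s by (auto simp: h_def inverse_eq_divide)
          have J: "{-(\<epsilon>/h)..\<epsilon>/h} = {-(\<epsilon> * Lp_norm M 2 (S n))..\<epsilon> * Lp_norm M 2 (S n)}" by (simp add: h_def \<sigma>)
          define Y where "Y \<omega> = S n \<omega> / \<sigma> n" for \<omega>
          have [measurable]: "Y \<in> borel_measurable M" unfolding Y_def by measurable
          define \<mu> where "\<mu> = distr M borel Y"
          have \<mu>: "real_distribution \<mu>" unfolding \<mu>_def by (rule real_distribution_distr) measurable
          interpret U: real_distribution \<mu> by (rule \<mu>)
          have nc: "normalized_char M (S n) = char \<mu>"
            unfolding normalized_char_def \<mu>_def Y_def \<sigma> ..
          have char0: "char \<mu> 0 = 1" by (rule U.char_zero)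
          define l where "l j = nth_vector_deriv j (Lam M (S n))" for j
          have Iy2: "integrable M (\<lambda>\<omega>. (Y \<omega>)\<^sup>2)" unfolding Y_def power_divide using Si by (rule integrable_divide)
          have IS: "integrable M (S n)" by (rule square_integrable_imp_integrable[OF Sm Si])
          have Iy: "integrable M Y" unfolding Y_def using IS by (rule integrable_divide)
          have EY: "(\<integral>\<omega>. Y \<omega> \<partial>M) = 0" unfolding Y_def using mean[OF n] by simp
          have VY: "(\<integral>\<omega>. (Y \<omega>)\<^sup>2 \<partial>M) = 1" unfolding Y_def power_divide using s by (simp add: \<sigma>2(1)[symmetric])
          have dl: "(l j has_vector_derivative l (Suc j) t) (at t within {-(\<epsilon>/h)..\<epsilon>/h})" if "j \<le> m" "t \<in> {-(\<epsilon>/h)..\<epsilon>/h}" for j t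
            unfolding l_def using df[OF n s(2) that(1) that(2)[unfolded J]] by (rule has_vector_derivative_at_within)
          have bl: "norm (l j t) \<le> C0 * h ^ (j - 2)" if "3 \<le> j" "j \<le> m + 1" "t \<in> {-(\<epsilon>/h)..\<epsilon>/h}" for j t
            unfolding l_def using bd[OF n s(2) that(1,2) that(3)[unfolded J]] by (simp add: h_def \<sigma> power_divide)
          have ch: "char \<mu> t = exp (l 0 t - of_real (t\<^sup>2 / 2))" if t: "t \<in> {-(\<epsilon>/h)..\<epsilon>/h}" for t
          proof -
            have "exp (continuous_log (char \<mu>) t) = char \<mu> t"
            proof (rule exp_continuous_log)
              show "continuous_on (closed_segment 0 t) (char \<mu>)"
                using U.isCont_char by (auto intro: continuous_at_imp_continuous_on)
              fix r assume r: "r \<in> closed_segment 0 t"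
              then have "r \<in> {-(\<epsilon>/h)..\<epsilon>/h}"
                using segment_bound1[OF r] t by (auto simp: abs_le_iff)
              then show "char \<mu> r \<noteq> 0" using nz[OF n s(2)] unfolding nc J by blast
            qed (rule char0)
            moreover have "l 0 t - of_real (t\<^sup>2 / 2) = continuous_log (char \<mu>) t"
              by (simp add: l_def nth_vector_deriv_def Lam_def nc)
            ultimately show ?thesis by simp
          qed
          have l00: "l 0 0 = 0"
            by (simp add: l_def nth_vector_deriv_def Lam_def nc continuous_log_0[of "char \<mu>", OF char0])
          have eh: "0 < \<epsilon> / h" using \<epsilon> h by simp
          have "l 1 0 = 0" "l 2 0 = 0"
            by (rule log_char_derivatives_0[OF assms(1) _ Iy Iy2 EY VY eh, of l "C0 * h ^ 1"];
                use dl bl[of 3] l00 ch m in \<open>auto simp: \<mu>_def\<close>)+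
          then have z: "l j 0 = 0" if "j < 3" for j using l00 that by (auto simp: less_Suc_eq numeral_3_eq_3 numeral_2_eq_2)
          have "transport (m - 1) \<mu> std_normal_distribution (K * h ^ (m - 1))"
            by (rule approx[OF h \<mu> dl bl z ch])
          then have "transport (m - 1) (distr \<mu> borel (\<lambda>x. \<sigma> n * x)) (distr std_normal_distribution borel (\<lambda>x. \<sigma> n * x)) (\<bar>\<sigma> n\<bar> ^ (m - 1) * (K * h ^ (m - 1)))"
            by (rule transport_scale) (use K h in simp)
          moreover have "\<bar>\<sigma> n\<bar> ^ (m - 1) * (K * h ^ (m - 1)) = K"
            using s by (simp add: h_def power_divide)
          moreover have "distr \<mu> borel (\<lambda>x. \<sigma> n * x) = distr M borel (S n)"
            unfolding \<mu>_def using s by (simp add: distr_distr comp_def Y_def)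
          ultimately show ?thesis by (simp only:)
        qed
      qed
    qed
  qed
qed

text \<open>The cost involves only the two sums, but whole vectors are to be coupled. Therefore the
  underlying spaces M and N are coupled through S n and the sum of the Z j, and the vectors are
  carried along as functions on them.\<close>

lemma increments_coupling:
  fixes M :: "'a measure" and N :: "'b measure"
    and S X :: "nat \<Rightarrow> 'a \<Rightarrow> real" and Z :: "nat \<Rightarrow> 'b \<Rightarrow> real"
    and \<sigma> B :: "nat \<Rightarrow> real" and m :: nat
  assumes "prob_space M" and "prob_space N"
    and "\<And>n. n \<ge> 1 \<Longrightarrow> in_Lp M 2 (S n)"
    and "\<And>n. n \<ge> 1 \<Longrightarrow> (\<integral>\<omega>. S n \<omega> \<partial>M) = 0"
    and "\<And>n. \<sigma> n = Lp_norm M 2 (S n)"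
    and "filterlim \<sigma> at_top sequentially"
    and "(\<lambda>n. B n - \<sigma> n) \<in> O(\<lambda>_. 1)"
    and "m \<ge> 2" and "growth_condition M S m"
    and "mono_on {1..} B" and "B 0 = 0"
    and "\<And>j. j \<ge> 1 \<Longrightarrow> centered_normal N (Z j) ((B j)\<^sup>2 - (B (j - 1))\<^sup>2)"
    and "prob_space.indep_vars N (\<lambda>_. borel) Z {1..}"
    and "\<And>\<omega>. S 0 \<omega> = 0"
    and "\<And>i \<omega>. i \<ge> 1 \<Longrightarrow> X i \<omega> = S i \<omega> - S (i - 1) \<omega>"
  shows "\<exists>C. \<forall>n\<ge>1. \<exists>(P :: ((nat \<Rightarrow> real) \<times> (nat \<Rightarrow> real)) measure) X' Z'.
           is_coupling P X' Z' (joint_law M n X) (joint_law N n Z) \<and>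
           in_Lp P (m - 1) (\<lambda>\<omega>. (\<Sum>i=1..n. X' \<omega> i) - (\<Sum>j=1..n. Z' \<omega> j)) \<and>
           Lp_norm P (m - 1) (\<lambda>\<omega>. (\<Sum>i=1..n. X' \<omega> i) - (\<Sum>j=1..n. Z' \<omega> j)) \<le> C"
proof (rule partial_sums_transport[OF assms(1,3,4,5,6,8,9)])
  fix K assume K: "0 \<le> K"
    and tr: "\<And>n. n \<ge> 1 \<Longrightarrow> transport (m - 1) (distr M borel (S n)) (distr std_normal_distribution borel (\<lambda>x. \<sigma> n * x)) K"
  define p where "p = m - 1"
  have p: "0 < p" using assms(8) by (simp add: p_def)
  interpret M: prob_space M by fact
  interpret N: prob_space N by fact
  have Sm: "S n \<in> borel_measurable M" for n
  proof (cases "n \<ge> 1")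
    case True
    then show ?thesis using assms(3) by (simp add: in_Lp_def)
  next
    case False
    then have "n = 0" by simp
    then have "S n = (\<lambda>_. 0)" using assms(14) by (simp add: fun_eq_iff)
    then show ?thesis by simp
  qed
  have Xm: "X i \<in> borel_measurable M" if "1 \<le> i" for i
  proof -
    have "X i = (\<lambda>\<omega>. S i \<omega> - S (i - 1) \<omega>)" using assms(15)[OF that] by auto
    then show ?thesis using Sm by simp
  qed
  have Zm: "Z j \<in> borel_measurable N" if "1 \<le> j" for j
    using assms(12)[OF that] by (simp add: centered_normal_def)
  have Xsum: "(\<Sum>i=1..n. X i \<omega>) = S n \<omega>" for n \<omega>
    by (induction n) (simp_all add: assms(14,15))
  \<comment> \<open>The O-condition speaks only of large n; the finitely many other indices are
    absorbed into the bound b.\<close>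
  have "Bseq (\<lambda>n. B n - \<sigma> n)"
  proof -
    obtain c where "eventually (\<lambda>n. norm (B n - \<sigma> n) \<le> c * norm (1::real)) sequentially"
      using assms(7) by (elim landau_o.bigE) auto
    then have "eventually (\<lambda>n. norm (B n - \<sigma> n) \<le> norm c) sequentially"
      by eventually_elim (auto simp: abs_le_iff)
    then show ?thesis by (rule Bseq_eventually_mono) (rule BseqI'[of _ "norm c"], simp)
  qed
  then obtain b where b: "0 < b" "\<And>n. norm (B n - \<sigma> n) \<le> b" by (auto elim: BseqE)
  define E where "E = (\<integral>x. std_normal_density x * \<bar>x\<bar> ^ p \<partial>lborel)"
  have E: "0 \<le> E" unfolding E_def by (intro integral_nonneg_AE) auto
  \<comment> \<open>The summand \<open>1 ^ p\<close> comes from composing the two couplings with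
    gluing tolerance 1.\<close>
  define K1 where "K1 = 3 ^ p * (K + b ^ p * E + 1 ^ p)"
  have K1: "0 \<le> K1" using K b E by (simp add: K1_def)
  define K2 where "K2 = 3 ^ p * (K1 + 2)"
  have K2: "0 \<le> K2" using K1 by (simp add: K2_def)
  show ?thesis
  proof (intro exI[of _ "root p K2"] allI impI)
    fix n :: nat assume n: "n \<ge> 1"
    define W where "W \<omega> = (\<Sum>j=1..n. Z j \<omega>)" for \<omega>
    have Wm: "W \<in> borel_measurable N" unfolding W_def[abs_def] using Zm by (intro borel_measurable_sum) auto
    have "transport p (distr std_normal_distribution borel (\<lambda>x. \<sigma> n * x)) (distr std_normal_distribution borel (\<lambda>x. B n * x)) (b ^ p * E)"
    proof (rule transport_mono[OF transport_std_normal_scales])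
      have "\<bar>\<sigma> n - B n\<bar> \<le> b" using b(2)[of n] by (simp add: abs_minus_commute)
      then show "\<bar>\<sigma> n - B n\<bar> ^ p * (\<integral>x. std_normal_density x * \<bar>x\<bar> ^ p \<partial>lborel) \<le> b ^ p * E"
        unfolding E_def[symmetric] using E by (intro mult_right_mono power_mono) auto
    qed
    then have tB: "transport p (distr M borel (S n)) (distr std_normal_distribution borel (\<lambda>x. B n * x)) K1"
      unfolding K1_def using K b E tr[OF n, folded p_def] by (intro transport_trans) auto
    have t: "transport p (distr M borel (S n)) (distr N borel W) K1"
    proof -
      have "distr N borel W = distr std_normal_distribution borel (\<lambda>x. B n * x)"
        unfolding W_def[abs_def] by (rule distr_sum_centered_normal[OF assms(2,11,12,13)])
      then show ?thesis using tB by (simp only:)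
    qed
    obtain Q where Q: "prob_space Q" "sets Q = sets (M \<Otimes>\<^sub>M N)" "distr Q M fst = M" "distr Q N snd = N"
      "(\<integral>\<^sup>+z. ennreal (\<bar>S n (fst z) - W (snd z)\<bar> ^ p) \<partial>Q) \<le> ennreal K2"
      unfolding K2_def by (rule couple_measure_spaces[OF assms(1,2) Sm Wm t K1])
    interpret Q: prob_space Q by (rule Q(1))
    have Qm: "fst \<in> measurable Q M" "snd \<in> measurable Q N"
      unfolding measurable_cong_sets[OF Q(2) refl] by measurable
    let ?\<Pi> = "Pi\<^sub>M {1..n} (\<lambda>_. borel :: real measure)"
    define vX where "vX \<omega> = (\<lambda>i\<in>{1..n}. X i \<omega>)" for \<omega>
    define vZ where "vZ \<omega> = (\<lambda>i\<in>{1..n}. Z i \<omega>)" for \<omega>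
    have vX: "vX \<in> measurable M ?\<Pi>" unfolding vX_def[abs_def] using Xm by (intro measurable_restrict) auto
    have vZ: "vZ \<in> measurable N ?\<Pi>" unfolding vZ_def[abs_def] using Zm by (intro measurable_restrict) auto
    define F where "F z = (vX (fst z), vZ (snd z))" for z
    have F: "F \<in> measurable Q (?\<Pi> \<Otimes>\<^sub>M ?\<Pi>)"
      unfolding F_def[abs_def] using measurable_compose[OF Qm(1) vX] measurable_compose[OF Qm(2) vZ]
      by (rule measurable_Pair)
    define P where "P = distr Q (?\<Pi> \<Otimes>\<^sub>M ?\<Pi>) F"
    have sP: "sets P = sets (?\<Pi> \<Otimes>\<^sub>M ?\<Pi>)" by (simp add: P_def)
    have jX: "joint_law M n X = distr M ?\<Pi> vX" by (simp add: joint_law_def vX_def[abs_def])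
    have jZ: "joint_law N n Z = distr N ?\<Pi> vZ" by (simp add: joint_law_def vZ_def[abs_def])
    have fm: "fst \<in> measurable P ?\<Pi>" "snd \<in> measurable P ?\<Pi>"
      unfolding measurable_cong_sets[OF sP refl] by measurable
    have dX: "distr P ?\<Pi> fst = distr M ?\<Pi> vX"
    proof -
      have "distr P ?\<Pi> fst = distr Q ?\<Pi> (fst \<circ> F)" unfolding P_def by (rule distr_distr[OF measurable_fst F])
      also have "fst \<circ> F = vX \<circ> fst" by (auto simp: F_def)
      also have "distr Q ?\<Pi> (vX \<circ> fst) = distr (distr Q M fst) ?\<Pi> vX" by (rule distr_distr[OF vX Qm(1), symmetric])
      finally show ?thesis by (simp add: Q(3))
    qed
    have dZ: "distr P ?\<Pi> snd = distr N ?\<Pi> vZ"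
    proof -
      have "distr P ?\<Pi> snd = distr Q ?\<Pi> (snd \<circ> F)" unfolding P_def by (rule distr_distr[OF measurable_snd F])
      also have "snd \<circ> F = vZ \<circ> snd" by (auto simp: F_def)
      also have "distr Q ?\<Pi> (vZ \<circ> snd) = distr (distr Q N snd) ?\<Pi> vZ" by (rule distr_distr[OF vZ Qm(2), symmetric])
      finally show ?thesis by (simp add: Q(4))
    qed
    have coup: "is_coupling P fst snd (joint_law M n X) (joint_law N n Z)"
    proof -
      have "prob_space P" unfolding P_def by (rule Q.prob_space_distr[OF F])
      \<comment> \<open>\<open>is_coupling\<close> takes the marginal law itself as target space, so
        the marginals have to be restated; only the \<sigma>-algebra of the target matters.\<close>
      moreover have "distr P (distr M ?\<Pi> vX) fst = distr P ?\<Pi> fst" "distr P (distr N ?\<Pi> vZ) snd = distr P ?\<Pi> snd"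
        by (rule distr_cong; simp)+
      ultimately show ?thesis unfolding is_coupling_def jX jZ using dX dZ fm by simp
    qed
    define D where "D = (\<lambda>\<omega>::(nat \<Rightarrow> real) \<times> (nat \<Rightarrow> real). (\<Sum>i=1..n. fst \<omega> i) - (\<Sum>j=1..n. snd \<omega> j))"
    have Dm: "D \<in> borel_measurable (?\<Pi> \<Otimes>\<^sub>M ?\<Pi>)"
      unfolding D_def by (intro borel_measurable_diff borel_measurable_sum measurable_compose[OF measurable_fst] measurable_compose[OF measurable_snd] measurable_component_singleton) auto
    have DP: "D \<in> borel_measurable P" unfolding measurable_cong_sets[OF sP refl] by (rule Dm)
    have DF: "D (F z) = S n (fst z) - W (snd z)" for z
      by (simp add: D_def F_def vX_def vZ_def W_def Xsum[symmetric])
    have "(\<integral>\<^sup>+\<omega>. ennreal (\<bar>D \<omega>\<bar> ^ p) \<partial>P) = (\<integral>\<^sup>+z. ennreal (\<bar>S n (fst z) - W (snd z)\<bar> ^ p) \<partial>Q)"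
      unfolding P_def using Dm by (subst nn_integral_distr[OF F]) (simp_all add: DF)
    then have nn: "(\<integral>\<^sup>+\<omega>. ennreal (\<bar>D \<omega>\<bar> ^ p) \<partial>P) \<le> ennreal K2" using Q(5) by simp
    have iD: "integrable P (\<lambda>\<omega>. \<bar>D \<omega>\<bar> ^ p)"
      by (rule integrableI_bounded) (use DP nn in \<open>auto simp: power_abs less_top intro: le_less_trans\<close>)
    have "ennreal (\<integral>\<omega>. \<bar>D \<omega>\<bar> ^ p \<partial>P) \<le> ennreal K2"
      using nn by (subst (asm) nn_integral_eq_integral[OF iD]) auto
    then have "(\<integral>\<omega>. \<bar>D \<omega>\<bar> ^ p \<partial>P) \<le> K2" using K2 by simp
    then have "Lp_norm P p D \<le> root p K2" unfolding Lp_norm_def using p by simp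
    moreover have "in_Lp P p D" using DP iD by (simp add: in_Lp_def)
    ultimately show "\<exists>(P :: ((nat \<Rightarrow> real) \<times> (nat \<Rightarrow> real)) measure) X' Z'.
           is_coupling P X' Z' (joint_law M n X) (joint_law N n Z) \<and>
           in_Lp P (m - 1) (\<lambda>\<omega>. (\<Sum>i=1..n. X' \<omega> i) - (\<Sum>j=1..n. Z' \<omega> j)) \<and>
           Lp_norm P (m - 1) (\<lambda>\<omega>. (\<Sum>i=1..n. X' \<omega> i) - (\<Sum>j=1..n. Z' \<omega> j)) \<le> root p K2"
      using coup unfolding D_def p_def by blast
  qed
qed

theorem corollary14:
  fixes M :: "'a measure" and N :: "'b measure"
    and S X :: "nat \<Rightarrow> 'a \<Rightarrow> real" and Z :: "nat \<Rightarrow> 'b \<Rightarrow> real"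
    and \<sigma> B :: "nat \<Rightarrow> real" and m :: nat
  assumes "prob_space M" and "prob_space N"
    and "\<And>n. n \<ge> 1 \<Longrightarrow> in_Lp M 2 (S n)"
    and "\<And>n. n \<ge> 1 \<Longrightarrow> (\<integral>\<omega>. S n \<omega> \<partial>M) = 0"
    and "\<And>n. \<sigma> n = Lp_norm M 2 (S n)"
    and "filterlim \<sigma> at_top sequentially"
    and "(\<lambda>n. B n - \<sigma> n) \<in> O(\<lambda>_. 1)"
    and "m \<ge> 2" and "growth_condition M S m"
    and "mono_on {1..} B" and "B 0 = 0"
    and "\<And>j. j \<ge> 1 \<Longrightarrow> centered_normal N (Z j) ((B j)\<^sup>2 - (B (j - 1))\<^sup>2)"
    and "prob_space.indep_vars N (\<lambda>_. borel) Z {1..}"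
    and "\<And>\<omega>. S 0 \<omega> = 0"
    and "\<And>i \<omega>. i \<ge> 1 \<Longrightarrow> X i \<omega> = S i \<omega> - S (i - 1) \<omega>"
  shows "\<exists>C. \<forall>n\<ge>1. \<exists>(P :: ((nat \<Rightarrow> real) \<times> (nat \<Rightarrow> real)) measure) X' Z'.
           is_coupling P X' Z' (joint_law M n X) (joint_law N n Z) \<and>
           in_Lp P (m - 1) (\<lambda>\<omega>. (\<Sum>i=1..n. X' \<omega> i) - (\<Sum>j=1..n. Z' \<omega> j)) \<and>
           Lp_norm P (m - 1) (\<lambda>\<omega>. (\<Sum>i=1..n. X' \<omega> i) - (\<Sum>j=1..n. Z' \<omega> j)) \<le> C"
  using assms by (rule increments_coupling)

end
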